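(* Let $Y$ be a spectrally positive Lévy process drifting to $+\infty$ that has positive jumps, with Lévy measure $\pi$, let $\overline{\pi}(x):=\pi([x,+\infty[)$ for $x>0$, and let $I(Y):=\int_0^{+\infty}e^{-Y(t)}\,dt$. Assume that for some $\alpha>0$, $$\forall y\in\mathbb{R},\quad\frac{\overline{\pi}(x+y)}{\overline{\pi}(x)}\underset{x\to+\infty}{\longrightarrow}e^{-\alpha y}.$$ Denote by $m_Y$ the density of $I(Y)$. Then $\mathbb{E}[I(Y)^{-\alpha}]<+\infty$ and $$m_Y(x)\underset{x\to0}{\sim}\mathbb{E}[I(Y)^{-\alpha}]\ \overline{\pi}(\log(1/x)).$$
   Context: A spectrally positive Lévy process is a real-valued càdlàg Lévy process with no negative jumps, started from $0$; drifting to $+\infty$ means $Y(t)\to+\infty$ a.s. "Has positive jumps" means $\pi(\cdot\cap]0,+\infty[)$ is non-zero. $I(Y)$ is absolutely continuous with respect to Lebesgue measure. The notation $f\sim g$ means that $f/g\to1$. *)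

theory Defs
  imports "HOL-Probability.Probability"
begin

text \<open>
  Time is \<^typ>\<open>real\<close>, and only the values of the process at nonnegative times are constrained.
  Stochastic continuity need not be required: it follows from right-continuity of the paths.
  All paths are cadlag, so that path functionals such as \<open>exp_functional\<close> below are measurable
  without completing the probability space.
\<close>

definition cadlag :: "(real \<Rightarrow> real) \<Rightarrow> bool" where
  "cadlag f \<longleftrightarrow>
     (\<forall>t\<ge>0. (f \<longlongrightarrow> f t) (at_right t)) \<and>
     (\<forall>t>0. \<exists>l. (f \<longlongrightarrow> l) (at_left t))"

definition jump :: "(real \<Rightarrow> real) \<Rightarrow> real \<Rightarrow> real" where
  "jump f t = f t - Lim (at_left t) f"

locale levy_process = prob_space M for M :: "'a measure" +
  fixes Y :: "real \<Rightarrow> 'a \<Rightarrow> real"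
  assumes random_variable: "\<And>t. 0 \<le> t \<Longrightarrow> Y t \<in> borel_measurable M"
    and start: "AE \<omega> in M. Y 0 \<omega> = 0"
    and indep_increments:
      "\<And>(n::nat) (t :: nat \<Rightarrow> real). 0 \<le> t 0 \<Longrightarrow> (\<And>i. i < n \<Longrightarrow> t i < t (Suc i)) \<Longrightarrow>
         indep_vars (\<lambda>_. borel) (\<lambda>i \<omega>. Y (t (Suc i)) \<omega> - Y (t i) \<omega>) {..<n}"
    and stationary_increments:
      "\<And>s h. 0 \<le> s \<Longrightarrow> 0 \<le> h \<Longrightarrow>
         distr M borel (\<lambda>\<omega>. Y (s + h) \<omega> - Y s \<omega>) = distr M borel (Y h)"
    and cadlag_paths: "\<And>\<omega>. \<omega> \<in> space M \<Longrightarrow> cadlag (\<lambda>t. Y t \<omega>)"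

locale spectrally_positive_levy_process = levy_process +
  assumes no_negative_jumps: "AE \<omega> in M. \<forall>t>0. 0 \<le> jump (\<lambda>s. Y s \<omega>) t"

definition drifts_to_infinity :: "'a measure \<Rightarrow> (real \<Rightarrow> 'a \<Rightarrow> real) \<Rightarrow> bool" where
  "drifts_to_infinity M Y \<longleftrightarrow> (AE \<omega> in M. filterlim (\<lambda>t. Y t \<omega>) at_top at_top)"

text \<open>
  The Levy measure is the one of the Levy--Khintchine formula, with drift \<open>a\<close> and Gaussian
  coefficient \<open>\<sigma>\<close>; the last component of the characteristic triplet is unique, so that
  \<open>has_levy_measure M Y\<close> holds of exactly one measure on the Borel sets for a Levy process \<open>Y\<close>.
\<close>

definition levy_khintchine_exponent :: "real \<Rightarrow> real \<Rightarrow> real measure \<Rightarrow> real \<Rightarrow> complex" where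
  "levy_khintchine_exponent a \<sigma> \<pi> u =
     \<i> * of_real (a * u) - of_real (\<sigma>\<^sup>2 * u\<^sup>2 / 2) +
     (\<integral>x. (iexp (u * x) - 1 - \<i> * of_real (u * x * indicator {-1..1} x)) \<partial>\<pi>)"

definition has_levy_measure :: "'a measure \<Rightarrow> (real \<Rightarrow> 'a \<Rightarrow> real) \<Rightarrow> real measure \<Rightarrow> bool" where
  "has_levy_measure M Y \<pi> \<longleftrightarrow>
     sets \<pi> = sets borel \<and>
     emeasure \<pi> {0} = 0 \<and>
     (\<integral>\<^sup>+x. ennreal (min 1 (x\<^sup>2)) \<partial>\<pi>) < \<infinity> \<and>
     (\<exists>a \<sigma>. \<forall>t\<ge>0. \<forall>u.
        char (distr M borel (Y t)) u = exp (of_real t * levy_khintchine_exponent a \<sigma> \<pi> u))"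

definition levy_tail :: "real measure \<Rightarrow> real \<Rightarrow> real" where
  "levy_tail \<pi> x = measure \<pi> {x..}"

text \<open>
  For a spectrally positive Levy process drifting to \<open>+\<infinity>\<close> the integral is almost surely finite;
  on the null set where it diverges the Bochner integral takes the value \<open>0\<close>.
\<close>

definition exp_functional :: "(real \<Rightarrow> 'a \<Rightarrow> real) \<Rightarrow> 'a \<Rightarrow> real" where
  "exp_functional Y \<omega> = (LBINT t:{0..}. exp (- Y t \<omega>))"

text \<open>
  A probability density is determined only up to Lebesgue-null sets, so its behaviour at a point
  is understood along this filter, which does not depend on the version of the density.  By the
  lemma below, convergence along it is ordinary right-sided convergence of a suitable version.
\<close>

definition ess_at_right :: "real \<Rightarrow> real filter" where
  "ess_at_right a = inf (at_right a) (ae_filter lborel)"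

lemma tendsto_ess_at_right_iff:
  fixes f :: "real \<Rightarrow> real"
  shows "(f \<longlongrightarrow> l) (ess_at_right a) \<longleftrightarrow>
    (\<exists>g. (AE x in lborel. g x = f x) \<and> (g \<longlongrightarrow> l) (at_right a))"
proof
  assume "\<exists>g. (AE x in lborel. g x = f x) \<and> (g \<longlongrightarrow> l) (at_right a)"
  then obtain g where g: "AE x in lborel. g x = f x" "(g \<longlongrightarrow> l) (at_right a)"
    by blast
  have "(g \<longlongrightarrow> l) (ess_at_right a)"
    unfolding ess_at_right_def by (rule tendsto_mono[OF _ g(2)]) simp
  moreover have "eventually (\<lambda>x. g x = f x) (ess_at_right a)"
    unfolding ess_at_right_def by (rule filter_leD[OF inf_le2]) (rule g(1))
  ultimately show "(f \<longlongrightarrow> l) (ess_at_right a)"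
    by (simp add: tendsto_cong)
next
  assume f: "(f \<longlongrightarrow> l) (ess_at_right a)"
  have "\<exists>P. eventually P (at_right a) \<and> (AE x in lborel. P x \<longrightarrow> dist (f x) l < inverse (real (Suc n)))" for n
  proof -
    have "eventually (\<lambda>x. dist (f x) l < inverse (real (Suc n))) (ess_at_right a)"
      using f by (rule tendstoD) simp
    then obtain P Q where "eventually P (at_right a)" "eventually Q (ae_filter lborel)"
      and "\<And>x. P x \<Longrightarrow> Q x \<Longrightarrow> dist (f x) l < inverse (real (Suc n))"
      unfolding ess_at_right_def eventually_inf by blast
    then show ?thesis
      by (intro exI[of _ P]) (auto elim: eventually_mono)
  qed
  then obtain P where P: "\<And>n. eventually (P n) (at_right a)"
    and AE_P: "\<And>n. AE x in lborel. P n x \<longrightarrow> dist (f x) l < inverse (real (Suc n))"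
    by metis
  define good where "good x \<longleftrightarrow> (\<forall>n. P n x \<longrightarrow> dist (f x) l < inverse (real (Suc n)))" for x
  define g where "g x = (if good x then f x else l)" for x
  have "AE x in lborel. good x"
    unfolding good_def using AE_P by (simp add: AE_all_countable)
  then have "AE x in lborel. g x = f x"
    by (rule AE_mp) (simp add: g_def)
  moreover have "(g \<longlongrightarrow> l) (at_right a)"
  proof (rule tendstoI)
    fix e :: real assume "0 < e"
    then obtain n where n: "inverse (real (Suc n)) < e"
      using reals_Archimedean by blast
    show "eventually (\<lambda>x. dist (g x) l < e) (at_right a)"
      using P[of n]
    proof (rule eventually_mono)
      fix x assume "P n x"
      then show "dist (g x) l < e"
        using n \<open>0 < e\<close> unfolding g_def good_def by (auto intro: less_trans)
    qed
  qed
  ultimately show "\<exists>g. (AE x in lborel. g x = f x) \<and> (g \<longlongrightarrow> l) (at_right a)"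
    by blast
qed

end

theory Submission
  imports Defs
begin

text \<open>
  Let \<open>I = I(Y)\<close>, let \<open>R s = \<integral> exp (- (Y (s + t) - Y s)) dt\<close>, which has the law of \<open>I\<close> and is independent of
  \<open>Y s\<close>, and let \<open>\<mu>\<close> be the law of \<open>ln I\<close>. Along a path, the logarithm \<open>ln (R s) - Y s\<close> of the tail of the
  integral decreases at the rate \<open>1 / R s\<close>. Taking expectations of \<open>exp (\<i> u (ln (R s) - Y s))\<close> turns
  this into a Fourier identity between \<open>\<mu>\<close> and \<open>exp (- z) \<mu>(dz)\<close>, whose multiplier is the Levy--Khintchine
  exponent at \<open>- u\<close>; convolution with a B-spline of width \<open>h\<close> makes it a pointwise equation
  \<open>exp (- x) k(x) \<approx> a k(x) + \<sigma>\<^sup>2 / 2 k'(x) + (jump term)\<close> for a smoothed density \<open>k\<close> of \<open>\<mu>\<close>.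

  As \<open>x \<longlonglongrightarrow> -\<infinity>\<close> the factor \<open>exp (- x)\<close> dominates all local terms, so \<open>k(x)\<close> should be \<open>exp x\<close> times
  the contribution of the big jumps, the integral of \<open>\<mu>(]-\<infinity>, x + y])\<close> over \<open>\<pi>(dy)\<close>, \<open>y > 1\<close>, which is
  equivalent to \<open>E[I powr (- \<alpha>)]\<close> times the tail of \<open>\<pi>\<close> at \<open>- x\<close>. This is justified by the maximum
  principle: at an extremum of the difference of \<open>k\<close> and a suitable barrier the equation would fail unless \<open>k\<close>
  obeys the bound. The same comparison, iterated, gives \<open>E[I powr (- \<alpha>)] < \<infinity>\<close>. All bounds are uniform in
  \<open>h\<close>; in the limit \<open>h \<longlonglongrightarrow> 0\<close> they enclose \<open>\<mu>\<close> near \<open>-\<infinity>\<close>, and hence the density of \<open>I\<close> near 0.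
\<close>

text \<open>The equation for \<open>k\<close> is nonlocal, and no bound on \<open>k\<close> uniform
  in \<open>h\<close> is known beforehand. Two features make comparison possible. All jumps go to
  the right, so on \<open>{..X}\<close> the jumps up to 1 only need \<open>k\<close> on
  \<open>{..X + 1}\<close>, while the larger ones enter through distribution functions alone; decay
  already known for these bounds the source term without circularity. Tilting by
  \<open>exp (- z)\<close> and convolving commute up to a factor between
  \<open>exp (- 3 * h)\<close> and 1.

  Each comparison gains a factor \<open>exp x\<close>, but only from an exponent below \<alpha>,
  where the exponential moment of the big jumps is finite. The last one starts within 1/2 of
  \<alpha> and so passes it with room to spare; this makes the moment of order \<alpha> finite and
  supplies a dominating function for the asymptotics.

  The tail of \<pi> is merely monotone, so the sharp barriers use it smoothed at a second width
  \<open>h0\<close> that stays fixed while \<open>h\<close> tends to 0.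

  The Fourier identity presupposes a finite mean of \<open>1 / I\<close>. This follows from a finite
  mean of \<open>Y 1\<close>, which in turn rests on the exponential decay of the tail of
  \<pi>.\<close>

subsection \<open>Smoothing by quadratic B-splines\<close>

text \<open>The density of the sum of three independent uniform variables on \<open>[0, h]\<close>; \<open>bspline_tail h\<close> is its survival function.\<close>
definition bspline :: "real \<Rightarrow> real \<Rightarrow> real" where
  "bspline h v = ((max 0 v)^2 - 3 * (max 0 (v - h))^2 + 3 * (max 0 (v - 2 * h))^2
     - (max 0 (v - 3 * h))^2) / (2 * h^3)"

definition bspline_deriv :: "real \<Rightarrow> real \<Rightarrow> real" where
  "bspline_deriv h v = (max 0 v - 3 * max 0 (v - h) + 3 * max 0 (v - 2 * h)
     - max 0 (v - 3 * h)) / h^3"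

definition bspline_tail :: "real \<Rightarrow> real \<Rightarrow> real" where
  "bspline_tail h v = 1 - ((max 0 v)^3 - 3 * (max 0 (v - h))^3 + 3 * (max 0 (v - 2 * h))^3
     - (max 0 (v - 3 * h))^3) / (6 * h^3)"

text \<open>The exponent starts at 2 because \<open>max 0 x\<close> itself has a kink. Quadratic
  pieces therefore make the spline once and its tail twice continuously differentiable, as many
  derivatives as the Gaussian part of the equation takes.\<close>

lemma has_real_derivative_max_0_power:
  "((\<lambda>x::real. (max 0 x) ^ Suc (Suc n)) has_real_derivative (real (Suc (Suc n)) * (max 0 x) ^ Suc n)) (at x)"
proof -
  consider "x < 0" | "x = 0" | "x > 0" by linarith
  then show ?thesis
  proof cases
    case 1
    have ev: "eventually (\<lambda>y. (max 0 y) ^ Suc (Suc n) = 0) (nhds x)"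
      using eventually_nhds_in_open[of "{..<0}" x] 1 by (auto elim!: eventually_mono)
    show ?thesis
      by (rule DERIV_cong_ev[THEN iffD2, OF refl ev refl]) (use 1 in auto)
  next
    case 2
    have "((\<lambda>y::real. (max 0 y) ^ Suc (Suc n) / y) \<longlongrightarrow> 0) (at 0)"
    proof (rule Lim_null_comparison)
      show "((\<lambda>y::real. \<bar>y\<bar> ^ Suc n) \<longlongrightarrow> 0) (at 0)"
        by (rule tendsto_eq_intros refl | simp)+
      show "\<forall>\<^sub>F y::real in at 0. norm ((max 0 y) ^ Suc (Suc n) / y) \<le> \<bar>y\<bar> ^ Suc n"
      proof (rule always_eventually, rule allI)
        fix y :: real
        show "norm ((max 0 y) ^ Suc (Suc n) / y) \<le> \<bar>y\<bar> ^ Suc n"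
          by (cases "0 \<le> y") (auto simp: max_def abs_mult intro: mult_nonpos_nonneg)
      qed
    qed
    then show ?thesis
      using 2 by (simp add: has_field_derivative_iff)
  next
    case 3
    have ev: "eventually (\<lambda>y. (max 0 y) ^ Suc (Suc n) = y ^ Suc (Suc n)) (nhds x)"
      using eventually_nhds_in_open[of "{0<..}" x] 3 by (auto elim!: eventually_mono)
    show ?thesis
      by (rule DERIV_cong_ev[THEN iffD2, OF refl ev refl], rule DERIV_cong[OF DERIV_pow])
        (use 3 in \<open>simp add: max_def\<close>)
  qed
qed

lemma has_real_derivative_max_0_power_shift:
  "((\<lambda>x::real. (max 0 (x - c)) ^ Suc (Suc n)) has_real_derivative (real (Suc (Suc n)) * (max 0 (x - c)) ^ Suc n)) (at x)"
proof -
  have "((\<lambda>x. x - c) has_real_derivative 1) (at x)"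
    by (auto intro!: derivative_eq_intros)
  from DERIV_chain'[OF this has_real_derivative_max_0_power[of n "x - c"]]
  show ?thesis by simp
qed

lemma DERIV_max_0_square_shift:
  "((\<lambda>x::real. (max 0 (x - c))^2) has_real_derivative (2 * max 0 (x - c))) (at x)"
  using has_real_derivative_max_0_power_shift[of c 0 x] by (simp add: numeral_2_eq_2)

lemma DERIV_max_0_cube_shift:
  "((\<lambda>x::real. (max 0 (x - c))^3) has_real_derivative (3 * (max 0 (x - c))^2)) (at x)"
  using has_real_derivative_max_0_power_shift[of c 1 x] by (simp add: numeral_3_eq_3 numeral_2_eq_2)

context
  fixes h :: real
  assumes h: "0 < h"
begin

lemma DERIV_bspline: "(bspline h has_real_derivative bspline_deriv h v) (at v)"
proof -
  note D = DERIV_max_0_square_shift[of 0 v, simplified] DERIV_max_0_square_shift[of h v]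
    DERIV_max_0_square_shift[of "2 * h" v] DERIV_max_0_square_shift[of "3 * h" v]
  show ?thesis
    unfolding bspline_def bspline_deriv_def
    by (rule DERIV_cong[OF DERIV_cdivide[OF DERIV_diff[OF DERIV_add[OF DERIV_diff[OF D(1) DERIV_cmult[OF D(2)]]
          DERIV_cmult[OF D(3)]] D(4)]]]) (use h in \<open>simp add: field_simps\<close>)
qed

lemma DERIV_bspline_tail: "(bspline_tail h has_real_derivative - bspline h v) (at v)"
proof -
  note D = DERIV_max_0_cube_shift[of 0 v, simplified] DERIV_max_0_cube_shift[of h v]
    DERIV_max_0_cube_shift[of "2 * h" v] DERIV_max_0_cube_shift[of "3 * h" v]
  show ?thesis
    unfolding bspline_def bspline_tail_def
    by (rule DERIV_cong[OF DERIV_diff[OF DERIV_const DERIV_cdivide[OF DERIV_diff[OF DERIV_add[OF DERIV_diff[OF D(1) DERIV_cmult[OF D(2)]]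
          DERIV_cmult[OF D(3)]] D(4)]]]]) (use h in \<open>simp add: field_simps\<close>)
qed

lemma bspline_left: "v \<le> 0 \<Longrightarrow> bspline h v = 0" "v \<le> 0 \<Longrightarrow> bspline_deriv h v = 0"
  "v \<le> 0 \<Longrightarrow> bspline_tail h v = 1"
  using h by (auto simp: bspline_def bspline_deriv_def bspline_tail_def max_def)

lemma bspline_right: "3 * h \<le> v \<Longrightarrow> bspline h v = 0" "3 * h \<le> v \<Longrightarrow> bspline_deriv h v = 0"
  "3 * h \<le> v \<Longrightarrow> bspline_tail h v = 0"
  using h by (auto simp: bspline_def bspline_deriv_def bspline_tail_def max_def divide_simps)
    (auto simp: power2_eq_square power3_eq_cube algebra_simps)

lemma bspline_nonneg: "0 \<le> bspline h v"
proof -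
  consider "v \<le> 0" | "3 * h \<le> v" | "0 < v" "v \<le> h" | "h < v" "v \<le> 2 * h" | "2 * h < v" "v < 3 * h"
    by linarith
  then have "0 \<le> (max 0 v)^2 - 3 * (max 0 (v - h))^2 + 3 * (max 0 (v - 2 * h))^2 - (max 0 (v - 3 * h))^2"
  proof cases
    case 4
    have "0 \<le> (v - h) * (2 * h - v)" using 4 by simp
    moreover have "v^2 - 3 * (v - h)^2 = h^2 + 2 * ((v - h) * (2 * h - v))"
      by (simp add: power2_eq_square algebra_simps)
    ultimately show ?thesis using 4 h by (simp add: max_def)
  next
    case 5
    have "v^2 - 3 * (v - h)^2 + 3 * (v - 2 * h)^2 = (3 * h - v)^2"
      by (simp add: power2_eq_square algebra_simps)
    then show ?thesis using 5 h by (simp add: max_def)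
  qed (use h in \<open>auto simp: max_def power2_eq_square algebra_simps\<close>)
  then show ?thesis using h by (simp add: bspline_def)
qed

lemma abs_bspline_deriv_le: "\<bar>bspline_deriv h v\<bar> \<le> 1 / h^2"
proof -
  have "\<bar>max 0 v - 3 * max 0 (v - h) + 3 * max 0 (v - 2 * h) - max 0 (v - 3 * h)\<bar> \<le> h"
    using h by (auto simp: max_def)
  then have "\<bar>bspline_deriv h v\<bar> \<le> h / h^3"
    using h by (simp add: bspline_deriv_def divide_right_mono)
  then show ?thesis using h by (simp add: power2_eq_square power3_eq_cube)
qed

lemma bspline_tail_antimono: "v \<le> w \<Longrightarrow> bspline_tail h w \<le> bspline_tail h v"
  by (rule DERIV_nonpos_imp_nonincreasing[of v w])
    (auto intro!: exI[of _ "- bspline h x" for x] DERIV_bspline_tail simp: bspline_nonneg)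

lemma bspline_tail_bounds: "0 \<le> bspline_tail h v" "bspline_tail h v \<le> 1"
  using bspline_tail_antimono[of v "max v (3 * h)"] bspline_tail_antimono[of "min v 0" v]
    bspline_right(3)[of "max v (3 * h)"] bspline_left(3)[of "min v 0"] by auto

lemma bspline_le: "bspline h v \<le> 3 / h"
proof (cases "0 < v \<and> v < 3 * h")
  case True
  obtain z where z: "bspline h v - bspline h 0 = (v - 0) * bspline_deriv h z"
    using MVT2[of 0 v "bspline h" "bspline_deriv h"] True DERIV_bspline by auto
  have "v * bspline_deriv h z \<le> v * (1 / h^2)"
    using True abs_bspline_deriv_le[of z] by (intro mult_left_mono) auto
  also have "\<dots> \<le> (3 * h) * (1 / h^2)"
    using True h by (intro mult_right_mono) auto
  finally have "v * bspline_deriv h z \<le> (3 * h) * (1 / h^2)" .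
  then show ?thesis using z h bspline_left(1)[of 0] by (simp add: power2_eq_square)
next
  case False
  then show ?thesis using bspline_left bspline_right h by auto
qed

lemma continuous_on_bspline:
  "continuous_on A (bspline h)" "continuous_on A (bspline_deriv h)" "continuous_on A (bspline_tail h)"
  unfolding bspline_def[abs_def] bspline_deriv_def[abs_def] bspline_tail_def[abs_def]
  using h by (auto intro!: continuous_intros)

lemma borel_measurable_bspline [measurable]:
  "bspline h \<in> borel_measurable borel" "bspline_deriv h \<in> borel_measurable borel"
  "bspline_tail h \<in> borel_measurable borel"
  by (auto intro!: borel_measurable_continuous_onI continuous_on_bspline)

end

lemma integrable_compact_support:
  fixes f :: "real \<Rightarrow> 'b :: {banach, second_countable_topology}"
  assumes f: "continuous_on UNIV f" and z: "\<And>v. v < a \<or> b < v \<Longrightarrow> f v = 0"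
  shows "integrable lborel f"
proof -
  have "integrable lborel (\<lambda>x. indicator {a..b} x *\<^sub>R f x)"
    using borel_integrable_compact[of "{a..b}" f] continuous_on_subset[OF f]
    by (auto simp: set_integrable_def)
  also have "(\<lambda>x. indicator {a..b} x *\<^sub>R f x) = f"
    using z by (auto simp: fun_eq_iff indicator_def not_le)
  finally show ?thesis .
qed

lemma fourier_deriv_compact_support:
  fixes f :: "real \<Rightarrow> real"
  assumes f: "\<And>v. (f has_real_derivative f' v) (at v)" and f': "continuous_on UNIV f'"
    and z: "\<And>v. v < a \<or> b < v \<Longrightarrow> f v = 0 \<and> f' v = 0"
  shows "(CLBINT v. iexp (- (u * v)) * of_real (f' v)) = \<i> * of_real u * (CLBINT v. iexp (- (u * v)) * of_real (f v))"
proof -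
  have cf: "continuous_on UNIV f"
    using f by (meson DERIV_isCont continuous_at_imp_continuous_on)
  \<comment> \<open>The hypothesis gives zeros only strictly outside \<open>{a..b}\<close>; one more
    unit on each side makes both functions vanish at the end points too, and \<open>min\<close>,
    \<open>max\<close> cover the case \<open>b < a\<close>.\<close>
  define A where "A = min a b - 1"
  define B where "B = max a b + 1"
  have AB: "A \<le> B" "\<And>v. v \<le> A \<or> B \<le> v \<Longrightarrow> f v = 0 \<and> f' v = 0"
  proof -
    show "A \<le> B" by (simp add: A_def B_def)
    show "f v = 0 \<and> f' v = 0" if "v \<le> A \<or> B \<le> v" for v
      by (rule z) (use that in \<open>auto simp: A_def B_def\<close>)
  qed
  define g where "g v = iexp (- (u * v)) * of_real (f v)" for v
  define g' where "g' v = iexp (- (u * v)) * of_real (f' v) - \<i> * of_real u * (iexp (- (u * v)) * of_real (f v))" for v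
  define c where "c = - (\<i> * complex_of_real u)"
  have iexp_c: "iexp (- (u * x)) = exp (c * of_real x)" for x
    by (simp add: c_def mult_ac)
  have dg: "(g has_vector_derivative g' v) (at v within S)" for v S
  proof -
    have e: "((\<lambda>x. exp (c * of_real x)) has_vector_derivative exp (c * of_real v) * c) (at v within S)"
      by (rule has_vector_derivative_real_field[OF DERIV_fun_exp[OF DERIV_cmult_Id]])
    have "((\<lambda>x. complex_of_real (f x)) has_vector_derivative of_real (f' v)) (at v within S)"
      by (rule has_vector_derivative_of_real[OF has_field_derivative_at_within[OF f]])
    from has_vector_derivative_mult[OF e this] show ?thesis
      unfolding g_def g'_def iexp_c by (rule has_vector_derivative_eq_rhs) (simp add: c_def)
  qed
  have cg': "continuous_on S g'" for S
    unfolding g'_def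
    by (intro continuous_intros continuous_on_subset[OF f'] continuous_on_subset[OF cf]) auto
  have "(CLBINT v. indicator {A..B} v *\<^sub>R g' v) = g B - g A"
    by (rule integral_FTC_Icc[OF AB(1) dg cg'])
  also have "\<dots> = 0" using AB by (simp add: g_def)
  also have "(\<lambda>v. indicator {A..B} v *\<^sub>R g' v) = g'"
    using AB by (auto simp: g'_def fun_eq_iff indicator_def not_le)
  finally have "(CLBINT v. g' v) = 0" .
  moreover have "(CLBINT v. g' v) = (CLBINT v. iexp (- (u * v)) * of_real (f' v)) - \<i> * of_real u * (CLBINT v. iexp (- (u * v)) * of_real (f v))"
    unfolding g'_def
  proof (subst Bochner_Integration.integral_diff)
    show "integrable lborel (\<lambda>v. iexp (- (u * v)) * complex_of_real (f' v))"
      by (rule integrable_compact_support[where a=A and b=B])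
        (auto intro!: continuous_intros f' simp: AB(2))
    show "integrable lborel (\<lambda>v. \<i> * complex_of_real u * (iexp (- (u * v)) * complex_of_real (f v)))"
      by (rule integrable_compact_support[where a=A and b=B])
        (auto intro!: continuous_intros cf simp: AB(2))
  qed simp
  ultimately show ?thesis by simp
qed

subsection \<open>Fourier uniqueness and convolutions\<close>

text \<open>The equation for \<mu> carries the factor \<open>\<i> * u\<close> and says nothing at
  frequency 0; continuity of the transform recovers that value.\<close>

lemma fourier_eq_0_at_0:
  fixes h :: "real \<Rightarrow> real"
  assumes h [measurable]: "integrable lborel h"
    and F: "\<And>u. u \<noteq> 0 \<Longrightarrow> (CLBINT x. iexp (u * x) * of_real (h x)) = 0"
  shows "(LBINT x. h x) = 0"
proof -
  have "(\<lambda>n. CLBINT x. iexp (inverse (real (Suc n)) * x) * of_real (h x)) \<longlonglongrightarrow> (CLBINT x. of_real (h x))"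
  proof (rule integral_dominated_convergence)
    show "integrable lborel (\<lambda>x. norm (h x))" using h by simp
    show "AE x in lborel. (\<lambda>n. iexp (inverse (real (Suc n)) * x) * of_real (h x)) \<longlonglongrightarrow> complex_of_real (h x)"
    proof (rule AE_I2)
      fix x :: real
      have "(\<lambda>n. inverse (real (Suc n)) * x) \<longlonglongrightarrow> 0 * x"
        by (intro tendsto_intros LIMSEQ_inverse_real_of_nat)
      then have "(\<lambda>n. iexp (inverse (real (Suc n)) * x)) \<longlonglongrightarrow> iexp 0"
        by (intro tendsto_intros) simp
      then show "(\<lambda>n. iexp (inverse (real (Suc n)) * x) * of_real (h x)) \<longlonglongrightarrow> complex_of_real (h x)"
        by (auto dest: tendsto_mult_right[where c = "complex_of_real (h x)"])
    qed
  qed (auto simp: norm_mult)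
  moreover have "(CLBINT x. iexp (inverse (real (Suc n)) * x) * of_real (h x)) = 0" for n
    by (rule F) simp
  ultimately have "(CLBINT x. of_real (h x)) = 0"
    using LIMSEQ_unique by fastforce
  then show ?thesis by simp
qed

text \<open>Frequency 0 gives the positive and negative parts of \<open>h\<close> the same mass.
  Unless it is 0, both can be normalised to probability densities with equal characteristic
  functions, and Levy's uniqueness theorem applies.\<close>

lemma fourier_uniqueness:
  fixes h :: "real \<Rightarrow> real"
  assumes h [measurable]: "integrable lborel h"
    and F: "\<And>u. u \<noteq> 0 \<Longrightarrow> (CLBINT x. iexp (u * x) * of_real (h x)) = 0"
  shows "AE x in lborel. h x = 0"
proof -
  have hm [measurable]: "h \<in> borel_measurable borel"
    using h by (simp add: borel_measurable_integrable)
  define p where "p x = max 0 (h x)" for x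
  define q where "q x = max 0 (- h x)" for x
  have pqm [measurable]: "p \<in> borel_measurable borel" "q \<in> borel_measurable borel"
    by (auto simp: p_def[abs_def] q_def[abs_def])
  have pq: "integrable lborel p" "integrable lborel q" "\<And>x. h x = p x - q x" "\<And>x. 0 \<le> p x" "\<And>x. 0 \<le> q x"
    using h by (auto simp: p_def q_def abs_if max_def intro!: Bochner_Integration.integrable_bound[OF h])
  define m where "m = (LBINT x. p x)"
  have mq: "m = (LBINT x. q x)"
    using fourier_eq_0_at_0[OF h F] pq by (simp add: m_def)
  have "0 \<le> m" unfolding m_def by (intro integral_nonneg_AE AE_I2 pq)
  show ?thesis
  proof (cases "m = 0")
    case True
    have "AE x in lborel. p x = 0" "AE x in lborel. q x = 0"
      using True mq pq integral_nonneg_eq_0_iff_AE[of lborel p] integral_nonneg_eq_0_iff_AE[of lborel q]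
      by (auto simp: m_def)
    then show ?thesis by (auto simp: pq(3))
  next
    case False
    with \<open>0 \<le> m\<close> have m: "0 < m" by simp
    have rd: "real_distribution (density lborel (\<lambda>x. ennreal (f x / m)))"
      if [measurable]: "f \<in> borel_measurable borel" and f: "integrable lborel f" "\<And>x. 0 \<le> f x" "(LBINT x. f x) = m" for f
    proof -
      have "emeasure (density lborel (\<lambda>x. ennreal (f x / m))) UNIV = (\<integral>\<^sup>+x. ennreal (f x / m) \<partial>lborel)"
        by (simp add: emeasure_density)
      also have "\<dots> = ennreal (LBINT x. f x / m)"
        using f m by (intro nn_integral_eq_integral) auto
      also have "\<dots> = 1" using f m by simp
      finally interpret prob_space "density lborel (\<lambda>x. ennreal (f x / m))"
        by (intro prob_spaceI) simp
      show ?thesis by unfold_locales (auto)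
    qed
    have ch: "char (density lborel (\<lambda>x. ennreal (f x / m))) u = (CLBINT x. iexp (u * x) * of_real (f x)) / m"
      if [measurable]: "f \<in> borel_measurable borel" and f: "\<And>x. 0 \<le> f x" for f u
    proof -
      have "char (density lborel (\<lambda>x. ennreal (f x / m))) u = (CLBINT x. (f x / m) *\<^sub>R iexp (u * x))"
        unfolding char_def using f m by (subst integral_density) auto
      also have "\<dots> = (CLBINT x. (iexp (u * x) * of_real (f x)) / m)"
        by (intro Bochner_Integration.integral_cong refl) (simp add: scaleR_conv_of_real)
      finally show ?thesis by simp
    qed
    have "char (density lborel (\<lambda>x. ennreal (p x / m))) = char (density lborel (\<lambda>x. ennreal (q x / m)))"
    proof
      fix u
      have int: "complex_integrable lborel (\<lambda>x. iexp (u * x) * of_real (f x))" if "integrable lborel f" for f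
        by (rule Bochner_Integration.integrable_bound[OF that]) (use borel_measurable_integrable[OF that] in \<open>auto simp: norm_mult\<close>)
      have "(CLBINT x. iexp (u * x) * of_real (h x)) = (CLBINT x. iexp (u * x) * of_real (p x)) - (CLBINT x. iexp (u * x) * of_real (q x))"
        using int[OF pq(1)] int[OF pq(2)] by (simp add: pq(3) algebra_simps)
      moreover have "(CLBINT x. iexp (u * x) * of_real (h x)) = 0"
        using F[of u] fourier_eq_0_at_0[OF h F] by (cases "u = 0") auto
      ultimately show "char (density lborel (\<lambda>x. ennreal (p x / m))) u = char (density lborel (\<lambda>x. ennreal (q x / m))) u"
        by (simp add: ch pq)
    qed
    with rd pq mq have "density lborel (\<lambda>x. ennreal (p x / m)) = density lborel (\<lambda>x. ennreal (q x / m))"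
      by (intro Levy_uniqueness) (auto simp: m_def)
    then have "AE x in lborel. ennreal (p x / m) = ennreal (q x / m)"
      by (subst (asm) sigma_finite_measure.density_unique_iff[OF sigma_finite_lborel]) auto
    then show ?thesis
      using m pq by (auto simp: divide_right_mono)
  qed
qed

text \<open>The kernel enters reflected, as \<open>f (z - x)\<close>, because a smoothed
  distribution function at \<open>x\<close> must count the mass to the left of \<open>x\<close>.
  This is why the transform of \<open>f\<close> appears at frequency \<open>- u\<close>.\<close>

lemma
  fixes f :: "real \<Rightarrow> real"
  assumes f: "integrable lborel f" and fm [measurable]: "f \<in> borel_measurable borel"
    and fin: "finite_measure \<mu>" and s [measurable_cong]: "sets \<mu> = sets borel"
  shows integrable_conv: "integrable lborel (\<lambda>x. LINT z|\<mu>. f (z - x))"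
    and fourier_conv: "(CLBINT x. iexp (u * x) * of_real (LINT z|\<mu>. f (z - x))) =
       (CLINT z|\<mu>. iexp (u * z)) * (CLBINT v. iexp (- (u * v)) * of_real (f v))"
    and integral_abs_conv_le: "(LBINT x. \<bar>LINT z|\<mu>. f (z - x)\<bar>) \<le> measure \<mu> UNIV * (LBINT v. \<bar>f v\<bar>)"
proof -
  interpret finite_measure \<mu> by fact
  interpret pair_sigma_finite lborel \<mu> ..
  have sp: "space \<mu> = UNIV" using s sets_eq_imp_space_eq by force
  have reflect: "(LBINT x. g (z - x)) = (LBINT v. g v)" for g :: "real \<Rightarrow> 'c::{banach, second_countable_topology}" and z
    using lborel_integral_real_affine[of "-1" g z] by simp
  have int_refl: "integrable lborel (\<lambda>x. g (z - x))" if "integrable lborel g" for g :: "real \<Rightarrow> 'c::{banach, second_countable_topology}" and z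
    using lborel_integrable_real_affine[OF that, of "-1" z] by simp
  have absint: "integrable (lborel \<Otimes>\<^sub>M \<mu>) (\<lambda>(x, z). \<bar>f (z - x)\<bar>)"
  proof (rule integrableI_bounded)
    have "(\<integral>\<^sup>+p. ennreal (norm (case p of (x, z) \<Rightarrow> \<bar>f (z - x)\<bar>)) \<partial>(lborel \<Otimes>\<^sub>M \<mu>)) =
       (\<integral>\<^sup>+z. (\<integral>\<^sup>+x. ennreal \<bar>f (z - x)\<bar> \<partial>lborel) \<partial>\<mu>)"
      by (subst nn_integral_snd[symmetric]) (auto simp: split_beta')
    also have "\<dots> = (\<integral>\<^sup>+z. ennreal (LBINT v. \<bar>f v\<bar>) \<partial>\<mu>)"
      using int_refl[of "\<lambda>x. \<bar>f x\<bar>"] f reflect[of "\<lambda>x. \<bar>f x\<bar>"]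
      by (intro nn_integral_cong) (subst nn_integral_eq_integral; simp)
    also have "\<dots> < \<infinity>"
      by (simp add: ennreal_mult_less_top emeasure_eq_measure)
    finally show "(\<integral>\<^sup>+p. ennreal (norm (case p of (x, z) \<Rightarrow> \<bar>f (z - x)\<bar>)) \<partial>(lborel \<Otimes>\<^sub>M \<mu>)) < \<infinity>" .
  qed measurable
  have int: "integrable (lborel \<Otimes>\<^sub>M \<mu>) (\<lambda>(x, z). f (z - x))"
    using absint by (rule Bochner_Integration.integrable_bound) (auto simp: split_beta')
  have cint: "complex_integrable (lborel \<Otimes>\<^sub>M \<mu>) (\<lambda>(x, z). iexp (u * x) * of_real (f (z - x)))"
    using absint by (rule Bochner_Integration.integrable_bound) (auto simp: split_beta' norm_mult)
  show i: "integrable lborel (\<lambda>x. LINT z|\<mu>. f (z - x))"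
    using integrable_fst[OF int] by simp
  have "(CLBINT x. iexp (u * x) * of_real (LINT z|\<mu>. f (z - x))) = (CLBINT x. (CLINT z|\<mu>. iexp (u * x) * of_real (f (z - x))))"
    by simp
  also have "\<dots> = (CLINT z|\<mu>. (CLBINT x. iexp (u * x) * of_real (f (z - x))))"
    using Fubini_integral[OF cint] by simp
  also have "\<dots> = (CLINT z|\<mu>. iexp (u * z) * (CLBINT v. iexp (- (u * v)) * of_real (f v)))"
  proof (intro Bochner_Integration.integral_cong refl)
    fix z
    have "(CLBINT x. iexp (u * x) * of_real (f (z - x))) = (CLBINT x. iexp (u * (z - (z - x))) * of_real (f (z - x)))"
      by simp
    also have "\<dots> = (CLBINT v. iexp (u * (z - v)) * of_real (f v))"
      by (rule reflect[of "\<lambda>v. iexp (u * (z - v)) * of_real (f v)"])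
    also have "\<dots> = (CLBINT v. iexp (u * z) * (iexp (- (u * v)) * of_real (f v)))"
      by (intro Bochner_Integration.integral_cong) (auto simp: exp_add[symmetric] algebra_simps)
    finally show "(CLBINT x. iexp (u * x) * of_real (f (z - x))) = iexp (u * z) * (CLBINT v. iexp (- (u * v)) * of_real (f v))"
      by simp
  qed
  finally show "(CLBINT x. iexp (u * x) * of_real (LINT z|\<mu>. f (z - x))) =
       (CLINT z|\<mu>. iexp (u * z)) * (CLBINT v. iexp (- (u * v)) * of_real (f v))" by simp
  have "(LBINT x. \<bar>LINT z|\<mu>. f (z - x)\<bar>) \<le> (LBINT x. (LINT z|\<mu>. \<bar>f (z - x)\<bar>))"
    using integrable_fst[OF absint] i by (intro integral_mono integral_abs_bound) auto
  also have "\<dots> = (LINT z|\<mu>. (LBINT x. \<bar>f (z - x)\<bar>))"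
    using Fubini_integral[OF absint] by simp
  also have "\<dots> = measure \<mu> UNIV * (LBINT v. \<bar>f v\<bar>)"
    using reflect[of "\<lambda>v. \<bar>f v\<bar>"] by (simp add: sp)
  finally show "(LBINT x. \<bar>LINT z|\<mu>. f (z - x)\<bar>) \<le> measure \<mu> UNIV * (LBINT v. \<bar>f v\<bar>)" .
qed

lemma
  fixes f :: "real \<Rightarrow> real"
  assumes f: "continuous_on UNIV f" and b: "\<And>v. \<bar>f v\<bar> \<le> B" and fin: "finite_measure \<mu>" and s [measurable_cong]: "sets \<mu> = sets borel"
  shows continuous_conv: "continuous_on UNIV (\<lambda>x. LINT z|\<mu>. f (z - x))"
    and integrable_conv_point: "integrable \<mu> (\<lambda>z. f (z - x))"
proof -
  interpret finite_measure \<mu> by fact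
  have [measurable]: "f \<in> borel_measurable borel" using f by (rule borel_measurable_continuous_onI)
  show "integrable \<mu> (\<lambda>z. f (z - x))"
    by (rule integrable_const_bound[of _ B]) (auto simp: b)
  have isf: "isCont f v" for v using f by (simp add: continuous_on_eq_continuous_at)
  show "continuous_on UNIV (\<lambda>x. LINT z|\<mu>. f (z - x))"
  proof (rule continuous_at_imp_continuous_on, rule ballI)
    fix x :: real
    show "isCont (\<lambda>x. LINT z|\<mu>. f (z - x)) x"
      unfolding continuous_at_sequentially comp_def
    proof (intro allI impI)
      fix X assume X: "X \<longlonglongrightarrow> x"
      show "(\<lambda>n. LINT z|\<mu>. f (z - X n)) \<longlonglongrightarrow> (LINT z|\<mu>. f (z - x))"
        by (rule integral_dominated_convergence[where w = "\<lambda>_. B"])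
          (auto simp: b intro!: isCont_tendsto_compose[OF isf] tendsto_intros X)
    qed
  qed
qed

lemma DERIV_conv:
  fixes f :: "real \<Rightarrow> real"
  assumes f: "\<And>v. (f has_real_derivative f' v) (at v)" and f': "continuous_on UNIV f'"
    and b: "\<And>v. \<bar>f v\<bar> \<le> B" "\<And>v. \<bar>f' v\<bar> \<le> B'"
    and fin: "finite_measure \<mu>" and s [measurable_cong]: "sets \<mu> = sets borel"
  shows "((\<lambda>x. LINT z|\<mu>. f (z - x)) has_real_derivative - (LINT z|\<mu>. f' (z - x))) (at x)"
proof -
  interpret finite_measure \<mu> by fact
  have cf: "continuous_on UNIV f"
    using f by (meson DERIV_isCont continuous_at_imp_continuous_on)
  have [measurable]: "f \<in> borel_measurable borel" "f' \<in> borel_measurable borel"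
    using f' cf by (auto intro: borel_measurable_continuous_onI)
  have lip: "\<bar>f v - f w\<bar> \<le> B' * \<bar>v - w\<bar>" for v w
    using field_differentiable_bound[of UNIV f f' B' v w] f b(2) by (auto simp: has_field_derivative_at_within)
  show ?thesis
    unfolding DERIV_def
  proof (rule LIMSEQ_SEQ_conv[THEN iffD1], intro allI impI, elim conjE)
    fix S :: "nat \<Rightarrow> real" assume S: "\<forall>n. S n \<noteq> 0" "S \<longlonglongrightarrow> 0"
    have "(\<lambda>n. LINT z|\<mu>. (f (z - (x + S n)) - f (z - x)) / S n) \<longlonglongrightarrow> (LINT z|\<mu>. - f' (z - x))"
    proof (rule integral_dominated_convergence[where w = "\<lambda>_. B'"])
      show "AE z in \<mu>. norm ((f (z - (x + S n)) - f (z - x)) / S n) \<le> B'" for n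
        using lip[of "z - (x + S n)" "z - x" for z] S by (auto simp: divide_simps)
      show "AE z in \<mu>. (\<lambda>n. (f (z - (x + S n)) - f (z - x)) / S n) \<longlonglongrightarrow> - f' (z - x)"
      proof (rule AE_I2)
        fix z
        have "((\<lambda>y. f (z - y)) has_real_derivative - f' (z - x)) (at x)"
          by (rule DERIV_cong[OF DERIV_chain'[OF _ f]]) (auto intro!: derivative_eq_intros)
        then have "((\<lambda>h. (f (z - (x + h)) - f (z - x)) / h) \<longlongrightarrow> - f' (z - x)) (at 0)"
          by (simp add: DERIV_def)
        then show "(\<lambda>n. (f (z - (x + S n)) - f (z - x)) / S n) \<longlonglongrightarrow> - f' (z - x)"
          by (rule filterlim_compose) (use S in \<open>auto simp: filterlim_at\<close>)
      qed
    qed (auto)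
    moreover have "(\<lambda>n. LINT z|\<mu>. (f (z - (x + S n)) - f (z - x)) / S n) = (\<lambda>n. ((LINT z|\<mu>. f (z - (x + S n))) - (LINT z|\<mu>. f (z - x))) / S n)"
      using integrable_conv_point[OF cf b(1) fin s] by (auto simp: fun_eq_iff)
    ultimately show "(\<lambda>n. ((LINT z|\<mu>. f (z - (x + S n))) - (LINT z|\<mu>. f (z - x))) / S n) \<longlonglongrightarrow> - (LINT z|\<mu>. f' (z - x))"
      by simp
  qed
qed

lemma continuous_AE_eq_0:
  fixes f :: "real \<Rightarrow> real"
  assumes f: "continuous_on UNIV f" and ae: "AE x in lborel. f x = 0"
  shows "f x = 0"
proof (rule ccontr)
  assume "f x \<noteq> 0"
  have "open {x. f x \<noteq> 0}"
    using f by (intro open_Collect_neq continuous_intros) auto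
  moreover have "negligible {x. f x \<noteq> 0}"
  proof -
    have "{x. f x \<noteq> 0} \<in> null_sets lborel"
      using ae f[THEN borel_measurable_continuous_onI] by (subst (asm) AE_iff_null) auto
    then show ?thesis
      by (simp add: negligible_iff_null_sets null_sets_completionI)
  qed
  ultimately show False
    using \<open>f x \<noteq> 0\<close> open_not_negligible by fastforce
qed

section \<open>The compensated jump kernel and its Fourier transform\<close>

definition compensated_tail :: "real \<Rightarrow> real \<Rightarrow> real \<Rightarrow> real" where
  "compensated_tail h y v = bspline_tail h (v - y) - bspline_tail h v - (if y \<le> 1 then y * bspline h v else 0)"

text \<open>Controls the compensated kernel both pointwise and in \<open>L1\<close>: quadratic near
  0 by Taylor expansion, linear for large \<open>y\<close> because the support of the kernel has
  length about \<open>3 * h + y\<close>. Its integrability is where the finite mean of the big jumps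
  enters.\<close>

definition levy_weight :: "real \<Rightarrow> real" where
  "levy_weight y = (if y \<le> 1 then y\<^sup>2 else y)"

context
  fixes h :: real
  assumes h: "0 < h"
begin

lemma continuous_on_compensated_tail: "continuous_on A (compensated_tail h y)"
proof -
  have "continuous_on UNIV (\<lambda>v. bspline_tail h (v - y))"
    by (intro continuous_on_compose2[OF continuous_on_bspline(3)[OF h]] continuous_intros) auto
  then have "continuous_on UNIV (compensated_tail h y)"
    unfolding compensated_tail_def[abs_def]
    by (cases "y \<le> 1") (auto intro!: continuous_intros continuous_on_bspline h)
  then show ?thesis by (rule continuous_on_subset) auto
qed

text \<open>The compensator \<open>y * bspline h v\<close> is the first-order Taylor term of the
  spline tail. The mean value theorem, applied to the tail and then to the spline, leaves
  \<open>y * (v - s)\<close> times a value of \<open>bspline_deriv h\<close>, with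
  \<open>v - s\<close> at most \<open>y\<close>.\<close>

lemma abs_compensated_tail_le:
  assumes y: "0 < y"
  shows "\<bar>compensated_tail h y v\<bar> \<le> (1 / h^2 + 1) * levy_weight y"
proof (cases "y \<le> 1")
  case True
  obtain s where s: "v - y < s" "s < v" "bspline_tail h v - bspline_tail h (v - y) = (v - (v - y)) * (- bspline h s)"
    using MVT2[of "v - y" v "bspline_tail h" "\<lambda>x. - bspline h x"] y DERIV_bspline_tail[OF h] by auto
  obtain r where r: "bspline h v - bspline h s = (v - s) * bspline_deriv h r"
    using MVT2[of s v "bspline h" "bspline_deriv h"] s DERIV_bspline[OF h] by auto
  have "compensated_tail h y v = - (y * (v - s) * bspline_deriv h r)"
  proof -
    have 1: "bspline_tail h (v - y) = bspline_tail h v + y * bspline h s" using s(3) by simp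
    have 2: "bspline h v = bspline h s + (v - s) * bspline_deriv h r" using r by simp
    have "compensated_tail h y v = bspline_tail h (v - y) - bspline_tail h v - y * bspline h v"
      using True by (simp add: compensated_tail_def)
    also have "\<dots> = - (y * (v - s) * bspline_deriv h r)"
      unfolding 1 2 by (simp add: algebra_simps)
    finally show ?thesis .
  qed
  then have "\<bar>compensated_tail h y v\<bar> = y * (v - s) * \<bar>bspline_deriv h r\<bar>"
    using s y by (simp add: abs_mult)
  also have "\<dots> \<le> y * y * (1 / h^2)"
    using s y abs_bspline_deriv_le[OF h, of r] by (intro mult_mono) auto
  also have "\<dots> \<le> (1 / h^2 + 1) * levy_weight y"
    using True by (simp add: levy_weight_def power2_eq_square algebra_simps)
  finally show ?thesis .
next
  case False
  have "\<bar>compensated_tail h y v\<bar> \<le> 1"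
    using False bspline_tail_bounds[OF h, of v] bspline_tail_bounds[OF h, of "v - y"]
    by (simp add: compensated_tail_def)
  also have "\<dots> \<le> y" using False by simp
  also have "\<dots> \<le> (1 / h^2 + 1) * levy_weight y"
    using False by (simp add: levy_weight_def algebra_simps)
  finally show ?thesis .
qed

lemma compensated_tail_eq_0: "v < 0 \<or> 3 * h + y < v \<Longrightarrow> 0 < y \<Longrightarrow> compensated_tail h y v = 0"
  using h bspline_left[OF h] bspline_right[OF h] by (auto simp: compensated_tail_def)

lemma integrable_compensated_tail: "0 < y \<Longrightarrow> integrable lborel (compensated_tail h y)"
  by (rule integrable_compact_support[where a = 0 and b = "3 * h + y"])
    (auto simp: continuous_on_compensated_tail compensated_tail_eq_0)

lemma integral_abs_compensated_tail_le:
  assumes y: "0 < y"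
  shows "(LBINT v. \<bar>compensated_tail h y v\<bar>) \<le> (3 * h + 1) * (1 / h^2 + 1) * levy_weight y"
proof -
  define b where "b = (if y \<le> 1 then (1 / h^2 + 1) * levy_weight y else 1)"
  have le: "\<bar>compensated_tail h y v\<bar> \<le> indicator {0..3 * h + y} v * b" for v
  proof (cases "v < 0 \<or> 3 * h + y < v")
    case True then show ?thesis using compensated_tail_eq_0[of v y] y by (auto simp: indicator_def)
  next
    case False
    then show ?thesis
      using abs_compensated_tail_le[OF y, of v] bspline_tail_bounds[OF h, of v] bspline_tail_bounds[OF h, of "v - y"]
      by (auto simp: b_def indicator_def compensated_tail_def)
  qed
  have "(LBINT v. \<bar>compensated_tail h y v\<bar>) \<le> (LBINT v. indicator {0..3 * h + y} v * b)"
    using le by (intro integral_mono integrable_abs integrable_compensated_tail y)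
      (auto simp: integrable_indicator_iff emeasure_lborel_Icc_eq)
  also have "\<dots> = (3 * h + y) * b"
    using h y by simp
  also have "\<dots> \<le> (3 * h + 1) * (1 / h^2 + 1) * levy_weight y"
  proof (cases "y \<le> 1")
    case True
    then have "(3 * h + y) * b \<le> (3 * h + 1) * b"
      using y h by (intro mult_right_mono) (auto simp: b_def levy_weight_def)
    then show ?thesis using True by (simp add: b_def mult.assoc)
  next
    case False
    have "3 * h + y \<le> (3 * h + 1) * y" using False h by (simp add: algebra_simps)
    also have "\<dots> \<le> (3 * h + 1) * ((1 / h^2 + 1) * y)"
      using False h by (intro mult_left_mono) (auto simp: algebra_simps)
    finally show ?thesis using False by (simp add: b_def levy_weight_def mult.assoc)
  qed
  finally show ?thesis .
qed

text \<open>Multiplication by \<open>\<i> * u\<close> stands for differentiation. The difference of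
  the two tails has derivative \<open>bspline h v - bspline h (v - y)\<close>, and the transform of
  this is that of the spline times \<open>1 - iexp (- (u * y))\<close>. Together with the
  compensator this is minus the Levy--Khintchine integrand at \<open>- u\<close>.\<close>

lemma fourier_compensated_tail:
  assumes y: "0 < y"
  shows "\<i> * of_real u * (CLBINT v. iexp (- (u * v)) * of_real (compensated_tail h y v)) =
    - (CLBINT v. iexp (- (u * v)) * of_real (bspline h v)) *
      (iexp (- u * y) - 1 - \<i> * of_real (- u * y * indicator {-1..1} y))"
proof -
  define R where "R = (CLBINT v. iexp (- (u * v)) * of_real (bspline h v))"
  have ci: "complex_integrable lborel (\<lambda>v. iexp (- (u * v)) * of_real (f v))" if "integrable lborel f" for f
    by (rule Bochner_Integration.integrable_bound[OF that])
      (use borel_measurable_integrable[OF that] in \<open>auto simp: norm_mult\<close>)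
  have ib: "integrable lborel (bspline h)"
    by (rule integrable_compact_support[where a = 0 and b = "3 * h"])
      (auto simp: continuous_on_bspline[OF h] bspline_left[OF h] bspline_right[OF h])
  have ibs: "integrable lborel (\<lambda>v. bspline h (v - y))"
    using lborel_integrable_real_affine[OF ib, of 1 "- y"] by simp
  define D where "D v = bspline_tail h (v - y) - bspline_tail h v" for v
  have iD: "integrable lborel D"
    unfolding D_def using h y
    by (intro integrable_compact_support[where a = 0 and b = "3 * h + y"])
      (auto simp: bspline_left[OF h] bspline_right[OF h] intro!: continuous_intros
        continuous_on_bspline[OF h] continuous_on_compose2[OF continuous_on_bspline(3)[OF h, of UNIV]])
  have dD: "(D has_real_derivative bspline h v - bspline h (v - y)) (at v)" for v
  proof -
    have "((\<lambda>v. bspline_tail h (v - y)) has_real_derivative - bspline h (v - y)) (at v)"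
      by (rule DERIV_cong[OF DERIV_chain'[OF _ DERIV_bspline_tail[OF h]]]) (auto intro!: derivative_eq_intros)
    from DERIV_diff[OF this DERIV_bspline_tail[OF h, of v]] show ?thesis
      by (simp add: D_def[abs_def])
  qed
  have "(CLBINT v. iexp (- (u * v)) * of_real (bspline h v - bspline h (v - y))) =
      \<i> * of_real u * (CLBINT v. iexp (- (u * v)) * of_real (D v))"
  proof (rule fourier_deriv_compact_support[where f = D and a = 0 and b = "3 * h + y"])
    show "(D has_real_derivative bspline h v - bspline h (v - y)) (at v)" for v by (rule dD)
    show "continuous_on UNIV (\<lambda>v. bspline h v - bspline h (v - y))"
      by (intro continuous_intros continuous_on_bspline[OF h] continuous_on_compose2[OF continuous_on_bspline(1)[OF h, of UNIV]]) auto
  qed (use h y in \<open>auto simp: D_def bspline_left[OF h] bspline_right[OF h]\<close>)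
  moreover have "(CLBINT v. iexp (- (u * v)) * of_real (bspline h (v - y))) = iexp (- (u * y)) * R"
  proof -
    have "(CLBINT v. iexp (- (u * v)) * of_real (bspline h (v - y))) =
        (CLBINT v. iexp (- (u * (y + 1 * v))) * of_real (bspline h ((y + 1 * v) - y)))"
      by (subst lborel_integral_real_affine[where c = 1 and t = y]) auto
    also have "\<dots> = (CLBINT v. iexp (- (u * y)) * (iexp (- (u * v)) * of_real (bspline h v)))"
      by (intro Bochner_Integration.integral_cong) (auto simp: exp_add[symmetric] algebra_simps)
    finally show ?thesis by (simp add: R_def)
  qed
  moreover have "(CLBINT v. iexp (- (u * v)) * of_real (bspline h v - bspline h (v - y))) =
     R - (CLBINT v. iexp (- (u * v)) * of_real (bspline h (v - y)))"
    unfolding R_def using ci[OF ib] ci[OF ibs] by (simp add: algebra_simps)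
  ultimately have *: "\<i> * of_real u * (CLBINT v. iexp (- (u * v)) * of_real (D v)) = R - iexp (- (u * y)) * R"
    by simp
  have "(CLBINT v. iexp (- (u * v)) * of_real (compensated_tail h y v)) =
     (CLBINT v. iexp (- (u * v)) * of_real (D v) - of_real (if y \<le> 1 then y else 0) * (iexp (- (u * v)) * of_real (bspline h v)))"
    by (intro Bochner_Integration.integral_cong) (auto simp: D_def compensated_tail_def algebra_simps)
  also have "\<dots> = (CLBINT v. iexp (- (u * v)) * of_real (D v)) - of_real (if y \<le> 1 then y else 0) * R"
    unfolding R_def using ci[OF ib] ci[OF iD] by simp
  finally have "(CLBINT v. iexp (- (u * v)) * of_real (compensated_tail h y v)) =
    (CLBINT v. iexp (- (u * v)) * of_real (D v)) - of_real (if y \<le> 1 then y else 0) * R" .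
  then have "\<i> * of_real u * (CLBINT v. iexp (- (u * v)) * of_real (compensated_tail h y v)) =
     \<i> * of_real u * (CLBINT v. iexp (- (u * v)) * of_real (D v)) - \<i> * of_real u * of_real (if y \<le> 1 then y else 0) * R"
    by (simp only: right_diff_distrib mult.assoc)
  also have "\<dots> = - R * (iexp (- u * y) - 1 - \<i> * of_real (- u * y * indicator {-1..1} y))"
    unfolding * using y by (auto simp: indicator_def algebra_simps)
  finally show ?thesis by (simp add: R_def)
qed

end

text \<open>Kept general because it serves both \<mu> and \<open>reflected_tail\<close>. The
  function \<open>bspline_tail h (z - x)\<close> is 1 up to \<open>z = x\<close> and 0 from
  \<open>x + 3 * h\<close> on, so smoothing looks only to the right, by at most
  \<open>3 * h\<close>.\<close>

lemma
  assumes h: "0 < h" and fin: "finite_measure N" and s [measurable_cong]: "sets N = sets borel"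
  shows conv_bspline_tail_ge: "cdf N x \<le> (LINT z|N. bspline_tail h (z - x))"
    and conv_bspline_tail_le: "(LINT z|N. bspline_tail h (z - x)) \<le> cdf N (x + 3 * h)"
    and conv_bspline_le: "(LINT z|N. bspline h (z - x)) \<le> 3 / h * cdf N (x + 3 * h)"
    and DERIV_conv_bspline_tail:
      "((\<lambda>x. LINT z|N. bspline_tail h (z - x)) has_real_derivative (LINT z|N. bspline h (z - x))) (at x)"
proof -
  interpret finite_measure N by fact
  have sp: "space N = UNIV" using s sets_eq_imp_space_eq by force
  have ab: "\<bar>bspline h v\<bar> \<le> 3 / h" "\<bar>- bspline h v\<bar> \<le> 3 / h" "\<bar>bspline_tail h v\<bar> \<le> 1" for v
    using bspline_nonneg[OF h] bspline_le[OF h] bspline_tail_bounds[OF h] by auto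
  have i: "integrable N (indicator {..x} :: real \<Rightarrow> real)" for x
    by (auto simp: integrable_indicator_iff sp emeasure_eq_measure)
  have eq: "cdf N x = (LINT z|N. indicator {..x} z)" for x
    by (simp add: cdf_def sp)
  have it: "integrable N (\<lambda>z. bspline_tail h (z - x))"
    by (rule integrable_conv_point[OF continuous_on_bspline(3)[OF h] ab(3) fin s])
  have ib: "integrable N (\<lambda>z. bspline h (z - x))"
    by (rule integrable_conv_point[OF continuous_on_bspline(1)[OF h] ab(1) fin s])
  show "cdf N x \<le> (LINT z|N. bspline_tail h (z - x))"
    unfolding eq
    by (intro integral_mono i it)
      (auto simp: indicator_def bspline_tail_bounds[OF h] bspline_left[OF h])
  show "(LINT z|N. bspline_tail h (z - x)) \<le> cdf N (x + 3 * h)"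
    unfolding eq
    by (intro integral_mono i it)
      (auto simp: indicator_def bspline_tail_bounds[OF h] bspline_right[OF h])
  have "(LINT z|N. bspline h (z - x)) \<le> (LINT z|N. 3 / h * indicator {..x + 3 * h} z)"
    by (intro integral_mono ib Bochner_Integration.integrable_mult_right i)
      (auto simp: indicator_def bspline_le[OF h] bspline_right[OF h])
  then show "(LINT z|N. bspline h (z - x)) \<le> 3 / h * cdf N (x + 3 * h)"
    by (simp add: eq)
  from DERIV_conv[OF DERIV_bspline_tail[OF h] continuous_on_minus[OF continuous_on_bspline(1)[OF h]] ab(3) ab(2) fin s]
  show "((\<lambda>x. LINT z|N. bspline_tail h (z - x)) has_real_derivative (LINT z|N. bspline h (z - x))) (at x)"
    by simp
qed

subsection \<open>The smoothed equation\<close>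

abbreviation (input) fourier_bspline :: "real \<Rightarrow> real \<Rightarrow> complex" where
  "fourier_bspline h u \<equiv> (CLBINT v. iexp (- (u * v)) * of_real (bspline h v))"

lemma levy_measure_Ici_finite:
  assumes s: "sets \<pi> = sets borel" and l: "(\<integral>\<^sup>+x. ennreal (min 1 (x\<^sup>2)) \<partial>\<pi>) < \<infinity>" and r: "0 < r"
  shows "emeasure \<pi> {r..} < \<infinity>"
proof -
  have "ennreal (min 1 (r\<^sup>2)) * emeasure \<pi> {r..} = (\<integral>\<^sup>+x. ennreal (min 1 (r\<^sup>2)) * indicator {r..} x \<partial>\<pi>)"
    by (subst nn_integral_cmult_indicator) (auto simp: s)
  also have "\<dots> \<le> (\<integral>\<^sup>+x. ennreal (min 1 (x\<^sup>2)) \<partial>\<pi>)"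
    using r by (intro nn_integral_mono) (auto simp: indicator_def intro!: ennreal_leI min.coboundedI2 power_mono)
  also note l
  finally have "ennreal (min 1 (r\<^sup>2)) * emeasure \<pi> {r..} < \<infinity>" .
  moreover have "0 < min 1 (r\<^sup>2)" using r by simp
  ultimately show ?thesis
    by (auto simp: ennreal_mult_less_top)
qed

text \<open>Separates the analysis from the process. Here \<mu> is to be the law of
  \<open>ln I\<close> on the event \<open>0 < I\<close>, \<open>integrable_exp_minus\<close> says
  that \<open>1 / I\<close> has finite mean, and \<open>fourier_equation\<close> is the stationarity
  relation in Fourier form.\<close>

locale log_functional_law =
  fixes \<mu> \<pi> :: "real measure" and a \<sigma> :: real
  assumes sets_mu [measurable_cong]: "sets \<mu> = sets borel"
    and finite_mu: "finite_measure \<mu>"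
    and mass_mu: "measure \<mu> UNIV \<le> 1"
    and integrable_exp_minus: "integrable \<mu> (\<lambda>z. exp (- z))"
    and sets_pi [measurable_cong]: "sets \<pi> = sets borel"
    and pi_nonpos: "emeasure \<pi> {..0} = 0"
    and pi_levy: "(\<integral>\<^sup>+x. ennreal (min 1 (x\<^sup>2)) \<partial>\<pi>) < \<infinity>"
    and pi_mean: "integrable \<pi> (\<lambda>y. indicator {1<..} y * y)"
    and fourier_equation: "\<And>u. \<i> * of_real u * (CLINT z|\<mu>. iexp (u * z) * of_real (exp (- z))) =
        - levy_khintchine_exponent a \<sigma> \<pi> (- u) * (CLINT z|\<mu>. iexp (u * z))"
begin

sublocale mu: finite_measure \<mu> by (rule finite_mu)

lemma space_mu: "space \<mu> = UNIV" and space_pi: "space \<pi> = UNIV"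
  using sets_eq_imp_space_eq[OF sets_mu] sets_eq_imp_space_eq[OF sets_pi] by auto

lemma AE_pi_pos: "AE y in \<pi>. 0 < y"
proof -
  have "{..0} \<in> null_sets \<pi>" using pi_nonpos by (auto simp: null_sets_def sets_pi)
  then have "AE y in \<pi>. y \<notin> {..0}" by (rule AE_not_in)
  then show ?thesis by eventually_elim auto
qed

lemmas emeasure_pi_Ici_finite = levy_measure_Ici_finite[OF sets_pi pi_levy]

sublocale pi: sigma_finite_measure \<pi>
proof
  let ?A = "insert {..0} (range (\<lambda>n. {inverse (real (Suc n))..}))"
  show "\<exists>A. countable A \<and> A \<subseteq> sets \<pi> \<and> \<Union> A = space \<pi> \<and> (\<forall>a\<in>A. emeasure \<pi> a \<noteq> \<infinity>)"
  proof (intro exI[of _ ?A] conjI)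
    have "x \<in> \<Union> ?A" for x :: real
    proof (cases "x \<le> 0")
      case False
      then obtain n where "inverse (real (Suc n)) < x" using reals_Archimedean[of x] by auto
      then show ?thesis by (auto intro: less_imp_le)
    qed auto
    then show "\<Union> ?A = space \<pi>" by (auto simp: space_pi)
    show "\<forall>a\<in>?A. emeasure \<pi> a \<noteq> \<infinity>"
      using emeasure_pi_Ici_finite pi_nonpos by (auto simp: less_top[symmetric])
  qed (auto simp: sets_pi)
qed

lemma integrable_levy_weight: "integrable \<pi> levy_weight"
proof -
  have 1: "integrable \<pi> (\<lambda>y. min 1 (y\<^sup>2))"
    using pi_levy by (intro integrableI_bounded) auto
  have 2: "integrable \<pi> (\<lambda>y. min 1 (y\<^sup>2) + indicator {1<..} y * y)"
    by (intro Bochner_Integration.integrable_add 1 pi_mean)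
  have [measurable]: "levy_weight \<in> borel_measurable borel"
    unfolding levy_weight_def[abs_def] by measurable
  show ?thesis
  proof (rule Bochner_Integration.integrable_bound[OF 2])
    show "AE y in \<pi>. norm (levy_weight y) \<le> norm (min 1 (y\<^sup>2) + indicator {1<..} y * y)"
      using AE_pi_pos
    proof eventually_elim
      case (elim y)
      then show ?case
        by (auto simp: levy_weight_def indicator_def power_le_one)
    qed
  qed simp
qed

definition smooth_density :: "real \<Rightarrow> real \<Rightarrow> real" where
  "smooth_density h x = (LINT z|\<mu>. bspline h (z - x))"

definition smooth_density_deriv :: "real \<Rightarrow> real \<Rightarrow> real" where
  "smooth_density_deriv h x = - (LINT z|\<mu>. bspline_deriv h (z - x))"

definition smooth_cdf :: "real \<Rightarrow> real \<Rightarrow> real" where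
  "smooth_cdf h x = (LINT z|\<mu>. bspline_tail h (z - x))"

text \<open>The weight \<open>exp (- z)\<close> stays inside the integral, as the Fourier equation
  concerns the tilted measure. Since the spline at \<open>x\<close> lives on
  \<open>x < z < x + 3 * h\<close>, the result differs from
  \<open>exp (- x) * smooth_density h x\<close> only by a factor between
  \<open>exp (- 3 * h)\<close> and 1.\<close>

definition smooth_tilted_density :: "real \<Rightarrow> real \<Rightarrow> real" where
  "smooth_tilted_density h x = (LINT z|\<mu>. exp (- z) * bspline h (z - x))"

definition smooth_jump :: "real \<Rightarrow> real \<Rightarrow> real \<Rightarrow> real" where
  "smooth_jump h x y = smooth_cdf h (x + y) - smooth_cdf h x - (if y \<le> 1 then y * smooth_density h x else 0)"

context
  fixes h :: real
  assumes h: "0 < h"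
begin

lemma bspline_abs_bounds: "\<bar>bspline h v\<bar> \<le> 3 / h" "\<bar>bspline_tail h v\<bar> \<le> 1"
  using bspline_nonneg[OF h] bspline_le[OF h] bspline_tail_bounds[OF h] by auto

lemma integrable_bspline_point:
  "integrable \<mu> (\<lambda>z. bspline h (z - x))" "integrable \<mu> (\<lambda>z. bspline_deriv h (z - x))" "integrable \<mu> (\<lambda>z. bspline_tail h (z - x))"
  by (rule integrable_conv_point[OF continuous_on_bspline(1)[OF h] bspline_abs_bounds(1) finite_mu sets_mu]
      integrable_conv_point[OF continuous_on_bspline(2)[OF h] abs_bspline_deriv_le[OF h] finite_mu sets_mu]
      integrable_conv_point[OF continuous_on_bspline(3)[OF h] bspline_abs_bounds(2) finite_mu sets_mu])+

lemma DERIV_smooth_density: "(smooth_density h has_real_derivative smooth_density_deriv h x) (at x)"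
  unfolding smooth_density_def[abs_def] smooth_density_deriv_def
  by (rule DERIV_conv[OF DERIV_bspline[OF h] continuous_on_bspline(2)[OF h] bspline_abs_bounds(1) abs_bspline_deriv_le[OF h] finite_mu sets_mu])

lemma DERIV_smooth_cdf: "(smooth_cdf h has_real_derivative smooth_density h x) (at x)"
  unfolding smooth_density_def smooth_cdf_def[abs_def]
  by (rule DERIV_conv_bspline_tail[OF h finite_mu sets_mu])

lemma continuous_on_smooth_density: "continuous_on A (smooth_density h)"
  using DERIV_smooth_density by (meson DERIV_isCont continuous_at_imp_continuous_on)

lemma continuous_on_smooth_cdf: "continuous_on A (smooth_cdf h)"
  using DERIV_smooth_cdf by (meson DERIV_isCont continuous_at_imp_continuous_on)

lemma continuous_on_smooth_density_deriv: "continuous_on A (smooth_density_deriv h)"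
proof -
  have "continuous_on UNIV (smooth_density_deriv h)"
    unfolding smooth_density_deriv_def[abs_def]
    by (intro continuous_intros continuous_conv[OF continuous_on_bspline(2)[OF h] abs_bspline_deriv_le[OF h] finite_mu sets_mu])
  then show ?thesis by (rule continuous_on_subset) simp
qed

lemma integrable_bspline: "integrable lborel (bspline h)" "integrable lborel (bspline_deriv h)"
proof -
  show "integrable lborel (bspline h)"
    by (rule integrable_compact_support[where a = 0 and b = "3 * h"])
      (auto simp: continuous_on_bspline[OF h] bspline_left[OF h] bspline_right[OF h])
  show "integrable lborel (bspline_deriv h)"
    by (rule integrable_compact_support[where a = 0 and b = "3 * h"])
      (auto simp: continuous_on_bspline[OF h] bspline_left[OF h] bspline_right[OF h])
qed

lemma fourier_smooth_density: "integrable lborel (smooth_density h)"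
  "(CLBINT x. iexp (u * x) * of_real (smooth_density h x)) = (CLINT z|\<mu>. iexp (u * z)) * fourier_bspline h u"
  unfolding smooth_density_def[abs_def]
  by (rule integrable_conv[OF integrable_bspline(1) _ finite_mu sets_mu] fourier_conv[OF integrable_bspline(1) _ finite_mu sets_mu],
    simp add: borel_measurable_bspline[OF h])+

lemma fourier_smooth_density_deriv: "integrable lborel (smooth_density_deriv h)"
  "(CLBINT x. iexp (u * x) * of_real (smooth_density_deriv h x)) =
     - (CLINT z|\<mu>. iexp (u * z)) * (\<i> * of_real u * fourier_bspline h u)"
proof -
  show "integrable lborel (smooth_density_deriv h)"
    unfolding smooth_density_deriv_def[abs_def]
    by (intro Bochner_Integration.integrable_minus integrable_conv[OF integrable_bspline(2) _ finite_mu sets_mu])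
      (simp add: borel_measurable_bspline[OF h])
  have "(CLBINT v. iexp (- (u * v)) * of_real (bspline_deriv h v)) = \<i> * of_real u * fourier_bspline h u"
    by (rule fourier_deriv_compact_support[where a = 0 and b = "3 * h"])
      (auto simp: continuous_on_bspline[OF h] bspline_left[OF h] bspline_right[OF h] DERIV_bspline[OF h])
  then show "(CLBINT x. iexp (u * x) * of_real (smooth_density_deriv h x)) =
     - (CLINT z|\<mu>. iexp (u * z)) * (\<i> * of_real u * fourier_bspline h u)"
    unfolding smooth_density_deriv_def
    using fourier_conv[OF integrable_bspline(2) _ finite_mu sets_mu, of u] borel_measurable_bspline[OF h]
    by simp
qed

lemma fourier_smooth_tilted_density: "integrable lborel (smooth_tilted_density h)"
  "(CLBINT x. iexp (u * x) * of_real (smooth_tilted_density h x)) =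
     (CLINT z|\<mu>. iexp (u * z) * of_real (exp (- z))) * fourier_bspline h u"
  "continuous_on UNIV (smooth_tilted_density h)"
proof -
  define \<nu> where "\<nu> = density \<mu> (\<lambda>z. ennreal (exp (- z)))"
  have s: "sets \<nu> = sets borel" by (simp add: \<nu>_def sets_mu)
  have f: "finite_measure \<nu>"
  proof
    have "emeasure \<nu> (space \<nu>) = (\<integral>\<^sup>+z. ennreal (exp (- z)) \<partial>\<mu>)"
      by (simp add: \<nu>_def emeasure_density space_mu)
    also have "\<dots> = ennreal (LINT z|\<mu>. exp (- z))"
      using integrable_exp_minus by (intro nn_integral_eq_integral) auto
    finally show "emeasure \<nu> (space \<nu>) \<noteq> \<infinity>" by simp
  qed
  have eq: "smooth_tilted_density h = (\<lambda>x. LINT z|\<nu>. bspline h (z - x))"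
  proof
    fix x
    show "smooth_tilted_density h x = (LINT z|\<nu>. bspline h (z - x))"
      unfolding \<nu>_def smooth_tilted_density_def using borel_measurable_bspline[OF h]
      by (subst integral_density) auto
  qed
  have N: "(CLINT z|\<nu>. iexp (u * z)) = (CLINT z|\<mu>. iexp (u * z) * of_real (exp (- z)))"
    unfolding \<nu>_def by (subst integral_density) (auto simp: scaleR_conv_of_real mult.commute)
  show "integrable lborel (smooth_tilted_density h)" unfolding eq
    by (rule integrable_conv[OF integrable_bspline(1) _ f s]) (simp add: borel_measurable_bspline[OF h])
  show "(CLBINT x. iexp (u * x) * of_real (smooth_tilted_density h x)) =
     (CLINT z|\<mu>. iexp (u * z) * of_real (exp (- z))) * fourier_bspline h u" unfolding eq N[symmetric]
    by (rule fourier_conv[OF integrable_bspline(1) _ f s]) (simp add: borel_measurable_bspline[OF h])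
  show "continuous_on UNIV (smooth_tilted_density h)" unfolding eq
    by (rule continuous_conv[OF continuous_on_bspline(1)[OF h] bspline_abs_bounds(1) f s])
qed

lemma smooth_jump_eq: "smooth_jump h x y = (LINT z|\<mu>. compensated_tail h y (z - x))"
  unfolding smooth_jump_def smooth_cdf_def smooth_density_def compensated_tail_def
  using integrable_bspline_point integrable_bspline_point(3)[of "x + y"]
  by (auto simp: diff_diff_eq)

lemma borel_measurable_smooth [measurable]:
  "smooth_cdf h \<in> borel_measurable borel" "smooth_density h \<in> borel_measurable borel"
  "smooth_density_deriv h \<in> borel_measurable borel"
  by (auto intro!: borel_measurable_continuous_onI continuous_on_smooth_cdf continuous_on_smooth_density
      continuous_on_smooth_density_deriv)

lemma borel_measurable_smooth_jump [measurable]: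
  assumes [measurable]: "f \<in> borel_measurable M" "g \<in> borel_measurable M"
  shows "(\<lambda>x. smooth_jump h (f x) (g x)) \<in> borel_measurable M"
  unfolding smooth_jump_def by measurable

lemma borel_measurable_smooth_jump_pi: "smooth_jump h x \<in> borel_measurable \<pi>"
proof -
  have "(\<lambda>y. smooth_jump h x y) \<in> borel_measurable \<pi>"
    unfolding smooth_jump_def by measurable
  then show ?thesis .
qed

lemma abs_smooth_jump_le:
  assumes y: "0 < y" shows "\<bar>smooth_jump h x y\<bar> \<le> (1 / h^2 + 1) * levy_weight y"
proof -
  have "integrable \<mu> (\<lambda>z. compensated_tail h y (z - x))"
    by (rule integrable_conv_point[OF continuous_on_compensated_tail[OF h] abs_compensated_tail_le[OF h y] finite_mu sets_mu])
  then have "\<bar>smooth_jump h x y\<bar> \<le> (LINT z|\<mu>. (1 / h^2 + 1) * levy_weight y)"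
    unfolding smooth_jump_eq
    by (intro order_trans[OF integral_abs_bound] integral_mono abs_compensated_tail_le h y) auto
  also have "\<dots> \<le> 1 * ((1 / h^2 + 1) * levy_weight y)"
  proof -
    have "0 \<le> (1 / h^2 + 1) * levy_weight y" using y by (simp add: levy_weight_def)
    then have "measure \<mu> UNIV * ((1 / h^2 + 1) * levy_weight y) \<le> 1 * ((1 / h^2 + 1) * levy_weight y)"
      by (intro mult_right_mono mass_mu)
    then show ?thesis by (simp add: space_mu)
  qed
  finally show ?thesis by simp
qed

lemma integrable_smooth_jump: "integrable \<pi> (smooth_jump h x)"
proof (rule Bochner_Integration.integrable_bound)
  show "integrable \<pi> (\<lambda>y. (1 / h^2 + 1) * levy_weight y)"
    by (intro Bochner_Integration.integrable_mult_right integrable_levy_weight)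
  show "AE y in \<pi>. norm (smooth_jump h x y) \<le> norm ((1 / h^2 + 1) * levy_weight y)"
    using AE_pi_pos
    by eventually_elim (simp only: real_norm_def, rule order_trans[OF abs_smooth_jump_le abs_ge_self])
qed (rule borel_measurable_smooth_jump_pi)

lemma continuous_on_smooth_jump_integral: "continuous_on UNIV (\<lambda>x. LINT y|\<pi>. smooth_jump h x y)"
proof (rule continuous_at_imp_continuous_on, rule ballI)
  fix x :: real
  show "isCont (\<lambda>x. LINT y|\<pi>. smooth_jump h x y) x"
    unfolding continuous_at_sequentially comp_def
  proof (intro allI impI)
    fix X assume X: "X \<longlonglongrightarrow> x"
    show "(\<lambda>n. LINT y|\<pi>. smooth_jump h (X n) y) \<longlonglongrightarrow> (LINT y|\<pi>. smooth_jump h x y)"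
    proof (rule integral_dominated_convergence)
      show "integrable \<pi> (\<lambda>y. (1 / h^2 + 1) * levy_weight y)"
        by (intro Bochner_Integration.integrable_mult_right integrable_levy_weight)
      show "AE y in \<pi>. norm (smooth_jump h (X n) y) \<le> (1 / h^2 + 1) * levy_weight y" for n
        using AE_pi_pos by eventually_elim (use abs_smooth_jump_le in force)
      have "isCont (smooth_cdf h) v" "isCont (smooth_density h) v" for v
        using DERIV_smooth_cdf DERIV_smooth_density DERIV_isCont by blast+
      then show "AE y in \<pi>. (\<lambda>n. smooth_jump h (X n) y) \<longlonglongrightarrow> smooth_jump h x y"
        unfolding smooth_jump_def
        by (auto intro!: AE_I2 tendsto_intros isCont_tendsto_compose[of _ "smooth_cdf h"] isCont_tendsto_compose[of _ "smooth_density h"] X)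
    qed (rule borel_measurable_smooth_jump_pi)+
  qed
qed

end

end

context log_functional_law begin

context
  fixes h :: real
  assumes h: "0 < h"
begin

text \<open>\<pi> may have infinite mass near 0, so exchanging the integrals over \<open>x\<close>
  and \<open>y\<close> needs the \<open>L1\<close> bound of the compensated kernel, which is a
  multiple of the integrable \<open>levy_weight\<close>.\<close>

lemma fourier_smooth_jump: "integrable lborel (\<lambda>x. LINT y|\<pi>. smooth_jump h x y)"
  "\<i> * of_real u * (CLBINT x. iexp (u * x) * of_real (LINT y|\<pi>. smooth_jump h x y)) =
    - (CLINT z|\<mu>. iexp (u * z)) * fourier_bspline h u *
      (CLINT y|\<pi>. iexp (- u * y) - 1 - \<i> * of_real (- u * y * indicator {-1..1} y))"
proof -
  note [measurable] = borel_measurable_smooth_jump[OF h]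
  have psf: "pair_sigma_finite \<pi> lborel"
    by (intro pair_sigma_finite.intro pi.sigma_finite_measure_axioms sigma_finite_lborel)
  have conv: "integrable lborel (\<lambda>x. smooth_jump h x y)"
    "(LBINT x. \<bar>smooth_jump h x y\<bar>) \<le> (3 * h + 1) * (1 / h^2 + 1) * levy_weight y"
    "(CLBINT x. iexp (u * x) * of_real (smooth_jump h x y)) =
       (CLINT z|\<mu>. iexp (u * z)) * (CLBINT v. iexp (- (u * v)) * of_real (compensated_tail h y v))"
    if y: "0 < y" for y
  proof -
    note i = integrable_compensated_tail[OF h y]
    have m: "compensated_tail h y \<in> borel_measurable borel"
      by (rule borel_measurable_continuous_onI[OF continuous_on_compensated_tail[OF h]])
    show "integrable lborel (\<lambda>x. smooth_jump h x y)"
      unfolding smooth_jump_eq[OF h] by (rule integrable_conv[OF i m finite_mu sets_mu])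
    show "(CLBINT x. iexp (u * x) * of_real (smooth_jump h x y)) =
       (CLINT z|\<mu>. iexp (u * z)) * (CLBINT v. iexp (- (u * v)) * of_real (compensated_tail h y v))"
      unfolding smooth_jump_eq[OF h] by (rule fourier_conv[OF i m finite_mu sets_mu])
    have "(LBINT x. \<bar>smooth_jump h x y\<bar>) \<le> measure \<mu> UNIV * (LBINT v. \<bar>compensated_tail h y v\<bar>)"
      unfolding smooth_jump_eq[OF h] by (rule integral_abs_conv_le[OF i m finite_mu sets_mu])
    also have "\<dots> \<le> 1 * (LBINT v. \<bar>compensated_tail h y v\<bar>)"
      using mass_mu by (intro mult_right_mono) auto
    finally show "(LBINT x. \<bar>smooth_jump h x y\<bar>) \<le> (3 * h + 1) * (1 / h^2 + 1) * levy_weight y"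
      using integral_abs_compensated_tail_le[OF h y] by simp
  qed
  have int: "integrable (\<pi> \<Otimes>\<^sub>M lborel) (\<lambda>(y, x). smooth_jump h x y)"
  proof (rule pair_sigma_finite.Fubini_integrable[OF psf])
    show "integrable \<pi> (\<lambda>y. LBINT x. norm (case (y, x) of (y, x) \<Rightarrow> smooth_jump h x y))"
    proof (rule Bochner_Integration.integrable_bound)
      show "integrable \<pi> (\<lambda>y. (3 * h + 1) * (1 / h^2 + 1) * levy_weight y)"
        by (intro Bochner_Integration.integrable_mult_right integrable_levy_weight)
      show "AE y in \<pi>. norm (LBINT x. norm (case (y, x) of (y, x) \<Rightarrow> smooth_jump h x y)) \<le> norm ((3 * h + 1) * (1 / h^2 + 1) * levy_weight y)"
        using AE_pi_pos by eventually_elim (use conv(2) in \<open>force simp: abs_of_nonneg\<close>)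
    qed (simp add: split_beta')
    show "AE y in \<pi>. integrable lborel (\<lambda>x. case (y, x) of (y, x) \<Rightarrow> smooth_jump h x y)"
      using AE_pi_pos by eventually_elim (use conv(1) in simp)
  qed (simp add: split_beta')
  have cint: "complex_integrable (\<pi> \<Otimes>\<^sub>M lborel) (\<lambda>(y, x). iexp (u * x) * of_real (smooth_jump h x y))"
    using int by (rule Bochner_Integration.integrable_bound) (auto simp: split_beta' norm_mult)
  show "integrable lborel (\<lambda>x. LINT y|\<pi>. smooth_jump h x y)"
    using pair_sigma_finite.integrable_snd[OF psf int] by simp
  have "(CLBINT x. iexp (u * x) * of_real (LINT y|\<pi>. smooth_jump h x y)) =
     (CLBINT x. (CLINT y|\<pi>. iexp (u * x) * of_real (smooth_jump h x y)))"
    by simp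
  also have "\<dots> = (CLINT y|\<pi>. (CLBINT x. iexp (u * x) * of_real (smooth_jump h x y)))"
    using pair_sigma_finite.Fubini_integral[OF psf cint] by simp
  finally have "\<i> * of_real u * (CLBINT x. iexp (u * x) * of_real (LINT y|\<pi>. smooth_jump h x y)) =
     (CLINT y|\<pi>. \<i> * of_real u * (CLBINT x. iexp (u * x) * of_real (smooth_jump h x y)))"
    by simp
  also have "\<dots> = (CLINT y|\<pi>. - (CLINT z|\<mu>. iexp (u * z)) * fourier_bspline h u *
      (iexp (- u * y) - 1 - \<i> * of_real (- u * y * indicator {-1..1} y)))"
  proof (rule integral_cong_AE)
    show "AE y in \<pi>. \<i> * of_real u * (CLBINT x. iexp (u * x) * of_real (smooth_jump h x y)) =
       - (CLINT z|\<mu>. iexp (u * z)) * fourier_bspline h u * (iexp (- u * y) - 1 - \<i> * of_real (- u * y * indicator {-1..1} y))"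
      using AE_pi_pos
    proof eventually_elim
      case (elim y)
      have "\<i> * of_real u * (CLBINT x. iexp (u * x) * of_real (smooth_jump h x y)) =
        (CLINT z|\<mu>. iexp (u * z)) * (\<i> * of_real u * (CLBINT v. iexp (- (u * v)) * of_real (compensated_tail h y v)))"
        unfolding conv(3)[OF elim] by (simp only: mult_ac)
      then show ?case unfolding fourier_compensated_tail[OF h elim] by simp
    qed
  qed measurable
  finally show "\<i> * of_real u * (CLBINT x. iexp (u * x) * of_real (LINT y|\<pi>. smooth_jump h x y)) =
    - (CLINT z|\<mu>. iexp (u * z)) * fourier_bspline h u *
      (CLINT y|\<pi>. iexp (- u * y) - 1 - \<i> * of_real (- u * y * indicator {-1..1} y))"
    by (simp only: integral_mult_right_zero)
qed

text \<open>The difference of the two sides has vanishing Fourier transform away from 0, hence is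
  null almost everywhere. It is also continuous, so the identity holds at every point; the maximum
  principle needs this, as it evaluates the equation at a single extremal point.\<close>

theorem smooth_equation:
  "smooth_tilted_density h x = a * smooth_density h x + \<sigma>\<^sup>2 / 2 * smooth_density_deriv h x + (LINT y|\<pi>. smooth_jump h x y)"
proof -
  define E where "E x = (LINT y|\<pi>. smooth_jump h x y)" for x
  define H where "H x = smooth_tilted_density h x - a * smooth_density h x - \<sigma>\<^sup>2 / 2 * smooth_density_deriv h x - E x" for x
  have iE: "integrable lborel E" unfolding E_def[abs_def] by (rule fourier_smooth_jump)
  note ints = fourier_smooth_tilted_density(1)[OF h] fourier_smooth_density(1)[OF h] fourier_smooth_density_deriv(1)[OF h] iE
  have "integrable lborel H"
    unfolding H_def[abs_def]
    by (intro Bochner_Integration.integrable_diff Bochner_Integration.integrable_mult_right ints)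
  moreover have "(CLBINT x. iexp (u * x) * of_real (H x)) = 0" if u: "u \<noteq> 0" for u
  proof -
    have ci: "complex_integrable lborel (\<lambda>v. iexp (u * v) * of_real (f v))" if "integrable lborel f" for f
      by (rule Bochner_Integration.integrable_bound[OF that])
        (use borel_measurable_integrable[OF that] in \<open>auto simp: norm_mult\<close>)
    define Mu where "Mu = (CLINT z|\<mu>. iexp (u * z))"
    define Nu where "Nu = (CLINT z|\<mu>. iexp (u * z) * of_real (exp (- z)))"
    define R where "R = fourier_bspline h u"
    define Psi where "Psi = (CLINT y|\<pi>. iexp (- u * y) - 1 - \<i> * of_real (- u * y * indicator {-1..1} y))"
    have "(CLBINT x. iexp (u * x) * of_real (H x)) =
      (CLBINT x. iexp (u * x) * of_real (smooth_tilted_density h x) - of_real a * (iexp (u * x) * of_real (smooth_density h x))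
        - of_real (\<sigma>\<^sup>2 / 2) * (iexp (u * x) * of_real (smooth_density_deriv h x)) - iexp (u * x) * of_real (E x))"
      by (intro Bochner_Integration.integral_cong) (auto simp: H_def algebra_simps)
    also have "\<dots> = (CLBINT x. iexp (u * x) * of_real (smooth_tilted_density h x)) - of_real a * (CLBINT x. iexp (u * x) * of_real (smooth_density h x))
        - of_real (\<sigma>\<^sup>2 / 2) * (CLBINT x. iexp (u * x) * of_real (smooth_density_deriv h x)) - (CLBINT x. iexp (u * x) * of_real (E x))"
      using ci[OF ints(1)] ci[OF ints(2)] ci[OF ints(3)] ci[OF ints(4)] by simp
    also have "\<dots> = Nu * R - of_real a * (Mu * R) - of_real (\<sigma>\<^sup>2 / 2) * (- Mu * (\<i> * of_real u * R)) - (CLBINT x. iexp (u * x) * of_real (E x))"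
      unfolding fourier_smooth_tilted_density(2)[OF h] fourier_smooth_density(2)[OF h] fourier_smooth_density_deriv(2)[OF h] Nu_def Mu_def R_def ..
    \<comment> \<open>The jump term and the tilted measure are known only after multiplication by
      \<open>\<i> * u\<close>; the factor is cancelled at the end because \<open>u\<close> is not
      0.\<close>
    finally have "\<i> * of_real u * (CLBINT x. iexp (u * x) * of_real (H x)) =
       \<i> * of_real u * (Nu * R - of_real a * (Mu * R) - of_real (\<sigma>\<^sup>2 / 2) * (- Mu * (\<i> * of_real u * R)))
       - \<i> * of_real u * (CLBINT x. iexp (u * x) * of_real (E x))"
      by (simp only: right_diff_distrib)
    also have "\<i> * of_real u * (CLBINT x. iexp (u * x) * of_real (E x)) = - Mu * R * Psi"
      unfolding E_def Mu_def R_def Psi_def by (rule fourier_smooth_jump)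
    also have "\<i> * of_real u * (Nu * R - of_real a * (Mu * R) - of_real (\<sigma>\<^sup>2 / 2) * (- Mu * (\<i> * of_real u * R))) - - Mu * R * Psi
      = R * (\<i> * of_real u * Nu + levy_khintchine_exponent a \<sigma> \<pi> (- u) * Mu)"
      unfolding levy_khintchine_exponent_def Psi_def[symmetric]
      by (simp add: algebra_simps power2_eq_square)
    also have "\<dots> = 0"
      using fourier_equation[of u] by (simp add: Nu_def Mu_def)
    finally show ?thesis using u by simp
  qed
  ultimately have "AE x in lborel. H x = 0" by (rule fourier_uniqueness)
  moreover have "continuous_on UNIV H"
    unfolding H_def[abs_def] E_def
    by (intro continuous_intros continuous_on_smooth_jump_integral continuous_on_smooth_density
        continuous_on_smooth_density_deriv fourier_smooth_tilted_density(3) h)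
  ultimately have "H x = 0" by (intro continuous_AE_eq_0)
  then show ?thesis by (simp add: H_def E_def)
qed

end

end

subsection \<open>Comparison with barriers\<close>

text \<open>Compactness is recovered from the behaviour at minus infinity: below some point the
  values are smaller than \<open>g x1\<close>, so the maximum over the remaining compact interval is
  global.\<close>

lemma attains_max_Iic:
  fixes g :: "real \<Rightarrow> real"
  assumes g: "continuous_on {..b} g" and x1: "x1 \<le> b" and ev: "\<forall>\<^sub>F x in at_bot. g x < g x1"
  obtains m where "m \<le> b" "g x1 \<le> g m" "\<And>x. x \<le> b \<Longrightarrow> g x \<le> g m"
proof -
  from ev obtain L where L: "\<And>x. x \<le> L \<Longrightarrow> g x < g x1"
    by (auto simp: eventually_at_bot_linorder)
  have "compact {min L x1..b}" "{min L x1..b} \<noteq> {}" using x1 by auto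
  then obtain m where m: "m \<in> {min L x1..b}" "\<And>x. x \<in> {min L x1..b} \<Longrightarrow> g x \<le> g m"
    using continuous_attains_sup[of "{min L x1..b}" g] continuous_on_subset[OF g] by (auto 0 4)
  have 1: "g x1 \<le> g m" using m(2)[of x1] x1 by auto
  show ?thesis
  proof (rule that[of m])
    show "g x \<le> g m" if "x \<le> b" for x
    proof (cases "min L x1 \<le> x")
      case False
      then have "g x < g x1" by (intro L) auto
      then show ?thesis using 1 by simp
    qed (use m(2)[of x] that in auto)
  qed (use m 1 in auto)
qed

lemma bump_derivative_zero:
  fixes g :: "real \<Rightarrow> real"
  assumes "(g has_real_derivative l) (at m)" "m < b" "\<And>x. x \<le> b \<Longrightarrow> g x \<le> g m"
  shows "l = 0"
  using assms by (intro DERIV_local_max[of g l m "b - m"]) auto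

context log_functional_law begin

sublocale fb: finite_borel_measure \<mu>
  by unfold_locales (rule sets_mu)

definition big_mass :: real where "big_mass = measure \<pi> {1<..}"

definition small_variance :: real where
  "small_variance = (LINT y|\<pi>. indicator {..1} y * y\<^sup>2)"

lemma emeasure_pi_Ioi_finite: "emeasure \<pi> {1<..} < \<infinity>"
  using emeasure_pi_Ici_finite[of 1]
  by (rule order.strict_trans1[rotated]) (auto intro!: emeasure_mono simp: sets_pi)

lemma integrable_pi_big: "integrable \<pi> (indicator {1<..} :: real \<Rightarrow> real)"
  using emeasure_pi_Ioi_finite by (auto simp: integrable_indicator_iff sets_pi space_pi)

lemma integral_pi_big: "(LINT y|\<pi>. indicator {1<..} y) = big_mass"
  by (simp add: big_mass_def space_pi)

lemma integrable_pi_small: "integrable \<pi> (\<lambda>y. indicator {..1} y * y\<^sup>2)"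
proof (rule Bochner_Integration.integrable_bound[OF integrable_levy_weight])
  show "AE y in \<pi>. norm (indicator {..1} y * y\<^sup>2) \<le> norm (levy_weight y)"
    by (auto simp: levy_weight_def indicator_def)
qed measurable

lemma small_variance_nonneg: "0 \<le> small_variance"
  unfolding small_variance_def by (intro integral_nonneg_AE AE_I2) auto

lemma big_mass_nonneg: "0 \<le> big_mass" by (simp add: big_mass_def)

lemma cdf_le_1: "cdf \<mu> x \<le> 1"
  using fb.cdf_bounded[of x] mass_mu by (simp add: space_mu)

definition big_jump :: "real \<Rightarrow> real \<Rightarrow> real" where
  "big_jump h x = (LINT y|\<pi>. indicator {1<..} y * (smooth_cdf h (x + y) - smooth_cdf h x))"

text \<open>Only the gain part of the big jumps. The loss part is at most
  \<open>big_mass * cdf \<mu> (x + 3 * h)\<close>, which turns out to be negligible against the tail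
  of \<pi>.\<close>

definition big_jump_cdf :: "real \<Rightarrow> real" where
  "big_jump_cdf x = (LINT y|\<pi>. indicator {1<..} y * cdf \<mu> (x + y))"

lemma borel_measurable_cdf [measurable]: "cdf \<mu> \<in> borel_measurable borel"
  by (intro borel_measurable_mono monoI fb.cdf_nondecreasing)

lemma integrable_big_jump_cdf: "integrable \<pi> (\<lambda>y. indicator {1<..} y * cdf \<mu> (x + y))"
  by (rule Bochner_Integration.integrable_bound[OF integrable_pi_big])
    (auto simp: fb.cdf_nonneg cdf_le_1 indicator_def)

context
  fixes h :: real
  assumes h: "0 < h"
begin

lemma smooth_cdf_bounds: "cdf \<mu> x \<le> smooth_cdf h x" "smooth_cdf h x \<le> cdf \<mu> (x + 3 * h)"
  unfolding smooth_cdf_def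
  by (rule conv_bspline_tail_ge[OF h finite_mu sets_mu] conv_bspline_tail_le[OF h finite_mu sets_mu])+

lemma smooth_cdf_range: "0 \<le> smooth_cdf h x" "smooth_cdf h x \<le> 1"
  using smooth_cdf_bounds[of x] fb.cdf_nonneg[of x] cdf_le_1[of "x + 3 * h"] by auto

lemma smooth_density_nonneg: "0 \<le> smooth_density h x"
  unfolding smooth_density_def by (intro integral_nonneg_AE AE_I2 bspline_nonneg h)

lemma smooth_cdf_mono: "x \<le> y \<Longrightarrow> smooth_cdf h x \<le> smooth_cdf h y"
  by (rule DERIV_nonneg_imp_nondecreasing) (auto intro!: exI[of _ "smooth_density h x" for x] DERIV_smooth_cdf h smooth_density_nonneg)

lemma smooth_density_le_cdf: "smooth_density h x \<le> 3 / h * cdf \<mu> (x + 3 * h)"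
  unfolding smooth_density_def by (rule conv_bspline_le[OF h finite_mu sets_mu])

lemma smooth_density_at_bot: "(smooth_density h \<longlongrightarrow> 0) at_bot"
proof (rule tendsto_sandwich[where f = "\<lambda>_. 0" and h = "\<lambda>x. 3 / h * cdf \<mu> (x + 3 * h)"])
  have "filterlim (\<lambda>x::real. x + 3 * h) at_bot at_bot"
    by (subst add.commute, rule filterlim_tendsto_add_at_bot_iff[THEN iffD2, OF tendsto_const]) (rule filterlim_ident)
  then have "((\<lambda>x. 3 / h * cdf \<mu> (x + 3 * h)) \<longlongrightarrow> 3 / h * 0) at_bot"
    by (intro tendsto_intros filterlim_compose[OF fb.cdf_lim_at_bot])
  then show "((\<lambda>x. 3 / h * cdf \<mu> (x + 3 * h)) \<longlongrightarrow> 0) at_bot" by simp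
qed (use smooth_density_nonneg smooth_density_le_cdf in simp_all)

lemma smooth_tilted_density_bounds:
  "exp (- x - 3 * h) * smooth_density h x \<le> smooth_tilted_density h x"
  "smooth_tilted_density h x \<le> exp (- x) * smooth_density h x"
proof -
  have e: "exp (- x - 3 * h) * bspline h (z - x) \<le> exp (- z) * bspline h (z - x) \<and>
    exp (- z) * bspline h (z - x) \<le> exp (- x) * bspline h (z - x)" for z
  proof (cases "0 < z - x \<and> z - x < 3 * h")
    case True
    then show ?thesis using bspline_nonneg[OF h, of "z - x"] by (intro conjI mult_right_mono) auto
  next
    case False
    then have "bspline h (z - x) = 0" using bspline_left[OF h, of "z - x"] bspline_right[OF h, of "z - x"] by auto
    then show ?thesis by simp
  qed
  note e = conjunct1[OF e] conjunct2[OF e]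
  have i: "integrable \<mu> (\<lambda>z. c * bspline h (z - x))" for c
    by (intro Bochner_Integration.integrable_mult_right integrable_bspline_point h)
  have j: "integrable \<mu> (\<lambda>z. exp (- z) * bspline h (z - x))"
    by (rule Bochner_Integration.integrable_bound[OF i[of "exp (- x)"]])
      (use borel_measurable_bspline[OF h] e(2) bspline_nonneg[OF h] in \<open>auto simp: abs_mult\<close>)
  show "exp (- x - 3 * h) * smooth_density h x \<le> smooth_tilted_density h x"
    unfolding smooth_tilted_density_def smooth_density_def
    by (subst integral_mult_right_zero[symmetric], intro integral_mono i j e)
  show "smooth_tilted_density h x \<le> exp (- x) * smooth_density h x"
    unfolding smooth_tilted_density_def smooth_density_def
    by (subst integral_mult_right_zero[symmetric], intro integral_mono i j e)
qed

lemma integrable_big_jump: "integrable \<pi> (\<lambda>y. indicator {1<..} y * (smooth_cdf h (x + y) - smooth_cdf h x))"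
proof (rule Bochner_Integration.integrable_bound[OF integrable_pi_big])
  note [measurable] = borel_measurable_smooth[OF h]
  show "(\<lambda>y. indicator {1<..} y * (smooth_cdf h (x + y) - smooth_cdf h x)) \<in> borel_measurable \<pi>"
    by measurable
  show "AE y in \<pi>. norm (indicator {1<..} y * (smooth_cdf h (x + y) - smooth_cdf h x)) \<le> norm (indicator {1<..} y :: real)"
    using smooth_cdf_range[of x] smooth_cdf_range[of "x + y" for y]
    by (auto simp: indicator_def abs_le_iff intro!: AE_I2) (smt (verit))+
qed

lemma big_jump_le: "big_jump h x \<le> big_mass" "0 \<le> big_jump h x"
proof -
  have "big_jump h x \<le> (LINT y|\<pi>. indicator {1<..} y)"
    unfolding big_jump_def using smooth_cdf_range[of x] smooth_cdf_range(2)
    by (intro integral_mono integrable_big_jump integrable_pi_big) (auto simp: indicator_def intro: diff_mono[of _ 1 0, simplified])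
  then show "big_jump h x \<le> big_mass" by (simp only: integral_pi_big)
  show "0 \<le> big_jump h x"
    unfolding big_jump_def by (intro integral_nonneg_AE AE_I2) (auto simp: indicator_def smooth_cdf_mono)
qed

lemma big_jump_cdf_bounds:
  "big_jump h x \<le> big_jump_cdf (x + 3 * h)"
  "big_jump_cdf x - big_mass * cdf \<mu> (x + 3 * h) \<le> big_jump h x"
proof -
  show "big_jump h x \<le> big_jump_cdf (x + 3 * h)"
    unfolding big_jump_def big_jump_cdf_def
  proof (intro integral_mono integrable_big_jump integrable_big_jump_cdf)
    fix y
    have "smooth_cdf h (x + y) - smooth_cdf h x \<le> cdf \<mu> (x + 3 * h + y)"
      using smooth_cdf_range[of x] smooth_cdf_bounds(2)[of "x + y"] by (simp add: algebra_simps)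
    then show "indicator {1<..} y * (smooth_cdf h (x + y) - smooth_cdf h x) \<le> indicator {1<..} y * cdf \<mu> (x + 3 * h + y)"
      by (auto simp: indicator_def)
  qed
  have "big_jump_cdf x - big_mass * cdf \<mu> (x + 3 * h) =
      (LINT y|\<pi>. indicator {1<..} y * cdf \<mu> (x + y) - indicator {1<..} y * cdf \<mu> (x + 3 * h))"
    using integrable_pi_big
    by (subst Bochner_Integration.integral_diff[OF integrable_big_jump_cdf])
      (auto simp: big_jump_cdf_def big_mass_def space_pi)
  also have "\<dots> \<le> big_jump h x"
    unfolding big_jump_def
  proof (intro integral_mono integrable_big_jump Bochner_Integration.integrable_diff integrable_big_jump_cdf)
    fix y
    have "cdf \<mu> (x + y) - cdf \<mu> (x + 3 * h) \<le> smooth_cdf h (x + y) - smooth_cdf h x"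
      using smooth_cdf_bounds(2)[of x] smooth_cdf_bounds(1)[of "x + y"] by simp
    then show "indicator {1<..} y * cdf \<mu> (x + y) - indicator {1<..} y * cdf \<mu> (x + 3 * h) \<le> indicator {1<..} y * (smooth_cdf h (x + y) - smooth_cdf h x)"
      by (auto simp: indicator_def)
  qed (use integrable_pi_big in simp)
  finally show "big_jump_cdf x - big_mass * cdf \<mu> (x + 3 * h) \<le> big_jump h x" .
qed

lemma smooth_equation_split:
  "smooth_tilted_density h x = a * smooth_density h x + \<sigma>\<^sup>2 / 2 * smooth_density_deriv h x
     + (LINT y|\<pi>. indicator {..1} y * smooth_jump h x y) + big_jump h x"
  "integrable \<pi> (\<lambda>y. indicator {..1} y * smooth_jump h x y)"
proof -
  show i: "integrable \<pi> (\<lambda>y. indicator {..1} y * smooth_jump h x y)"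
    by (rule Bochner_Integration.integrable_bound[OF integrable_smooth_jump[OF h, of x]])
      (use borel_measurable_smooth_jump_pi[OF h, of x] in \<open>auto simp: indicator_def\<close>)
  have "(LINT y|\<pi>. smooth_jump h x y) = (LINT y|\<pi>. indicator {..1} y * smooth_jump h x y
      + indicator {1<..} y * (smooth_cdf h (x + y) - smooth_cdf h x))"
    by (intro Bochner_Integration.integral_cong) (auto simp: indicator_def smooth_jump_def)
  also have "\<dots> = (LINT y|\<pi>. indicator {..1} y * smooth_jump h x y) + big_jump h x"
    unfolding big_jump_def by (rule Bochner_Integration.integral_add[OF i integrable_big_jump])
  finally show "smooth_tilted_density h x = a * smooth_density h x + \<sigma>\<^sup>2 / 2 * smooth_density_deriv h x
     + (LINT y|\<pi>. indicator {..1} y * smooth_jump h x y) + big_jump h x"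
    using smooth_equation[OF h, of x] by simp
qed

lemma small_jump_le:
  assumes c: "\<And>y. 0 < y \<Longrightarrow> y \<le> 1 \<Longrightarrow> smooth_jump h x y \<le> c * y\<^sup>2"
  shows "(LINT y|\<pi>. indicator {..1} y * smooth_jump h x y) \<le> c * small_variance"
proof -
  have "(LINT y|\<pi>. indicator {..1} y * smooth_jump h x y) \<le> (LINT y|\<pi>. c * (indicator {..1} y * y\<^sup>2))"
  proof (intro integral_mono_AE smooth_equation_split Bochner_Integration.integrable_mult_right integrable_pi_small)
    show "AE y in \<pi>. indicator {..1} y * smooth_jump h x y \<le> c * (indicator {..1} y * y\<^sup>2)"
      using AE_pi_pos by eventually_elim (auto simp: indicator_def c)
  qed
  then show ?thesis by (simp add: small_variance_def)
qed

lemma small_jump_ge: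
  assumes c: "\<And>y. 0 < y \<Longrightarrow> y \<le> 1 \<Longrightarrow> c * y\<^sup>2 \<le> smooth_jump h x y"
  shows "c * small_variance \<le> (LINT y|\<pi>. indicator {..1} y * smooth_jump h x y)"
proof -
  have "(LINT y|\<pi>. c * (indicator {..1} y * y\<^sup>2)) \<le> (LINT y|\<pi>. indicator {..1} y * smooth_jump h x y)"
  proof (intro integral_mono_AE smooth_equation_split Bochner_Integration.integrable_mult_right integrable_pi_small)
    show "AE y in \<pi>. c * (indicator {..1} y * y\<^sup>2) \<le> indicator {..1} y * smooth_jump h x y"
      using AE_pi_pos by eventually_elim (auto simp: indicator_def c)
  qed
  then show ?thesis by (simp add: small_variance_def)
qed

lemma DERIV_smooth_jump_remainder:
  "((\<lambda>s. smooth_cdf h (x + s) - smooth_cdf h x - s * smooth_density h x - c * s\<^sup>2 / 2) has_real_derivative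
     (smooth_density h (x + s) - smooth_density h x - c * s)) (at s)"
proof -
  have "((\<lambda>s. smooth_cdf h (x + s)) has_real_derivative smooth_density h (x + s)) (at s)"
    by (rule DERIV_cong[OF DERIV_chain'[OF _ DERIV_smooth_cdf[OF h]]]) (auto intro!: derivative_eq_intros)
  then show ?thesis
    by (auto intro!: derivative_eq_intros)
qed

text \<open>Integrating a linear bound on the increments of the smoothed density bounds the
  compensated jump of size \<open>y\<close> by \<open>c / 2 * y\<^sup>2\<close>. Only increments to
  the right appear because \<pi> lives on the positive half-line, and the left side takes the lower
  bound of the tilted density, with its loss \<open>exp (- 3 * h)\<close>.\<close>

lemma equation_upper:
  assumes c: "\<And>s. 0 \<le> s \<Longrightarrow> s \<le> 1 \<Longrightarrow> smooth_density h (x + s) - smooth_density h x \<le> c * s"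
  shows "exp (- x - 3 * h) * smooth_density h x \<le>
    a * smooth_density h x + \<sigma>\<^sup>2 / 2 * smooth_density_deriv h x + c / 2 * small_variance + big_jump h x"
proof -
  have "smooth_jump h x y \<le> c / 2 * y\<^sup>2" if y: "0 < y" "y \<le> 1" for y
  proof -
    have "smooth_cdf h (x + y) - smooth_cdf h x - y * smooth_density h x - c * y\<^sup>2 / 2
        \<le> smooth_cdf h (x + 0) - smooth_cdf h x - 0 * smooth_density h x - c * 0\<^sup>2 / 2"
      by (rule DERIV_nonpos_imp_nonincreasing[where f = "\<lambda>s. smooth_cdf h (x + s) - smooth_cdf h x - s * smooth_density h x - c * s\<^sup>2 / 2"])
        (use y c in \<open>auto intro!: exI[of _ "smooth_density h (x + s) - smooth_density h x - c * s" for s] DERIV_smooth_jump_remainder\<close>)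
    then show ?thesis using y by (simp add: smooth_jump_def)
  qed
  from small_jump_le[OF this] show ?thesis
    using smooth_equation_split(1)[of x] smooth_tilted_density_bounds(1)[of x] by simp
qed

lemma equation_lower:
  assumes c: "\<And>s. 0 \<le> s \<Longrightarrow> s \<le> 1 \<Longrightarrow> c * s \<le> smooth_density h (x + s) - smooth_density h x"
  shows "a * smooth_density h x + \<sigma>\<^sup>2 / 2 * smooth_density_deriv h x + c / 2 * small_variance + big_jump h x
    \<le> exp (- x) * smooth_density h x"
proof -
  have "c / 2 * y\<^sup>2 \<le> smooth_jump h x y" if y: "0 < y" "y \<le> 1" for y
  proof -
    have "smooth_cdf h (x + 0) - smooth_cdf h x - 0 * smooth_density h x - c * 0\<^sup>2 / 2
       \<le> smooth_cdf h (x + y) - smooth_cdf h x - y * smooth_density h x - c * y\<^sup>2 / 2"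
      by (rule DERIV_nonneg_imp_nondecreasing[where f = "\<lambda>s. smooth_cdf h (x + s) - smooth_cdf h x - s * smooth_density h x - c * s\<^sup>2 / 2"])
        (use y c in \<open>auto intro!: exI[of _ "smooth_density h (x + s) - smooth_density h x - c * s" for s] DERIV_smooth_jump_remainder\<close>)
    then show ?thesis using y by (simp add: smooth_jump_def)
  qed
  from small_jump_ge[OF this] show ?thesis
    using smooth_equation_split(1)[of x] smooth_tilted_density_bounds(2)[of x] by simp
qed

end

end

section \<open>An a priori bound and two comparison principles\<close>

context log_functional_law begin

text \<open>A maximum principle on a half-line needs control at its right end, and none uniform in
  \<open>h\<close> is available yet. The remedy is to choose the end point well: where
  \<open>smooth_cdf h x - x\<close> is maximal on an interval of length 2, the density is at most 1
  and the distribution function grows by at most \<open>s\<close> over the next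
  \<open>s\<close>.\<close>

lemma smooth_density_crude_bound:
  assumes h: "0 < h" "3 * h \<le> 1" and X: "\<bar>a\<bar> + 1 \<le> exp (- X - 1)" and x: "x \<le> X - 1"
  shows "smooth_density h x \<le> max 1 big_mass"
proof -
  let ?k = "smooth_density h" and ?F = "smooth_cdf h"
  define g where "g x = ?F x - x" for x
  have dg: "(g has_real_derivative ?k x - 1) (at x)" for x
    unfolding g_def[abs_def] by (intro derivative_intros DERIV_smooth_cdf h)
  have "continuous_on {X - 1..X + 1} g"
    using dg by (meson DERIV_isCont continuous_at_imp_continuous_on)
  then obtain x0 where x0: "x0 \<in> {X - 1..X + 1}" "\<And>x. x \<in> {X - 1..X + 1} \<Longrightarrow> g x \<le> g x0"
    using continuous_attains_sup[of "{X - 1..X + 1}" g] by force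
  \<comment> \<open>The distribution function rises by at most 1 in total, so the maximiser lies at
    most 1 to the right of the left end \<open>X - 1\<close>. This leaves a full unit to its right
    inside the interval.\<close>
  have x0X: "x0 \<le> X"
    using x0(2)[of "X - 1"] smooth_cdf_range[OF h(1), of x0] smooth_cdf_range[OF h(1), of "X - 1"] by (simp add: g_def)
  have inc: "?F (x0 + s) - ?F x0 \<le> s" if "0 \<le> s" "s \<le> 1" for s
    using x0(2)[of "x0 + s"] x0(1) x0X that by (simp add: g_def)
  have k0: "?k x0 \<le> 1"
  proof (rule ccontr)
    assume "\<not> ?k x0 \<le> 1"
    then obtain d where d: "d > 0" "\<And>s. 0 < s \<Longrightarrow> s < d \<Longrightarrow> g x0 < g (x0 + s)"
      using DERIV_pos_inc_right[OF dg[of x0]] by auto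
    define s where "s = min (d / 2) 1"
    have "0 < s" "s < d" "s \<le> 1" using d(1) by (auto simp: s_def)
    then show False using d(2)[of s] inc[of s] by (simp add: g_def)
  qed
  have "?k x \<le> max 1 big_mass" if x: "x \<le> x0" for x
  proof (rule ccontr)
    assume "\<not> ?k x \<le> max 1 big_mass"
    then have kx: "1 < ?k x" "big_mass < ?k x" by auto
    have "\<forall>\<^sub>F y in at_bot. ?k y < ?k x"
      using order_tendstoD(2)[OF smooth_density_at_bot[OF h(1)], of "?k x"] kx by simp
    then obtain m where m: "m \<le> x0" "?k x \<le> ?k m" "\<And>y. y \<le> x0 \<Longrightarrow> ?k y \<le> ?k m"
      using attains_max_Iic[OF continuous_on_smooth_density[OF h(1)] x] by blast
    have "m < x0" using m k0 kx by (cases "m = x0") auto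
    have k'0: "smooth_density_deriv h m = 0"
      by (rule bump_derivative_zero[OF DERIV_smooth_density[OF h(1)] \<open>m < x0\<close>]) (rule m)
    have mv: "?F q - ?F p \<le> (q - p) * ?k m" if pq: "p \<le> q" "q \<le> x0" for p q
    proof (cases "p = q")
      case False
      then obtain z where z: "p < z" "z < q" "?F q - ?F p = (q - p) * ?k z"
        using MVT2[of p q ?F ?k] pq DERIV_smooth_cdf[OF h(1)] by auto
      then show ?thesis using m(3)[of z] pq by (simp add: mult_left_mono)
    qed simp
    \<comment> \<open>A small jump from \<open>m\<close> that stays left of \<open>x0\<close> is
      controlled by the maximality of \<open>m\<close>, and the part of a jump beyond
      \<open>x0\<close> by the choice of \<open>x0\<close>.\<close>
    have "smooth_jump h m y \<le> 0 * y\<^sup>2" if y: "0 < y" "y \<le> 1" for y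
    proof (cases "m + y \<le> x0")
      case True
      then show ?thesis using mv[of m "m + y"] y by (simp add: smooth_jump_def)
    next
      case False
      have "?F (m + y) - ?F x0 \<le> (m + y - x0) * 1"
        using inc[of "m + y - x0"] False y m by simp
      also have "\<dots> \<le> (m + y - x0) * ?k m" using False m kx by (intro mult_left_mono) auto
      finally show ?thesis using mv[of m x0] m y by (simp add: smooth_jump_def algebra_simps)
    qed
    from small_jump_le[OF h(1) this]
    have "exp (- m - 3 * h) * ?k m \<le> a * ?k m + big_mass"
      using smooth_equation_split(1)[OF h(1), of m] smooth_tilted_density_bounds(1)[OF h(1), of m] k'0 big_jump_le[OF h(1), of m]
      by simp
    moreover have "\<bar>a\<bar> + 1 \<le> exp (- m - 3 * h)"
      using X m x0X h by (elim order_trans) auto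
    then have "(\<bar>a\<bar> + 1) * ?k m \<le> exp (- m - 3 * h) * ?k m"
      using m kx by (intro mult_right_mono) auto
    moreover have "a * ?k m \<le> \<bar>a\<bar> * ?k m" using m kx by (intro mult_right_mono) auto
    ultimately have "?k m \<le> big_mass" by (simp add: algebra_simps)
    then show False using m kx by simp
  qed
  moreover have "x \<le> x0" using x x0 by simp
  ultimately show ?thesis by blast
qed

text \<open>At a point where \<open>smooth_density h\<close> touches a tame barrier \<open>B\<close>, the drift, the Gaussian part and the small jumps
  contribute at most \<open>perturbation C * B x\<close>, which is negligible against \<open>exp (- x) * B x\<close>.\<close>
definition tame :: "real \<Rightarrow> real \<Rightarrow> (real \<Rightarrow> real) \<Rightarrow> bool" where
  "tame C X B \<longleftrightarrow> (\<forall>x\<le>X. 0 \<le> B x \<and> (\<exists>D. (B has_real_derivative D) (at x) \<and> \<bar>D\<bar> \<le> C * B x) \<and>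
     (\<forall>s. 0 \<le> s \<longrightarrow> s \<le> 1 \<longrightarrow> \<bar>B (x + s) - B x\<bar> \<le> C * s * B x))"

definition perturbation :: "real \<Rightarrow> real" where
  "perturbation C = \<bar>a\<bar> + \<sigma>\<^sup>2 / 2 * C + C / 2 * small_variance"

text \<open>If \<open>k - B\<close> exceeded \<open>e\<close> somewhere, its maximum on the
  half-line would be at an interior point where \<open>k' = B'\<close> and where \<open>k\<close>
  grows to the right no faster than \<open>B\<close>. The equation there, with \<open>super\<close>,
  reduces to \<open>(E - \<bar>a\<bar>) * k \<le> (E - \<bar>a\<bar>) * B\<close>, a contradiction.
  The boundary condition covers a whole unit interval because the small jumps reach that
  far.\<close>

lemma smooth_density_le_barrier:
  assumes h: "0 < h" and B: "tame C X B"
    and boundary: "\<And>x. X \<le> x \<Longrightarrow> x \<le> X + 1 \<Longrightarrow> smooth_density h x \<le> B x"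
    and pos: "\<And>x. x \<le> X \<Longrightarrow> \<bar>a\<bar> < exp (- x - 3 * h)"
    and super: "\<And>x. x \<le> X \<Longrightarrow> big_jump h x \<le> (exp (- x - 3 * h) - perturbation C) * B x"
    and x: "x \<le> X"
  shows "smooth_density h x \<le> B x"
proof (rule field_le_epsilon)
  let ?k = "smooth_density h"
  \<comment> \<open>The slack \<open>e\<close> makes the maximum attained: \<open>k\<close> tends to
    0 and \<open>B\<close> is nonnegative, so \<open>k - B - e\<close> is negative near minus
    infinity.\<close>
  fix e :: real assume e: "0 < e"
  show "?k x \<le> B x + e"
  proof (rule ccontr)
    assume "\<not> ?k x \<le> B x + e"
    define D where "D y = ?k y - B y - e" for y
    have Dx: "0 < D x" using \<open>\<not> ?k x \<le> B x + e\<close> by (simp add: D_def)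
    have B0: "0 \<le> B y" if "y \<le> X" for y using B that by (auto simp: tame_def)
    have cont: "continuous_on {..X} D"
      unfolding D_def[abs_def]
      using B by (intro continuous_intros continuous_on_smooth_density h continuous_at_imp_continuous_on)
        (auto simp: tame_def intro: DERIV_isCont)
    have "\<forall>\<^sub>F y in at_bot. ?k y < e \<and> y \<le> X"
      using order_tendstoD(2)[OF smooth_density_at_bot[OF h] e] eventually_le_at_bot[of X]
      by eventually_elim simp
    then have "\<forall>\<^sub>F y in at_bot. D y < D x"
    proof eventually_elim
      case (elim y)
      then show ?case using B0[of y] Dx by (simp add: D_def)
    qed
    then obtain m where m: "m \<le> X" "D x \<le> D m" "\<And>y. y \<le> X \<Longrightarrow> D y \<le> D m"
      using attains_max_Iic[OF cont x] by blast
    have Dm: "0 < D m" using m Dx by simp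
    have "m < X" using m Dm boundary[of X] e by (cases "m = X") (auto simp: D_def)
    obtain B' where B': "(B has_real_derivative B') (at m)" "\<bar>B'\<bar> \<le> C * B m"
      using B m by (auto simp: tame_def)
    have "(D has_real_derivative smooth_density_deriv h m - B' - 0) (at m)"
      unfolding D_def[abs_def] by (intro derivative_intros DERIV_smooth_density h B')
    from bump_derivative_zero[OF this \<open>m < X\<close> m(3)] have k': "smooth_density_deriv h m = B'" by simp
    have inc: "?k (m + s) - ?k m \<le> C * B m * s" if s: "0 \<le> s" "s \<le> 1" for s
    proof -
      have Bs: "B (m + s) - B m \<le> C * s * B m"
        using B m s by (auto simp: tame_def dest: abs_le_D1)
      show ?thesis
      proof (cases "m + s \<le> X")
        case True
        then show ?thesis using m(3)[of "m + s"] Bs by (simp add: D_def mult_ac)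
      next
        case False
        then show ?thesis using boundary[of "m + s"] m s Bs Dm e by (simp add: D_def mult_ac)
      qed
    qed
    define E where "E = exp (- m - 3 * h)"
    have "E * ?k m \<le> a * ?k m + \<sigma>\<^sup>2 / 2 * B' + C * B m / 2 * small_variance + big_jump h m"
      using equation_upper[OF h inc] by (simp add: k' E_def)
    also have "\<dots> \<le> a * ?k m + \<sigma>\<^sup>2 / 2 * (C * B m) + C * B m / 2 * small_variance + (E - perturbation C) * B m"
      using super[OF m(1)] B'(2) by (intro add_mono mult_left_mono order_refl) (auto simp: E_def)
    also have "\<dots> = a * ?k m + (E - \<bar>a\<bar>) * B m"
      by (simp add: perturbation_def algebra_simps)
    finally have 1: "E * ?k m \<le> a * ?k m + (E - \<bar>a\<bar>) * B m" .
    have "a * ?k m \<le> \<bar>a\<bar> * ?k m" using smooth_density_nonneg[OF h, of m] by (intro mult_right_mono) auto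
    with 1 have "(E - \<bar>a\<bar>) * ?k m \<le> (E - \<bar>a\<bar>) * B m" by (simp add: algebra_simps)
    moreover have "0 < E - \<bar>a\<bar>" using pos[OF m(1)] by (simp add: E_def)
    ultimately have "?k m \<le> B m" by simp
    then show False using Dm e by (simp add: D_def)
  qed
qed

text \<open>No positive lower bound on \<open>k\<close> is known near \<open>X\<close>, so the main
  term \<open>A\<close> alone cannot serve as a barrier. The correction \<open>B\<close> dominates
  \<open>A\<close> on \<open>{X..X + 1}\<close>, where \<open>0 \<le> k\<close> then suffices, and
  is later chosen negligible at minus infinity. Only \<open>A\<close> has to be a subsolution; for
  \<open>B\<close> it is enough that \<open>exp (- x)\<close> outweighs the perturbation.\<close>

lemma smooth_density_ge_barrier:
  assumes h: "0 < h" and A: "tame C X A" and B: "tame C X B"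
    and boundary: "\<And>x. X \<le> x \<Longrightarrow> x \<le> X + 1 \<Longrightarrow> A x \<le> B x"
    and pos: "\<And>x. x \<le> X \<Longrightarrow> \<bar>a\<bar> < exp (- x)" "\<And>x. x \<le> X \<Longrightarrow> perturbation C \<le> exp (- x)"
    and C: "0 \<le> C"
    and sub: "\<And>x. x \<le> X \<Longrightarrow> (exp (- x) + perturbation C) * A x \<le> big_jump h x"
    and x: "x \<le> X"
  shows "A x - B x \<le> smooth_density h x"
proof (rule field_le_epsilon)
  let ?k = "smooth_density h"
  fix e :: real assume e: "0 < e"
  show "A x - B x \<le> ?k x + e"
  proof (rule ccontr)
    assume "\<not> A x - B x \<le> ?k x + e"
    define D where "D y = A y - B y - ?k y - e" for y
    have Dx: "0 < D x" using \<open>\<not> A x - B x \<le> ?k x + e\<close> by (simp add: D_def)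
    have AB0: "0 \<le> A y" "0 \<le> B y" if "y \<le> X" for y using A B that by (auto simp: tame_def)
    have cont: "continuous_on {..X} D"
      unfolding D_def[abs_def]
      using A B by (intro continuous_intros continuous_on_smooth_density h continuous_at_imp_continuous_on)
        (auto simp: tame_def intro: DERIV_isCont)
    have pert0: "0 \<le> perturbation C"
      using C small_variance_nonneg by (simp add: perturbation_def)
    \<comment> \<open>The decay of \<open>A\<close> at minus infinity, needed for the maximum to be
      attained, comes for free from the subsolution property, since the big jumps contribute at most
      \<open>big_mass\<close>.\<close>
    have Ale: "A y \<le> big_mass * exp y" if y: "y \<le> X" for y
    proof -
      have "exp (- y) * A y \<le> (exp (- y) + perturbation C) * A y"
        using AB0[OF y] pert0 by (intro mult_right_mono) auto
      also have "\<dots> \<le> big_mass" using sub[OF y] big_jump_le[OF h, of y] by simp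
      finally show ?thesis by (simp add: exp_minus field_simps)
    qed
    have "((\<lambda>y. big_mass * exp y) \<longlongrightarrow> big_mass * 0) at_bot"
      by (intro tendsto_intros exp_at_bot)
    then have "\<forall>\<^sub>F y in at_bot. big_mass * exp y < e"
      using order_tendstoD(2)[of _ 0 at_bot e] e by simp
    then have "\<forall>\<^sub>F y in at_bot. D y < D x"
      using eventually_le_at_bot[of X]
    proof eventually_elim
      case (elim y)
      then show ?case using AB0[of y] Dx Ale[of y] smooth_density_nonneg[OF h, of y] by (simp add: D_def)
    qed
    then obtain m where m: "m \<le> X" "D x \<le> D m" "\<And>y. y \<le> X \<Longrightarrow> D y \<le> D m"
      using attains_max_Iic[OF cont x] by blast
    have Dm: "0 < D m" using m Dx by simp
    have "m < X" using m Dm boundary[of X] e smooth_density_nonneg[OF h, of X] by (cases "m = X") (auto simp: D_def)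
    obtain A' where A': "(A has_real_derivative A') (at m)" "\<bar>A'\<bar> \<le> C * A m"
      using A m by (auto simp: tame_def)
    obtain B' where B': "(B has_real_derivative B') (at m)" "\<bar>B'\<bar> \<le> C * B m"
      using B m by (auto simp: tame_def)
    have "(D has_real_derivative A' - B' - smooth_density_deriv h m - 0) (at m)"
      unfolding D_def[abs_def] by (intro derivative_intros DERIV_smooth_density h A' B')
    from bump_derivative_zero[OF this \<open>m < X\<close> m(3)] have k': "smooth_density_deriv h m = A' - B'" by simp
    have inc: "- (C * (A m + B m)) * s \<le> ?k (m + s) - ?k m" if s: "0 \<le> s" "s \<le> 1" for s
    proof -
      have "A m - A (m + s) \<le> C * s * A m" "B (m + s) - B m \<le> C * s * B m"
        using A B m s by (auto simp: tame_def abs_le_iff)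
      then have ABs: "A m - B m - C * (A m + B m) * s \<le> A (m + s) - B (m + s)"
        by (simp add: algebra_simps)
      show ?thesis
      proof (cases "m + s \<le> X")
        case True
        then show ?thesis using m(3)[of "m + s"] ABs by (simp add: D_def)
      next
        case False
        then show ?thesis using boundary[of "m + s"] m s ABs Dm e smooth_density_nonneg[OF h, of "m + s"]
          by (simp add: D_def)
      qed
    qed
    define E where "E = exp (- m)"
    have E: "\<bar>a\<bar> < E" "perturbation C \<le> E" using pos m by (auto simp: E_def)
    have "a * ?k m - \<sigma>\<^sup>2 / 2 * (C * (A m + B m)) - (C * (A m + B m)) / 2 * small_variance + (E + perturbation C) * A m
      \<le> a * ?k m + \<sigma>\<^sup>2 / 2 * (A' - B') + - (C * (A m + B m)) / 2 * small_variance + big_jump h m"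
    proof -
      have "- (C * (A m + B m)) \<le> A' - B'" using A'(2) B'(2) by (simp add: algebra_simps abs_le_iff)
      then have "\<sigma>\<^sup>2 / 2 * (- (C * (A m + B m))) \<le> \<sigma>\<^sup>2 / 2 * (A' - B')" by (intro mult_left_mono) auto
      then show ?thesis using sub[OF m(1)] by (simp add: E_def)
    qed
    also have "\<dots> \<le> E * ?k m"
      using equation_lower[OF h inc] by (simp add: k' E_def)
    finally have 1: "(\<bar>a\<bar> + E) * A m - (perturbation C - \<bar>a\<bar>) * B m \<le> (E - a) * ?k m"
      by (simp add: perturbation_def algebra_simps add_divide_distrib)
    have "(E - a) * ?k m < (E - a) * (A m - B m)"
      using Dm e E(1) by (intro mult_strict_left_mono) (auto simp: D_def)
    with 1 have "(\<bar>a\<bar> + a) * A m < (perturbation C - E - (\<bar>a\<bar> - a)) * B m"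
      by (simp add: algebra_simps)
    also have "\<dots> \<le> 0" using E(2) AB0[OF m(1)] by (intro mult_nonpos_nonneg) auto
    finally have "(\<bar>a\<bar> + a) * A m < 0" .
    moreover have "0 \<le> (\<bar>a\<bar> + a) * A m" using AB0[OF m(1)] by (intro mult_nonneg_nonneg) auto
    ultimately show False by simp
  qed
qed

end

subsection \<open>Tails of exponential type\<close>

text \<open>Slicing \<open>{1..}\<close> into unit intervals gives a geometric series of ratio
  \<open>exp (\<beta> - q)\<close>. It is applied to \<pi> and to the reflection of \<mu>.\<close>

lemma nn_integral_exp_finite:
  fixes N :: "real measure"
  assumes s [measurable_cong]: "sets N = sets borel" and \<beta>: "0 \<le> \<beta>" "\<beta> < q"
    and tail: "\<And>n::nat. 1 \<le> n \<Longrightarrow> emeasure N {real n..} \<le> ennreal (C * exp (- q * real n))"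
  shows "(\<integral>\<^sup>+y. ennreal (indicator {1..} y * exp (\<beta> * y)) \<partial>N) < \<infinity>"
proof -
  define r where "r = exp (\<beta> - q)"
  have r: "0 < r" "r < 1" using \<beta> by (auto simp: r_def)
  define C' where "C' = max C 0"
  have "(\<integral>\<^sup>+y. ennreal (indicator {1..} y * exp (\<beta> * y)) \<partial>N)
    \<le> (\<integral>\<^sup>+y. (\<Sum>n. ennreal (exp (\<beta> * (real (Suc n) + 1))) * indicator {real (Suc n)..} y) \<partial>N)"
  proof (rule nn_integral_mono)
    fix y :: real
    show "ennreal (indicator {1..} y * exp (\<beta> * y)) \<le> (\<Sum>n. ennreal (exp (\<beta> * (real (Suc n) + 1))) * indicator {real (Suc n)..} y)"
    proof (cases "1 \<le> y")
      case True
      define m where "m = nat \<lfloor>y\<rfloor> - 1"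
      have m: "real (Suc m) \<le> y" "y \<le> real (Suc m) + 1"
        using True by (auto simp: m_def)
      have "ennreal (indicator {1..} y * exp (\<beta> * y)) \<le> ennreal (exp (\<beta> * (real (Suc m) + 1))) * indicator {real (Suc m)..} y"
        using m True \<beta> by (auto simp: indicator_def intro!: ennreal_leI mult_left_mono)
      also have "\<dots> \<le> (\<Sum>n. ennreal (exp (\<beta> * (real (Suc n) + 1))) * indicator {real (Suc n)..} y)"
      proof -
        define f where "f n = ennreal (exp (\<beta> * (real (Suc n) + 1))) * indicator {real (Suc n)..} y" for n
        have "f m \<le> (\<Sum>n. f n)" using sum_le_suminf[of f "{m}"] by simp
        then show ?thesis by (simp add: f_def)
      qed
      finally show ?thesis .
    qed simp
  qed
  also have "\<dots> = (\<Sum>n. ennreal (exp (\<beta> * (real (Suc n) + 1))) * emeasure N {real (Suc n)..})"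
    by (subst nn_integral_suminf) (auto simp: s nn_integral_cmult_indicator)
  also have "\<dots> \<le> (\<Sum>n. ennreal (C' * exp \<beta> * r ^ Suc n))"
  proof (intro suminf_le summableI)
    fix n
    have "ennreal (exp (\<beta> * (real (Suc n) + 1))) * emeasure N {real (Suc n)..} \<le>
        ennreal (exp (\<beta> * (real (Suc n) + 1))) * ennreal (C' * exp (- q * real (Suc n)))"
      by (intro mult_left_mono order_trans[OF tail] ennreal_leI mult_right_mono) (auto simp: C'_def)
    also have "\<dots> = ennreal (exp (\<beta> * (real (Suc n) + 1)) * (C' * exp (- q * real (Suc n))))"
      by (simp add: ennreal_mult' C'_def)
    also have "exp (\<beta> * (real (Suc n) + 1)) * (C' * exp (- q * real (Suc n))) = C' * exp \<beta> * r ^ Suc n"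
      unfolding r_def exp_of_nat_mult[symmetric] by (simp add: exp_add[symmetric] exp_diff[symmetric] algebra_simps exp_minus)
    finally show "ennreal (exp (\<beta> * (real (Suc n) + 1))) * emeasure N {real (Suc n)..} \<le> ennreal (C' * exp \<beta> * r ^ Suc n)" .
  qed
  also have "\<dots> = ennreal (\<Sum>n. C' * exp \<beta> * r ^ Suc n)"
    using r by (intro suminf_ennreal2) (auto simp: C'_def intro!: summable_mult summable_geometric)
  finally show ?thesis using order_le_less_trans by fastforce
qed

locale exponential_tail =
  fixes \<pi> :: "real measure" and \<alpha> :: real
  assumes sets_pi' [measurable_cong]: "sets \<pi> = sets borel"
    and pi_levy': "(\<integral>\<^sup>+x. ennreal (min 1 (x\<^sup>2)) \<partial>\<pi>) < \<infinity>"
    and alpha_pos: "0 < \<alpha>"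
    and tail_ratio: "\<And>y. ((\<lambda>x. levy_tail \<pi> (x + y) / levy_tail \<pi> x) \<longlongrightarrow> exp (- \<alpha> * y)) at_top"
begin

lemmas emeasure_Ici_finite = levy_measure_Ici_finite[OF sets_pi' pi_levy']

lemma emeasure_tail: "0 < x \<Longrightarrow> emeasure \<pi> {x..} = ennreal (levy_tail \<pi> x)"
  using emeasure_Ici_finite[of x] by (simp add: levy_tail_def emeasure_eq_ennreal_measure)

lemma tail_nonneg: "0 \<le> levy_tail \<pi> x"
  by (simp add: levy_tail_def)

lemma tail_antimono: "0 < x \<Longrightarrow> x \<le> y \<Longrightarrow> levy_tail \<pi> y \<le> levy_tail \<pi> x"
  unfolding levy_tail_def using emeasure_Ici_finite[of x] by (intro measure_mono_fmeasurable) (auto simp: fmeasurable_def sets_pi')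

text \<open>As \<open>x / 0 = 0\<close>, a tail that vanished from some point on would make the
  ratio with \<open>y = 0\<close> equal to 0 there instead of tending to 1.\<close>

lemma tail_pos: "0 < x \<Longrightarrow> 0 < levy_tail \<pi> x"
proof -
  assume x: "0 < x"
  have "\<forall>\<^sub>F z in at_top. 0 < levy_tail \<pi> (z + 0) / levy_tail \<pi> z"
    using order_tendstoD(1)[OF tail_ratio[of 0], of 0] by simp
  then have "\<forall>\<^sub>F z in at_top. 0 < levy_tail \<pi> z \<and> x \<le> z"
    using eventually_ge_at_top[of x] by eventually_elim (use tail_nonneg in \<open>auto simp: zero_less_divide_iff less_le\<close>)
  then obtain z where "0 < levy_tail \<pi> z" "x \<le> z" by (auto dest: eventually_happens)
  then show ?thesis using tail_antimono[OF x, of z] by simp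
qed

lemma tail_le_exp:
  assumes \<beta>: "0 \<le> \<beta>" "\<beta> < \<alpha>"
  shows "\<exists>C. \<forall>x\<ge>1. levy_tail \<pi> x \<le> C * exp (- \<beta> * x)"
proof -
  let ?G = "levy_tail \<pi>"
  have "\<forall>\<^sub>F x in at_top. ?G (x + 1) / ?G x < exp (- \<beta>)"
    using order_tendstoD(2)[OF tail_ratio[of 1], of "exp (- \<beta>)"] \<beta> by simp
  then obtain x1 where x1: "\<And>x. x \<ge> x1 \<Longrightarrow> ?G (x + 1) / ?G x < exp (- \<beta>)"
    by (auto simp: eventually_at_top_linorder)
  define x0 where "x0 = max x1 1"
  have step: "?G (x + 1) \<le> exp (- \<beta>) * ?G x" if "x0 \<le> x" for x
    using x1[of x] tail_pos[of x] that by (simp add: x0_def field_simps)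
  have iter: "?G (x0 + real n) \<le> exp (- \<beta> * real n) * ?G x0" for n
  proof (induction n)
    case (Suc n)
    have "?G (x0 + real (Suc n)) \<le> exp (- \<beta>) * ?G (x0 + real n)"
      using step[of "x0 + real n"] by (simp add: algebra_simps)
    also have "\<dots> \<le> exp (- \<beta>) * (exp (- \<beta> * real n) * ?G x0)"
      using Suc by (intro mult_left_mono) auto
    also have "\<dots> = exp (- \<beta> * real (Suc n)) * ?G x0"
      by (simp add: exp_add[symmetric] algebra_simps)
    finally show ?case .
  qed simp
  have "?G x \<le> ?G 1 * exp (\<beta> * (x0 + 1)) * exp (- \<beta> * x)" if x: "1 \<le> x" for x
  proof (cases "x0 \<le> x")
    case True
    define n where "n = nat \<lfloor>x - x0\<rfloor>"
    have n: "real n \<le> x - x0" "x - x0 \<le> real n + 1" using True by (auto simp: n_def)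
    have "?G x \<le> ?G (x0 + real n)"
      using n by (intro tail_antimono) (auto simp: x0_def intro: add_pos_nonneg)
    also have "\<dots> \<le> exp (- \<beta> * real n) * ?G x0" by (rule iter)
    also have "\<dots> \<le> exp (- \<beta> * (x - x0 - 1)) * ?G 1"
      using \<beta> n tail_nonneg by (intro mult_mono tail_antimono) (auto simp: x0_def intro!: mult_left_mono)
    finally show ?thesis by (simp add: exp_add[symmetric] algebra_simps exp_diff)
  next
    case False
    have "?G x \<le> ?G 1 * 1" using tail_antimono[of 1 x] x by simp
    also have "\<dots> \<le> ?G 1 * exp (\<beta> * (x0 + 1 - x))"
      using False \<beta> tail_nonneg by (intro mult_left_mono) auto
    finally show ?thesis by (simp add: exp_add[symmetric] algebra_simps)
  qed
  then show ?thesis by blast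
qed

text \<open>A Potter bound for tails of exponential type. Beyond \<open>x0\<close> each unit step
  loses at most a factor \<open>exp q\<close>, and below \<open>x0\<close> monotonicity costs only
  the constant \<open>G 1 / G x0\<close>. It allows \<open>u\<close> to start at 1, so that it holds
  uniformly enough to dominate the tail ratios.\<close>

lemma tail_Potter:
  assumes q: "\<alpha> < q"
  obtains C x0 where "0 < C" "1 \<le> x0"
    "\<And>u w. 1 \<le> u \<Longrightarrow> u \<le> w \<Longrightarrow> x0 \<le> w \<Longrightarrow> levy_tail \<pi> u \<le> C * exp (q * (w - u)) * levy_tail \<pi> w"
proof -
  let ?G = "levy_tail \<pi>"
  have q0: "0 < q" using q alpha_pos by simp
  have "\<forall>\<^sub>F x in at_top. exp (- q) < ?G (x + 1) / ?G x"
    using order_tendstoD(1)[OF tail_ratio[of 1], of "exp (- q)"] q by simp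
  then obtain x1 where x1: "\<And>x. x \<ge> x1 \<Longrightarrow> exp (- q) < ?G (x + 1) / ?G x"
    by (auto simp: eventually_at_top_linorder)
  define x0 where "x0 = max x1 1"
  have step: "?G x \<le> exp q * ?G (x + 1)" if "x0 \<le> x" for x
    using x1[of x] tail_pos[of x] that by (simp add: x0_def field_simps exp_minus)
  have iter: "?G x \<le> exp (q * real n) * ?G (x + real n)" if "x0 \<le> x" for x n
  proof (induction n)
    case (Suc n)
    have "exp (q * real n) * ?G (x + real n) \<le> exp (q * real n) * (exp q * ?G (x + real n + 1))"
      using step[of "x + real n"] that by (intro mult_left_mono) auto
    also have "\<dots> = exp (q * real (Suc n)) * ?G (x + real (Suc n))"
      by (simp add: exp_add[symmetric] algebra_simps)
    finally show ?case using Suc by simp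
  qed simp
  have main: "?G u \<le> exp q * exp (q * (w - u)) * ?G w" if u: "x0 \<le> u" "u \<le> w" for u w
  proof -
    define n where "n = nat \<lceil>w - u\<rceil>"
    have n: "w - u \<le> real n" "real n \<le> w - u + 1" using u by (auto simp: n_def)
    have "?G u \<le> exp (q * real n) * ?G (u + real n)" by (rule iter[OF u(1)])
    also have "\<dots> \<le> exp (q * (w - u + 1)) * ?G w"
      using n q0 u tail_nonneg by (intro mult_mono tail_antimono) (auto simp: x0_def)
    finally show ?thesis by (simp add: exp_add[symmetric] algebra_simps)
  qed
  define C where "C = exp q * (?G 1 / ?G x0)"
  have G10: "1 \<le> ?G 1 / ?G x0"
    using tail_antimono[of 1 x0] tail_pos[of x0] by (simp add: x0_def)
  have Cq: "exp q \<le> C" using mult_left_mono[OF G10, of "exp q"] by (simp add: C_def)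
  show ?thesis
  proof (rule that[of C x0])
    show "0 < C" using Cq exp_gt_zero[of q] by linarith
    show "1 \<le> x0" by (simp add: x0_def)
    fix u w :: real assume u: "1 \<le> u" "u \<le> w" "x0 \<le> w"
    have Gw: "0 \<le> ?G w" by (rule tail_nonneg)
    show "?G u \<le> C * exp (q * (w - u)) * ?G w"
    proof (cases "x0 \<le> u")
      case True
      have "?G u \<le> exp q * exp (q * (w - u)) * ?G w" by (rule main[OF True u(2)])
      also have "\<dots> \<le> C * exp (q * (w - u)) * ?G w" using Cq Gw by (intro mult_right_mono) auto
      finally show ?thesis .
    next
      case False
      have "?G u \<le> ?G 1 / ?G x0 * ?G x0"
      proof -
        have "0 < x0" by (simp add: x0_def)
        then have "0 < ?G x0" by (rule tail_pos)
        then show ?thesis using tail_antimono[of 1 u] u by simp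
      qed
      also have "\<dots> \<le> ?G 1 / ?G x0 * (exp q * exp (q * (w - x0)) * ?G w)"
        using main[of x0 w] u G10 by (intro mult_left_mono) auto
      also have "\<dots> = C * exp (q * (w - x0)) * ?G w" by (simp add: C_def)
      also have "\<dots> \<le> C * exp (q * (w - u)) * ?G w"
        using False q0 Gw order_trans[OF exp_ge_zero Cq] by (intro mult_right_mono mult_left_mono) auto
      finally show ?thesis .
    qed
  qed
qed

lemma integrable_exp_tail:
  assumes \<beta>: "0 \<le> \<beta>" "\<beta> < \<alpha>"
  shows "integrable \<pi> (\<lambda>y. indicator {1..} y * exp (\<beta> * y))"
proof -
  obtain q where q: "\<beta> < q" "q < \<alpha>" using \<beta> dense by blast
  obtain C where C: "\<And>x. 1 \<le> x \<Longrightarrow> levy_tail \<pi> x \<le> C * exp (- q * x)"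
    using tail_le_exp[of q] q \<beta> by auto
  have "(\<integral>\<^sup>+y. ennreal (indicator {1..} y * exp (\<beta> * y)) \<partial>\<pi>) < \<infinity>"
    by (rule nn_integral_exp_finite[OF sets_pi' \<beta>(1) q(1), of C]) (use C[of "real n" for n] in \<open>auto simp: emeasure_tail intro!: ennreal_leI\<close>)
  then show ?thesis by (intro integrableI_bounded) (auto simp: abs_mult)
qed

lemma integrable_power_tail: "integrable \<pi> (\<lambda>y. indicator {1<..} y * y ^ n)"
proof -
  define \<beta> where "\<beta> = \<alpha> / 2"
  have \<beta>: "0 < \<beta>" "\<beta> < \<alpha>" using alpha_pos by (auto simp: \<beta>_def)
  define C where "C = fact n / \<beta> ^ n"
  have "integrable \<pi> (\<lambda>y. C * (indicator {1..} y * exp (\<beta> * y)))"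
    by (intro Bochner_Integration.integrable_mult_right integrable_exp_tail) (use \<beta> in auto)
  then show ?thesis
  proof (rule Bochner_Integration.integrable_bound)
    have "y ^ n \<le> C * exp (\<beta> * y)" if y: "1 < y" for y
    proof -
      have "(\<beta> * y) ^ n / fact n \<le> exp (\<beta> * y)"
        unfolding exp_def
        using sum_le_suminf[OF summable_exp_generic[of "\<beta> * y"], of "{n}"] \<beta> y by (simp add: divide_inverse mult.commute)
      then show ?thesis using \<beta> by (simp add: C_def field_simps power_mult_distrib)
    qed
    then show "AE y in \<pi>. norm (indicator {1<..} y * y ^ n) \<le> norm (C * (indicator {1..} y * exp (\<beta> * y)))"
      using \<beta> by (intro AE_I2) (auto simp: indicator_def abs_mult C_def)
  qed measurable
qed

end

locale tail_log_functional_law = log_functional_law + exponential_tail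
begin

lemma tame_exp:
  assumes \<gamma>: "0 \<le> \<gamma>" and W: "0 \<le> W"
  shows "tame (\<gamma> * exp \<gamma>) X (\<lambda>x. W * exp (\<gamma> * x))"
  unfolding tame_def
proof (intro allI impI conjI)
  fix x
  show "0 \<le> W * exp (\<gamma> * x)" using W by simp
  have "\<gamma> * (W * exp (\<gamma> * x)) \<le> \<gamma> * exp \<gamma> * (W * exp (\<gamma> * x))"
    using \<gamma> W by (intro mult_right_mono) (auto simp: mult_le_cancel_left1)
  then show "\<exists>D. ((\<lambda>x. W * exp (\<gamma> * x)) has_real_derivative D) (at x) \<and> \<bar>D\<bar> \<le> \<gamma> * exp \<gamma> * (W * exp (\<gamma> * x))"
    using \<gamma> W by (intro exI[of _ "\<gamma> * (W * exp (\<gamma> * x))"]) (auto intro!: derivative_eq_intros simp: abs_mult)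
  fix s :: real assume s: "0 \<le> s" "s \<le> 1"
  have "\<bar>exp (\<gamma> * s) - 1\<bar> \<le> \<gamma> * exp \<gamma> * s"
  proof (cases "s = 0")
    case False
    have d: "((\<lambda>s. exp (\<gamma> * s)) has_real_derivative \<gamma> * exp (\<gamma> * x)) (at x)" for x
      by (auto intro!: derivative_eq_intros)
    obtain z where z: "0 < z" "z < s" "exp (\<gamma> * s) - exp (\<gamma> * 0) = (s - 0) * (\<gamma> * exp (\<gamma> * z))"
      using MVT2[of 0 s, OF _ d] s False by auto
    have "s * (\<gamma> * exp (\<gamma> * z)) \<le> s * (\<gamma> * exp (\<gamma> * 1))"
      using s z \<gamma> by (intro mult_left_mono) (auto intro!: mult_left_le)
    then show ?thesis using z s \<gamma> by (simp add: mult_ac)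
  qed simp
  then have "\<bar>exp (\<gamma> * s) - 1\<bar> * (W * exp (\<gamma> * x)) \<le> \<gamma> * exp \<gamma> * s * (W * exp (\<gamma> * x))"
    using W by (intro mult_right_mono) auto
  moreover have "\<bar>W * exp (\<gamma> * (x + s)) - W * exp (\<gamma> * x)\<bar> = \<bar>exp (\<gamma> * s) - 1\<bar> * (W * exp (\<gamma> * x))"
  proof -
    have "W * exp (\<gamma> * (x + s)) - W * exp (\<gamma> * x) = (exp (\<gamma> * s) - 1) * (W * exp (\<gamma> * x))"
      by (simp add: distrib_left exp_add algebra_simps)
    then show ?thesis using W by (simp add: abs_mult)
  qed
  ultimately show "\<bar>W * exp (\<gamma> * (x + s)) - W * exp (\<gamma> * x)\<bar> \<le> \<gamma> * exp \<gamma> * s * (W * exp (\<gamma> * x))"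
    by simp
qed

lemma big_jump_cdf_le_exp:
  assumes \<beta>: "0 \<le> \<beta>" "\<beta> < \<alpha>" and F: "\<And>z. cdf \<mu> z \<le> C * exp (\<beta> * z)"
  obtains C' where "0 \<le> C'" "\<And>x. big_jump_cdf x \<le> C' * exp (\<beta> * x)"
proof
  define E where "E = (LINT y|\<pi>. indicator {1..} y * exp (\<beta> * y))"
  have C0: "0 \<le> C" using F[of 0] fb.cdf_nonneg[of 0] by simp
  have "0 \<le> E" unfolding E_def by (intro integral_nonneg_AE AE_I2) auto
  then show "0 \<le> C * E" using C0 by simp
  fix x
  have "big_jump_cdf x \<le> (LINT y|\<pi>. C * exp (\<beta> * x) * (indicator {1..} y * exp (\<beta> * y)))"
    unfolding big_jump_cdf_def
  proof (intro integral_mono integrable_big_jump_cdf Bochner_Integration.integrable_mult_right integrable_exp_tail \<beta>)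
    fix y
    have "cdf \<mu> (x + y) \<le> C * exp (\<beta> * x) * exp (\<beta> * y)"
      using F[of "x + y"] by (simp add: distrib_left exp_add mult_ac)
    then show "indicator {1<..} y * cdf \<mu> (x + y) \<le> C * exp (\<beta> * x) * (indicator {1..} y * exp (\<beta> * y))"
      using C0 by (auto simp: indicator_def)
  qed
  then show "big_jump_cdf x \<le> C * E * exp (\<beta> * x)" unfolding integral_mult_right_zero E_def[symmetric] by (simp add: mult_ac)
qed

text \<open>The left side of the equation carries the factor \<open>exp (- x)\<close>, so that each use of it improves the decay of \<open>cdf \<mu>\<close> by \<open>exp x\<close>.\<close>
lemma cdf_growth_step:
  assumes \<beta>: "0 \<le> \<beta>" "\<beta> < \<alpha>" and F: "\<And>z. cdf \<mu> z \<le> C * exp (\<beta> * z)"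
  obtains C' where "\<And>z. cdf \<mu> z \<le> C' * exp ((1 + \<beta>) * z)"
proof -
  obtain T where T: "0 \<le> T" "\<And>x. big_jump_cdf x \<le> T * exp (\<beta> * x)"
    using big_jump_cdf_le_exp[OF \<beta> F] by blast
  define \<gamma> where "\<gamma> = 1 + \<beta>"
  define P where "P = perturbation (\<gamma> * exp \<gamma>)"
  have P0: "0 \<le> P" using \<beta> small_variance_nonneg by (simp add: P_def perturbation_def \<gamma>_def)
  \<comment> \<open>Only a rate is wanted here, so one fixed width suffices.\<close>
  define h :: real where "h = 1 / 3"
  have h: "0 < h" "3 * h \<le> 1" by (auto simp: h_def)
  \<comment> \<open>The margin 3 serves the crude bound, which is applied with threshold
    \<open>X + 2\<close> in order to cover \<open>{X..X + 1}\<close>. The summand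
    \<open>2 * P\<close> lets the perturbation use up at most half of
    \<open>exp (- x - 1)\<close>.\<close>
  define X where "X = - ln (\<bar>a\<bar> + 1 + 2 * P) - 3"
  have pos: "0 < \<bar>a\<bar> + 1 + 2 * P" using P0 by simp
  have X: "exp (- X - 3) = \<bar>a\<bar> + 1 + 2 * P" using pos by (simp add: X_def)
  have ex: "\<bar>a\<bar> + 1 + 2 * P \<le> exp (- x - 3 * h)" if "x \<le> X" for x
    unfolding X[symmetric] using that by (simp add: h_def)
  \<comment> \<open>The first entry makes the barrier exceed the crude bound from \<open>X\<close>
    on, the second makes half of the left side of the equation outweigh the big jumps.\<close>
  define W where "W = max (max 1 big_mass * exp (- \<gamma> * X)) (2 * T * exp (\<beta> + 1))"
  have W: "max 1 big_mass * exp (- \<gamma> * X) \<le> W" "2 * T * exp (\<beta> + 1) \<le> W" "0 \<le> W"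
    using T by (auto simp: W_def le_max_iff_disj)
  have kle: "smooth_density h x \<le> W * exp (\<gamma> * x)" if x: "x \<le> X" for x
  proof (rule smooth_density_le_barrier[OF h(1) tame_exp _ _ _ x])
    show "0 \<le> \<gamma>" using \<beta> by (simp add: \<gamma>_def)
    show "0 \<le> W" by fact
    show "smooth_density h x \<le> W * exp (\<gamma> * x)" if "X \<le> x" "x \<le> X + 1" for x
    proof -
      have "smooth_density h x \<le> max 1 big_mass"
      proof (rule smooth_density_crude_bound[OF h, of "X + 2"])
        have "- (X + 2) - 1 = - X - 3" by simp
        then show "\<bar>a\<bar> + 1 \<le> exp (- (X + 2) - 1)" using X P0 by (simp only:)
      qed (use that in simp)
      also have "\<dots> = max 1 big_mass * exp (- \<gamma> * X) * exp (\<gamma> * X)" by (simp add: exp_add[symmetric])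
      also have "\<dots> \<le> W * exp (\<gamma> * x)" using W that \<beta> by (intro mult_mono) (auto simp: \<gamma>_def)
      finally show ?thesis .
    qed
    show "\<bar>a\<bar> < exp (- x - 3 * h)" if "x \<le> X" for x using ex[OF that] P0 by simp
    show "big_jump h x \<le> (exp (- x - 3 * h) - perturbation (\<gamma> * exp \<gamma>)) * (W * exp (\<gamma> * x))" if "x \<le> X" for x
    proof -
      have "big_jump h x \<le> T * exp (\<beta> * (x + 1))"
        using big_jump_cdf_bounds(1)[OF h(1), of x] T(2)[of "x + 1"] by (simp add: h_def)
      also have "\<dots> = exp (- x - 1) / 2 * (2 * T * exp (\<beta> + 1) * exp (\<gamma> * x))"
        by (simp add: \<gamma>_def exp_add[symmetric] algebra_simps)
      also have "\<dots> \<le> exp (- x - 1) / 2 * (W * exp (\<gamma> * x))"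
        using W by (intro mult_left_mono mult_right_mono) auto
      also have "\<dots> \<le> (exp (- x - 3 * h) - P) * (W * exp (\<gamma> * x))"
        using ex[OF that] W by (intro mult_right_mono) (auto simp: h_def)
      finally show ?thesis by (simp add: P_def)
    qed
  qed
  have \<gamma>: "0 < \<gamma>" using \<beta> by (simp add: \<gamma>_def)
  have Fle: "cdf \<mu> z \<le> W / \<gamma> * exp (\<gamma> * z)" if z: "z \<le> X" for z
  proof -
    define g where "g x = smooth_cdf h x - W / \<gamma> * exp (\<gamma> * x)" for x
    have mono: "g z \<le> g y" if y: "y \<le> z" for y
    proof (rule DERIV_nonpos_imp_nonincreasing[OF y])
      fix x assume x: "y \<le> x" "x \<le> z"
      have "(g has_real_derivative smooth_density h x - W * exp (\<gamma> * x)) (at x)"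
        unfolding g_def[abs_def] using \<gamma>
        by (auto intro!: derivative_eq_intros DERIV_smooth_cdf h)
      then show "\<exists>D. (g has_real_derivative D) (at x) \<and> D \<le> 0"
        using kle[of x] x z by (intro exI[of _ "smooth_density h x - W * exp (\<gamma> * x)"]) auto
    qed
    have ge: "g z \<le> cdf \<mu> (y + 1)" if "y \<le> z" for y
    proof -
      have "0 \<le> W / \<gamma> * exp (\<gamma> * y)" using W \<gamma> by simp
      then show ?thesis using mono[OF that] smooth_cdf_bounds(2)[OF h(1), of y] unfolding g_def by (simp add: h_def)
    qed
    \<comment> \<open>Integrating the density bound from minus infinity: \<open>g\<close> decreases
      on the half-line and is bounded by a quantity with limit 0 there.\<close>
    have "g z \<le> 0"
    proof (rule tendsto_lowerbound[of "\<lambda>y. cdf \<mu> (y + 1)" 0 at_bot])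
      have "filterlim (\<lambda>y::real. y + 1) at_bot at_bot"
        by (subst add.commute, rule filterlim_tendsto_add_at_bot_iff[THEN iffD2, OF tendsto_const]) (rule filterlim_ident)
      then show "((\<lambda>y. cdf \<mu> (y + 1)) \<longlongrightarrow> 0) at_bot"
        by (rule filterlim_compose[OF fb.cdf_lim_at_bot])
      show "\<forall>\<^sub>F y in at_bot. g z \<le> cdf \<mu> (y + 1)"
        using eventually_le_at_bot[of z] by eventually_elim (rule ge)
    qed simp
    then show ?thesis using smooth_cdf_bounds(1)[OF h(1), of z] by (simp add: g_def)
  qed
  show ?thesis
  proof (rule that[of "max (W / \<gamma>) (exp (- \<gamma> * X))"])
    fix z
    show "cdf \<mu> z \<le> max (W / \<gamma>) (exp (- \<gamma> * X)) * exp ((1 + \<beta>) * z)"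
    proof (cases "z \<le> X")
      case True
      have "W / \<gamma> * exp (\<gamma> * z) \<le> max (W / \<gamma>) (exp (- \<gamma> * X)) * exp (\<gamma> * z)"
        by (intro mult_right_mono) auto
      then show ?thesis using Fle[OF True] unfolding \<gamma>_def by linarith
    next
      case False
      have "cdf \<mu> z \<le> 1" by (rule cdf_le_1)
      also have "1 \<le> exp (- \<gamma> * X) * exp (\<gamma> * z)" using False \<gamma> by (simp add: exp_add[symmetric])
      also have "\<dots> \<le> max (W / \<gamma>) (exp (- \<gamma> * X)) * exp ((1 + \<beta>) * z)"
        by (auto simp: \<gamma>_def intro!: mult_right_mono)
      finally show ?thesis .
    qed
  qed
qed

lemma cdf_growth_mono:
  assumes F: "\<And>z. cdf \<mu> z \<le> C * exp (q * z)" and q': "0 \<le> q'" "q' \<le> q"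
  shows "cdf \<mu> z \<le> max C 1 * exp (q' * z)"
proof (cases "z \<le> 0")
  case True
  have "q * z \<le> q' * z" using True q' by (intro mult_right_mono_neg) auto
  then have "C * exp (q * z) \<le> max C 1 * exp (q' * z)" by (intro mult_mono) auto
  then show ?thesis using F[of z] by simp
next
  case False
  have "cdf \<mu> z \<le> 1 * 1" using cdf_le_1 by simp
  also have "\<dots> \<le> max C 1 * exp (q' * z)" using False q' by (intro mult_mono) auto
  finally show ?thesis .
qed

text \<open>A step may start only from an exponent below \<alpha>, where the exponential moment of
  \<pi> is finite. Hence the surplus is discarded after every step and the exponent is capped at
  \<beta>.\<close>

lemma cdf_growth_iterate:
  assumes \<beta>: "0 \<le> \<beta>" "\<beta> < \<alpha>"
  shows "\<exists>C. \<forall>z. cdf \<mu> z \<le> C * exp (min (real n) \<beta> * z)"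
proof (induction n)
  case 0
  then show ?case using \<beta> cdf_le_1 by (intro exI[of _ 1]) (simp add: min_def)
next
  case (Suc n)
  then obtain C where C: "\<And>z. cdf \<mu> z \<le> C * exp (min (real n) \<beta> * z)" by blast
  have "0 \<le> min (real n) \<beta>" "min (real n) \<beta> < \<alpha>" using \<beta> by auto
  from cdf_growth_step[OF this C]
  obtain C' where "\<And>z. cdf \<mu> z \<le> C' * exp ((1 + min (real n) \<beta>) * z)" by blast
  from cdf_growth_mono[OF this, of "min (real (Suc n)) \<beta>"] \<beta> show ?case
    by (intro exI[of _ "max C' 1"]) auto
qed

text \<open>The last step starts at \<open>max 0 (\<alpha> - 1 / 2)\<close>, which is below
  \<alpha>, and ends at \<open>\<alpha> + 1 / 2\<close> or more. The surplus over \<alpha> gives the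
  moment of order \<alpha>, makes \<open>cdf \<mu>\<close> negligible against the tail of \<pi>, and
  leaves room for a dominating function.\<close>

lemma cdf_growth:
  obtains C where "\<And>z. cdf \<mu> z \<le> C * exp ((\<alpha> + 1 / 2) * z)"
proof -
  define \<beta> where "\<beta> = max 0 (\<alpha> - 1 / 2)"
  have \<beta>: "0 \<le> \<beta>" "\<beta> < \<alpha>" using alpha_pos by (auto simp: \<beta>_def)
  obtain n :: nat where n: "\<beta> \<le> real n" using real_arch_simple by blast
  then have "min (real n) \<beta> = \<beta>" by simp
  then obtain C where C: "\<And>z. cdf \<mu> z \<le> C * exp (\<beta> * z)"
    using cdf_growth_iterate[OF \<beta>, of n] by auto
  obtain C' where C': "\<And>z. cdf \<mu> z \<le> C' * exp ((1 + \<beta>) * z)"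
    using cdf_growth_step[OF \<beta> C] by blast
  show ?thesis
    by (rule that, rule cdf_growth_mono[OF C']) (use alpha_pos in \<open>auto simp: \<beta>_def\<close>)
qed

lemma integrable_exp_minus_mu:
  assumes \<beta>: "0 \<le> \<beta>" "\<beta> < \<alpha> + 1 / 2"
  shows "integrable \<mu> (\<lambda>z. exp (- \<beta> * z))"
proof -
  obtain C where C: "\<And>z. cdf \<mu> z \<le> C * exp ((\<alpha> + 1 / 2) * z)" using cdf_growth by blast
  define N where "N = distr \<mu> borel uminus"
  have "(\<integral>\<^sup>+y. ennreal (indicator {1..} y * exp (\<beta> * y)) \<partial>N) < \<infinity>"
  proof (rule nn_integral_exp_finite[OF _ \<beta>])
    show "sets N = sets borel" by (simp add: N_def)
    fix n :: nat
    have "uminus -` {real n..} = {.. - real n}" by auto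
    then have "emeasure N {real n..} = emeasure \<mu> {.. - real n}"
      unfolding N_def by (subst emeasure_distr) (auto simp: space_mu)
    also have "\<dots> = ennreal (cdf \<mu> (- real n))" by (simp add: cdf_def mu.emeasure_eq_measure)
    also have "\<dots> \<le> ennreal (C * exp (- (\<alpha> + 1 / 2) * real n))"
      using C[of "- real n"] by (intro ennreal_leI) (simp add: algebra_simps)
    finally show "emeasure N {real n..} \<le> ennreal (C * exp (- (\<alpha> + 1 / 2) * real n))" .
  qed
  also have "(\<integral>\<^sup>+y. ennreal (indicator {1..} y * exp (\<beta> * y)) \<partial>N) = (\<integral>\<^sup>+z. ennreal (indicator {1..} (- z) * exp (- \<beta> * z)) \<partial>\<mu>)"
    unfolding N_def by (subst nn_integral_distr) auto
  finally have "integrable \<mu> (\<lambda>z. indicator {1..} (- z) * exp (- \<beta> * z))"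
    by (intro integrableI_bounded) (auto simp: abs_mult)
  then have "integrable \<mu> (\<lambda>z. indicator {1..} (- z) * exp (- \<beta> * z) + exp \<beta>)"
    by simp
  then show ?thesis
  proof (rule Bochner_Integration.integrable_bound)
    show "AE z in \<mu>. norm (exp (- \<beta> * z)) \<le> norm (indicator {1..} (- z) * exp (- \<beta> * z) + exp \<beta>)"
    proof (intro AE_I2)
      fix z
      show "norm (exp (- \<beta> * z)) \<le> norm (indicator {1..} (- z) * exp (- \<beta> * z) + exp \<beta>)"
      proof (cases "1 \<le> - z")
        case False
        then have "\<beta> * (- z) \<le> \<beta> * 1" using \<beta> by (intro mult_left_mono) auto
        then show ?thesis using False by (simp add: indicator_def)
      qed (simp add: indicator_def add_nonneg_nonneg)
    qed
  qed measurable
qed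

end

subsection \<open>Asymptotics at minus infinity\<close>

context tail_log_functional_law
begin

abbreviation L :: "real \<Rightarrow> real" where "L \<equiv> levy_tail \<pi>"

definition neg_moment :: real where "neg_moment = (LINT z|\<mu>. exp (- \<alpha> * z))"

lemma neg_moment_nonneg: "0 \<le> neg_moment"
  unfolding neg_moment_def by (intro integral_nonneg_AE AE_I2) simp

lemma finite_big_part:
  "{1<..} \<inter> {u..} \<in> fmeasurable \<pi>" for u
proof -
  have "emeasure \<pi> ({1<..} \<inter> {u..}) \<le> emeasure \<pi> {1<..}"
    by (intro emeasure_mono) (auto simp: sets_pi)
  then show ?thesis using emeasure_pi_Ioi_finite by (auto simp: fmeasurable_def sets_pi)
qed

text \<open>Exchanging the integrals puts the tail of \<pi> under the integral over \<mu>, where the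
  ratio hypothesis can act for each fixed \<open>z\<close>.\<close>

lemma big_jump_cdf_eq: "big_jump_cdf x = (LINT z|\<mu>. measure \<pi> ({1<..} \<inter> {z - x..}))"
proof -
  have psf: "pair_sigma_finite \<pi> \<mu>"
    by (intro pair_sigma_finite.intro pi.sigma_finite_measure_axioms mu.sigma_finite_measure_axioms)
  define f :: "real \<times> real \<Rightarrow> real" where "f = (\<lambda>(y, z). if 1 < y \<and> z \<le> x + y then 1 else 0)"
  have f_eq: "f (y, z) = indicator {1<..} y * indicator {..x + y} z" for y z
    by (simp add: f_def indicator_def)
  have mf: "f \<in> borel_measurable (borel \<Otimes>\<^sub>M borel)"
    unfolding f_def by measurable
  have e: "(LINT z|\<mu>. indicator {..w} z) = cdf \<mu> w" for w
    by (simp add: cdf_def space_mu)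
  have "integrable (\<pi> \<Otimes>\<^sub>M \<mu>) f"
  proof (rule pair_sigma_finite.Fubini_integrable[OF psf])
    show "f \<in> borel_measurable (\<pi> \<Otimes>\<^sub>M \<mu>)"
      using mf by (simp cong: measurable_cong_sets add: sets_pair_measure_cong[OF sets_pi sets_mu])
    show "integrable \<pi> (\<lambda>y. LINT z|\<mu>. norm (f (y, z)))"
      using integrable_big_jump_cdf[of x] by (simp add: f_eq cdf_def space_mu)
    show "AE y in \<pi>. integrable \<mu> (\<lambda>z. f (y, z))"
      by (intro AE_I2) (auto simp: f_eq integrable_indicator_iff space_mu mu.emeasure_eq_measure)
  qed
  then have "integrable (\<pi> \<Otimes>\<^sub>M \<mu>) (\<lambda>(y, z). f (y, z))" by simp
  from pair_sigma_finite.Fubini_integral[OF psf this]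
  have "(LINT z|\<mu>. (LINT y|\<pi>. f (y, z))) = (LINT y|\<pi>. (LINT z|\<mu>. f (y, z)))" .
  also have "\<dots> = big_jump_cdf x" by (simp add: f_eq cdf_def space_mu big_jump_cdf_def)
  finally have "(LINT z|\<mu>. (LINT y|\<pi>. f (y, z))) = big_jump_cdf x" .
  moreover have "(LINT y|\<pi>. f (y, z)) = measure \<pi> ({1<..} \<inter> {z - x..})" for z
  proof -
    have "(LINT y|\<pi>. f (y, z)) = (LINT y|\<pi>. indicator ({1<..} \<inter> {z - x..}) y)"
      by (intro Bochner_Integration.integral_cong) (auto simp: f_def indicator_def)
    then show ?thesis by (simp add: space_pi)
  qed
  ultimately show ?thesis by simp
qed

text \<open>The constant of the theorem originates here: after division by \<open>L x\<close> the
  integrand at \<open>z\<close> tends to \<open>exp (- \<alpha> * z)\<close>, and dominated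
  convergence yields the moment of order \<alpha>.\<close>

lemma big_jump_cdf_asymp: "((\<lambda>x. big_jump_cdf (- x) / L x) \<longlongrightarrow> neg_moment) at_top"
proof -
  \<comment> \<open>Between \<alpha>, which the Potter bound must exceed, and
    \<open>\<alpha> + 1 / 2\<close>, below which \<mu> has exponential moments.\<close>
  define q where "q = \<alpha> + 1 / 4"
  obtain C x0 where C: "0 < C" "1 \<le> x0"
    and P: "\<And>u w. 1 \<le> u \<Longrightarrow> u \<le> w \<Longrightarrow> x0 \<le> w \<Longrightarrow> L u \<le> C * exp (q * (w - u)) * L w"
    using tail_Potter[of q] by (auto simp: q_def)
  have q0: "0 < q" using alpha_pos by (simp add: q_def)
  define r where "r x z = measure \<pi> ({1<..} \<inter> {z + x..}) / L x" for x z
  have "((\<lambda>x. LINT z|\<mu>. r x z) \<longlongrightarrow> (LINT z|\<mu>. exp (- \<alpha> * z))) at_top"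
  proof (rule integral_dominated_convergence_at_top)
    show "r x \<in> borel_measurable \<mu>" for x
    proof -
      have "antimono (r x)"
        unfolding r_def antimono_def using finite_big_part
        by (auto intro!: divide_right_mono measure_mono_fmeasurable tail_nonneg simp: sets_pi)
      then have "mono (\<lambda>z. - r x z)" by (auto simp: mono_def antimono_def)
      then have "(\<lambda>z. - r x z) \<in> borel_measurable borel" by (rule borel_measurable_mono)
      then have "(\<lambda>z. - (- r x z)) \<in> borel_measurable borel" by (rule borel_measurable_uminus)
      then show ?thesis by (simp cong: measurable_cong_sets add: sets_mu)
    qed
    show "integrable \<mu> (\<lambda>z. 1 + C * exp (- q * z))"
      using integrable_exp_minus_mu[of q] alpha_pos by (auto simp: q_def)
    show "\<forall>\<^sub>F x in at_top. AE z in \<mu>. norm (r x z) \<le> 1 + C * exp (- q * z)"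
      using eventually_ge_at_top[of x0]
    proof eventually_elim
      case (elim x)
      have Lx: "0 < L x" using elim C by (intro tail_pos) simp
      have "r x z \<le> 1 + C * exp (- q * z)" for z
      proof (cases "0 \<le> z")
        case True
        have "measure \<pi> ({1<..} \<inter> {z + x..}) \<le> L x"
          unfolding levy_tail_def using True elim C emeasure_pi_Ici_finite[of x]
          by (intro measure_mono_fmeasurable) (auto simp: fmeasurable_def sets_pi)
        then have "r x z \<le> 1" using Lx by (simp add: r_def)
        then show ?thesis using C by (intro order_trans[OF \<open>r x z \<le> 1\<close>]) simp
      next
        case False
        \<comment> \<open>Only jumps above 1 are counted, and the Potter bound is available from 1
          on, hence the truncation.\<close>
        define u where "u = max 1 (z + x)"
        have u: "1 \<le> u" "u \<le> x" "x - u \<le> - z" using False elim C by (auto simp: u_def)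
        have "measure \<pi> ({1<..} \<inter> {z + x..}) \<le> L u"
          unfolding levy_tail_def using emeasure_pi_Ici_finite[of u] u
          by (intro measure_mono_fmeasurable) (auto simp: fmeasurable_def sets_pi u_def)
        also have "\<dots> \<le> C * exp (q * (x - u)) * L x" using P u elim by simp
        also have "\<dots> \<le> C * exp (q * (- z)) * L x"
        proof -
          have "q * (x - u) \<le> q * (- z)" using u q0 by (intro mult_left_mono) auto
          then show ?thesis using C Lx by (intro mult_right_mono mult_left_mono) auto
        qed
        finally have "r x z \<le> C * exp (- q * z)" using Lx by (simp add: r_def field_simps)
        then show ?thesis by simp
      qed
      then show ?case using Lx by (intro AE_I2) (simp add: r_def)
    qed
    show "AE z in \<mu>. ((\<lambda>x. r x z) \<longlongrightarrow> exp (- \<alpha> * z)) at_top"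
    proof (rule AE_I2)
      fix z
      have "\<forall>\<^sub>F x in at_top. r x z = L (x + z) / L x"
        using eventually_gt_at_top[of "1 - z"]
      proof eventually_elim
        case (elim x)
        then have "{1<..} \<inter> {z + x..} = {x + z..}" by auto
        then show ?case by (simp add: r_def levy_tail_def)
      qed
      then show "((\<lambda>x. r x z) \<longlongrightarrow> exp (- \<alpha> * z)) at_top"
        using tail_ratio[of z] by (simp add: tendsto_cong)
    qed
  qed simp
  moreover have "(LINT z|\<mu>. r x z) = big_jump_cdf (- x) / L x" for x
    by (simp add: r_def big_jump_cdf_eq)
  ultimately show ?thesis by (simp add: neg_moment_def)
qed

lemma exp_negligible:
  assumes q: "\<alpha> < q" shows "((\<lambda>x. exp (- q * x) / L x) \<longlongrightarrow> 0) at_top"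
proof -
  obtain q' where q': "\<alpha> < q'" "q' < q" using q dense by blast
  obtain C x0 where C: "0 < C" "1 \<le> x0"
    and P: "\<And>u w. 1 \<le> u \<Longrightarrow> u \<le> w \<Longrightarrow> x0 \<le> w \<Longrightarrow> L u \<le> C * exp (q' * (w - u)) * L w"
    using tail_Potter[OF q'(1)] by auto
  have L1: "0 < L 1" by (rule tail_pos) simp
  define D where "D = C * exp (- q') / L 1"
  show ?thesis
  proof (rule tendsto_sandwich)
    show "\<forall>\<^sub>F x in at_top. 0 \<le> exp (- q * x) / L x"
      by (intro always_eventually allI divide_nonneg_nonneg tail_nonneg) auto
    show "\<forall>\<^sub>F x in at_top. exp (- q * x) / L x \<le> D * exp (- (q - q') * x)"
      using eventually_ge_at_top[of x0]
    proof eventually_elim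
      case (elim x)
      have Lx: "0 < L x" using elim C by (intro tail_pos) simp
      have "L 1 \<le> C * exp (q' * (x - 1)) * L x" using P[of 1 x] elim C by simp
      then have "exp (- q * x) * L 1 \<le> exp (- q * x) * (C * exp (q' * (x - 1)) * L x)"
        by (intro mult_left_mono) auto
      also have "\<dots> = C * exp (- q') * exp (- (q - q') * x) * L x"
        by (simp add: exp_add[symmetric] algebra_simps)
      finally show ?case using Lx L1 by (simp add: D_def field_simps)
    qed
    have "filterlim (\<lambda>x. - (q - q') * x) at_bot at_top"
      using q' by (intro filterlim_tendsto_neg_mult_at_bot[OF tendsto_const]) (auto intro: filterlim_ident)
    then have "((\<lambda>x. D * exp (- (q - q') * x)) \<longlongrightarrow> D * 0) at_top"
      by (intro tendsto_intros filterlim_compose[OF exp_at_bot])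
    then show "((\<lambda>x. D * exp (- (q - q') * x)) \<longlongrightarrow> 0) at_top" by simp
  qed simp
qed

lemma cdf_negligible: "((\<lambda>x. cdf \<mu> (1 - x) / L x) \<longlongrightarrow> 0) at_top"
proof -
  obtain C where C: "\<And>z. cdf \<mu> z \<le> C * exp ((\<alpha> + 1 / 2) * z)" using cdf_growth by blast
  show ?thesis
  proof (rule tendsto_sandwich)
    show "\<forall>\<^sub>F x in at_top. 0 \<le> cdf \<mu> (1 - x) / L x"
      by (intro always_eventually allI divide_nonneg_nonneg tail_nonneg fb.cdf_nonneg)
    show "\<forall>\<^sub>F x in at_top. cdf \<mu> (1 - x) / L x \<le> C * exp (\<alpha> + 1 / 2) * (exp (- (\<alpha> + 1 / 2) * x) / L x)"
    proof (intro always_eventually allI)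
      fix x
      have "(\<alpha> + 1 / 2) * (1 - x) = (\<alpha> + 1 / 2) + - (\<alpha> + 1 / 2) * x"
        by (simp add: field_simps)
      then have "cdf \<mu> (1 - x) \<le> C * exp (\<alpha> + 1 / 2) * exp (- (\<alpha> + 1 / 2) * x)"
        using C[of "1 - x"] by (simp only: exp_add mult.assoc)
      then show "cdf \<mu> (1 - x) / L x \<le> C * exp (\<alpha> + 1 / 2) * (exp (- (\<alpha> + 1 / 2) * x) / L x)"
        using divide_right_mono[OF _ tail_nonneg[of x]] by fastforce
    qed
    have "((\<lambda>x. C * exp (\<alpha> + 1 / 2) * (exp (- (\<alpha> + 1 / 2) * x) / L x)) \<longlongrightarrow> C * exp (\<alpha> + 1 / 2) * 0) at_top"
      by (intro tendsto_intros exp_negligible) simp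
    then show "((\<lambda>x. C * exp (\<alpha> + 1 / 2) * (exp (- (\<alpha> + 1 / 2) * x) / L x)) \<longlongrightarrow> 0) at_top" by simp
  qed simp
qed

text \<open>Smoothing the distribution function of this measure yields a differentiable substitute for \<open>x \<mapsto> L (- x)\<close>.\<close>
definition reflected_tail :: "real measure" where
  "reflected_tail = distr (density \<pi> (indicator {1..})) borel uminus"

lemma sets_reflected_tail: "sets reflected_tail = sets borel"
  by (simp add: reflected_tail_def)

lemma emeasure_reflected_tail: "B \<in> sets borel \<Longrightarrow> emeasure reflected_tail B = emeasure \<pi> ({1..} \<inter> uminus -` B)"
proof -
  assume [measurable]: "B \<in> sets borel"
  have m: "uminus -` B \<in> sets borel" using measurable_sets[of uminus borel borel B] by simp
  have "emeasure reflected_tail B = emeasure (density \<pi> (indicator {1..})) (uminus -` B)"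
    unfolding reflected_tail_def by (subst emeasure_distr) (auto simp: space_pi)
  also have "\<dots> = (\<integral>\<^sup>+y. indicator {1..} y * indicator (uminus -` B) y \<partial>\<pi>)"
    using m by (subst emeasure_density) (auto simp: sets_pi)
  also have "\<dots> = (\<integral>\<^sup>+y. indicator ({1..} \<inter> uminus -` B) y \<partial>\<pi>)"
    by (intro nn_integral_cong) (auto simp: indicator_def)
  also have "\<dots> = emeasure \<pi> ({1..} \<inter> uminus -` B)"
    using m by (subst nn_integral_indicator) (auto simp: sets_pi)
  finally show ?thesis .
qed

lemma finite_reflected_tail: "finite_measure reflected_tail"
proof
  show "emeasure reflected_tail (space reflected_tail) \<noteq> \<infinity>"
    using emeasure_pi_Ici_finite[of 1] emeasure_reflected_tail[of UNIV] by (simp add: reflected_tail_def)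
qed

lemma cdf_reflected_tail: "cdf reflected_tail x = L (max 1 (- x))"
proof -
  have "{1..} \<inter> uminus -` {..x} = {max 1 (- x)..}" by auto
  then show ?thesis
    by (simp add: cdf_def levy_tail_def measure_def emeasure_reflected_tail)
qed

definition smooth_tail :: "real \<Rightarrow> real \<Rightarrow> real" where
  "smooth_tail h x = (LINT z|reflected_tail. bspline_tail h (z - x))"

lemma smooth_tail_bounds:
  assumes h: "0 < h" "3 * h \<le> 1" and x: "x \<le> - 2"
  shows "L (- x) \<le> smooth_tail h x" "smooth_tail h x \<le> L (- x - 3 * h)"
  using conv_bspline_tail_ge[OF h(1) finite_reflected_tail sets_reflected_tail, of x]
    conv_bspline_tail_le[OF h(1) finite_reflected_tail sets_reflected_tail, of x] h x
  by (auto simp: smooth_tail_def cdf_reflected_tail max_def)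

text \<open>Differentiating the smoothed tail costs the factor \<open>3 / h\<close>, and the Potter
  bound compares the tail at nearby arguments. Both \<open>C\<close> and \<open>X\<close> depend on
  \<open>h\<close> but not on \<open>W\<close>, since \<open>W\<close> is fixed only after
  \<open>C\<close>.\<close>

lemma tame_smooth_tail:
  assumes h: "0 < h" "3 * h \<le> 1"
  obtains C X where "0 \<le> C" "\<And>W. 0 \<le> W \<Longrightarrow> tame C X (\<lambda>x. W * exp x * smooth_tail h x)"
proof -
  obtain Cp x0 where Cp: "0 < Cp" "1 \<le> x0"
    and P: "\<And>u w. 1 \<le> u \<Longrightarrow> u \<le> w \<Longrightarrow> x0 \<le> w \<Longrightarrow> L u \<le> Cp * exp ((\<alpha> + 1) * (w - u)) * L w"
    using tail_Potter[of "\<alpha> + 1"] by auto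
  \<comment> \<open>The argument of the tail moves by at most 2: one unit for
    \<open>t \<le> x + 1\<close> and one for \<open>3 * h \<le> 1\<close>.\<close>
  define K where "K = Cp * exp ((\<alpha> + 1) * 2)"
  define C where "C = (1 + 3 / h) * exp 1 * K"
  define X where "X = - max x0 3"
  have K: "0 < K" using Cp by (simp add: K_def)
  have C0: "0 \<le> C" using K h by (simp add: C_def)
  show ?thesis
  proof (rule that[OF C0])
    fix W :: real assume W: "0 \<le> W"
    let ?B = "\<lambda>x. W * exp x * smooth_tail h x"
    define d where "d x = (LINT z|reflected_tail. bspline h (z - x))" for x
    have dB: "(?B has_real_derivative W * exp x * smooth_tail h x + W * exp x * d x) (at x)" for x
    proof -
      have "(smooth_tail h has_real_derivative d x) (at x)"
        unfolding smooth_tail_def[abs_def] d_def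
        by (rule DERIV_conv_bspline_tail[OF h(1) finite_reflected_tail sets_reflected_tail])
      then show ?thesis by (auto intro!: derivative_eq_intros)
    qed
    have bound: "\<bar>W * exp t * smooth_tail h t + W * exp t * d t\<bar> \<le> C * ?B x"
      if x: "x \<le> X" "x \<le> t" "t \<le> x + 1" for x t
    proof -
      have t: "t \<le> - 2" using x by (simp add: X_def max_def split: if_splits)
      have st: "smooth_tail h t \<le> L (- t - 3 * h)" "0 \<le> smooth_tail h t"
        using smooth_tail_bounds[OF h t] tail_nonneg[of "- t"] by auto
      have "d t \<le> 3 / h * L (- t - 3 * h)"
        using conv_bspline_le[OF h(1) finite_reflected_tail sets_reflected_tail, of t] h t
        by (simp add: d_def cdf_reflected_tail max_def)
      then have Wd: "W * exp t * d t \<le> W * exp t * (3 / h * L (- t - 3 * h))"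
        using W by (intro mult_left_mono) auto
      have "0 \<le> d t"
        unfolding d_def by (intro integral_nonneg_AE AE_I2 bspline_nonneg h)
      have "\<bar>W * exp t * smooth_tail h t + W * exp t * d t\<bar> \<le> W * exp t * L (- t - 3 * h) + W * exp t * (3 / h * L (- t - 3 * h))"
      proof -
        have "W * exp t * smooth_tail h t \<le> W * exp t * L (- t - 3 * h)"
          using W st by (intro mult_left_mono) auto
        moreover have "0 \<le> W * exp t * smooth_tail h t" "0 \<le> W * exp t * d t"
          using W st \<open>0 \<le> d t\<close> by auto
        ultimately show ?thesis
          using Wd by linarith
      qed
      also have "\<dots> = (1 + 3 / h) * (W * exp t * L (- t - 3 * h))" by (simp add: algebra_simps)
      also have "\<dots> \<le> (1 + 3 / h) * (W * (exp 1 * exp x) * (K * L (- x)))"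
      proof (intro mult_left_mono mult_mono)
        have "L (- t - 3 * h) \<le> L (- x - 2)"
          using x h by (intro tail_antimono) (auto simp: X_def max_def split: if_splits)
        also have "\<dots> \<le> K * L (- x)"
          using P[of "- x - 2" "- x"] x by (simp add: K_def X_def max_def split: if_splits)
        finally show "L (- t - 3 * h) \<le> K * L (- x)" .
        show "exp t \<le> exp 1 * exp x" using x by (simp add: exp_add[symmetric])
      qed (use W h tail_nonneg in auto)
      also have "\<dots> \<le> (1 + 3 / h) * (W * (exp 1 * exp x) * (K * smooth_tail h x))"
        using smooth_tail_bounds(1)[OF h, of x] x t W h K by (intro mult_left_mono) auto
      also have "\<dots> = C * ?B x" by (simp add: C_def mult_ac)
      finally show ?thesis .
    qed
    show "tame C X ?B"
      unfolding tame_def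
    proof (intro allI impI conjI)
      fix x assume x: "x \<le> X"
      have x2: "x \<le> - 2" using x by (simp add: X_def max_def split: if_splits)
      show "0 \<le> ?B x" using W smooth_tail_bounds(1)[OF h x2] tail_nonneg[of "- x"] by simp
      show "\<exists>D. (?B has_real_derivative D) (at x) \<and> \<bar>D\<bar> \<le> C * ?B x"
        using dB[of x] bound[OF x, of x] by (intro exI conjI) auto
      fix s :: real assume s: "0 \<le> s" "s \<le> 1"
      show "\<bar>?B (x + s) - ?B x\<bar> \<le> C * s * ?B x"
      proof (cases "s = 0")
        case False
        then obtain t where t: "x < t" "t < x + s"
          "?B (x + s) - ?B x = (x + s - x) * (W * exp t * smooth_tail h t + W * exp t * d t)"
          using MVT2[of x "x + s", OF _ dB] s by auto
        have "\<bar>?B (x + s) - ?B x\<bar> = s * \<bar>W * exp t * smooth_tail h t + W * exp t * d t\<bar>"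
          using t s by (simp add: abs_mult)
        also have "\<dots> \<le> s * (C * ?B x)" using t s by (intro mult_left_mono bound x) auto
        finally show ?thesis by (simp add: mult_ac)
      qed simp
    qed
  qed
qed

lemma tame_mono: "tame C X B \<Longrightarrow> C \<le> C' \<Longrightarrow> X' \<le> X \<Longrightarrow> tame C' X' B"
  unfolding tame_def
  by (meson order_trans mult_right_mono)

lemma tame_add:
  assumes A: "tame C X A" and B: "tame C X B" shows "tame C X (\<lambda>x. A x + B x)"
  unfolding tame_def
proof (intro allI impI conjI)
  fix x assume x: "x \<le> X"
  show "0 \<le> A x + B x" using A B x by (auto simp: tame_def)
  obtain D1 D2 where D: "(A has_real_derivative D1) (at x)" "\<bar>D1\<bar> \<le> C * A x"
    "(B has_real_derivative D2) (at x)" "\<bar>D2\<bar> \<le> C * B x"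
    using A B x unfolding tame_def by blast
  then show "\<exists>D. ((\<lambda>x. A x + B x) has_real_derivative D) (at x) \<and> \<bar>D\<bar> \<le> C * (A x + B x)"
    by (intro exI[of _ "D1 + D2"]) (auto intro!: derivative_intros simp: distrib_left)
  fix s :: real assume "0 \<le> s" "s \<le> 1"
  then have "\<bar>A (x + s) - A x\<bar> \<le> C * s * A x" "\<bar>B (x + s) - B x\<bar> \<le> C * s * B x"
    using A B x by (auto simp: tame_def)
  then show "\<bar>A (x + s) + B (x + s) - (A x + B x)\<bar> \<le> C * s * (A x + B x)"
    by (auto simp: distrib_left)
qed

end

section \<open>Sharp two-sided bounds for the smoothed density\<close>

lemma eventually_at_bot_uminus:
  "(\<forall>\<^sub>F w::real in at_top. P w) \<Longrightarrow> \<forall>\<^sub>F x in at_bot. P (- x)"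
  by (rule eventually_compose_filterlim[OF _ filterlim_uminus_at_top_at_bot])

lemma eventually_exp_less: "0 < c \<Longrightarrow> \<forall>\<^sub>F x::real in at_bot. exp x < c"
  using order_tendstoD(2)[OF exp_at_bot] by blast

lemma eventually_exp_uminus_greater: "\<forall>\<^sub>F x::real in at_bot. c < exp (- x - d)"
proof -
  have "\<forall>\<^sub>F x::real in at_bot. exp x < exp (- d) / (\<bar>c\<bar> + 1)"
    by (rule eventually_exp_less) simp
  then show ?thesis
  proof eventually_elim
    case (elim x)
    have "\<bar>c\<bar> + 1 < exp (- d) / exp x" using elim by (simp add: field_simps)
    also have "\<dots> = exp (- x - d)" by (simp add: exp_diff exp_minus field_simps)
    finally show ?case by simp
  qed
qed

context tail_log_functional_law
begin

text \<open>A width costs twice: the factor \<open>exp (- 3 * h)\<close> lost on the left side of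
  the equation, and the shift of the tail by \<open>3 * h\<close>, worth about
  \<open>exp (\<alpha> * 3 * h)\<close>. Dividing \<open>ln (1 + \<eta>)\<close> by
  \<open>\<alpha> + 2\<close>, which exceeds both 1 and \<alpha>, keeps each below
  \<open>1 + \<eta>\<close>.\<close>

lemma smoothing_scale:
  assumes \<eta>: "0 < \<eta>"
  obtains h where "0 < h" "3 * h \<le> 1" "exp (- (3 * h)) > 1 / (1 + \<eta>)"
    "\<forall>\<^sub>F x in at_bot. L (- x - 3 * h) \<le> (1 + \<eta>) * L (- x)"
proof -
  define t where "t = min 1 (ln (1 + \<eta>) / (\<alpha> + 2))"
  have l: "0 < ln (1 + \<eta>)" using \<eta> by simp
  have t: "0 < t" "t \<le> 1" using l alpha_pos by (auto simp: t_def)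
  have tl: "t * (\<alpha> + 2) \<le> ln (1 + \<eta>)"
  proof -
    have "t \<le> ln (1 + \<eta>) / (\<alpha> + 2)" by (simp add: t_def)
    then show ?thesis using alpha_pos by (simp add: pos_le_divide_eq)
  qed
  then have 1: "t < ln (1 + \<eta>)" "\<alpha> * t < ln (1 + \<eta>)"
  proof -
    have "0 < \<alpha> * t" using t alpha_pos by simp
    moreover have "t * (\<alpha> + 2) = \<alpha> * t + 2 * t" by (simp add: algebra_simps)
    ultimately show "t < ln (1 + \<eta>)" "\<alpha> * t < ln (1 + \<eta>)" using t tl by linarith+
  qed
  have "exp t < exp (ln (1 + \<eta>))" using 1 by (subst exp_less_cancel_iff)
  then have "exp t < 1 + \<eta>" using \<eta> by simp
  then have 2: "1 / (1 + \<eta>) < exp (- t)" using \<eta> by (simp add: exp_minus field_simps)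
  have "exp (\<alpha> * t) < exp (ln (1 + \<eta>))" using 1 by (subst exp_less_cancel_iff)
  then have 3: "exp (- \<alpha> * (- t)) < 1 + \<eta>" using \<eta> by simp
  have "\<forall>\<^sub>F w in at_top. L (w + - t) / L w < 1 + \<eta>"
    using order_tendstoD(2)[OF tail_ratio 3] .
  then have "\<forall>\<^sub>F w in at_top. L (w - t) \<le> (1 + \<eta>) * L w"
    using eventually_gt_at_top[of 0]
  proof eventually_elim
    case (elim w)
    then show ?case using tail_pos[of w] by (simp add: field_simps)
  qed
  from eventually_at_bot_uminus[OF this]
  show ?thesis using t 2 by (intro that[of "t / 3"]) auto
qed

text \<open>The barrier is a multiple of \<open>exp x\<close> times the tail smoothed at the fixed
  width \<open>h0\<close>, plus an exponential that takes care of the boundary. As \<open>h0\<close>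
  does not move, all constants are uniform in \<open>h \<le> h0\<close>. The three factors
  \<open>1 + \<eta>\<close> pay for the shift of the tail, for \<open>exp (- 3 * h)\<close> together
  with the perturbation, and for returning from the smoothed tail to \<open>L\<close>.\<close>

lemma smooth_density_upper_bound:
  assumes \<eta>: "0 < \<eta>"
  shows "\<exists>X h\<^sub>0. 0 < h\<^sub>0 \<and> 3 * h\<^sub>0 \<le> 1 \<and> (\<forall>h x. 0 < h \<longrightarrow> h \<le> h\<^sub>0 \<longrightarrow> x \<le> X \<longrightarrow>
    smooth_density h x \<le> ((neg_moment + \<eta>) * (1 + \<eta>) ^ 3 + \<eta>) * (exp x * L (- x)))"
proof -
  obtain h0 where h0: "0 < h0" "3 * h0 \<le> 1" "exp (- (3 * h0)) > 1 / (1 + \<eta>)"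
    and Lh: "\<forall>\<^sub>F x in at_bot. L (- x - 3 * h0) \<le> (1 + \<eta>) * L (- x)"
    using smoothing_scale[OF \<eta>] by blast
  obtain C1 X1 where C1: "0 \<le> C1" "\<And>W. 0 \<le> W \<Longrightarrow> tame C1 X1 (\<lambda>x. W * exp x * smooth_tail h0 x)"
    using tame_smooth_tail[OF h0(1,2)] by blast
  \<comment> \<open>\<open>exp (\<gamma> * x)\<close> is \<open>exp x\<close> times
    \<open>exp ((\<alpha> + 1) * x)\<close>, and the latter is negligible against
    \<open>L (- x)\<close>; the boundary term thus leaves the leading constant intact.\<close>
  define \<gamma> where "\<gamma> = \<alpha> + 2"
  define C where "C = max C1 (\<gamma> * exp \<gamma>)"
  define P where "P = perturbation C"
  have \<gamma>: "0 < \<gamma>" using alpha_pos by (simp add: \<gamma>_def)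
  have C0: "0 \<le> C" using C1 by (simp add: C_def)
  have P0: "0 \<le> P" using C0 small_variance_nonneg by (simp add: P_def perturbation_def)
  define c where "c = neg_moment"
  have c0: "0 \<le> c" by (simp add: c_def neg_moment_nonneg)
  define W where "W = (c + \<eta>) * (1 + \<eta>)\<^sup>2"
  have W0: "0 \<le> W" using \<eta> c0 by (simp add: W_def)
  \<comment> \<open>The strict inequality in the choice of \<open>h0\<close> leaves this room for
    the perturbation, which relative to \<open>exp (- x)\<close> has size
    \<open>P * exp x\<close>.\<close>
  define gap where "gap = exp (- (3 * h0)) - 1 / (1 + \<eta>)"
  have gap: "0 < gap" using h0 by (simp add: gap_def)
  have "\<forall>\<^sub>F w in at_top. big_jump_cdf (- w) / L w < c + \<eta>"
    using order_tendstoD(2)[OF big_jump_cdf_asymp, of "c + \<eta>"] \<eta> by (simp add: c_def)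
  then have "\<forall>\<^sub>F w in at_top. big_jump_cdf (- w) \<le> (c + \<eta>) * L w"
    using eventually_gt_at_top[of 0]
  proof eventually_elim
    case (elim w)
    then show ?case using tail_pos[of w] by (simp add: field_simps)
  qed
  from eventually_at_bot_uminus[OF this]
  have Tev: "\<forall>\<^sub>F x in at_bot. big_jump_cdf x \<le> (c + \<eta>) * L (- x)" by simp
  have "\<forall>\<^sub>F x in at_bot. L (- x - 3 * h0) \<le> (1 + \<eta>) * L (- x) \<and> big_jump_cdf x \<le> (c + \<eta>) * L (- x) \<and>
      P < exp (- x - 1) \<and> \<bar>a\<bar> + 1 < exp (- x - 3) \<and> exp x < gap / (P + 1) \<and> x < min X1 (- 3)"
    by (intro eventually_conj Lh Tev eventually_exp_uminus_greater eventually_exp_less eventually_gt_at_bot)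
      (use gap P0 in auto)
  then obtain X' where X': "\<And>x. x \<le> X' \<Longrightarrow> L (- x - 3 * h0) \<le> (1 + \<eta>) * L (- x) \<and> big_jump_cdf x \<le> (c + \<eta>) * L (- x) \<and>
      P < exp (- x - 1) \<and> \<bar>a\<bar> + 1 < exp (- x - 3) \<and> exp x < gap / (P + 1) \<and> x < min X1 (- 3)"
    by (auto simp: eventually_at_bot_linorder)
  \<comment> \<open>One unit is kept in reserve, as the estimates are also used at
    \<open>x + 3 * h\<close> and on \<open>{X..X + 1}\<close>.\<close>
  define X where "X = X' - 1"
  define K where "K = max 1 big_mass"
  have K0: "0 \<le> K" by (simp add: K_def)
  define B where "B x = W * exp x * smooth_tail h0 x + K * exp (- \<gamma> * X) * exp (\<gamma> * x)" for x
  have bound: "smooth_density h x \<le> B x" if h: "0 < h" "h \<le> h0" and x: "x \<le> X" for h x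
  proof (rule smooth_density_le_barrier[OF h(1) _ _ _ _ x])
    have X1: "X \<le> X1" using X'[of X] by (simp add: X_def)
    show "tame C X B"
      unfolding B_def[abs_def]
      by (intro tame_add tame_mono[OF C1(2)[OF W0] _ X1] tame_mono[OF tame_exp _ order_refl])
        (use K0 \<gamma> in \<open>auto simp: C_def\<close>)
    show "smooth_density h x \<le> B x" if "X \<le> x" "x \<le> X + 1" for x
    proof -
      have "\<bar>a\<bar> + 1 < exp (- X - 3)" using X'[of X] by (simp add: X_def)
      moreover have "- (X + 2) - 1 = - X - 3" by simp
      ultimately have "\<bar>a\<bar> + 1 \<le> exp (- (X + 2) - 1)" by (simp only:)
      then have "smooth_density h x \<le> K"
        unfolding K_def using that h h0 by (intro smooth_density_crude_bound[of h "X + 2"]) auto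
      also have "\<dots> \<le> K * exp (\<gamma> * (x - X))"
        using K0 \<gamma> that by (simp add: mult_le_cancel_left1)
      also have "\<dots> = K * exp (- \<gamma> * X) * exp (\<gamma> * x)"
        by (simp add: exp_add[symmetric] algebra_simps)
      also have "\<dots> \<le> B x"
      proof -
        have "x \<le> - 2" using X'[of x] that by (simp add: X_def)
        then have "0 \<le> smooth_tail h0 x"
          using smooth_tail_bounds(1)[OF h0(1,2), of x] tail_nonneg[of "- x"] by simp
        then show ?thesis using W0 by (simp add: B_def)
      qed
      finally show ?thesis .
    qed
    show "\<bar>a\<bar> < exp (- x - 3 * h)" if "x \<le> X" for x
    proof -
      have "\<bar>a\<bar> < exp (- x - 3)" using X'[of x] that by (simp add: X_def)
      also have "\<dots> \<le> exp (- x - 3 * h)" using h h0 by simp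
      finally show ?thesis .
    qed
    show "big_jump h x \<le> (exp (- x - 3 * h) - perturbation C) * B x" if x: "x \<le> X" for x
    proof -
      note X'x = X'[of x, unfolded min_less_iff_conj]
      have x2: "x \<le> X'" "x \<le> - 2" using x X'x by (auto simp: X_def)
      have L0: "0 \<le> L (- x)" by (rule tail_nonneg)
      have PP: "P < exp (- x - 3 * h)"
      proof -
        have "P < exp (- x - 1)" using X'x x2 by simp
        also have "\<dots> \<le> exp (- x - 3 * h)" using h h0 by simp
        finally show ?thesis .
      qed
      have "big_jump h x \<le> big_jump_cdf (x + 3 * h)" by (rule big_jump_cdf_bounds(1)[OF h(1)])
      also have "\<dots> \<le> (c + \<eta>) * L (- (x + 3 * h))" using X'[of "x + 3 * h"] x h h0 by (simp add: X_def)
      also have "\<dots> \<le> (c + \<eta>) * L (- x - 3 * h0)"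
        using c0 \<eta> h h0 X'x x2 by (intro mult_left_mono tail_antimono) auto
      also have "\<dots> \<le> (c + \<eta>) * ((1 + \<eta>) * L (- x))"
        using X'x x2 c0 \<eta> by (intro mult_left_mono) auto
      also have "\<dots> = W * (1 / (1 + \<eta>)) * L (- x)"
        using \<eta> by (simp add: W_def power2_eq_square field_simps)
      also have "\<dots> \<le> W * (exp (- 3 * h) - P * exp x) * L (- x)"
      proof -
        have "P * exp x \<le> (P + 1) * exp x" by (simp add: algebra_simps)
        also have "\<dots> \<le> gap" using X'x x2 P0 by (simp add: field_simps)
        also have "gap \<le> exp (- 3 * h) - 1 / (1 + \<eta>)" using h by (simp add: gap_def)
        finally have "1 / (1 + \<eta>) \<le> exp (- 3 * h) - P * exp x" by simp
        then show ?thesis using W0 L0 by (intro mult_right_mono mult_left_mono)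
      qed
      also have "\<dots> = (exp (- x - 3 * h) - P) * (W * exp x * L (- x))"
        by (simp add: algebra_simps exp_add[symmetric])
      also have "\<dots> \<le> (exp (- x - 3 * h) - P) * B x"
      proof (intro mult_left_mono)
        have "W * exp x * L (- x) \<le> W * exp x * smooth_tail h0 x"
          using W0 smooth_tail_bounds(1)[OF h0(1,2) x2(2)] by (intro mult_left_mono) auto
        then show "W * exp x * L (- x) \<le> B x" using K0 by (simp add: B_def add_increasing2)
      qed (use PP in simp)
      finally show ?thesis by (simp add: P_def)
    qed
  qed
  have "((\<lambda>w. (K * exp (- \<gamma> * X)) * (exp (- (\<alpha> + 1) * w) / L w)) \<longlongrightarrow> (K * exp (- \<gamma> * X)) * 0) at_top"
    by (intro tendsto_intros exp_negligible) simp
  then have "\<forall>\<^sub>F w in at_top. (K * exp (- \<gamma> * X)) * (exp (- (\<alpha> + 1) * w) / L w) < \<eta>"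
    using order_tendstoD(2)[of _ 0 at_top \<eta>] \<eta> by simp
  then have "\<forall>\<^sub>F w in at_top. (K * exp (- \<gamma> * X)) * exp (- (\<alpha> + 1) * w) \<le> \<eta> * L w"
    using eventually_gt_at_top[of 0]
  proof eventually_elim
    case (elim w)
    then show ?case using tail_pos[of w] by (simp add: field_simps)
  qed
  from eventually_at_bot_uminus[OF this]
  have "\<forall>\<^sub>F x in at_bot. (K * exp (- \<gamma> * X)) * exp ((\<alpha> + 1) * x) \<le> \<eta> * L (- x)"
    by (simp only: minus_mult_minus)
  then obtain X2 where X2: "\<And>x. x \<le> X2 \<Longrightarrow> (K * exp (- \<gamma> * X)) * exp ((\<alpha> + 1) * x) \<le> \<eta> * L (- x)"
    by (auto simp: eventually_at_bot_linorder)
  show ?thesis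
  proof (rule exI[of _ "min X X2"], rule exI[of _ h0], intro conjI allI impI h0(1,2))
    fix h x :: real assume h: "0 < h" "h \<le> h0" and x: "x \<le> min X X2"
    have x2: "x \<le> X'" "x \<le> - 2" using x X'[of x] by (auto simp: X_def)
    have "smooth_density h x \<le> B x" using bound[OF h] x by simp
    also have "B x \<le> W * exp x * ((1 + \<eta>) * L (- x)) + exp x * (\<eta> * L (- x))"
      unfolding B_def
    proof (intro add_mono mult_left_mono)
      show "smooth_tail h0 x \<le> (1 + \<eta>) * L (- x)"
        using smooth_tail_bounds(2)[OF h0(1,2) x2(2)] X'[of x] x2 by simp
      have "K * exp (- \<gamma> * X) * exp (\<gamma> * x) = exp x * (K * exp (- \<gamma> * X) * exp ((\<alpha> + 1) * x))"
        by (simp add: \<gamma>_def exp_add[symmetric] algebra_simps)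
      also have "\<dots> \<le> exp x * (\<eta> * L (- x))" using X2[of x] x by (intro mult_left_mono) auto
      finally show "K * exp (- \<gamma> * X) * exp (\<gamma> * x) \<le> exp x * (\<eta> * L (- x))" .
    qed (use W0 in simp)
    also have "\<dots> = ((neg_moment + \<eta>) * (1 + \<eta>) ^ 3 + \<eta>) * (exp x * L (- x))"
      by (simp add: W_def c_def power2_eq_square power3_eq_cube algebra_simps)
    finally show "smooth_density h x \<le> ((neg_moment + \<eta>) * (1 + \<eta>) ^ 3 + \<eta>) * (exp x * L (- x))" .
  qed
qed

text \<open>Here \<open>h\<close> need not be small beyond \<open>3 * h \<le> 1\<close>: the upper
  bound of the tilted density carries \<open>exp (- x)\<close> without loss. The condition on \<eta>
  keeps the main term \<open>A\<close> nonnegative, as tameness demands.\<close>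

lemma smooth_density_lower_bound:
  assumes \<eta>: "0 < \<eta>" "2 * \<eta> < neg_moment"
  shows "\<exists>X. \<forall>h x. 0 < h \<longrightarrow> 3 * h \<le> 1 \<longrightarrow> x \<le> X \<longrightarrow>
    ((neg_moment - 2 * \<eta>) / (1 + \<eta>)\<^sup>2 - \<eta>) * (exp x * L (- x)) \<le> smooth_density h x"
proof -
  obtain h0 where h0: "0 < h0" "3 * h0 \<le> 1" "exp (- (3 * h0)) > 1 / (1 + \<eta>)"
    and Lh: "\<forall>\<^sub>F x in at_bot. L (- x - 3 * h0) \<le> (1 + \<eta>) * L (- x)"
    using smoothing_scale[OF \<eta>(1)] by blast
  obtain C1 X1 where C1: "0 \<le> C1" "\<And>W. 0 \<le> W \<Longrightarrow> tame C1 X1 (\<lambda>x. W * exp x * smooth_tail h0 x)"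
    using tame_smooth_tail[OF h0(1,2)] by blast
  define \<gamma> where "\<gamma> = \<alpha> + 2"
  define C where "C = max C1 (\<gamma> * exp \<gamma>)"
  define P where "P = perturbation C"
  have \<gamma>: "0 < \<gamma>" using alpha_pos by (simp add: \<gamma>_def)
  have C0: "0 \<le> C" using C1 by (simp add: C_def)
  have P0: "0 \<le> P" using C0 small_variance_nonneg by (simp add: P_def perturbation_def)
  define c where "c = neg_moment"
  \<comment> \<open>One \<eta> is spent on the limit of the big jumps and one on their loss part.
    The two factors \<open>1 + \<eta>\<close> pay for the perturbation and for replacing
    \<open>L\<close> by its smoothed version.\<close>
  define W where "W = (c - 2 * \<eta>) / (1 + \<eta>)\<^sup>2"
  have W0: "0 \<le> W" using \<eta> by (simp add: W_def c_def)
  have "\<forall>\<^sub>F w in at_top. c - \<eta> < big_jump_cdf (- w) / L w"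
    using order_tendstoD(1)[OF big_jump_cdf_asymp, of "c - \<eta>"] \<eta> by (simp add: c_def)
  moreover have "((\<lambda>w. big_mass * (cdf \<mu> (1 - w) / L w)) \<longlongrightarrow> big_mass * 0) at_top"
    by (intro tendsto_intros cdf_negligible)
  then have "\<forall>\<^sub>F w in at_top. big_mass * (cdf \<mu> (1 - w) / L w) < \<eta>"
    using order_tendstoD(2)[of _ 0 at_top \<eta>] \<eta> by simp
  ultimately have "\<forall>\<^sub>F w in at_top. (c - 2 * \<eta>) * L w \<le> big_jump_cdf (- w) - big_mass * cdf \<mu> (1 - w)"
    using eventually_gt_at_top[of 0]
  proof eventually_elim
    case (elim w)
    then show ?case using tail_pos[of w] by (simp add: field_simps)
  qed
  from eventually_at_bot_uminus[OF this]
  have Tev: "\<forall>\<^sub>F x in at_bot. (c - 2 * \<eta>) * L (- x) \<le> big_jump_cdf x - big_mass * cdf \<mu> (1 + x)" by simp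
  have "\<forall>\<^sub>F x in at_bot. L (- x - 3 * h0) \<le> (1 + \<eta>) * L (- x) \<and>
      (c - 2 * \<eta>) * L (- x) \<le> big_jump_cdf x - big_mass * cdf \<mu> (1 + x) \<and>
      P < exp (- x - 0) \<and> \<bar>a\<bar> < exp (- x - 0) \<and> exp x < \<eta> / (P + 1) \<and> x < min X1 (- 4)"
    by (intro eventually_conj Lh Tev eventually_exp_uminus_greater eventually_exp_less eventually_gt_at_bot)
      (use \<eta> P0 in auto)
  then obtain X where X: "\<And>x. x \<le> X \<Longrightarrow> L (- x - 3 * h0) \<le> (1 + \<eta>) * L (- x) \<and>
      (c - 2 * \<eta>) * L (- x) \<le> big_jump_cdf x - big_mass * cdf \<mu> (1 + x) \<and>
      P < exp (- x) \<and> \<bar>a\<bar> < exp (- x) \<and> exp x < \<eta> / (P + 1) \<and> x < min X1 (- 4)"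
    by (auto simp: eventually_at_bot_linorder)
  \<comment> \<open>An upper bound for \<open>A\<close> on \<open>{X..X + 1}\<close>, where the
    argument of the tail is at least \<open>- X - 2\<close>. With it \<open>B\<close> equals
    \<open>K\<close> at \<open>X\<close> and grows from there.\<close>
  define K where "K = W * exp (X + 1) * L (- X - 2)"
  have K0: "0 \<le> K" using W0 tail_nonneg by (simp add: K_def)
  define A where "A x = W * exp x * smooth_tail h0 x" for x
  define B where "B x = K * exp (- \<gamma> * X) * exp (\<gamma> * x)" for x
  have X4: "X \<le> X1" "X < - 4" using X[of X] by auto
  have bound: "A x - B x \<le> smooth_density h x" if h: "0 < h" "3 * h \<le> 1" and x: "x \<le> X" for h x
  proof (rule smooth_density_ge_barrier[OF h(1) _ _ _ _ _ C0 _ x])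
    show "tame C X A"
      unfolding A_def[abs_def] by (rule tame_mono[OF C1(2)[OF W0] _ X4(1)]) (simp add: C_def)
    show "tame C X B"
      unfolding B_def[abs_def] by (rule tame_mono[OF tame_exp _ order_refl]) (use K0 \<gamma> in \<open>auto simp: C_def\<close>)
    show "A x \<le> B x" if x: "X \<le> x" "x \<le> X + 1" for x
    proof -
      have "smooth_tail h0 x \<le> L (- x - 3 * h0)" using smooth_tail_bounds(2)[OF h0(1,2), of x] x X4 by simp
      also have "\<dots> \<le> L (- X - 2)" using x X4 h0 by (intro tail_antimono) auto
      finally have "A x \<le> W * exp (X + 1) * L (- X - 2)"
        unfolding A_def using W0 x tail_nonneg smooth_tail_bounds(1)[OF h0(1,2), of x] X4
        by (intro mult_mono) (auto intro: order_trans[OF tail_nonneg])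
      also have "\<dots> = K" by (simp add: K_def)
      also have "\<dots> \<le> K * exp (\<gamma> * (x - X))"
        using K0 \<gamma> x by (simp add: mult_le_cancel_left1)
      also have "\<dots> = B x"
        by (simp add: B_def exp_add[symmetric] algebra_simps)
      finally show ?thesis .
    qed
    show "\<bar>a\<bar> < exp (- x)" if "x \<le> X" for x using X[OF that] by simp
    show "perturbation C \<le> exp (- x)" if "x \<le> X" for x using X[OF that] by (simp add: P_def)
    show "(exp (- x) + perturbation C) * A x \<le> big_jump h x" if x: "x \<le> X" for x
    proof -
      note Xx = X[OF x]
      have x2: "x \<le> - 2" using x X4 by simp
      have L0: "0 \<le> L (- x)" by (rule tail_nonneg)
      have Px: "P * exp x \<le> \<eta>"
      proof -
        have "P * exp x \<le> (P + 1) * exp x" by (simp add: algebra_simps)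
        also have "\<dots> \<le> \<eta>" using Xx P0 by (simp add: field_simps)
        finally show ?thesis .
      qed
      have st: "smooth_tail h0 x \<le> (1 + \<eta>) * L (- x)"
        using smooth_tail_bounds(2)[OF h0(1,2) x2] Xx by simp
      have "(exp (- x) + P) * A x = (1 + P * exp x) * (W * smooth_tail h0 x)"
        by (simp add: A_def algebra_simps exp_add[symmetric])
      also have "\<dots> \<le> (1 + \<eta>) * (W * ((1 + \<eta>) * L (- x)))"
        using Px st W0 \<eta> P0 smooth_tail_bounds(1)[OF h0(1,2) x2] L0
        by (intro mult_mono mult_left_mono mult_nonneg_nonneg add_mono) auto
      also have "\<dots> = (c - 2 * \<eta>) * L (- x)"
      proof -
        have "(1 + \<eta>)\<^sup>2 \<noteq> 0" using \<eta> by simp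
        then have "(1 + \<eta>)\<^sup>2 * W = c - 2 * \<eta>" by (simp add: W_def)
        then have "(1 + \<eta>)\<^sup>2 * W * L (- x) = (c - 2 * \<eta>) * L (- x)" by simp
        then show ?thesis by (simp only: power2_eq_square mult_ac)
      qed
      also have "\<dots> \<le> big_jump_cdf x - big_mass * cdf \<mu> (1 + x)" using Xx by simp
      also have "\<dots> \<le> big_jump_cdf x - big_mass * cdf \<mu> (x + 3 * h)"
        using h big_mass_nonneg by (intro diff_left_mono mult_left_mono fb.cdf_nondecreasing) auto
      also have "\<dots> \<le> big_jump h x" by (rule big_jump_cdf_bounds(2)[OF h(1)])
      finally show ?thesis by (simp add: P_def)
    qed
  qed
  have "((\<lambda>w. (K * exp (- \<gamma> * X)) * (exp (- (\<alpha> + 1) * w) / L w)) \<longlongrightarrow> (K * exp (- \<gamma> * X)) * 0) at_top"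
    by (intro tendsto_intros exp_negligible) simp
  then have "\<forall>\<^sub>F w in at_top. (K * exp (- \<gamma> * X)) * (exp (- (\<alpha> + 1) * w) / L w) < \<eta>"
    using order_tendstoD(2)[of _ 0 at_top \<eta>] \<eta> by simp
  then have "\<forall>\<^sub>F w in at_top. (K * exp (- \<gamma> * X)) * exp (- (\<alpha> + 1) * w) \<le> \<eta> * L w"
    using eventually_gt_at_top[of 0]
  proof eventually_elim
    case (elim w)
    then show ?case using tail_pos[of w] by (simp add: field_simps)
  qed
  from eventually_at_bot_uminus[OF this]
  have "\<forall>\<^sub>F x in at_bot. (K * exp (- \<gamma> * X)) * exp ((\<alpha> + 1) * x) \<le> \<eta> * L (- x)"
    by (simp only: minus_mult_minus)
  then obtain X2 where X2: "\<And>x. x \<le> X2 \<Longrightarrow> (K * exp (- \<gamma> * X)) * exp ((\<alpha> + 1) * x) \<le> \<eta> * L (- x)"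
    by (auto simp: eventually_at_bot_linorder)
  show ?thesis
  proof (intro exI[of _ "min X X2"] allI impI)
    fix h x :: real assume h: "0 < h" "3 * h \<le> 1" and x: "x \<le> min X X2"
    have x2: "x \<le> - 2" using x X4 by simp
    have "((neg_moment - 2 * \<eta>) / (1 + \<eta>)\<^sup>2 - \<eta>) * (exp x * L (- x)) = W * exp x * L (- x) - exp x * (\<eta> * L (- x))"
      by (simp add: W_def c_def algebra_simps)
    also have "\<dots> \<le> A x - B x"
    proof (intro diff_mono)
      show "W * exp x * L (- x) \<le> A x"
        unfolding A_def using W0 smooth_tail_bounds(1)[OF h0(1,2) x2] by (intro mult_left_mono) auto
      have "B x = exp x * (K * exp (- \<gamma> * X) * exp ((\<alpha> + 1) * x))"
        by (simp add: B_def \<gamma>_def exp_add[symmetric] algebra_simps)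
      also have "\<dots> \<le> exp x * (\<eta> * L (- x))" using X2[of x] x by (intro mult_left_mono) auto
      finally show "B x \<le> exp x * (\<eta> * L (- x))" .
    qed
    also have "\<dots> \<le> smooth_density h x" using bound[OF h] x by simp
    finally show "((neg_moment - 2 * \<eta>) / (1 + \<eta>)\<^sup>2 - \<eta>) * (exp x * L (- x)) \<le> smooth_density h x" .
  qed
qed

theorem smooth_density_asymp:
  assumes e: "0 < e"
  obtains X h\<^sub>0 where "0 < h\<^sub>0"
    "\<And>h x. 0 < h \<Longrightarrow> h \<le> h\<^sub>0 \<Longrightarrow> x \<le> X \<Longrightarrow> smooth_density h x \<le> (neg_moment + e) * (exp x * L (- x))"
    "\<And>h x. 0 < h \<Longrightarrow> h \<le> h\<^sub>0 \<Longrightarrow> x \<le> X \<Longrightarrow> (neg_moment - e) * (exp x * L (- x)) \<le> smooth_density h x"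
proof -
  have "((\<lambda>\<eta>. (neg_moment + \<eta>) * (1 + \<eta>) ^ 3 + \<eta>) \<longlongrightarrow> (neg_moment + 0) * (1 + 0) ^ 3 + 0) (at_right 0)"
    by (intro tendsto_intros)
  then have 1: "\<forall>\<^sub>F \<eta> in at_right 0. (neg_moment + \<eta>) * (1 + \<eta>) ^ 3 + \<eta> < neg_moment + e"
    using e by (intro order_tendstoD(2)) auto
  have "((\<lambda>\<eta>. (neg_moment - 2 * \<eta>) / (1 + \<eta>)\<^sup>2 - \<eta>) \<longlongrightarrow> (neg_moment - 2 * 0) / (1 + 0)\<^sup>2 - 0) (at_right 0)"
    by (intro tendsto_intros) auto
  then have 2: "\<forall>\<^sub>F \<eta> in at_right 0. neg_moment - e < (neg_moment - 2 * \<eta>) / (1 + \<eta>)\<^sup>2 - \<eta>"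
    using e by (intro order_tendstoD(1)) auto
  have 3: "\<forall>\<^sub>F \<eta> in at_right 0. 0 < \<eta> \<and> (0 < neg_moment \<longrightarrow> 2 * \<eta> < neg_moment)"
  proof (cases "0 < neg_moment")
    case True
    then show ?thesis
      using eventually_at_right_less[of 0] eventually_at_rightI[of 0 "neg_moment / 2" "\<lambda>\<eta>. 2 * \<eta> < neg_moment"]
      by (auto elim: eventually_elim2)
  qed (use eventually_at_right_less[of 0] in auto)
  from eventually_conj[OF 1 eventually_conj[OF 2 3]]
  obtain \<eta> where \<eta>: "(neg_moment + \<eta>) * (1 + \<eta>) ^ 3 + \<eta> < neg_moment + e"
    "neg_moment - e < (neg_moment - 2 * \<eta>) / (1 + \<eta>)\<^sup>2 - \<eta>" "0 < \<eta>" "0 < neg_moment \<longrightarrow> 2 * \<eta> < neg_moment"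
    using eventually_happens'[OF trivial_limit_at_right_real] by blast
  have g: "0 \<le> exp x * L (- x)" for x using tail_nonneg by simp
  obtain X1 h0 where h0: "0 < h0" "3 * h0 \<le> 1" and up: "\<And>h x. 0 < h \<Longrightarrow> h \<le> h0 \<Longrightarrow> x \<le> X1 \<Longrightarrow>
    smooth_density h x \<le> ((neg_moment + \<eta>) * (1 + \<eta>) ^ 3 + \<eta>) * (exp x * L (- x))"
    using smooth_density_upper_bound[OF \<eta>(3)] by blast
  obtain X2 where lo: "\<And>h x. 0 < h \<Longrightarrow> 3 * h \<le> 1 \<Longrightarrow> x \<le> X2 \<Longrightarrow> (neg_moment - e) * (exp x * L (- x)) \<le> smooth_density h x"
  proof (cases "0 < neg_moment")
    case True
    obtain X2 where "\<And>h x. 0 < h \<Longrightarrow> 3 * h \<le> 1 \<Longrightarrow> x \<le> X2 \<Longrightarrow>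
      ((neg_moment - 2 * \<eta>) / (1 + \<eta>)\<^sup>2 - \<eta>) * (exp x * L (- x)) \<le> smooth_density h x"
      using smooth_density_lower_bound[of \<eta>] \<eta> True by blast
    then show ?thesis
      using \<eta>(2) g by (intro that[of X2]) (meson less_imp_le mult_right_mono order_trans)
  next
    \<comment> \<open>With a vanishing moment the constant on the left is negative, and
      nonnegativity of the density is enough.\<close>
    case False
    have "(neg_moment - e) * (exp x * L (- x)) \<le> smooth_density h x" if "0 < h" for h x
    proof -
      have "(neg_moment - e) * (exp x * L (- x)) \<le> 0" using False e g by (intro mult_nonpos_nonneg) auto
      then show ?thesis using smooth_density_nonneg[OF that, of x] by simp
    qed
    then show ?thesis by (intro that[of 0])
  qed
  show ?thesis
  proof (rule that[of h0 "min X1 X2"])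
    show "smooth_density h x \<le> (neg_moment + e) * (exp x * L (- x))" if "0 < h" "h \<le> h0" "x \<le> min X1 X2" for h x
      using up[of h x] that \<eta>(1) g[of x] by (meson less_imp_le min.boundedE mult_right_mono order_trans)
    show "(neg_moment - e) * (exp x * L (- x)) \<le> smooth_density h x" if "0 < h" "h \<le> h0" "x \<le> min X1 X2" for h x
      using lo[of h x] that h0 by simp
  qed (rule h0)
qed

end

section \<open>From the smoothed densities to the law\<close>

lemma nn_integral_bspline:
  assumes h: "0 < h" shows "(\<integral>\<^sup>+v. ennreal (bspline h v) \<partial>lborel) = 1"
proof -
  have "(\<integral>\<^sup>+v. ennreal (bspline h v) \<partial>lborel) = (\<integral>\<^sup>+v. ennreal (bspline h v) * indicator {0..3 * h} v \<partial>lborel)"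
    by (intro nn_integral_cong) (auto simp: indicator_def bspline_left[OF h] bspline_right[OF h] not_le)
  also have "\<dots> = ennreal (- bspline_tail h (3 * h) - - bspline_tail h 0)"
  proof (rule nn_integral_FTC_Icc)
    show "DERIV (\<lambda>v. - bspline_tail h v) x :> bspline h x" for x
      using DERIV_minus[OF DERIV_bspline_tail[OF h, of x]] by simp
  qed (use h borel_measurable_bspline[OF h] bspline_nonneg[OF h] in auto)
  finally show ?thesis using h by (simp add: bspline_left[OF h] bspline_right[OF h])
qed

lemma nn_integral_bspline_reflect:
  assumes h: "0 < h" shows "(\<integral>\<^sup>+x. ennreal (bspline h (z - x)) \<partial>lborel) = 1"
  using nn_integral_real_affine[of "\<lambda>v. ennreal (bspline h v)" "-1" z] nn_integral_bspline[OF h] borel_measurable_bspline[OF h]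
  by simp

lemma nn_integral_exp_Iio_finite: "(\<integral>\<^sup>+x. ennreal (exp x) * indicator {..<X} x \<partial>lborel) < \<infinity>"
proof -
  have "(\<integral>\<^sup>+x. ennreal (exp x) * indicator {..<X} x \<partial>lborel) \<le> (\<integral>\<^sup>+x. ennreal (exp x) * indicator {..X} x \<partial>lborel)"
    by (intro nn_integral_mono) (auto simp: indicator_def)
  also have "\<dots> = (\<integral>\<^sup>+x. ennreal (exp (- x)) * indicator {..X} (- x) \<partial>lborel)"
    by (subst nn_integral_real_affine[where c = "-1" and t = 0]) auto
  also have "\<dots> = (\<integral>\<^sup>+x. ennreal (exp (- x)) * indicator {- X..} x \<partial>lborel)"
    by (intro nn_integral_cong) (auto simp: indicator_def)
  also have "\<dots> = ennreal (0 - - exp (- (- X)))"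
  proof (rule nn_integral_FTC_atLeast)
    show "DERIV (\<lambda>x. - exp (- x)) x :> exp (- x)" for x :: real
      by (auto intro!: derivative_eq_intros)
    have "((\<lambda>x::real. - exp (- x)) \<longlongrightarrow> - 0) at_top"
      by (intro tendsto_intros filterlim_compose[OF exp_at_bot] filterlim_uminus_at_bot_at_top)
    then show "((\<lambda>x::real. - exp (- x)) \<longlongrightarrow> 0) at_top" by simp
  qed auto
  also have "\<dots> < \<infinity>" by simp
  finally show ?thesis .
qed

context log_functional_law
begin

lemma nn_integral_smooth_density:
  assumes h: "0 < h" and [measurable]: "U \<in> sets borel"
  shows "(\<integral>\<^sup>+x. indicator U x * ennreal (smooth_density h x) \<partial>lborel) =
    (\<integral>\<^sup>+z. (\<integral>\<^sup>+x. indicator U x * ennreal (bspline h (z - x)) \<partial>lborel) \<partial>\<mu>)"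
proof -
  note [measurable] = borel_measurable_bspline[OF h]
  have psf: "pair_sigma_finite lborel \<mu>"
    by (intro pair_sigma_finite.intro mu.sigma_finite_measure_axioms sigma_finite_lborel)
  have "ennreal (smooth_density h x) = (\<integral>\<^sup>+z. ennreal (bspline h (z - x)) \<partial>\<mu>)" for x
    unfolding smooth_density_def
    by (rule nn_integral_eq_integral[symmetric, OF integrable_bspline_point(1)[OF h]]) (simp add: bspline_nonneg[OF h])
  then have "(\<integral>\<^sup>+x. indicator U x * ennreal (smooth_density h x) \<partial>lborel) =
     (\<integral>\<^sup>+x. (\<integral>\<^sup>+z. indicator U x * ennreal (bspline h (z - x)) \<partial>\<mu>) \<partial>lborel)"
    by (simp add: nn_integral_cmult)
  also have "\<dots> = (\<integral>\<^sup>+z. (\<integral>\<^sup>+x. indicator U x * ennreal (bspline h (z - x)) \<partial>lborel) \<partial>\<mu>)"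
    by (rule pair_sigma_finite.Fubini'[OF psf, symmetric]) measurable
  finally show ?thesis .
qed

text \<open>The open-set half of the portmanteau theorem, from Fatou's lemma: for \<open>z\<close>
  in \<open>U\<close> the spline attached to \<open>z\<close> occupies
  \<open>{z - 3 * h<..<z}\<close>, which lies in \<open>U\<close> once \<open>h\<close> is small, so
  that its full mass is counted.\<close>

lemma emeasure_le_liminf_smooth_density:
  assumes U: "open U"
  shows "emeasure \<mu> U \<le> liminf (\<lambda>n. \<integral>\<^sup>+x. indicator U x * ennreal (smooth_density (inverse (real (Suc n))) x) \<partial>lborel)"
proof -
  have [measurable]: "U \<in> sets borel" using U by simp
  define h where "h n = inverse (real (Suc n))" for n
  have h: "0 < h n" for n by (simp add: h_def)
  note [measurable] = borel_measurable_bspline[OF h]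
  define \<psi> where "\<psi> n z = (\<integral>\<^sup>+x. indicator U x * ennreal (bspline (h n) (z - x)) \<partial>lborel)" for n z
  have \<psi>m: "\<psi> n \<in> borel_measurable \<mu>" for n
    unfolding \<psi>_def by measurable
  have "emeasure \<mu> U = (\<integral>\<^sup>+z. indicator U z \<partial>\<mu>)" by (simp add: sets_mu)
  also have "\<dots> \<le> (\<integral>\<^sup>+z. liminf (\<lambda>n. \<psi> n z) \<partial>\<mu>)"
  proof (rule nn_integral_mono)
    fix z
    show "indicator U z \<le> liminf (\<lambda>n. \<psi> n z)"
    proof (cases "z \<in> U")
      case True
      then obtain e where e: "0 < e" "ball z e \<subseteq> U" using U open_contains_ball by blast
      have "h \<longlonglongrightarrow> 0" unfolding h_def by (rule LIMSEQ_inverse_real_of_nat)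
      then have "\<forall>\<^sub>F n in sequentially. h n < e / 3" using e by (intro order_tendstoD) auto
      then have "\<forall>\<^sub>F n in sequentially. 1 \<le> \<psi> n z"
      proof eventually_elim
        case (elim n)
        have "1 = (\<integral>\<^sup>+x. ennreal (bspline (h n) (z - x)) \<partial>lborel)"
          by (simp add: nn_integral_bspline_reflect h)
        also have "\<dots> \<le> \<psi> n z"
          unfolding \<psi>_def
        proof (rule nn_integral_mono)
          fix x
          show "ennreal (bspline (h n) (z - x)) \<le> indicator U x * ennreal (bspline (h n) (z - x))"
          proof (cases "x \<in> U")
            case False
            then have "\<not> (dist z x < e)" using e by auto
            then have "z - x \<le> 0 \<or> 3 * h n \<le> z - x" using elim by (auto simp: dist_real_def)
            then show ?thesis using bspline_left[OF h, of "z - x"] bspline_right[OF h, of n "z - x"] by auto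
          qed simp
        qed
        finally show ?case .
      qed
      then show ?thesis using True by (auto intro: Liminf_bounded)
    qed simp
  qed
  also have "\<dots> \<le> liminf (\<lambda>n. \<integral>\<^sup>+z. \<psi> n z \<partial>\<mu>)"
    by (rule nn_integral_liminf[OF \<psi>m])
  also have "\<dots> = liminf (\<lambda>n. \<integral>\<^sup>+x. indicator U x * ennreal (smooth_density (h n) x) \<partial>lborel)"
    by (simp add: \<psi>_def nn_integral_smooth_density[OF h])
  finally show ?thesis by (simp add: h_def)
qed

end

context tail_log_functional_law
begin

text \<open>\<open>L\<close> is antitone only on positive arguments, since further left the mass may
  be infinite and \<open>measure\<close> then returns 0. Freezing the function at \<open>L 1\<close>
  makes it monotone on the whole line.\<close>

lemma borel_measurable_L_uminus:
  assumes X: "X \<le> - 1"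
  shows "(\<lambda>x. indicator {..<X} x * L (- x)) \<in> borel_measurable borel"
proof -
  define f where "f x = (if x < - 1 then L (- x) else L 1)" for x
  have "mono f"
    unfolding mono_def f_def using tail_antimono[of "- y" "- x" for x y] tail_antimono[of 1] by auto
  then have "f \<in> borel_measurable borel" by (rule borel_measurable_mono)
  then have "(\<lambda>x. indicator {..<X} x * f x) \<in> borel_measurable borel" by measurable
  also have "(\<lambda>x. indicator {..<X} x * f x) = (\<lambda>x. indicator {..<X} x * L (- x))"
    using X by (auto simp: f_def indicator_def fun_eq_iff)
  finally show ?thesis .
qed

text \<open>Under \<open>ln\<close> a density \<open>c * L (ln (1 / t))\<close> near
  \<open>t = 0\<close> becomes \<open>c * exp x * L (- x)\<close> near minus infinity. For negative
  \<open>c\<close> this is the zero measure, because \<open>ennreal\<close> truncates, so the lower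
  estimate makes sense for every \<open>e\<close>.\<close>

definition tail_measure :: "real \<Rightarrow> real \<Rightarrow> real measure" where
  "tail_measure c X = density lborel (\<lambda>x. ennreal (c * (exp x * (indicator {..<X} x * L (- x)))))"

lemma
  assumes X: "X \<le> - 1"
  shows sets_tail_measure: "sets (tail_measure c X) = sets borel"
    and emeasure_tail_measure: "A \<in> sets borel \<Longrightarrow> emeasure (tail_measure c X) A =
      (\<integral>\<^sup>+x. indicator A x * ennreal (c * (exp x * (indicator {..<X} x * L (- x)))) \<partial>lborel)"
    and finite_tail_measure: "emeasure (tail_measure c X) A \<noteq> \<infinity>"
proof -
  have [measurable]: "(\<lambda>x. indicator {..<X} x * L (- x)) \<in> borel_measurable borel"
    by (rule borel_measurable_L_uminus[OF X])
  show s: "sets (tail_measure c X) = sets borel" by (simp add: tail_measure_def)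
  show e: "emeasure (tail_measure c X) A =
      (\<integral>\<^sup>+x. indicator A x * ennreal (c * (exp x * (indicator {..<X} x * L (- x)))) \<partial>lborel)" if "A \<in> sets borel" for A
  proof -
    have "(\<lambda>x. ennreal (c * (exp x * (indicator {..<X} x * L (- x))))) \<in> borel_measurable lborel"
      by measurable
    from emeasure_density[OF this, of A] that show ?thesis
      by (simp add: tail_measure_def mult.commute[of "indicator A x" for x])
  qed
  have UNIV_borel: "UNIV \<in> sets (borel :: real measure)" by simp
  have "emeasure (tail_measure c X) A \<le> emeasure (tail_measure c X) UNIV"
    using emeasure_space[of "tail_measure c X" A] sets_eq_imp_space_eq[OF s] by simp
  also have "\<dots> \<le> (\<integral>\<^sup>+x. ennreal (\<bar>c\<bar> * L 1) * (ennreal (exp x) * indicator {..<X} x) \<partial>lborel)"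
    unfolding e[OF UNIV_borel]
  proof (rule nn_integral_mono)
    fix x
    have "c * (exp x * L (- x)) \<le> \<bar>c\<bar> * L 1 * exp x" if "x < X"
    proof -
      have "c * (exp x * L (- x)) \<le> \<bar>c\<bar> * (exp x * L (- x))"
        using tail_nonneg[of "- x"] by (intro mult_right_mono) auto
      also have "\<dots> \<le> \<bar>c\<bar> * (exp x * L 1)"
        using that X by (intro mult_left_mono tail_antimono) auto
      finally show ?thesis by (simp add: mult_ac)
    qed
    then show "indicator UNIV x * ennreal (c * (exp x * (indicator {..<X} x * L (- x)))) \<le>
        ennreal (\<bar>c\<bar> * L 1) * (ennreal (exp x) * indicator {..<X} x)"
      by (auto simp: indicator_def ennreal_mult'[symmetric] tail_nonneg intro!: ennreal_leI)
  qed
  also have "\<dots> = ennreal (\<bar>c\<bar> * L 1) * (\<integral>\<^sup>+x. ennreal (exp x) * indicator {..<X} x \<partial>lborel)"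
    by (rule nn_integral_cmult) measurable
  also have "\<dots> < \<infinity>" using nn_integral_exp_Iio_finite[of X] by (simp add: ennreal_mult_less_top)
  finally show "emeasure (tail_measure c X) A \<noteq> \<infinity>" by simp
qed

end

context tail_log_functional_law
begin

text \<open>Fatou's lemma gives one inequality, on open sets. It transfers the upper bound directly;
  the lower bound is obtained on compact sets by passing to the complement. Outer and inner
  regularity of the two comparison measures then reach all Borel sets.\<close>

theorem law_asymp:
  assumes e: "0 < e"
  obtains X where "X \<le> - 1"
    "\<And>A. A \<in> sets borel \<Longrightarrow> A \<subseteq> {..<X} \<Longrightarrow> emeasure \<mu> A \<le> emeasure (tail_measure (neg_moment + e) X) A"
    "\<And>A. A \<in> sets borel \<Longrightarrow> A \<subseteq> {..<X} \<Longrightarrow> emeasure (tail_measure (neg_moment - e) X) A \<le> emeasure \<mu> A"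
proof -
  obtain X0 h0 where h0: "0 < h0"
    and up: "\<And>h x. 0 < h \<Longrightarrow> h \<le> h0 \<Longrightarrow> x \<le> X0 \<Longrightarrow> smooth_density h x \<le> (neg_moment + e) * (exp x * L (- x))"
    and lo: "\<And>h x. 0 < h \<Longrightarrow> h \<le> h0 \<Longrightarrow> x \<le> X0 \<Longrightarrow> (neg_moment - e) * (exp x * L (- x)) \<le> smooth_density h x"
    by (rule smooth_density_asymp[OF e], rule that)
  define X where "X = min X0 (- 1)"
  have X: "X \<le> - 1" by (simp add: X_def)
  define h where "h n = inverse (real (Suc n))" for n
  have hpos: "0 < h n" for n by (simp add: h_def)
  have "h \<longlonglongrightarrow> 0" unfolding h_def by (rule LIMSEQ_inverse_real_of_nat)
  then have hev: "\<forall>\<^sub>F n in sequentially. h n \<le> h0"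
    using order_tendstoD(2)[of h 0 sequentially h0] h0 by (auto elim: eventually_mono)
  note fatou = emeasure_le_liminf_smooth_density[folded h_def]
  let ?U = "tail_measure (neg_moment + e) X" and ?D = "tail_measure (neg_moment - e) X"
  have sU: "sets ?U = sets borel" and sD: "sets ?D = sets borel" using sets_tail_measure[OF X] by auto
  have spaces: "space ?U = UNIV" "space ?D = UNIV" using sets_eq_imp_space_eq[OF sU] sets_eq_imp_space_eq[OF sD] by auto
  have upper_open: "emeasure \<mu> U \<le> emeasure ?U U" if U: "open U" "U \<subseteq> {..<X}" for U
  proof -
    have "emeasure \<mu> U \<le> liminf (\<lambda>n. \<integral>\<^sup>+x. indicator U x * ennreal (smooth_density (h n) x) \<partial>lborel)"
      by (rule fatou[OF U(1)])
    also have "\<dots> \<le> liminf (\<lambda>n. emeasure ?U U)"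
    proof (rule Liminf_mono)
      show "\<forall>\<^sub>F n in sequentially. (\<integral>\<^sup>+x. indicator U x * ennreal (smooth_density (h n) x) \<partial>lborel) \<le> emeasure ?U U"
        using hev
      proof eventually_elim
        case (elim n)
        have "indicator U x * ennreal (smooth_density (h n) x) \<le>
           indicator U x * ennreal ((neg_moment + e) * (exp x * (indicator {..<X} x * L (- x))))" for x
          using U(2) up[OF hpos elim, of x] by (auto simp: indicator_def X_def intro!: ennreal_leI)
        then show ?case
          using U by (subst emeasure_tail_measure[OF X]) (auto intro!: nn_integral_mono)
      qed
    qed
    also have "\<dots> = emeasure ?U U" by (simp add: Liminf_const)
    finally show ?thesis .
  qed
  have lower_compact: "emeasure ?D K \<le> emeasure \<mu> K" if K: "compact K" "K \<subseteq> {..<X}" for K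
  proof -
    have [measurable]: "K \<in> sets borel" using K by (simp add: compact_imp_closed borel_closed)
    have "open (- K)" using K by (simp add: compact_imp_closed open_Compl)
    \<comment> \<open>Smoothing preserves the total mass, which converts a lower bound for the
      smoothed mass of \<open>K\<close> into an upper bound on its complement.\<close>
    have total: "(\<integral>\<^sup>+x. indicator (- K) x * ennreal (smooth_density (h n) x) \<partial>lborel)
       + (\<integral>\<^sup>+x. indicator K x * ennreal (smooth_density (h n) x) \<partial>lborel) = emeasure \<mu> UNIV" for n
    proof -
      note [measurable] = borel_measurable_smooth[OF hpos]
      have "(\<integral>\<^sup>+x. indicator (- K) x * ennreal (smooth_density (h n) x) \<partial>lborel)
         + (\<integral>\<^sup>+x. indicator K x * ennreal (smooth_density (h n) x) \<partial>lborel)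
         = (\<integral>\<^sup>+x. indicator UNIV x * ennreal (smooth_density (h n) x) \<partial>lborel)"
        by (subst nn_integral_add[symmetric]) (auto intro!: nn_integral_cong simp: indicator_def)
      also have "\<dots> = emeasure \<mu> UNIV"
        by (subst nn_integral_smooth_density[OF hpos]) (auto simp: nn_integral_bspline_reflect[OF hpos] space_mu)
      finally show ?thesis .
    qed
    have fin: "emeasure ?D K \<noteq> \<infinity>" by (rule finite_tail_measure[OF X])
    have le: "emeasure \<mu> (- K) \<le> emeasure \<mu> UNIV - emeasure ?D K"
    proof -
      have "emeasure \<mu> (- K) \<le> liminf (\<lambda>n. \<integral>\<^sup>+x. indicator (- K) x * ennreal (smooth_density (h n) x) \<partial>lborel)"
        by (rule fatou[OF \<open>open (- K)\<close>])
      also have "\<dots> \<le> liminf (\<lambda>n. emeasure \<mu> UNIV - emeasure ?D K)"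
      proof (rule Liminf_mono)
        show "\<forall>\<^sub>F n in sequentially. (\<integral>\<^sup>+x. indicator (- K) x * ennreal (smooth_density (h n) x) \<partial>lborel)
            \<le> emeasure \<mu> UNIV - emeasure ?D K"
          using hev
        proof eventually_elim
          case (elim n)
          have "indicator K x * ennreal ((neg_moment - e) * (exp x * (indicator {..<X} x * L (- x))))
            \<le> indicator K x * ennreal (smooth_density (h n) x)" for x
            using K(2) lo[OF hpos elim, of x] by (auto simp: indicator_def X_def intro!: ennreal_leI)
          then have "emeasure ?D K \<le> (\<integral>\<^sup>+x. indicator K x * ennreal (smooth_density (h n) x) \<partial>lborel)"
            by (subst emeasure_tail_measure[OF X]) (auto intro!: nn_integral_mono)
          then have "(\<integral>\<^sup>+x. indicator (- K) x * ennreal (smooth_density (h n) x) \<partial>lborel) + emeasure ?D K \<le> emeasure \<mu> UNIV"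
            unfolding total[of n, symmetric] by (intro add_left_mono)
          then show ?case using fin by (simp add: ennreal_le_minus_iff add.commute)
        qed
      qed
      also have "\<dots> = emeasure \<mu> UNIV - emeasure ?D K" by (simp add: Liminf_const)
      finally show ?thesis .
    qed
    have split: "emeasure \<mu> UNIV = emeasure \<mu> (- K) + emeasure \<mu> K"
      by (subst plus_emeasure) (auto simp: sets_mu)
    have "emeasure \<mu> (- K) + emeasure ?D K \<le> emeasure \<mu> (- K) + emeasure \<mu> K"
    proof -
      \<comment> \<open>Subtraction in \<open>ennreal\<close> is truncated; this inequality is what
        allows the difference to be undone.\<close>
      have "emeasure ?D K \<le> emeasure \<mu> UNIV"
      proof -
        obtain n where n: "h n \<le> h0" using hev by (auto dest: eventually_happens)
        have "indicator K x * ennreal ((neg_moment - e) * (exp x * (indicator {..<X} x * L (- x))))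
            \<le> indicator K x * ennreal (smooth_density (h n) x)" for x
          using K(2) lo[OF hpos n, of x] by (auto simp: indicator_def X_def intro!: ennreal_leI)
        then have "emeasure ?D K \<le> (\<integral>\<^sup>+x. indicator K x * ennreal (smooth_density (h n) x) \<partial>lborel)"
          by (subst emeasure_tail_measure[OF X]) (auto intro!: nn_integral_mono)
        also have "\<dots> \<le> emeasure \<mu> UNIV" unfolding total[of n, symmetric] by simp
        finally show ?thesis .
      qed
      then have "emeasure \<mu> UNIV - emeasure ?D K + emeasure ?D K = emeasure \<mu> UNIV"
        by (rule diff_add_cancel_ennreal)
      then show ?thesis using add_right_mono[OF le, of "emeasure ?D K"] split by simp
    qed
    then show ?thesis
      using mu.emeasure_finite[of "- K"] by (simp add: ennreal_add_left_cancel_le)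
  qed
  show ?thesis
  proof (rule that[OF X])
    fix A :: "real set" assume A: "A \<in> sets borel" "A \<subseteq> {..<X}"
    show "emeasure \<mu> A \<le> emeasure ?U A"
    proof -
      have "emeasure ?U A = (INF U \<in> {U. A \<subseteq> U \<and> open U}. emeasure ?U U)"
        by (rule outer_regular[OF sU _ A(1)]) (rule finite_tail_measure[OF X])
      also have "\<dots> \<ge> emeasure \<mu> A"
      proof (rule INF_greatest, clarify)
        fix U :: "real set" assume U: "A \<subseteq> U" "open U"
        have "emeasure \<mu> A \<le> emeasure \<mu> (U \<inter> {..<X})"
          using A U by (intro emeasure_mono) (auto simp: sets_mu)
        also have "\<dots> \<le> emeasure ?U (U \<inter> {..<X})" using U by (intro upper_open) auto
        also have "\<dots> \<le> emeasure ?U U" using U by (intro emeasure_mono) (auto simp: sU)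
        finally show "emeasure \<mu> A \<le> emeasure ?U U" .
      qed
      finally show ?thesis .
    qed
    show "emeasure ?D A \<le> emeasure \<mu> A"
    proof -
      have "emeasure ?D A = (SUP K \<in> {K. K \<subseteq> A \<and> compact K}. emeasure ?D K)"
        by (rule inner_regular[OF sD _ A(1)]) (rule finite_tail_measure[OF X])
      also have "\<dots> \<le> emeasure \<mu> A"
      proof (rule SUP_least, clarify)
        fix K :: "real set" assume K: "K \<subseteq> A" "compact K"
        have "emeasure ?D K \<le> emeasure \<mu> K" using K A by (intro lower_compact) auto
        also have "\<dots> \<le> emeasure \<mu> A" using K A by (intro emeasure_mono) (auto simp: sets_mu)
        finally show "emeasure ?D K \<le> emeasure \<mu> A" .
      qed
      finally show ?thesis .
    qed
  qed
qed

end

subsection \<open>Cadlag paths\<close>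

text \<open>The summand 1 places the point strictly to the right of \<open>t\<close>, even when
  \<open>t\<close> lies on the grid, so that the limit runs along \<open>at_right t\<close>.\<close>

definition grid_point :: "nat \<Rightarrow> real \<Rightarrow> real" where
  "grid_point n t = (of_int \<lfloor>real (Suc n) * t\<rfloor> + 1) / real (Suc n)"

lemma grid_point_gt: "t < grid_point n t"
  and grid_point_le: "grid_point n t \<le> t + inverse (real (Suc n))"
proof -
  define N where "N = real (Suc n)"
  have N: "0 < N" by (simp add: N_def)
  have "N * t < of_int \<lfloor>N * t\<rfloor> + 1" "of_int \<lfloor>N * t\<rfloor> + 1 \<le> N * t + 1" by linarith+
  then show "t < grid_point n t" "grid_point n t \<le> t + inverse (real (Suc n))"
    unfolding grid_point_def N_def[symmetric] using N by (simp_all add: field_simps)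
qed

lemma filterlim_grid_point: "filterlim (\<lambda>n. grid_point n t) (at_right t) sequentially"
  unfolding filterlim_at_right_to_0 filterlim_at
proof (intro conjI)
  have "(\<lambda>n. grid_point n t - t) \<longlonglongrightarrow> 0"
  proof (rule tendsto_sandwich[of "\<lambda>_. 0" _ _ "\<lambda>n. inverse (real (Suc n))"])
    show "\<forall>\<^sub>F n in sequentially. 0 \<le> grid_point n t - t"
      using grid_point_gt[of t] by (auto intro!: always_eventually simp: less_imp_le)
    show "\<forall>\<^sub>F n in sequentially. grid_point n t - t \<le> inverse (real (Suc n))"
      using grid_point_le[of _ t] by (auto intro!: always_eventually simp: algebra_simps)
    show "(\<lambda>n. inverse (real (Suc n))) \<longlonglongrightarrow> 0" by (rule LIMSEQ_inverse_real_of_nat)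
  qed simp
  then show "(\<lambda>n. grid_point n t) \<longlonglongrightarrow> t" by (simp add: LIM_zero_iff)
qed (use grid_point_gt[of t] in \<open>auto intro!: always_eventually simp: less_imp_neq[symmetric]\<close>)

text \<open>Evaluated at grid points the process uses only countably many times, and
  right-continuity passes to the limit. The maximum with 0 gives a function on all of
  \<open>real\<close>, as nothing is known at negative times.\<close>

lemma borel_measurable_right_continuous_process:
  fixes F :: "real \<Rightarrow> 'a \<Rightarrow> real"
  assumes F: "\<And>t. 0 \<le> t \<Longrightarrow> F t \<in> borel_measurable M"
    and rc: "\<And>t \<omega>. 0 \<le> t \<Longrightarrow> \<omega> \<in> space M \<Longrightarrow> ((\<lambda>s. F s \<omega>) \<longlongrightarrow> F t \<omega>) (at_right t)"
  shows "(\<lambda>x::real \<times> 'a. F (max 0 (fst x)) (snd x)) \<in> borel_measurable (borel \<Otimes>\<^sub>M M)"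
proof (rule borel_measurable_LIMSEQ_real[where u = "\<lambda>n (x::real \<times> 'a). F (max 0 (grid_point n (max 0 (fst x)))) (snd x)"])
  fix x :: "real \<times> 'a" assume x: "x \<in> space (borel \<Otimes>\<^sub>M M)"
  have "max 0 (grid_point n (max 0 (fst x))) = grid_point n (max 0 (fst x))" for n
    using grid_point_gt[of "max 0 (fst x)" n] by simp
  moreover have "(\<lambda>n. F (grid_point n (max 0 (fst x))) (snd x)) \<longlonglongrightarrow> F (max 0 (fst x)) (snd x)"
    by (rule filterlim_compose[OF rc filterlim_grid_point]) (use x in \<open>auto simp: space_pair_measure\<close>)
  ultimately show "(\<lambda>n. F (max 0 (grid_point n (max 0 (fst x)))) (snd x)) \<longlonglongrightarrow> F (max 0 (fst x)) (snd x)"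
    by simp
next
  fix n
  let ?c = "\<lambda>i::int. (of_int i + 1) / real (Suc n)"
  have "(\<lambda>x. (\<lambda>i x. F (max 0 (?c i)) (snd x)) \<lfloor>real (Suc n) * max 0 (fst x)\<rfloor> x) \<in> borel_measurable (borel \<Otimes>\<^sub>M M)"
  proof (rule measurable_compose_countable[where f = "\<lambda>i (x::real \<times> 'a). F (max 0 (?c i)) (snd x)"
        and g = "\<lambda>x. \<lfloor>real (Suc n) * max 0 (fst x)\<rfloor>"])
    show "(\<lambda>x::real \<times> 'a. F (max 0 (?c i)) (snd x)) \<in> borel_measurable (borel \<Otimes>\<^sub>M M)" for i
      using F[of "max 0 (?c i)"] by measurable
    show "(\<lambda>x::real \<times> 'a. \<lfloor>real (Suc n) * max 0 (fst x)\<rfloor>) \<in> borel \<Otimes>\<^sub>M M \<rightarrow>\<^sub>M count_space UNIV"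
      by measurable
  qed
  then show "(\<lambda>x. F (max 0 (grid_point n (max 0 (fst x)))) (snd x)) \<in> borel_measurable (borel \<Otimes>\<^sub>M M)"
    by (simp add: grid_point_def)
qed

lemma cadlag_right: "cadlag f \<Longrightarrow> 0 \<le> t \<Longrightarrow> (f \<longlongrightarrow> f t) (at_right t)"
  by (simp add: cadlag_def)

lemma cadlag_left: "cadlag f \<Longrightarrow> 0 < t \<Longrightarrow> \<exists>l. (f \<longlongrightarrow> l) (at_left t)"
  by (simp add: cadlag_def)

lemma borel_measurable_cadlag:
  assumes "cadlag f" shows "(\<lambda>t. f (max 0 t)) \<in> borel_measurable borel"
proof -
  have "(\<lambda>x. f (max 0 (fst x))) \<in> borel_measurable (borel \<Otimes>\<^sub>M count_space {()})"
    using borel_measurable_right_continuous_process[of "\<lambda>t _. f t" "count_space {()}"] cadlag_right[OF assms] by simp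
  then have "(\<lambda>t. (\<lambda>x. f (max 0 (fst x))) (t, ())) \<in> borel_measurable borel"
    by (rule measurable_compose[rotated]) simp
  then show ?thesis by simp
qed

lemma cadlag_locally:
  assumes f: "cadlag f" and x: "0 \<le> x" and e: "0 < e"
  obtains l d where "0 < d" "\<And>s. x \<le> s \<Longrightarrow> s < x + d \<Longrightarrow> \<bar>f s - f x\<bar> < e"
    "\<And>s. 0 \<le> s \<Longrightarrow> x - d < s \<Longrightarrow> s < x \<Longrightarrow> \<bar>f s - l\<bar> < e" "0 < x \<Longrightarrow> (f \<longlongrightarrow> l) (at_left x)"
proof -
  have "\<forall>\<^sub>F s in at_right x. dist (f s) (f x) < e"
    using cadlag_right[OF f x] e by (rule tendstoD)
  then obtain b where b: "x < b" "\<And>s. x < s \<Longrightarrow> s < b \<Longrightarrow> \<bar>f s - f x\<bar> < e"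
    by (auto simp: eventually_at_right_field dist_real_def)
  obtain l c where c: "c < x" "\<And>s. 0 \<le> s \<Longrightarrow> c < s \<Longrightarrow> s < x \<Longrightarrow> \<bar>f s - l\<bar> < e" "0 < x \<Longrightarrow> (f \<longlongrightarrow> l) (at_left x)"
  proof (cases "x = 0")
    case True
    then show ?thesis by (intro that[of "-1" 0]) auto
  next
    case False
    then obtain l where l: "(f \<longlongrightarrow> l) (at_left x)" using cadlag_left[OF f, of x] x by auto
    then have "\<forall>\<^sub>F s in at_left x. dist (f s) l < e" using e by (rule tendstoD)
    then obtain c where "c < x" "\<And>s. c < s \<Longrightarrow> s < x \<Longrightarrow> \<bar>f s - l\<bar> < e"
      by (auto simp: eventually_at_left_field dist_real_def)
    then show ?thesis using l by (intro that[of c l]) auto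
  qed
  show ?thesis
  proof (rule that[of "min (b - x) (x - c)" l])
    show "\<bar>f s - f x\<bar> < e" if "x \<le> s" "s < x + min (b - x) (x - c)" for s
      using b(2)[of s] that e by (cases "s = x") auto
  qed (use b c in auto)
qed

lemma cadlag_bounded:
  assumes f: "cadlag f" and T: "0 \<le> T" shows "\<exists>B. \<forall>t\<in>{0..T}. \<bar>f t\<bar> \<le> B"
proof -
  define P where "P a b \<longleftrightarrow> (\<exists>B. \<forall>t. 0 \<le> t \<longrightarrow> a \<le> t \<longrightarrow> t \<le> b \<longrightarrow> \<bar>f t\<bar> \<le> B)" for a b
  have "P 0 T"
  proof (rule Bolzano[OF T])
    fix a b c assume "P a b" "P b c"
    then obtain B C where "\<And>t. 0 \<le> t \<Longrightarrow> a \<le> t \<Longrightarrow> t \<le> b \<Longrightarrow> \<bar>f t\<bar> \<le> B"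
      "\<And>t. 0 \<le> t \<Longrightarrow> b \<le> t \<Longrightarrow> t \<le> c \<Longrightarrow> \<bar>f t\<bar> \<le> C"
      unfolding P_def by blast
    then show "P a c" unfolding P_def by (intro exI[of _ "max B C"]) (metis le_max_iff_disj linear)
  next
    fix x assume x: "0 \<le> x" "x \<le> T"
    obtain l d where d: "0 < d" "\<And>s. x \<le> s \<Longrightarrow> s < x + d \<Longrightarrow> \<bar>f s - f x\<bar> < 1"
      "\<And>s. 0 \<le> s \<Longrightarrow> x - d < s \<Longrightarrow> s < x \<Longrightarrow> \<bar>f s - l\<bar> < 1"
      using cadlag_locally[OF f x(1), of 1] by (metis zero_less_one)
    show "\<exists>d>0. \<forall>a b. a \<le> x \<and> x \<le> b \<and> b - a < d \<longrightarrow> P a b"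
    proof (intro exI[of _ d] conjI allI impI d)
      fix a b assume ab: "a \<le> x \<and> x \<le> b \<and> b - a < d"
      show "P a b"
        unfolding P_def
      proof (intro exI[of _ "max (\<bar>f x\<bar> + 1) (\<bar>l\<bar> + 1)"] allI impI)
        fix t assume t: "0 \<le> t" "a \<le> t" "t \<le> b"
        then show "\<bar>f t\<bar> \<le> max (\<bar>f x\<bar> + 1) (\<bar>l\<bar> + 1)"
          using d(2)[of t] d(3)[of t] ab by (cases "x \<le> t") auto
      qed
    qed
  qed
  then obtain B where "\<And>t. 0 \<le> t \<Longrightarrow> t \<le> T \<Longrightarrow> \<bar>f t\<bar> \<le> B" by (auto simp: P_def)
  then show ?thesis by (intro exI[of _ B]) auto
qed

text \<open>Near a point \<open>x\<close> the path is close to its left limit before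
  \<open>x\<close> and to \<open>f x\<close> from \<open>x\<close> on, and the jump between the two
  levels is upward; an increment can then be negative only by little. A Lebesgue number makes this
  uniform on \<open>{0..T}\<close>.\<close>

lemma cadlag_increments_ge:
  assumes f: "cadlag f" and j: "\<And>t. 0 < t \<Longrightarrow> 0 \<le> jump f t" and e: "0 < e"
  obtains d where "0 < d" "\<And>s t. 0 \<le> s \<Longrightarrow> s \<le> t \<Longrightarrow> t \<le> T \<Longrightarrow> t - s < d \<Longrightarrow> - e < f t - f s"
proof -
  have "\<exists>d>0. \<forall>s t. 0 \<le> s \<longrightarrow> s \<le> t \<longrightarrow> s \<in> ball x d \<longrightarrow> t \<in> ball x d \<longrightarrow> - e < f t - f s" if x: "x \<in> {0..T}" for x
  proof -
    have x0: "0 \<le> x" and e2: "0 < e / 2" using x e by auto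
    obtain l d where d: "0 < d" "\<And>s. x \<le> s \<Longrightarrow> s < x + d \<Longrightarrow> \<bar>f s - f x\<bar> < e / 2"
      "\<And>s. 0 \<le> s \<Longrightarrow> x - d < s \<Longrightarrow> s < x \<Longrightarrow> \<bar>f s - l\<bar> < e / 2" "0 < x \<Longrightarrow> (f \<longlongrightarrow> l) (at_left x)"
      using cadlag_locally[OF f x0 e2] by metis
    have jx: "l \<le> f x" if "0 < x"
    proof -
      have "Lim (at_left x) f = l" using d(4)[OF that] by (intro tendsto_Lim) auto
      then show ?thesis using j[OF that] by (simp add: jump_def)
    qed
    show ?thesis
    proof (intro exI[of _ d] conjI allI impI d)
      fix s t assume st: "0 \<le> s" "s \<le> t" "s \<in> ball x d" "t \<in> ball x d"
      then show "- e < f t - f s"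
        using d(2)[of s] d(2)[of t] d(3)[of s] d(3)[of t] jx
        by (cases "x \<le> s"; cases "x \<le> t") (auto simp: dist_real_def abs_less_iff, (smt (verit))+)
    qed
  qed
  then obtain D where D: "\<And>x. x \<in> {0..T} \<Longrightarrow> 0 < D x"
    "\<And>x s t. x \<in> {0..T} \<Longrightarrow> 0 \<le> s \<Longrightarrow> s \<le> t \<Longrightarrow> s \<in> ball x (D x) \<Longrightarrow> t \<in> ball x (D x) \<Longrightarrow> - e < f t - f s"
    by metis
  show ?thesis
  proof (cases "0 \<le> T")
    case False
    then show ?thesis by (intro that[of 1]) auto
  next
    case True
    obtain d where d: "0 < d" "\<And>S. S \<subseteq> {0..T} \<Longrightarrow> diameter S < d \<Longrightarrow> \<exists>B\<in>(\<lambda>x. ball x (D x)) ` {0..T}. S \<subseteq> B"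
    proof (rule Lebesgue_number_lemma[of "{0..T}" "(\<lambda>x. ball x (D x)) ` {0..T}"])
      show "{0..T} \<subseteq> \<Union> ((\<lambda>x. ball x (D x)) ` {0..T})" using D(1) by force
    qed (use True that in auto)
    show ?thesis
    proof (rule that[OF d(1)])
      fix s t assume st: "0 \<le> s" "s \<le> t" "t \<le> T" "t - s < d"
      obtain x where "x \<in> {0..T}" "{s..t} \<subseteq> ball x (D x)"
        using d(2)[of "{s..t}"] st by auto
      moreover have "s \<in> {s..t}" "t \<in> {s..t}" using st by auto
      ultimately show "- e < f t - f s" using D(2)[of x s t] st by blast
    qed
  qed
qed

lemma right_derivative_zero_constant:
  fixes g :: "real \<Rightarrow> 'b::real_normed_vector"
  assumes ab: "a \<le> b" and cont: "continuous_on {a..b} g"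
    and der: "\<And>t. a \<le> t \<Longrightarrow> t < b \<Longrightarrow> (g has_vector_derivative 0) (at t within {t..b})"
  shows "g b = g a"
proof -
  have bound: "norm (g b - g a) \<le> e * (b - a)" if e: "0 < e" for e
  proof (rule ccontr)
    assume neg: "\<not> norm (g b - g a) \<le> e * (b - a)"
    define S where "S = {s \<in> {a..b}. norm (g s - g a) \<le> e * (s - a)}"
    have "closed S"
      unfolding S_def by (intro continuous_on_closed_Collect_le continuous_intros cont closed_atLeastAtMost)
    moreover have "a \<in> S" using ab by (simp add: S_def)
    moreover have "bdd_above S" by (auto simp: S_def intro: bdd_aboveI[of _ b])
    ultimately have SS: "Sup S \<in> S" by (intro closed_contains_Sup) auto
    define s where "s = Sup S"
    have s: "a \<le> s" "s \<le> b" "norm (g s - g a) \<le> e * (s - a)" using SS by (auto simp: S_def s_def)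
    have sb: "s < b" using s neg by (cases "s = b") auto
    have "(g has_derivative (\<lambda>h. h *\<^sub>R 0)) (at s within {s..b})"
      using der[OF s(1) sb] by (simp add: has_vector_derivative_def)
    then obtain d where d: "0 < d" "\<And>y. y \<in> {s..b} \<Longrightarrow> norm (y - s) < d \<Longrightarrow> norm (g y - g s - (y - s) *\<^sub>R 0) \<le> e * norm (y - s)"
      using e unfolding has_derivative_within_alt by blast
    define y where "y = min b (s + d / 2)"
    have y: "s < y" "y \<le> b" "norm (y - s) < d" using sb d(1) by (auto simp: y_def)
    have "norm (g y - g a) \<le> norm (g y - g s) + norm (g s - g a)"
      using norm_triangle_ineq[of "g y - g s" "g s - g a"] by simp
    also have "\<dots> \<le> e * (y - s) + e * (s - a)"
      using d(2)[of y] y s by (intro add_mono) auto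
    finally have "y \<in> S" using y s by (simp add: S_def algebra_simps)
    then have "y \<le> s" unfolding s_def by (intro cSup_upper) (auto simp: S_def intro: bdd_aboveI[of _ b])
    then show False using y by simp
  qed
  have "norm (g b - g a) \<le> 0"
  proof (rule field_le_epsilon)
    fix e :: real assume e: "0 < e"
    have "norm (g b - g a) \<le> e / (b - a + 1) * (b - a)" using ab e by (intro bound) simp
    also have "\<dots> \<le> e" using ab e by (simp add: field_simps)
    finally show "norm (g b - g a) \<le> 0 + e" by simp
  qed
  then show ?thesis by simp
qed

subsection \<open>The functional along a path\<close>

definition path_functional :: "(real \<Rightarrow> real) \<Rightarrow> real" where
  "path_functional f = (LBINT t:{0..}. exp (- f t))"

definition path_shift :: "real \<Rightarrow> (real \<Rightarrow> real) \<Rightarrow> real \<Rightarrow> real" where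
  "path_shift s f t = f (s + t) - f s"

lemma cadlag_shift:
  assumes f: "cadlag f" and s: "0 \<le> s" shows "cadlag (path_shift s f)"
  unfolding cadlag_def
proof (intro conjI allI impI)
  fix t :: real assume t: "0 \<le> t"
  have "filterlim (\<lambda>t. s + t) (at_right (s + t)) (at_right t)"
    unfolding filterlim_at
    by (intro conjI tendsto_intros eventually_mono[OF eventually_at_right_less[of t]]) auto
  then have "((\<lambda>u. f (s + u)) \<longlongrightarrow> f (s + t)) (at_right t)"
    using filterlim_compose[OF cadlag_right[OF f, of "s + t"]] s t by simp
  then show "(path_shift s f \<longlongrightarrow> path_shift s f t) (at_right t)"
    unfolding path_shift_def[abs_def] by (intro tendsto_intros)
next
  fix t :: real assume t: "0 < t"
  obtain l where l: "(f \<longlongrightarrow> l) (at_left (s + t))" using cadlag_left[OF f, of "s + t"] s t by auto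
  have "filterlim (\<lambda>t. s + t) (at_left (s + t)) (at_left t)"
    unfolding filterlim_at
    by (intro conjI tendsto_intros) (auto simp: eventually_at_left_field intro!: exI[of _ "t - 1"])
  from filterlim_compose[OF l this] have "((\<lambda>u. f (s + u)) \<longlongrightarrow> l) (at_left t)"
    by simp
  then have "(path_shift s f \<longlongrightarrow> l - f s) (at_left t)"
    unfolding path_shift_def[abs_def] by (intro tendsto_intros)
  then show "\<exists>l. (path_shift s f \<longlongrightarrow> l) (at_left t)" by blast
qed

context
  fixes f :: "real \<Rightarrow> real"
  assumes f: "cadlag f"
begin

lemma set_measurable_exp_path: "A \<in> sets borel \<Longrightarrow> A \<subseteq> {0..} \<Longrightarrow> (\<lambda>t. indicator A t *\<^sub>R exp (- f t)) \<in> borel_measurable borel"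
proof -
  assume A: "A \<in> sets borel" "A \<subseteq> {0..}"
  have "(\<lambda>t. indicator A t *\<^sub>R exp (- f (max 0 t))) \<in> borel_measurable borel"
    using borel_measurable_cadlag[OF f] A(1) by measurable
  also have "(\<lambda>t. indicator A t *\<^sub>R exp (- f (max 0 t))) = (\<lambda>t. indicator A t *\<^sub>R exp (- f t))"
    using A(2) by (auto simp: indicator_def fun_eq_iff max_def)
  finally show ?thesis .
qed

lemma set_integrable_exp_path:
  assumes a: "0 \<le> a" shows "set_integrable lborel {a..b} (\<lambda>t. exp (- f t))"
proof -
  obtain B where "\<forall>t\<in>{0..max a b}. \<bar>f t\<bar> \<le> B"
    using cadlag_bounded[OF f, of "max a b"] a by (auto simp: le_max_iff_disj)
  note B = bspec[OF this]
  show ?thesis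
    unfolding set_integrable_def
  proof (rule Bochner_Integration.integrable_bound)
    show "integrable lborel (\<lambda>t. indicator {a..b} t * exp B)"
      by (auto simp: integrable_indicator_iff emeasure_lborel_Icc_eq)
    show "(\<lambda>t. indicator {a..b} t *\<^sub>R exp (- f t)) \<in> borel_measurable lborel"
      using set_measurable_exp_path[of "{a..b}"] a by auto
    show "AE t in lborel. norm (indicator {a..b} t *\<^sub>R exp (- f t)) \<le> norm (indicator {a..b} t * exp B)"
      using B a by (intro AE_I2) (auto simp: indicator_def abs_le_iff)
  qed
qed

lemma path_functional_not_integrable:
  "\<not> set_integrable lborel {0..} (\<lambda>t. exp (- f t)) \<Longrightarrow> path_functional f = 0"
  by (simp add: path_functional_def set_lebesgue_integral_def set_integrable_def not_integrable_integral_eq)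

lemma path_functional_pos:
  assumes i: "set_integrable lborel {0..} (\<lambda>t. exp (- f t))" shows "0 < path_functional f"
proof -
  obtain B where "\<forall>t\<in>{0..1}. \<bar>f t\<bar> \<le> B"
    using cadlag_bounded[OF f, of 1] by auto
  note B = bspec[OF this]
  have "exp (- B) = (LBINT t::real. indicator {0..1} t * exp (- B))" by simp
  also have "\<dots> \<le> (LBINT t. indicator {0..} t *\<^sub>R exp (- f t))"
  proof (rule integral_mono)
    show "integrable lborel (\<lambda>t::real. indicator {0..1} t * exp (- B))"
      by (auto simp: integrable_indicator_iff emeasure_lborel_Icc_eq)
    show "integrable lborel (\<lambda>t. indicator {0..} t *\<^sub>R exp (- f t))"
      using i by (simp add: set_integrable_def)
    show "indicator {0..1} t * exp (- B) \<le> indicator {0..} t *\<^sub>R exp (- f t)" for t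
      using B[of t] by (auto simp: indicator_def abs_le_iff)
  qed
  finally show ?thesis
    unfolding path_functional_def set_lebesgue_integral_def using exp_gt_zero[of "- B"] by linarith
qed

lemma path_functional_nonneg: "0 \<le> path_functional f"
  using path_functional_pos path_functional_not_integrable by force

lemma set_integrable_shift_iff:
  assumes s: "0 \<le> s"
  shows "set_integrable lborel {0..} (\<lambda>t. exp (- path_shift s f t)) \<longleftrightarrow> set_integrable lborel {0..} (\<lambda>t. exp (- f t))"
    and tail_integral_shift: "(LBINT t:{s..}. exp (- f t)) = exp (- f s) * path_functional (path_shift s f)"
proof -
  have eq: "(\<lambda>t. indicator {0..} t *\<^sub>R exp (- path_shift s f t)) = (\<lambda>t. exp (f s) * (indicator {s..} (s + 1 * t) *\<^sub>R exp (- f (s + 1 * t))))"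
    by (auto simp: fun_eq_iff indicator_def path_shift_def exp_diff exp_minus field_simps)
  have "set_integrable lborel {0..} (\<lambda>t. exp (- path_shift s f t)) \<longleftrightarrow> set_integrable lborel {s..} (\<lambda>t. exp (- f t))"
    unfolding set_integrable_def eq
    using lborel_integrable_real_affine_iff[of 1 "\<lambda>t. indicator {s..} t *\<^sub>R exp (- f t)" s] by simp
  moreover have "set_integrable lborel {s..} (\<lambda>t. exp (- f t)) \<longleftrightarrow> set_integrable lborel {0..} (\<lambda>t. exp (- f t))"
  proof
    assume i: "set_integrable lborel {s..} (\<lambda>t. exp (- f t))"
    have "set_integrable lborel ({0..s} \<union> {s..}) (\<lambda>t. exp (- f t))"
      by (intro set_integrable_Un i set_integrable_exp_path) auto
    also have "{0..s} \<union> {s..} = {0..}" using s by auto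
    finally show "set_integrable lborel {0..} (\<lambda>t. exp (- f t))" .
  next
    assume i: "set_integrable lborel {0..} (\<lambda>t. exp (- f t))"
    then show "set_integrable lborel {s..} (\<lambda>t. exp (- f t))"
      by (rule set_integrable_subset) (use s in auto)
  qed
  ultimately show "set_integrable lborel {0..} (\<lambda>t. exp (- path_shift s f t)) \<longleftrightarrow> set_integrable lborel {0..} (\<lambda>t. exp (- f t))"
    by simp
  have "path_functional (path_shift s f) = exp (f s) * (LBINT t:{s..}. exp (- f t))"
    unfolding path_functional_def set_lebesgue_integral_def eq
    using lborel_integral_real_affine[of 1 "\<lambda>t. indicator {s..} t *\<^sub>R exp (- f t)" s] by simp
  then show "(LBINT t:{s..}. exp (- f t)) = exp (- f s) * path_functional (path_shift s f)"
    by (simp add: exp_minus)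
qed

end

text \<open>By \<open>tail_integral_shift\<close> this is the integral of \<open>exp (- f t)\<close>
  over \<open>{s..}\<close>. The product form separates the past \<open>f s\<close> from the
  functional of the shifted path, which carries the independence.\<close>

definition tail_functional :: "(real \<Rightarrow> real) \<Rightarrow> real \<Rightarrow> real" where
  "tail_functional f s = exp (- f s) * path_functional (path_shift s f)"

context
  fixes f :: "real \<Rightarrow> real"
  assumes f: "cadlag f" and i: "set_integrable lborel {0..} (\<lambda>t. exp (- f t))"
begin

lemma path_functional_shift_pos: "0 \<le> s \<Longrightarrow> 0 < path_functional (path_shift s f)"
  by (rule path_functional_pos[OF cadlag_shift[OF f]]) (simp_all add: set_integrable_shift_iff[OF f] i)

lemma tail_functional_pos: "0 \<le> s \<Longrightarrow> 0 < tail_functional f s"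
  by (simp add: tail_functional_def path_functional_shift_pos)

lemma exp_path_integrable_on: "0 \<le> a \<Longrightarrow> (\<lambda>t. exp (- f t)) integrable_on {a..b}"
  by (rule set_borel_integral_eq_integral(1)[OF set_integrable_exp_path[OF f]])

lemma tail_functional_eq:
  assumes s: "0 \<le> s" "s \<le> t"
  shows "tail_functional f t = tail_functional f s - integral {s..t} (\<lambda>r. exp (- f r))"
proof -
  have "tail_functional f s = (LBINT r:{s..t} \<union> {t<..}. exp (- f r))"
    unfolding tail_functional_def tail_integral_shift[OF f s(1), symmetric]
    using s by (intro arg_cong2[where f="\<lambda>A. set_lebesgue_integral lborel A"]) auto
  also have "\<dots> = (LBINT r:{s..t}. exp (- f r)) + (LBINT r:{t<..}. exp (- f r))"
  proof (rule set_integral_Un)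
    show "set_integrable lborel {s..t} (\<lambda>r. exp (- f r))" by (rule set_integrable_exp_path[OF f s(1)])
    show "set_integrable lborel {t<..} (\<lambda>r. exp (- f r))"
      by (rule set_integrable_subset[OF i]) (use s in auto)
  qed auto
  also have "(LBINT r:{t<..}. exp (- f r)) = (LBINT r:{t..}. exp (- f r))"
  proof -
    have "AE r in lborel. r \<noteq> t" by (rule AE_lborel_singleton)
    then have "AE r in lborel. indicator {t<..} r *\<^sub>R exp (- f r) = indicator {t..} r *\<^sub>R exp (- f r)"
      by eventually_elim (auto simp: indicator_def)
    moreover have "(\<lambda>r. indicator {t<..} r *\<^sub>R exp (- f r)) \<in> borel_measurable borel"
      "(\<lambda>r. indicator {t..} r *\<^sub>R exp (- f r)) \<in> borel_measurable borel"
      by (rule set_measurable_exp_path[OF f]; use s in auto)+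
    ultimately show ?thesis
      unfolding set_lebesgue_integral_def by (intro integral_cong_AE) auto
  qed
  also have "\<dots> = tail_functional f t"
    unfolding tail_functional_def using s by (intro tail_integral_shift[OF f]) simp
  finally show ?thesis
    using set_borel_integral_eq_integral(2)[OF set_integrable_exp_path[OF f s(1)], of t] by simp
qed

lemma continuous_on_tail_functional: "0 \<le> a \<Longrightarrow> continuous_on {a..b} (tail_functional f)"
proof -
  assume a: "0 \<le> a"
  have "continuous_on {a..b} (\<lambda>t. tail_functional f a - integral {a..t} (\<lambda>r. exp (- f r)))"
    by (intro continuous_intros indefinite_integral_continuous_1 exp_path_integrable_on a)
  then show ?thesis
    by (rule continuous_on_eq) (rule tail_functional_eq[symmetric], use a in auto)
qed

lemma right_continuous_exp_path: "0 \<le> t \<Longrightarrow> continuous (at t within {t..b}) (\<lambda>r. exp (- f r))"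
proof -
  assume "0 \<le> t"
  from cadlag_right[OF f this] have "(f \<longlongrightarrow> f t) (at t within {t..b})"
    unfolding at_within_Ici_at_right[symmetric] by (rule tendsto_within_subset) auto
  then show ?thesis unfolding continuous_within by (intro tendsto_intros)
qed

lemma right_derivative_integral:
  fixes g :: "real \<Rightarrow> 'b::banach"
  assumes g: "g integrable_on {a..b}" and c: "continuous (at t within {t..b}) g" and t: "a \<le> t" "t < b"
  shows "((\<lambda>u. integral {a..u} g) has_vector_derivative g t) (at t within {t..b})"
proof -
  have i: "g integrable_on {t..b}" by (rule integrable_subinterval_real[OF g]) (use t in auto)
  have "((\<lambda>u. integral {t..u} g) has_vector_derivative g t) (at t within {t..b})"
    using integral_has_vector_derivative_continuous_at[OF i, of t "{}"] c t by simp
  then have "((\<lambda>u. integral {a..t} g + integral {t..u} g) has_vector_derivative g t) (at t within {t..b})"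
    using has_vector_derivative_add[OF has_vector_derivative_const, of "\<lambda>u. integral {t..u} g"] by fastforce
  then show ?thesis
  proof (rule has_vector_derivative_transform[rotated 2])
    show "t \<in> {t..b}" using t by simp
    show "integral {a..u} g = integral {a..t} g + integral {t..u} g" if "u \<in> {t..b}" for u
      using that t by (intro Henstock_Kurzweil_Integration.integral_combine[symmetric] integrable_subinterval_real[OF g]) auto
  qed
qed

lemma right_derivative_tail_functional:
  assumes t: "0 \<le> t" "t < b"
  shows "(tail_functional f has_vector_derivative - exp (- f t)) (at t within {t..b})"
proof -
  have "((\<lambda>u. integral {t..u} (\<lambda>r. exp (- f r))) has_vector_derivative exp (- f t)) (at t within {t..b})"
    using t by (intro right_derivative_integral exp_path_integrable_on right_continuous_exp_path) auto
  then have "((\<lambda>u. tail_functional f t - integral {t..u} (\<lambda>r. exp (- f r))) has_vector_derivative 0 - exp (- f t)) (at t within {t..b})"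
    by (intro has_vector_derivative_diff has_vector_derivative_const)
  then have "((\<lambda>u. tail_functional f t - integral {t..u} (\<lambda>r. exp (- f r))) has_vector_derivative - exp (- f t)) (at t within {t..b})"
    by simp
  then show ?thesis
  proof (rule has_vector_derivative_transform[rotated 2])
    show "tail_functional f u = tail_functional f t - integral {t..u} (\<lambda>r. exp (- f r))" if "u \<in> {t..b}" for u
      by (rule tail_functional_eq) (use t that in auto)
  qed (use t in auto)
qed

definition inverse_functional :: "real \<Rightarrow> real" where
  "inverse_functional s = inverse (path_functional (path_shift s f))"

lemma inverse_functional_eq: "inverse_functional s = exp (- f s) / tail_functional f s"
  by (simp add: inverse_functional_def tail_functional_def field_simps)

text \<open>The tail functional decreases, so on \<open>{0..T}\<close> it stays above its positive
  value at \<open>T\<close>, and the rate is at most a constant times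
  \<open>exp (- f s)\<close>.\<close>

lemma set_integrable_inverse_functional:
  assumes "0 \<le> T"
  shows "set_integrable lborel {0..T} inverse_functional"
proof -
  have "tail_functional f T \<le> tail_functional f s" if "s \<in> {0..T}" for s
    using tail_functional_eq[of s T] that
    by (auto intro!: Henstock_Kurzweil_Integration.integral_nonneg exp_path_integrable_on)
  note ge = this
  have pT: "0 < tail_functional f T" using assms by (rule tail_functional_pos)
  have c: "continuous_on {0..T} (\<lambda>s. inverse (tail_functional f s))"
    by (intro continuous_intros continuous_on_tail_functional) (use tail_functional_pos in force)+
  have m1: "(\<lambda>s. indicator {0..T} s *\<^sub>R inverse (tail_functional f s)) \<in> borel_measurable borel"
    by (rule borel_measurable_continuous_on_indicator[OF _ c]) simp
  have "(\<lambda>s. (indicator {0..T} s *\<^sub>R inverse (tail_functional f s)) * (indicator {0..T} s *\<^sub>R exp (- f s))) \<in> borel_measurable borel"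
    by (intro borel_measurable_times m1 set_measurable_exp_path[OF f]) auto
  also have "(\<lambda>s. (indicator {0..T} s *\<^sub>R inverse (tail_functional f s)) * (indicator {0..T} s *\<^sub>R exp (- f s)))
    = (\<lambda>s. indicator {0..T} s *\<^sub>R inverse_functional s)"
    by (auto simp: fun_eq_iff indicator_def inverse_functional_eq field_simps)
  finally have m: "(\<lambda>s. indicator {0..T} s *\<^sub>R inverse_functional s) \<in> borel_measurable borel" .
  show ?thesis
    unfolding set_integrable_def
  proof (rule Bochner_Integration.integrable_bound)
    show "integrable lborel (\<lambda>s. inverse (tail_functional f T) * (indicator {0..T} s *\<^sub>R exp (- f s)))"
      using set_integrable_exp_path[OF f, of 0 T] unfolding set_integrable_def by simp
    show "AE s in lborel. norm (indicator {0..T} s *\<^sub>R inverse_functional s)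
      \<le> norm (inverse (tail_functional f T) * (indicator {0..T} s *\<^sub>R exp (- f s)))"
    proof (intro AE_I2)
      fix s
      show "norm (indicator {0..T} s *\<^sub>R inverse_functional s)
        \<le> norm (inverse (tail_functional f T) * (indicator {0..T} s *\<^sub>R exp (- f s)))"
      proof (cases "s \<in> {0..T}")
        case True
        then have "0 < tail_functional f s" by (intro tail_functional_pos) simp
        then show ?thesis
          using True pT ge[OF True] by (simp add: inverse_functional_eq divide_inverse mult.commute le_imp_inverse_le mult_left_mono)
      qed simp
    qed
  qed (use m in simp)
qed

lemma right_continuous_inverse_functional:
  assumes t: "0 \<le> t" "t < b" shows "continuous (at t within {t..b}) inverse_functional"
proof -
  have "continuous (at t within {t..b}) (\<lambda>s. exp (- f s) / tail_functional f s)"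
  proof (rule continuous_at_within_divide)
    show "continuous (at t within {t..b}) (tail_functional f)"
      using continuous_on_tail_functional[OF t(1), of b] t by (simp add: continuous_on_eq_continuous_within)
    show "tail_functional f t \<noteq> 0" using tail_functional_pos[OF t(1)] by simp
  qed (rule right_continuous_exp_path[OF t(1)])
  then show ?thesis by (simp add: inverse_functional_eq[abs_def])
qed

lemma inverse_functional_integrable_on: "0 \<le> a \<Longrightarrow> inverse_functional integrable_on {a..b}"
proof -
  assume a: "0 \<le> a"
  have "inverse_functional integrable_on {0..max 0 b}"
    by (rule set_borel_integral_eq_integral(1)[OF set_integrable_inverse_functional]) simp
  then show ?thesis by (rule integrable_subinterval_real) (use a in auto)
qed

lemma right_derivative_ln_tail_functional:
  assumes t: "0 \<le> t" "t < b"
  shows "((\<lambda>s. ln (tail_functional f s)) has_vector_derivative - inverse_functional t) (at t within {t..b})"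
proof -
  have "(ln has_real_derivative inverse (tail_functional f t)) (at (tail_functional f t) within tail_functional f ` {t..b})"
    using DERIV_ln[OF tail_functional_pos[OF t(1)]] by (rule has_field_derivative_at_within)
  from field_vector_diff_chain_within[OF right_derivative_tail_functional[OF t] this]
  show ?thesis by (simp add: comp_def inverse_functional_eq divide_inverse)
qed

lemma continuous_on_ln_tail_functional:
  assumes a: "0 \<le> a" shows "continuous_on {a..b} (\<lambda>s. ln (tail_functional f s))"
proof (intro continuous_on_ln continuous_on_tail_functional a ballI)
  fix s assume "s \<in> {a..b}"
  then have "0 < tail_functional f s" using a by (intro tail_functional_pos) simp
  then show "tail_functional f s \<noteq> 0" by simp
qed

lemma ln_tail_functional_eq:
  assumes t: "0 \<le> t"
  shows "ln (path_functional (path_shift 0 f)) - f 0 - ln (tail_functional f t) = (LBINT s:{0..t}. inverse_functional s)"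
proof -
  let ?g = "\<lambda>u. ln (tail_functional f u) + integral {0..u} inverse_functional"
  have "?g t = ?g 0"
  proof (rule right_derivative_zero_constant[OF t])
    show "continuous_on {0..t} ?g"
      by (intro continuous_on_add continuous_on_ln_tail_functional indefinite_integral_continuous_1 inverse_functional_integrable_on) auto
    fix u assume u: "0 \<le> u" "u < t"
    have "(?g has_vector_derivative - inverse_functional u + inverse_functional u) (at u within {u..t})"
      by (intro has_vector_derivative_add right_derivative_ln_tail_functional right_derivative_integral
          inverse_functional_integrable_on right_continuous_inverse_functional u) auto
    then show "(?g has_vector_derivative 0) (at u within {u..t})" by simp
  qed
  moreover have "ln (tail_functional f 0) = ln (path_functional (path_shift 0 f)) - f 0"
    using path_functional_shift_pos[of 0] by (simp add: tail_functional_def ln_mult)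
  ultimately show ?thesis
    using set_borel_integral_eq_integral(2)[OF set_integrable_inverse_functional[OF t]] by simp
qed

definition iexp_ln_tail :: "real \<Rightarrow> real \<Rightarrow> complex" where
  "iexp_ln_tail u s = iexp (u * ln (tail_functional f s))"

lemma continuous_on_iexp_ln_tail: "0 \<le> a \<Longrightarrow> continuous_on {a..b} (iexp_ln_tail u)"
  unfolding iexp_ln_tail_def[abs_def]
  by (intro continuous_intros continuous_on_ln_tail_functional) auto

lemma set_integrable_iexp_ln_tail:
  assumes t: "0 \<le> t"
  shows "set_integrable lborel {0..t} (\<lambda>s. iexp_ln_tail u s * of_real (inverse_functional s))"
  unfolding set_integrable_def
proof (rule Bochner_Integration.integrable_bound)
  define w where "w s = indicator {0..t} s *\<^sub>R inverse_functional s" for s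
  define r where "r s = indicator {0..t} s *\<^sub>R iexp_ln_tail u s" for s
  show i: "integrable lborel w"
    using set_integrable_inverse_functional[OF t] by (simp add: set_integrable_def w_def[abs_def])
  have [measurable]: "w \<in> borel_measurable borel" using borel_measurable_integrable[OF i] by simp
  have [measurable]: "r \<in> borel_measurable borel"
    unfolding r_def[abs_def] by (rule borel_measurable_continuous_on_indicator[OF _ continuous_on_iexp_ln_tail]) auto
  have eq: "(\<lambda>s. indicator {0..t} s *\<^sub>R (iexp_ln_tail u s * of_real (inverse_functional s))) = (\<lambda>s. r s * of_real (w s))"
    by (auto simp: fun_eq_iff indicator_def r_def w_def)
  show "(\<lambda>s. indicator {0..t} s *\<^sub>R (iexp_ln_tail u s * of_real (inverse_functional s))) \<in> borel_measurable lborel"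
    unfolding eq by measurable
  show "AE s in lborel. norm (indicator {0..t} s *\<^sub>R (iexp_ln_tail u s * of_real (inverse_functional s))) \<le> norm (w s)"
    by (intro AE_I2) (simp add: norm_mult indicator_def w_def iexp_ln_tail_def)
qed

lemma right_derivative_iexp_ln_tail:
  assumes v: "0 \<le> v" "v < t"
  shows "(iexp_ln_tail u has_vector_derivative - (\<i> * of_real u * (iexp_ln_tail u v * of_real (inverse_functional v)))) (at v within {v..t})"
proof -
  have a: "((\<lambda>s. u * ln (tail_functional f s)) has_vector_derivative u * - inverse_functional v) (at v within {v..t})"
    by (intro has_vector_derivative_mult_right right_derivative_ln_tail_functional v)
  have b: "(iexp has_vector_derivative \<i> * iexp_ln_tail u v) (at (u * ln (tail_functional f v)) within (\<lambda>s. u * ln (tail_functional f s)) ` {v..t})"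
    unfolding iexp_ln_tail_def by (rule has_vector_derivative_iexp)
  from vector_diff_chain_within[OF a b]
  show ?thesis
    unfolding comp_def iexp_ln_tail_def[symmetric]
    by (rule has_vector_derivative_eq_rhs) (simp add: scaleR_conv_of_real)
qed

lemma iexp_ln_tail_eq:
  assumes t: "0 \<le> t"
  shows "iexp_ln_tail u 0 - iexp_ln_tail u t =
    \<i> * of_real u * (CLBINT s:{0..t}. iexp_ln_tail u s * of_real (inverse_functional s))"
proof -
  define q where "q s = iexp_ln_tail u s * complex_of_real (inverse_functional s)" for s
  note qi = set_integrable_iexp_ln_tail[OF t, of u, folded q_def[abs_def]]
  have qon: "q integrable_on {0..t}" by (rule set_borel_integral_eq_integral(1)[OF qi])
  define g where "g v = iexp_ln_tail u v + \<i> * of_real u * integral {0..v} q" for v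
  have "g t = g 0"
  proof (rule right_derivative_zero_constant[OF t])
    show "continuous_on {0..t} g"
      unfolding g_def[abs_def]
      by (intro continuous_on_add continuous_on_iexp_ln_tail continuous_on_mult continuous_on_const indefinite_integral_continuous_1 qon) auto
    fix v assume v: "0 \<le> v" "v < t"
    have c: "continuous (at v within {v..t}) q"
      unfolding q_def[abs_def]
    proof (intro continuous_mult continuous_of_real right_continuous_inverse_functional v)
      show "continuous (at v within {v..t}) (iexp_ln_tail u)"
        using continuous_on_iexp_ln_tail[OF v(1), of t u] v by (simp add: continuous_on_eq_continuous_within)
    qed
    have "(g has_vector_derivative - (\<i> * of_real u * q v) + \<i> * of_real u * q v) (at v within {v..t})"
      unfolding g_def[abs_def]
    proof (rule has_vector_derivative_add)
      show "(iexp_ln_tail u has_vector_derivative - (\<i> * of_real u * q v)) (at v within {v..t})"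
        using right_derivative_iexp_ln_tail[OF v, of u] by (simp add: q_def)
      show "((\<lambda>v. \<i> * of_real u * integral {0..v} q) has_vector_derivative \<i> * of_real u * q v) (at v within {v..t})"
        by (rule has_vector_derivative_mult_right[OF right_derivative_integral[OF qon c v]])
    qed
    then show "(g has_vector_derivative 0) (at v within {v..t})" by simp
  qed
  then have "iexp_ln_tail u 0 - iexp_ln_tail u t = \<i> * of_real u * integral {0..t} q"
    by (simp add: g_def algebra_simps)
  then show ?thesis
    using set_borel_integral_eq_integral(2)[OF qi] by (simp add: q_def[abs_def])
qed

end

subsection \<open>Independence of the past\<close>

text \<open>Evaluated on a shifted path, such a sum depends on finitely many increments, to which
  independence and stationarity apply; both pass to the functional in the limit.\<close>

definition riemann_sum :: "nat \<Rightarrow> nat \<Rightarrow> (real \<Rightarrow> real) \<Rightarrow> real" where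
  "riemann_sum N n f = (\<Sum>k<N * Suc n. exp (- f (real (Suc k) / real (Suc n))) / real (Suc n))"

lemma riemann_sum_eq_integral:
  "(LBINT t:{0..<real N}. exp (- f (grid_point n t))) = riemann_sum N n f"
proof -
  define d where "d = real (Suc n)"
  have d: "0 < d" by (simp add: d_def)
  have eq: "indicator {0..<real N} t *\<^sub>R exp (- f (grid_point n t)) =
    (\<Sum>k<N * Suc n. indicator {real k / d..<real (Suc k) / d} t * exp (- f (real (Suc k) / d)))" for t
  proof (cases "t \<in> {0..<real N}")
    case True
    define m where "m = nat \<lfloor>d * t\<rfloor>"
    have m: "real m = of_int \<lfloor>d * t\<rfloor>" using True d by (simp add: m_def)
    have m2: "real m \<le> d * t" "d * t < real m + 1" unfolding m by linarith+
    have mN: "m < N * Suc n"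
    proof -
      have "d * t < d * real N" using True d by simp
      then have "real m < d * real N" using m2 by linarith
      also have "\<dots> = real (N * Suc n)" by (simp only: d_def of_nat_mult mult.commute)
      finally have "real m < real (N * Suc n)" .
      then show ?thesis by (simp only: of_nat_less_iff)
    qed
    have ind: "indicator {real k / d..<real (Suc k) / d} t = (if k = m then 1 else (0::real))" for k
    proof -
      have "t \<in> {real k / d..<real (Suc k) / d} \<longleftrightarrow> real k \<le> d * t \<and> d * t < real k + 1"
        using d by (auto simp: field_simps)
      also have "\<dots> \<longleftrightarrow> k = m" using m2 by auto
      finally show ?thesis by (simp add: indicator_def)
    qed
    have "(\<Sum>k<N * Suc n. indicator {real k / d..<real (Suc k) / d} t * exp (- f (real (Suc k) / d)))
      = (\<Sum>k<N * Suc n. if k = m then exp (- f (real (Suc m) / d)) else 0)"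
      by (intro sum.cong refl) (simp only: ind, simp)
    also have "\<dots> = exp (- f (real (Suc m) / d))"
      using mN by (subst sum.delta) (simp_all only: finite_lessThan lessThan_iff if_True)
    also have "real (Suc m) / d = grid_point n t" using m by (simp add: grid_point_def d_def)
    finally show ?thesis using True by simp
  next
    case False
    have "indicator {real k / d..<real (Suc k) / d} t = (0::real)" if "k < N * Suc n" for k
    proof -
      have "real (Suc k) \<le> real (N * Suc n)" using that by (simp only: of_nat_le_iff Suc_le_eq)
      then have "real (Suc k) / d \<le> real N" using d by (simp add: field_simps d_def)
      moreover have "0 \<le> real k / d" using d by simp
      ultimately show ?thesis using False by (auto simp: indicator_def)
    qed
    then show ?thesis using False by simp
  qed
  have int: "integrable lborel (\<lambda>t::real. indicator {real k / d..<real (Suc k) / d} t * c)" for k and c :: real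
    using d by (auto simp: integrable_indicator_iff emeasure_lborel_Ico divide_right_mono)
  have "(LBINT t:{0..<real N}. exp (- f (grid_point n t))) =
     (\<Sum>k<N * Suc n. (LBINT t. indicator {real k / d..<real (Suc k) / d} t * exp (- f (real (Suc k) / d))))"
    unfolding set_lebesgue_integral_def eq by (rule Bochner_Integration.integral_sum) (rule int)
  also have "\<dots> = riemann_sum N n f"
  proof -
    have "(LBINT t. indicator {real k / d..<real (Suc k) / d} t * c) = c / d" for k and c :: real
      using d by (simp add: field_simps measure_def emeasure_lborel_Ico divide_right_mono)
    then show ?thesis by (simp add: riemann_sum_def d_def)
  qed
  finally show ?thesis .
qed

lemma atLeastLessThan_subset_Ici: "{a..<b} \<subseteq> {a..}" for a b :: real
  by auto

lemma riemann_sum_tendsto: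
  assumes f: "cadlag f"
  shows "(\<lambda>n. riemann_sum N n f) \<longlonglongrightarrow> (LBINT t:{0..<real N}. exp (- f t))"
proof -
  obtain B where "\<forall>t\<in>{0..real N + 1}. \<bar>f t\<bar> \<le> B"
    using cadlag_bounded[OF f, of "real N + 1"] by auto
  note B = bspec[OF this]
  have "(\<lambda>n. LBINT t. indicator {0..<real N} t *\<^sub>R exp (- f (grid_point n t))) \<longlonglongrightarrow> (LBINT t. indicator {0..<real N} t *\<^sub>R exp (- f t))"
  proof (rule integral_dominated_convergence)
    show "integrable lborel (\<lambda>t::real. indicator {0..<real N} t * exp B)"
      by (auto simp: integrable_indicator_iff emeasure_lborel_Ico)
    show "(\<lambda>t. indicator {0..<real N} t *\<^sub>R exp (- f t)) \<in> borel_measurable lborel"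
      using set_measurable_exp_path[OF f, of "{0..<real N}"] atLeastLessThan_subset_Ici by simp
    show "(\<lambda>t. indicator {0..<real N} t *\<^sub>R exp (- f (grid_point n t))) \<in> borel_measurable lborel" for n
    proof -
      have [measurable]: "(\<lambda>t. f (max 0 t)) \<in> borel_measurable borel" by (rule borel_measurable_cadlag[OF f])
      have [measurable]: "grid_point n \<in> borel_measurable borel"
        unfolding grid_point_def[abs_def] by measurable
      have "(\<lambda>t. indicator {0..<real N} t *\<^sub>R exp (- (\<lambda>t. f (max 0 t)) (grid_point n t))) \<in> borel_measurable borel"
        by measurable
      also have "(\<lambda>t. indicator {0..<real N} t *\<^sub>R exp (- (\<lambda>t. f (max 0 t)) (grid_point n t))) =
          (\<lambda>t. indicator {0..<real N} t *\<^sub>R exp (- f (grid_point n t)))"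
        using grid_point_gt[of _ n] by (auto simp: fun_eq_iff indicator_def max_def) (meson le_less_trans less_imp_le order.trans)
      finally show ?thesis by simp
    qed
    show "AE t in lborel. (\<lambda>n. indicator {0..<real N} t *\<^sub>R exp (- f (grid_point n t))) \<longlonglongrightarrow> indicator {0..<real N} t *\<^sub>R exp (- f t)"
    proof (rule AE_I2)
      fix t :: real
      show "(\<lambda>n. indicator {0..<real N} t *\<^sub>R exp (- f (grid_point n t))) \<longlonglongrightarrow> indicator {0..<real N} t *\<^sub>R exp (- f t)"
      proof (cases "0 \<le> t")
        case True
        have "(\<lambda>n. f (grid_point n t)) \<longlonglongrightarrow> f t"
          by (rule filterlim_compose[OF cadlag_right[OF f True] filterlim_grid_point])
        then show ?thesis by (intro tendsto_intros)
      qed simp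
    qed
    show "AE t in lborel. norm (indicator {0..<real N} t *\<^sub>R exp (- f (grid_point n t))) \<le> indicator {0..<real N} t * exp B" for n
    proof (rule AE_I2)
      fix t :: real
      have "\<bar>f (grid_point n t)\<bar> \<le> B" if "t \<in> {0..<real N}"
      proof (rule B)
        have "inverse (real (Suc n)) \<le> 1" by (simp add: inverse_eq_divide)
        then show "grid_point n t \<in> {0..real N + 1}"
          using grid_point_gt[of t n] grid_point_le[of n t] that by auto
      qed
      then show "norm (indicator {0..<real N} t *\<^sub>R exp (- f (grid_point n t))) \<le> indicator {0..<real N} t * exp B"
        by (auto simp: indicator_def abs_le_iff)
    qed
  qed
  then show ?thesis
    by (simp add: riemann_sum_eq_integral[symmetric] set_lebesgue_integral_def)
qed

text \<open>A convergent integral is positive, so \<open>0 < path_functional f\<close> tells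
  convergence apart from the default value 0. The exponential turns divergence into an honest
  limit.\<close>

lemma exp_minus_path_functional_tendsto:
  assumes f: "cadlag f"
  shows "(\<lambda>N. exp (- (LBINT t:{0..<real N}. exp (- f t)))) \<longlonglongrightarrow>
    (if 0 < path_functional f then exp (- path_functional f) else 0)"
proof -
  define J where "J N = (LBINT t:{0..<real N}. exp (- f t))" for N
  have J: "ennreal (J N) = (\<integral>\<^sup>+t. ennreal (indicator {0..<real N} t *\<^sub>R exp (- f t)) \<partial>lborel)" for N
  proof -
    have "integrable lborel (\<lambda>t. indicator {0..<real N} t *\<^sub>R exp (- f t))"
      by (rule set_integrable_subset[OF set_integrable_exp_path[OF f, of 0 "real N"], of "{0..<real N}", unfolded set_integrable_def]) auto
    then show ?thesis
      unfolding J_def set_lebesgue_integral_def by (intro nn_integral_eq_integral[symmetric]) auto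
  qed
  have Jn: "0 \<le> J N" for N unfolding J_def set_lebesgue_integral_def by (intro integral_nonneg_AE AE_I2) auto
  have inc: "incseq J"
  proof (rule incseq_SucI)
    fix N
    have "ennreal (J N) \<le> ennreal (J (Suc N))"
      unfolding J by (intro nn_integral_mono ennreal_leI) (auto simp: indicator_def)
    then show "J N \<le> J (Suc N)" using Jn by simp
  qed
  have lim: "(\<lambda>N. ennreal (J N)) \<longlonglongrightarrow> (\<integral>\<^sup>+t. ennreal (indicator {0..} t *\<^sub>R exp (- f t)) \<partial>lborel)"
    unfolding J
  proof (rule nn_integral_LIMSEQ)
    show "incseq (\<lambda>N t. ennreal (indicator {0..<real N} t *\<^sub>R exp (- f t)))"
      by (auto simp: incseq_def le_fun_def indicator_def intro!: ennreal_leI)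
    show "(\<lambda>t. ennreal (indicator {0..<real N} t *\<^sub>R exp (- f t))) \<in> borel_measurable lborel" for N
      using set_measurable_exp_path[OF f, of "{0..<real N}"] atLeastLessThan_subset_Ici by simp
    show "(\<lambda>N. ennreal (indicator {0..<real N} t *\<^sub>R exp (- f t))) \<longlonglongrightarrow> ennreal (indicator {0..} t *\<^sub>R exp (- f t))" for t
    proof (rule tendsto_eventually)
      obtain N0 :: nat where N0: "t < real N0" using reals_Archimedean2 by blast
      show "\<forall>\<^sub>F N in sequentially. ennreal (indicator {0..<real N} t *\<^sub>R exp (- f t)) = ennreal (indicator {0..} t *\<^sub>R exp (- f t))"
        using eventually_ge_at_top[of N0]
      proof eventually_elim
        case (elim N)
        then have "t < real N" using N0 by (meson less_le_trans of_nat_le_iff)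
        then show ?case by (auto simp: indicator_def)
      qed
    qed
  qed
  have m: "(\<lambda>t. indicator {0..} t *\<^sub>R exp (- f t)) \<in> borel_measurable lborel"
    using set_measurable_exp_path[OF f, of "{0..}"] by auto
  show ?thesis
  proof (cases "set_integrable lborel {0..} (\<lambda>t. exp (- f t))")
    case True
    then have "(\<integral>\<^sup>+t. ennreal (indicator {0..} t *\<^sub>R exp (- f t)) \<partial>lborel) = ennreal (path_functional f)"
      unfolding path_functional_def set_lebesgue_integral_def set_integrable_def by (intro nn_integral_eq_integral) auto
    then have "J \<longlonglongrightarrow> path_functional f"
      using lim path_functional_nonneg[OF f] Jn by simp
    then have "(\<lambda>N. exp (- J N)) \<longlonglongrightarrow> exp (- path_functional f)" by (intro tendsto_intros)
    then show ?thesis using path_functional_pos[OF f True] by (simp add: J_def)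
  next
    case False
    then have "(\<integral>\<^sup>+t. ennreal (norm (indicator {0..} t *\<^sub>R exp (- f t))) \<partial>lborel) = \<infinity>"
      using m by (auto simp: set_integrable_def integrable_iff_bounded not_less top_unique)
    then have "(\<integral>\<^sup>+t. ennreal (indicator {0..} t *\<^sub>R exp (- f t)) \<partial>lborel) = \<infinity>"
      by simp
    then have "(\<lambda>N. ennreal (J N)) \<longlonglongrightarrow> \<top>" using lim by simp
    then have "filterlim J at_top sequentially"
      using ennreal_tendsto_top_eq_at_top[of J sequentially] by simp
    then have "(\<lambda>N. exp (- J N)) \<longlonglongrightarrow> 0"
      by (intro filterlim_compose[OF exp_at_bot] filterlim_compose[OF filterlim_uminus_at_bot_at_top])
    then show ?thesis using path_functional_not_integrable[OF f False] by (simp add: J_def)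
  qed
qed

text \<open>Pointwise limits preserve characteristic functions by bounded convergence, and these
  determine the law; the two sequences may live on different spaces.\<close>

lemma distr_eq_limit:
  fixes V :: "nat \<Rightarrow> 'a \<Rightarrow> real" and W :: "nat \<Rightarrow> 'b \<Rightarrow> real"
  assumes M: "prob_space M" and N: "prob_space N"
    and [measurable]: "\<And>n. V n \<in> borel_measurable M" "\<And>n. W n \<in> borel_measurable N"
      "V' \<in> borel_measurable M" "W' \<in> borel_measurable N"
    and eq: "\<And>n. distr M borel (V n) = distr N borel (W n)"
    and V: "\<And>\<omega>. \<omega> \<in> space M \<Longrightarrow> (\<lambda>n. V n \<omega>) \<longlonglongrightarrow> V' \<omega>"
    and W: "\<And>\<omega>. \<omega> \<in> space N \<Longrightarrow> (\<lambda>n. W n \<omega>) \<longlonglongrightarrow> W' \<omega>"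
  shows "distr M borel V' = distr N borel W'"
proof -
  interpret M: prob_space M by fact
  interpret N: prob_space N by fact
  have "char (distr M borel V') = char (distr N borel W')"
  proof
    fix u
    have "(\<lambda>n. CLINT \<omega>|M. iexp (u * V n \<omega>)) \<longlonglongrightarrow> (CLINT \<omega>|M. iexp (u * V' \<omega>))"
      by (rule integral_dominated_convergence[where w = "\<lambda>_. 1"]) (auto intro!: AE_I2 tendsto_intros V)
    moreover have "(\<lambda>n. CLINT \<omega>|N. iexp (u * W n \<omega>)) \<longlonglongrightarrow> (CLINT \<omega>|N. iexp (u * W' \<omega>))"
      by (rule integral_dominated_convergence[where w = "\<lambda>_. 1"]) (auto intro!: AE_I2 tendsto_intros W)
    moreover have "(CLINT \<omega>|M. iexp (u * V n \<omega>)) = (CLINT \<omega>|N. iexp (u * W n \<omega>))" for n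
    proof -
      have "(CLINT \<omega>|M. iexp (u * V n \<omega>)) = (CLINT x|distr M borel (V n). iexp (u * x))"
        by (subst integral_distr) auto
      also have "\<dots> = (CLINT \<omega>|N. iexp (u * W n \<omega>))"
        unfolding eq by (subst integral_distr) auto
      finally show ?thesis .
    qed
    ultimately have "(CLINT \<omega>|M. iexp (u * V' \<omega>)) = (CLINT \<omega>|N. iexp (u * W' \<omega>))"
      using LIMSEQ_unique by fastforce
    then show "char (distr M borel V') u = char (distr N borel W') u"
      unfolding char_def by (subst (1 2) integral_distr) auto
  qed
  then show ?thesis
    by (intro Levy_uniqueness M.real_distribution_distr N.real_distribution_distr) auto
qed

text \<open>Conditioning on \<open>U \<in> B\<close> reduces independence to equality of laws: under
  the conditioned measure \<open>V n\<close> is distributed as \<open>W n\<close> is under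
  \<open>M\<close>, and \<open>distr_eq_limit\<close> applies. A null event cannot be conditioned
  on, but makes both sides 0.\<close>

lemma (in prob_space) independent_copy_limit:
  fixes U :: "'a \<Rightarrow> real" and V W :: "nat \<Rightarrow> 'a \<Rightarrow> real"
  assumes [measurable]: "random_variable borel U" "\<And>n. random_variable borel (V n)" "\<And>n. random_variable borel (W n)"
      "random_variable borel V'" "random_variable borel W'"
    and eq: "\<And>n B C. B \<in> sets borel \<Longrightarrow> C \<in> sets borel \<Longrightarrow>
       prob ({\<omega> \<in> space M. U \<omega> \<in> B} \<inter> {\<omega> \<in> space M. V n \<omega> \<in> C}) = prob {\<omega> \<in> space M. U \<omega> \<in> B} * prob {\<omega> \<in> space M. W n \<omega> \<in> C}"
    and V: "\<And>\<omega>. \<omega> \<in> space M \<Longrightarrow> (\<lambda>n. V n \<omega>) \<longlonglongrightarrow> V' \<omega>"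
    and W: "\<And>\<omega>. \<omega> \<in> space M \<Longrightarrow> (\<lambda>n. W n \<omega>) \<longlonglongrightarrow> W' \<omega>"
    and B: "B \<in> sets borel" and C: "C \<in> sets borel"
  shows "prob ({\<omega> \<in> space M. U \<omega> \<in> B} \<inter> {\<omega> \<in> space M. V' \<omega> \<in> C}) = prob {\<omega> \<in> space M. U \<omega> \<in> B} * prob {\<omega> \<in> space M. W' \<omega> \<in> C}"
proof -
  define A where "A = {\<omega> \<in> space M. U \<omega> \<in> B}"
  have [measurable]: "A \<in> events" unfolding A_def using B by measurable
  show ?thesis
  proof (cases "prob A = 0")
    case True
    have "prob (A \<inter> {\<omega> \<in> space M. V' \<omega> \<in> C}) \<le> prob A" by (intro finite_measure_mono) auto
    then show ?thesis using True by (simp add: A_def[symmetric] measure_le_0_iff)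
  next
    case False
    define N where "N = uniform_measure M A"
    have N: "prob_space N"
      unfolding N_def using False by (intro prob_space_uniform_measure) (auto simp: emeasure_eq_measure)
    have sN [measurable_cong]: "sets N = sets M" by (simp add: N_def)
    have spN: "space N = space M" by (simp add: N_def)
    have meas: "measure N {\<omega> \<in> space M. X \<omega> \<in> D} = prob (A \<inter> {\<omega> \<in> space M. X \<omega> \<in> D}) / prob A"
      if "random_variable borel X" "D \<in> sets borel" for X :: "'a \<Rightarrow> real" and D
    proof -
      have "{\<omega> \<in> space M. X \<omega> \<in> D} \<in> events" using that by measurable
      then show ?thesis unfolding N_def by (subst measure_uniform_measure) (use False in \<open>auto simp: emeasure_eq_measure\<close>)
    qed
    have "distr N borel V' = distr M borel W'"
    proof (rule distr_eq_limit[OF N prob_space_axioms])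
      fix n
      show "distr N borel (V n) = distr M borel (W n)"
      proof (rule measure_eqI)
        fix D assume "D \<in> sets (distr N borel (V n))"
        then have D [measurable]: "D \<in> sets borel" by simp
        interpret N: prob_space N by fact
        have "emeasure (distr N borel (V n)) D = emeasure N {\<omega> \<in> space M. V n \<omega> \<in> D}"
          by (subst emeasure_distr) (auto simp: spN intro!: arg_cong[where f = "emeasure N"])
        also have "\<dots> = ennreal (prob (A \<inter> {\<omega> \<in> space M. V n \<omega> \<in> D}) / prob A)"
          unfolding N.emeasure_eq_measure by (subst meas) auto
        also have "\<dots> = ennreal (prob {\<omega> \<in> space M. W n \<omega> \<in> D})"
          unfolding A_def using eq[OF B D, of n] False by (simp add: A_def)
        also have "\<dots> = emeasure (distr M borel (W n)) D"
          by (subst emeasure_distr) (auto simp: emeasure_eq_measure intro!: arg_cong[where f = prob])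
        finally show "emeasure (distr N borel (V n)) D = emeasure (distr M borel (W n)) D" .
      qed simp
    qed (use V W in \<open>auto simp: spN\<close>)
    then have "measure (distr N borel V') C = measure (distr M borel W') C" by simp
    also have "measure (distr N borel V') C = measure N {\<omega> \<in> space M. V' \<omega> \<in> C}"
      using C by (subst measure_distr) (auto simp: spN intro!: arg_cong[where f = "measure N"])
    also have "\<dots> = prob (A \<inter> {\<omega> \<in> space M. V' \<omega> \<in> C}) / prob A"
      using C by (intro meas) auto
    also have "measure (distr M borel W') C = prob {\<omega> \<in> space M. W' \<omega> \<in> C}"
      using C by (subst measure_distr) (auto intro!: arg_cong[where f = prob])
    finally show ?thesis using False by (simp add: A_def[symmetric] field_simps)
  qed
qed

section \<open>Independence and stationarity of the remaining functional\<close>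

lemma exp_functional_eq: "exp_functional Y \<omega> = path_functional (\<lambda>t. Y t \<omega>)"
  by (simp add: exp_functional_def path_functional_def)

lemma path_functional_shift: "path_functional (path_shift 0 f) = exp (f 0) * path_functional f"
proof -
  have "path_functional (path_shift 0 f) = (LBINT t:{0..}. exp (f 0) * exp (- f t))"
    unfolding path_functional_def path_shift_def by (simp add: exp_diff exp_minus divide_inverse)
  then show ?thesis by (simp add: path_functional_def)
qed

context levy_process
begin

definition remaining :: "real \<Rightarrow> 'a \<Rightarrow> real" where
  "remaining s \<omega> = path_functional (path_shift s (\<lambda>t. Y t \<omega>))"

definition increment :: "nat \<Rightarrow> real \<Rightarrow> nat \<Rightarrow> 'a \<Rightarrow> real" where
  "increment n s j \<omega> = Y (s + real (Suc j) / real (Suc n)) \<omega> - Y (s + real j / real (Suc n)) \<omega>"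

text \<open>The Riemann sum as a function of the increments alone: the sum over
  \<open>j \<le> k\<close> telescopes to the shifted path at the right end point
  \<open>(k + 1) / (n + 1)\<close> of the k-th cell.\<close>

definition partial_functional :: "nat \<Rightarrow> nat \<Rightarrow> (nat \<Rightarrow> real) \<Rightarrow> real" where
  "partial_functional N n \<delta> = exp (- (\<Sum>k<N * Suc n. exp (- (\<Sum>j\<le>k. \<delta> j)) / real (Suc n)))"

lemma borel_measurable_Y_pair: "(\<lambda>x. Y (max 0 (fst x)) (snd x)) \<in> borel_measurable (borel \<Otimes>\<^sub>M M)"
  using borel_measurable_right_continuous_process[of Y M] random_variable cadlag_paths cadlag_right by blast

lemma borel_measurable_remaining_pair: "(\<lambda>x. remaining (max 0 (fst x)) (snd x)) \<in> borel_measurable (borel \<Otimes>\<^sub>M M)"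
proof -
  let ?Y = "\<lambda>x. Y (max 0 (fst x)) (snd x)"
  have [measurable]: "?Y \<in> borel_measurable (borel \<Otimes>\<^sub>M M)" by (rule borel_measurable_Y_pair)
  have "(\<lambda>(x, t). indicator {0..} t *\<^sub>R exp (- (?Y (max 0 (fst x) + t, snd x) - ?Y (fst x, snd x)))) \<in> borel_measurable ((borel \<Otimes>\<^sub>M M) \<Otimes>\<^sub>M lborel)"
    by measurable
  then have "(\<lambda>x. LBINT t. indicator {0..} t *\<^sub>R exp (- (?Y (max 0 (fst x) + t, snd x) - ?Y (fst x, snd x)))) \<in> borel_measurable (borel \<Otimes>\<^sub>M M)"
    by (rule sigma_finite_measure.borel_measurable_lebesgue_integral[OF sigma_finite_lborel])
  also have "(\<lambda>x. LBINT t. indicator {0..} t *\<^sub>R exp (- (?Y (max 0 (fst x) + t, snd x) - ?Y (fst x, snd x)))) =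
     (\<lambda>x. remaining (max 0 (fst x)) (snd x))"
    unfolding remaining_def path_functional_def path_shift_def set_lebesgue_integral_def
    by (intro ext Bochner_Integration.integral_cong refl) (auto simp: indicator_def)
  finally show ?thesis .
qed

lemma random_variable_remaining [measurable]: "0 \<le> s \<Longrightarrow> random_variable borel (remaining s)"
proof -
  assume s: "0 \<le> s"
  have "(\<lambda>\<omega>. (\<lambda>x. remaining (max 0 (fst x)) (snd x)) (s, \<omega>)) \<in> borel_measurable M"
    by (rule measurable_compose[OF _ borel_measurable_remaining_pair]) measurable
  then show ?thesis using s by (simp add: max_def)
qed

lemma random_variable_exp_functional: "random_variable borel (exp_functional Y)"
proof -
  have "(\<lambda>\<omega>. exp (- Y 0 \<omega>) * remaining 0 \<omega>) \<in> borel_measurable M"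
    using random_variable[of 0] by measurable
  also have "(\<lambda>\<omega>. exp (- Y 0 \<omega>) * remaining 0 \<omega>) = exp_functional Y"
    by (auto simp: fun_eq_iff remaining_def exp_functional_eq path_functional_shift exp_minus)
  finally show ?thesis .
qed

lemma remaining_0_eq: "AE \<omega> in M. remaining 0 \<omega> = exp_functional Y \<omega>"
  using start by eventually_elim (simp add: remaining_def exp_functional_eq path_functional_shift)

lemma random_variable_increment: "0 \<le> s \<Longrightarrow> random_variable borel (increment n s j)"
  unfolding increment_def[abs_def] by (intro borel_measurable_diff random_variable) auto

lemma distr_increment:
  assumes s: "0 \<le> s"
  shows "distr M borel (increment n s j) = distr M borel (Y (inverse (real (Suc n))))"
proof -
  have "s + real (Suc j) / real (Suc n) = s + real j / real (Suc n) + inverse (real (Suc n))"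
    by (simp add: field_simps)
  then have "increment n s j = (\<lambda>\<omega>. Y ((s + real j / real (Suc n)) + inverse (real (Suc n))) \<omega> - Y (s + real j / real (Suc n)) \<omega>)"
    by (simp only: increment_def[abs_def])
  then show ?thesis using stationary_increments[of "s + real j / real (Suc n)" "inverse (real (Suc n))"] s by simp
qed

lemma indep_vars_increment:
  assumes s: "0 \<le> s" shows "indep_vars (\<lambda>_. borel) (increment n s) {..<m}"
proof -
  have "indep_vars (\<lambda>_. borel) (\<lambda>i \<omega>. Y (s + real (Suc i) / real (Suc n)) \<omega> - Y (s + real i / real (Suc n)) \<omega>) {..<m}"
    using indep_increments[of "\<lambda>i. s + real i / real (Suc n)" m] s by (simp add: divide_strict_right_mono)
  then show ?thesis by (simp add: increment_def[abs_def])
qed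

lemma distr_increments:
  assumes s: "0 \<le> s"
  shows "distr M (PiM {..<Suc m} (\<lambda>_. borel)) (\<lambda>\<omega>. \<lambda>j\<in>{..<Suc m}. increment n s j \<omega>) =
    PiM {..<Suc m} (\<lambda>_. distr M borel (Y (inverse (real (Suc n)))))"
proof -
  have "distr M (PiM {..<Suc m} (\<lambda>_. borel)) (\<lambda>\<omega>. \<lambda>j\<in>{..<Suc m}. increment n s j \<omega>) = PiM {..<Suc m} (\<lambda>j. distr M borel (increment n s j))"
    using indep_vars_increment[OF s, of n "Suc m"] random_variable_increment[OF s]
    by (subst (asm) indep_vars_iff_distr_eq_PiM) auto
  then show ?thesis by (simp add: distr_increment[OF s])
qed

lemma measurable_partial_functional:
  "partial_functional N n \<in> borel_measurable (PiM {..<N * Suc n} (\<lambda>_. borel))"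
  unfolding partial_functional_def[abs_def] by measurable

lemma partial_functional_restrict: "partial_functional N n (restrict \<delta> {..<N * Suc n}) = partial_functional N n \<delta>"
proof -
  have "(\<Sum>j\<le>k. restrict \<delta> {..<N * Suc n} j) = (\<Sum>j\<le>k. \<delta> j)" if "k < N * Suc n" for k
    using that by (intro sum.cong) auto
  then show ?thesis by (simp add: partial_functional_def)
qed

lemma partial_functional_increment:
  "partial_functional N n (\<lambda>j. increment n s j \<omega>) = exp (- riemann_sum N n (path_shift s (\<lambda>t. Y t \<omega>)))"
proof -
  have "(\<Sum>j\<le>k. increment n s j \<omega>) = path_shift s (\<lambda>t. Y t \<omega>) (real (Suc k) / real (Suc n))" for k
  proof (induction k)
    case (Suc k)
    then show ?case by (simp add: increment_def path_shift_def del: of_nat_Suc)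
  qed (simp add: increment_def path_shift_def)
  then show ?thesis by (simp add: partial_functional_def riemann_sum_def)
qed

lemma random_variable_partial: "0 \<le> s \<Longrightarrow> random_variable borel (\<lambda>\<omega>. partial_functional N n (\<lambda>j. increment n s j \<omega>))"
  unfolding partial_functional_def using random_variable_increment by measurable

text \<open>The joint law of the increments is a product that does not involve \<open>s\<close>, so
  neither does the law of a function of them. The horizon is \<open>Suc N\<close> to keep the index
  set non-empty; the limit is unaffected.\<close>

lemma distr_partial:
  assumes s: "0 \<le> s"
  shows "distr M borel (\<lambda>\<omega>. partial_functional (Suc N) n (\<lambda>j. increment n s j \<omega>)) =
    distr (PiM {..<Suc N * Suc n} (\<lambda>_. distr M borel (Y (inverse (real (Suc n)))))) borel (partial_functional (Suc N) n)"
proof -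
  let ?P = "PiM {..<Suc N * Suc n} (\<lambda>_. borel :: real measure)"
  obtain m where m: "Suc N * Suc n = Suc m" by simp
  have pr: "partial_functional (Suc N) n (\<lambda>j\<in>{..<Suc m}. \<delta> j) = partial_functional (Suc N) n \<delta>" for \<delta>
    using partial_functional_restrict[of "Suc N" n \<delta>] unfolding m .
  have r: "(\<lambda>\<omega>. \<lambda>j\<in>{..<Suc N * Suc n}. increment n s j \<omega>) \<in> measurable M ?P"
    by (intro measurable_restrict random_variable_increment s)
  have "distr (distr M ?P (\<lambda>\<omega>. \<lambda>j\<in>{..<Suc N * Suc n}. increment n s j \<omega>)) borel (partial_functional (Suc N) n)
     = distr M borel (partial_functional (Suc N) n \<circ> (\<lambda>\<omega>. \<lambda>j\<in>{..<Suc N * Suc n}. increment n s j \<omega>))"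
    by (rule distr_distr[OF measurable_partial_functional r])
  then show ?thesis
    using distr_increments[OF s, of m n] by (simp only: comp_def pr m)
qed

lemma indep_var_partial:
  assumes s: "0 < s"
  shows "indep_var borel (\<lambda>\<omega>. Y s \<omega> - Y 0 \<omega>) borel (\<lambda>\<omega>. partial_functional N n (\<lambda>j. increment n s j \<omega>))"
proof -
  define m where "m = N * Suc n"
  \<comment> \<open>Time 0 is put in front of the grid starting at \<open>s\<close>: the increment
    over the past gets index 0 and all later ones are shifted by one.\<close>
  define t where "t i = (case i of 0 \<Rightarrow> 0 | Suc k \<Rightarrow> s + real k / real (Suc n))" for i
  define X where "X i \<omega> = Y (t (Suc i)) \<omega> - Y (t i) \<omega>" for i \<omega>
  have ind: "indep_vars (\<lambda>_. borel) X {..<Suc m}"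
    unfolding X_def
  proof (rule indep_increments)
    show "t i < t (Suc i)" for i
      using s by (cases i) (auto simp: t_def divide_strict_right_mono)
  qed (simp add: t_def)
  have X0: "X 0 \<omega> = Y s \<omega> - Y 0 \<omega>" and XS: "X (Suc j) \<omega> = increment n s j \<omega>" for j \<omega>
    by (simp_all add: X_def t_def increment_def)
  let ?A = "{0::nat}" and ?B = "Suc ` {..<m}"
  have iv: "indep_var (PiM ?A (\<lambda>_. borel)) (\<lambda>\<omega>. restrict (\<lambda>i. X i \<omega>) ?A) (PiM ?B (\<lambda>_. borel)) (\<lambda>\<omega>. restrict (\<lambda>i. X i \<omega>) ?B)"
    by (rule indep_var_restrict[OF ind]) auto
  have mA: "(\<lambda>x. x 0) \<in> borel_measurable (PiM ?A (\<lambda>_. borel :: real measure))" by measurable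
  have mB: "(\<lambda>x. partial_functional N n (\<lambda>j. x (Suc j))) \<in> borel_measurable (PiM ?B (\<lambda>_. borel))"
  proof -
    have "(\<lambda>x. \<lambda>j\<in>{..<m}. x (Suc j)) \<in> measurable (PiM ?B (\<lambda>_. borel :: real measure)) (PiM {..<m} (\<lambda>_. borel))"
      by (intro measurable_restrict measurable_component_singleton) auto
    from measurable_compose[OF this] measurable_partial_functional[of N n]
    have "(\<lambda>x. partial_functional N n (\<lambda>j\<in>{..<m}. x (Suc j))) \<in> borel_measurable (PiM ?B (\<lambda>_. borel))"
      by (simp add: m_def)
    then show ?thesis using partial_functional_restrict[of N n "\<lambda>j. x (Suc j)" for x] by (simp add: m_def)
  qed
  have "partial_functional N n (\<lambda>j. restrict (\<lambda>i. X i \<omega>) ?B (Suc j)) = partial_functional N n (\<lambda>j. increment n s j \<omega>)" for \<omega>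
    by (subst (1 2) partial_functional_restrict[symmetric]) (auto simp: m_def XS intro!: arg_cong[where f = "partial_functional N n"])
  with indep_var_compose[OF iv mA mB] show ?thesis
    by (simp add: comp_def X0)
qed

lemma partial_functional_tendsto:
  assumes s: "0 \<le> s" and \<omega>: "\<omega> \<in> space M"
  shows "(\<lambda>n. partial_functional N n (\<lambda>j. increment n s j \<omega>)) \<longlonglongrightarrow>
    exp (- (LBINT t:{0..<real N}. exp (- path_shift s (\<lambda>t. Y t \<omega>) t)))"
  unfolding partial_functional_increment
  by (intro tendsto_intros riemann_sum_tendsto cadlag_shift cadlag_paths s \<omega>)

text \<open>Divergence is encoded by the value 0 both in \<open>path_functional\<close> and in the limit of \<open>partial_functional\<close>.\<close>
definition coded :: "real \<Rightarrow> real" where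
  "coded x = (if 0 < x then exp (- x) else 0)"

text \<open>The product formula holds for Riemann sums and survives two successive limits, first in
  the mesh and then in the horizon. Working with exponentials keeps both limits finite on every
  path, including those with divergent integral.\<close>

lemma remaining_coded:
  assumes s: "0 < s" and B: "B \<in> sets borel" and C: "C \<in> sets borel"
  shows "prob ({\<omega> \<in> space M. Y s \<omega> - Y 0 \<omega> \<in> B} \<inter> {\<omega> \<in> space M. coded (remaining s \<omega>) \<in> C}) =
     prob {\<omega> \<in> space M. Y s \<omega> - Y 0 \<omega> \<in> B} * prob {\<omega> \<in> space M. coded (remaining 0 \<omega>) \<in> C}"
proof -
  have U: "random_variable borel (\<lambda>\<omega>. Y s \<omega> - Y 0 \<omega>)" using s by (intro borel_measurable_diff random_variable) auto
  define V where "V s n N \<omega> = partial_functional (Suc N) n (\<lambda>j. increment n s j \<omega>)" for s n N \<omega>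
  define J where "J s N \<omega> = exp (- (LBINT t:{0..<real (Suc N)}. exp (- path_shift s (\<lambda>t. Y t \<omega>) t)))" for s N \<omega>
  have VJ: "(\<lambda>n. V r n N \<omega>) \<longlonglongrightarrow> J r N \<omega>" if "0 \<le> r" "\<omega> \<in> space M" for r N \<omega>
    unfolding V_def J_def by (rule partial_functional_tendsto[OF that])
  have Vm: "random_variable borel (V r n N)" if "0 \<le> r" for r n N
    unfolding V_def by (rule random_variable_partial[OF that])
  have Jm: "random_variable borel (J r N)" if "0 \<le> r" for r N
    by (rule borel_measurable_LIMSEQ_real[OF VJ Vm]) (use that in auto)
  have JR: "(\<lambda>N. J r N \<omega>) \<longlonglongrightarrow> coded (remaining r \<omega>)" if "0 \<le> r" "\<omega> \<in> space M" for r \<omega>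
    unfolding J_def coded_def remaining_def
    by (rule LIMSEQ_Suc[OF exp_minus_path_functional_tendsto[OF cadlag_shift[OF cadlag_paths[OF that(2)] that(1)]]])
  have Rm: "random_variable borel (\<lambda>\<omega>. coded (remaining r \<omega>))" if "0 \<le> r" for r
    unfolding coded_def using random_variable_remaining[OF that] by measurable
  have base: "prob ({\<omega> \<in> space M. Y s \<omega> - Y 0 \<omega> \<in> B} \<inter> {\<omega> \<in> space M. V s n N \<omega> \<in> C}) =
      prob {\<omega> \<in> space M. Y s \<omega> - Y 0 \<omega> \<in> B} * prob {\<omega> \<in> space M. V 0 n N \<omega> \<in> C}"
    if "B \<in> sets borel" "C \<in> sets borel" for n N B C
  proof -
    have iv: "indep_var borel (\<lambda>\<omega>. Y s \<omega> - Y 0 \<omega>) borel (V s n N)"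
      unfolding V_def by (rule indep_var_partial[OF s])
    have "prob ((\<lambda>\<omega>. (Y s \<omega> - Y 0 \<omega>, V s n N \<omega>)) -` (B \<times> C) \<inter> space M) =
      prob ((\<lambda>\<omega>. Y s \<omega> - Y 0 \<omega>) -` B \<inter> space M) * prob (V s n N -` C \<inter> space M)"
      using indep_varD[OF iv that] .
    moreover have "prob (V s n N -` C \<inter> space M) = prob (V 0 n N -` C \<inter> space M)"
    proof -
      have "distr M borel (V s n N) = distr M borel (V 0 n N)"
        unfolding V_def using distr_partial[of s N n] distr_partial[of 0 N n] s by simp
      then have "measure (distr M borel (V s n N)) C = measure (distr M borel (V 0 n N)) C" by simp
      then show ?thesis using Vm[of s] Vm[of 0] s that by (simp add: measure_distr)
    qed
    ultimately show ?thesis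
      by (simp add: vimage_def Int_def conj_ac)
  qed
  have step: "prob ({\<omega> \<in> space M. Y s \<omega> - Y 0 \<omega> \<in> B} \<inter> {\<omega> \<in> space M. J s N \<omega> \<in> C}) =
      prob {\<omega> \<in> space M. Y s \<omega> - Y 0 \<omega> \<in> B} * prob {\<omega> \<in> space M. J 0 N \<omega> \<in> C}"
    if "B \<in> sets borel" "C \<in> sets borel" for N B C
    by (rule independent_copy_limit[OF U Vm Vm Jm Jm base VJ VJ that]) (use s in auto)
  show ?thesis
    by (rule independent_copy_limit[OF U Jm Jm Rm Rm step JR JR B C]) (use s in auto)
qed

lemma remaining_nonneg: "0 \<le> s \<Longrightarrow> \<omega> \<in> space M \<Longrightarrow> 0 \<le> remaining s \<omega>"
  unfolding remaining_def by (rule path_functional_nonneg[OF cadlag_shift[OF cadlag_paths]])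

lemma remaining_indep_aux:
  assumes s: "0 < s" and B: "B \<in> sets borel" and C: "C \<in> sets borel"
  shows "prob ({\<omega> \<in> space M. Y s \<omega> - Y 0 \<omega> \<in> B} \<inter> {\<omega> \<in> space M. remaining s \<omega> \<in> C}) =
     prob {\<omega> \<in> space M. Y s \<omega> - Y 0 \<omega> \<in> B} * prob {\<omega> \<in> space M. remaining 0 \<omega> \<in> C}"
proof -
  \<comment> \<open>Inverts \<open>coded\<close> on nonnegative numbers: positive values have codes
    strictly between 0 and 1, and the code 0 is left for the value 0.\<close>
  define decode where "decode z = (if 0 < z then - ln z else 0)" for z :: real
  have dec: "decode (coded x) = x" if "0 \<le> x" for x
    using that by (auto simp: decode_def coded_def)
  have [measurable]: "decode \<in> borel_measurable borel" unfolding decode_def[abs_def] by measurable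
  have "decode -` C \<in> sets borel" using measurable_sets[of decode borel borel C] C by simp
  from remaining_coded[OF s B this] show ?thesis
    using s by (simp add: dec remaining_nonneg cong: conj_cong)
qed

lemma distr_remaining:
  assumes s: "0 < s" shows "distr M borel (remaining s) = distr M borel (remaining 0)"
proof (rule measure_eqI)
  fix C assume "C \<in> sets (distr M borel (remaining s))"
  then have C: "C \<in> sets borel" by simp
  have "prob {\<omega> \<in> space M. remaining s \<omega> \<in> C} = prob {\<omega> \<in> space M. remaining 0 \<omega> \<in> C}"
    using remaining_indep_aux[OF s _ C, of UNIV] by (simp add: prob_space Int_def)
  then show "emeasure (distr M borel (remaining s)) C = emeasure (distr M borel (remaining 0)) C"
    using s C by (subst (1 2) emeasure_distr) (auto simp: emeasure_eq_measure vimage_def Int_def conj_commute)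
qed simp

lemma indep_var_remaining:
  assumes s: "0 < s" shows "indep_var borel (\<lambda>\<omega>. Y s \<omega> - Y 0 \<omega>) borel (remaining s)"
proof -
  have U [measurable]: "random_variable borel (\<lambda>\<omega>. Y s \<omega> - Y 0 \<omega>)" using s by (intro borel_measurable_diff random_variable) auto
  have R [measurable]: "random_variable borel (remaining s)" using s by simp
  have eq: "distr M borel (\<lambda>\<omega>. Y s \<omega> - Y 0 \<omega>) \<Otimes>\<^sub>M distr M borel (remaining s) =
     distr M (borel \<Otimes>\<^sub>M borel) (\<lambda>\<omega>. (Y s \<omega> - Y 0 \<omega>, remaining s \<omega>))"
  proof (rule pair_measure_eqI)
    show "sigma_finite_measure (distr M borel (\<lambda>\<omega>. Y s \<omega> - Y 0 \<omega>))" "sigma_finite_measure (distr M borel (remaining s))"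
      by (auto intro!: prob_space_imp_sigma_finite prob_space_distr)
    fix B C assume "B \<in> sets (distr M borel (\<lambda>\<omega>. Y s \<omega> - Y 0 \<omega>))" "C \<in> sets (distr M borel (remaining s))"
    then have BC [measurable]: "B \<in> sets borel" "C \<in> sets borel" by auto
    have "prob {\<omega> \<in> space M. remaining s \<omega> \<in> C} = prob {\<omega> \<in> space M. remaining 0 \<omega> \<in> C}"
      using remaining_indep_aux[OF s _ BC(2), of UNIV] by (simp add: prob_space Int_def)
    then have "prob {\<omega> \<in> space M. Y s \<omega> - Y 0 \<omega> \<in> B} * prob {\<omega> \<in> space M. remaining s \<omega> \<in> C} =
       prob ({\<omega> \<in> space M. Y s \<omega> - Y 0 \<omega> \<in> B} \<inter> {\<omega> \<in> space M. remaining s \<omega> \<in> C})"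
      using remaining_indep_aux[OF s BC] by simp
    then show "emeasure (distr M borel (\<lambda>\<omega>. Y s \<omega> - Y 0 \<omega>)) B * emeasure (distr M borel (remaining s)) C =
       emeasure (distr M (borel \<Otimes>\<^sub>M borel) (\<lambda>\<omega>. (Y s \<omega> - Y 0 \<omega>, remaining s \<omega>))) (B \<times> C)"
      by (subst (1 2 3) emeasure_distr)
        (auto simp: emeasure_eq_measure ennreal_mult[symmetric] vimage_def Int_def conj_ac)
  qed (simp add: sets_pair_measure_cong[of "distr M borel (\<lambda>\<omega>. Y s \<omega> - Y 0 \<omega>)" borel "distr M borel (remaining s)" borel])
  then show ?thesis
    by (subst indep_var_distribution_eq) auto
qed

end

subsection \<open>Small times and the Levy measure\<close>

lemma iexp_diff_linear_bound: "cmod (iexp z - 1 - \<i> * of_real z) \<le> z\<^sup>2 / 2"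
proof -
  have "cmod (iexp z - (\<Sum>k\<le>1. (\<i> * z)^k / fact k)) \<le> \<bar>z\<bar>^(Suc 1) / fact (Suc 1)"
    by (rule iexp_approx1)
  then show ?thesis
    by (simp add: diff_diff_eq power2_eq_square)
qed

lemma one_minus_cos_le: "1 - cos z \<le> z\<^sup>2 / 2" for z :: real
  using order_trans[OF abs_Re_le_cmod iexp_diff_linear_bound, of z] by (simp add: Re_exp)

lemma abs_sin_minus_le: "\<bar>sin z - z\<bar> \<le> z\<^sup>2 / 2" for z :: real
  using order_trans[OF abs_Im_le_cmod iexp_diff_linear_bound, of z] by (simp add: Im_exp)

lemma levy_integrand_bound:
  "cmod (iexp (u * x) - 1 - \<i> * of_real (u * x * indicator {-1..1} x)) \<le> (u\<^sup>2 + 2) * min 1 (x\<^sup>2)"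
proof (cases "x \<in> {-1..1}")
  case True
  have "cmod (iexp (u * x) - 1 - \<i> * of_real (u * x)) \<le> (u * x)\<^sup>2 / 2"
    by (rule iexp_diff_linear_bound)
  also have "\<dots> \<le> (u\<^sup>2 + 2) * x\<^sup>2" by (simp add: power_mult_distrib algebra_simps)
  also have "x\<^sup>2 = min 1 (x\<^sup>2)" using True abs_square_le_1[of x] by (simp add: abs_le_iff)
  finally show ?thesis using True by simp
next
  case False
  then have "1 \<le> x\<^sup>2" using abs_square_le_1[of x] by (auto simp: abs_le_iff)
  have "cmod (iexp (u * x) - 1) \<le> cmod (iexp (u * x)) + cmod 1" by (rule norm_triangle_ineq4)
  also have "\<dots> \<le> (u\<^sup>2 + 2) * min 1 (x\<^sup>2)" using \<open>1 \<le> x\<^sup>2\<close> by simp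
  finally show ?thesis using False by simp
qed

lemma integrable_levy_integrand:
  assumes [measurable_cong]: "sets \<pi> = sets borel" and l: "(\<integral>\<^sup>+x. ennreal (min 1 (x\<^sup>2)) \<partial>\<pi>) < \<infinity>"
  shows "complex_integrable \<pi> (\<lambda>x. iexp (u * x) - 1 - \<i> * of_real (u * x * indicator {-1..1} x))"
    and integrable_min_square: "integrable \<pi> (\<lambda>x::real. min 1 (x\<^sup>2))"
proof -
  show i: "integrable \<pi> (\<lambda>x::real. min 1 (x\<^sup>2))"
    using l by (intro integrableI_bounded) auto
  show "complex_integrable \<pi> (\<lambda>x. iexp (u * x) - 1 - \<i> * of_real (u * x * indicator {-1..1} x))"
  proof (rule Bochner_Integration.integrable_bound)
    show "integrable \<pi> (\<lambda>x. (u\<^sup>2 + 2) * min 1 (x\<^sup>2))" using i by simp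
    show "AE x in \<pi>. cmod (iexp (u * x) - 1 - \<i> * of_real (u * x * indicator {-1..1} x)) \<le> norm ((u\<^sup>2 + 2) * min 1 (x\<^sup>2))"
      by (intro AE_I2 order_trans[OF levy_integrand_bound]) simp
  qed measurable
qed

text \<open>This weight vanishes to fourth order at the origin, so that it annihilates the Gaussian part.\<close>
definition cos_weight :: "real \<Rightarrow> real \<Rightarrow> real" where
  "cos_weight h x = (1 - cos (h * x))\<^sup>2"

lemma borel_measurable_cos_weight [measurable]: "cos_weight h \<in> borel_measurable borel"
  unfolding cos_weight_def[abs_def] by measurable

lemma cos_weight_bounds: "0 \<le> cos_weight h x" "cos_weight h x \<le> 4" "cos_weight h x \<le> (h ^ 4 + 4) * min 1 (x\<^sup>2)"
proof -
  show "0 \<le> cos_weight h x" by (simp add: cos_weight_def)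
  have c: "0 \<le> 1 - cos (h * x)" "1 - cos (h * x) \<le> 2"
    using cos_le_one[of "h * x"] cos_ge_minus_one[of "h * x"] by auto
  have "(1 - cos (h * x))\<^sup>2 \<le> 2\<^sup>2" using c by (intro power_mono) auto
  then show 4: "cos_weight h x \<le> 4" by (simp add: cos_weight_def)
  show "cos_weight h x \<le> (h ^ 4 + 4) * min 1 (x\<^sup>2)"
  proof (cases "x\<^sup>2 \<le> 1")
    case True
    have "(1 - cos (h * x))\<^sup>2 \<le> ((h * x)\<^sup>2 / 2)\<^sup>2"
      using c(1) one_minus_cos_le by (intro power_mono) auto
    also have "\<dots> = h ^ 4 * (x\<^sup>2 * x\<^sup>2) / 4" by (simp add: power2_eq_square power4_eq_xxxx)
    also have "\<dots> \<le> h ^ 4 * (x\<^sup>2 * 1)"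
    proof -
      have "h ^ 4 * (x\<^sup>2 * x\<^sup>2) \<le> h ^ 4 * (x\<^sup>2 * 1)" using True by (intro mult_left_mono) auto
      moreover have "0 \<le> h ^ 4 * (x\<^sup>2 * x\<^sup>2)" by simp
      ultimately show ?thesis by linarith
    qed
    also have "\<dots> \<le> (h ^ 4 + 4) * x\<^sup>2" by (simp add: algebra_simps)
    finally show ?thesis using True by (simp add: cos_weight_def min_def)
  next
    case False
    then have "min 1 (x\<^sup>2) = 1" by simp
    then show ?thesis using 4 by (simp add: add_increasing)
  qed
qed

text \<open>\<open>(1 - cos t)\<^sup>2 = 3 / 2 - 2 * cos t + cos (2 * t) / 2\<close>, so
  multiplication by the weight is a quarter of the fourth central difference in the frequency, with
  step \<open>h\<close>.\<close>

lemma iexp_cos_weight: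
  "iexp (u * x) * of_real (cos_weight h x) = 3 / 2 * iexp (u * x) - iexp ((u + h) * x) - iexp ((u - h) * x)
     + iexp ((u + 2 * h) * x) / 4 + iexp ((u - 2 * h) * x) / 4"
proof -
  define e where "e = iexp (h * x)"
  define E where "E = iexp (u * x)"
  have e0: "e \<noteq> 0" by (simp add: e_def)
  have c: "complex_of_real (cos (h * x)) = (e + inverse e) / 2"
    by (simp add: e_def cos_of_real[symmetric] cos_exp_eq exp_minus[symmetric])
  have 1: "iexp ((u + h) * x) = E * e" "iexp ((u - h) * x) = E * inverse e"
    "iexp ((u + 2 * h) * x) = E * e^2" "iexp ((u - 2 * h) * x) = E * (inverse e)^2"
    by (simp_all add: e_def E_def exp_add[symmetric] exp_minus[symmetric] power2_eq_square algebra_simps)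
  show ?thesis
    unfolding 1 E_def[symmetric] cos_weight_def of_real_power of_real_diff of_real_1 c
    using e0 by (simp add: power2_eq_square field_simps)
qed

text \<open>A fourth difference annihilates polynomials of degree at most 3: the drift, the Gaussian
  term and the compensator all disappear, and only the jumps remain.\<close>

lemma levy_exponent_cos_weight:
  fixes a \<sigma> :: real
  assumes s [measurable_cong]: "sets \<pi> = sets borel" and l: "(\<integral>\<^sup>+x. ennreal (min 1 (x\<^sup>2)) \<partial>\<pi>) < \<infinity>"
  defines "\<psi> \<equiv> levy_khintchine_exponent a \<sigma> \<pi>"
  shows "3 / 2 * \<psi> u - \<psi> (u + h) - \<psi> (u - h) + \<psi> (u + 2 * h) / 4 + \<psi> (u - 2 * h) / 4 =
    (CLINT x|\<pi>. iexp (u * x) * of_real (cos_weight h x))"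
proof -
  define E where "E v x = iexp (v * x) - 1 - \<i> * of_real (v * x * indicator {-1..1} x)" for v x :: real
  have i: "complex_integrable \<pi> (E v)" for v unfolding E_def[abs_def] by (rule integrable_levy_integrand[OF s l])
  have "iexp (u * x) * of_real (cos_weight h x) = 3 / 2 * E u x - E (u + h) x - E (u - h) x + E (u + 2 * h) x / 4 + E (u - 2 * h) x / 4" for x
  proof -
    define g where "g v = iexp (v * x)" for v
    define w where "w = complex_of_real (x * indicator {-1..1} x)"
    have E: "E v x = g v - 1 - \<i> * (of_real v * w)" for v by (simp add: E_def g_def w_def)
    then show ?thesis
      unfolding iexp_cos_weight unfolding g_def[symmetric] E by (simp add: field_simps)
  qed
  then have "(CLINT x|\<pi>. iexp (u * x) * of_real (cos_weight h x)) =
    (CLINT x|\<pi>. 3 / 2 * E u x - E (u + h) x - E (u - h) x + E (u + 2 * h) x / 4 + E (u - 2 * h) x / 4)" by simp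
  also have "\<dots> = 3 / 2 * (CLINT x|\<pi>. E u x) - (CLINT x|\<pi>. E (u + h) x) - (CLINT x|\<pi>. E (u - h) x)
     + (CLINT x|\<pi>. E (u + 2 * h) x) / 4 + (CLINT x|\<pi>. E (u - 2 * h) x) / 4"
    by (simp add: i)
  finally have eq: "(CLINT x|\<pi>. iexp (u * x) * of_real (cos_weight h x)) = \<dots>" .
  show ?thesis
    unfolding eq \<psi>_def levy_khintchine_exponent_def E_def[symmetric]
    by (simp add: field_simps power2_eq_square)
qed

lemma tendsto_power_exp:
  "(\<lambda>n. of_nat (Suc n) * (exp (z / of_nat (Suc n)) - 1)) \<longlonglongrightarrow> (z :: complex)"
proof (cases "z = 0")
  case False
  have "((\<lambda>h. (exp (0 + h) - exp 0) / h) \<longlongrightarrow> exp 0) (at (0::complex))"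
    using DERIV_exp[of "0::complex"] by (simp add: DERIV_def)
  moreover have "filterlim (\<lambda>n. z / of_nat (Suc n)) (at 0) sequentially"
    unfolding filterlim_at
  proof (intro conjI)
    have "(\<lambda>n. z * inverse (of_nat (Suc n))) \<longlonglongrightarrow> z * 0"
      by (intro tendsto_intros LIMSEQ_Suc lim_inverse_n)
    then show "(\<lambda>n. z / of_nat (Suc n)) \<longlonglongrightarrow> 0" by (simp add: divide_inverse)
  qed (use False in \<open>auto simp del: of_nat_Suc\<close>)
  ultimately have "(\<lambda>n. (exp (0 + z / of_nat (Suc n)) - exp 0) / (z / of_nat (Suc n))) \<longlonglongrightarrow> exp 0"
    by (rule filterlim_compose)
  then have "(\<lambda>n. z * ((exp (z / of_nat (Suc n)) - 1) / (z / of_nat (Suc n)))) \<longlonglongrightarrow> z * 1"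
    by (intro tendsto_intros) simp
  moreover have "z * ((exp (z / of_nat (Suc n)) - 1) / (z / of_nat (Suc n))) = of_nat (Suc n) * (exp (z / of_nat (Suc n)) - 1)" for n
    using False by (simp del: of_nat_Suc)
  ultimately show ?thesis by (simp del: of_nat_Suc)
qed simp

text \<open>The finite measures with density \<open>real (Suc n) * cos_weight h\<close> relative to \<open>P n\<close> converge weakly to the one with
  density \<open>cos_weight h\<close> relative to \<open>\<pi>\<close>, because their characteristic functions do.\<close>
lemma levy_measure_negative_null:
  fixes P :: "nat \<Rightarrow> real measure"
  assumes s [measurable_cong]: "sets \<pi> = sets borel" and l: "(\<integral>\<^sup>+x. ennreal (min 1 (x\<^sup>2)) \<partial>\<pi>) < \<infinity>"
    and P: "\<And>n. real_distribution (P n)"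
    and char: "\<And>n u. char (P n) u = exp (levy_khintchine_exponent a \<sigma> \<pi> u / of_nat (Suc n))"
    and left: "\<And>e. 0 < e \<Longrightarrow> (\<lambda>n. real (Suc n) * measure (P n) {..<-e}) \<longlonglongrightarrow> 0"
  shows "emeasure \<pi> {..<0} = 0"
proof -
  interpret P: real_distribution "P n" for n by (rule P)
  have sp: "space \<pi> = UNIV" using sets_eq_imp_space_eq[OF s] by simp
  have AEh: "AE x in \<pi>. x < 0 \<longrightarrow> cos_weight h x = 0" for h
  proof -
    define F where "F u = (CLINT x|\<pi>. iexp (u * x) * of_real (cos_weight h x))" for u
    define Fn where "Fn n u = of_nat (Suc n) * (CLINT x|P n. iexp (u * x) * of_real (cos_weight h x))" for n u
    have wint: "integrable \<pi> (cos_weight h)"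
    proof (rule Bochner_Integration.integrable_bound)
      show "integrable \<pi> (\<lambda>x. (h ^ 4 + 4) * min 1 (x\<^sup>2))"
        using integrable_min_square[OF s l] by simp
      show "AE x in \<pi>. norm (cos_weight h x) \<le> norm ((h ^ 4 + 4) * min 1 (x\<^sup>2))"
        using cos_weight_bounds[of h] by (intro AE_I2) (auto intro: order_trans)
    qed measurable
    have wintP: "integrable (P n) (cos_weight h)" for n
      by (rule P.integrable_const_bound[of _ 4]) (auto simp: cos_weight_bounds)
    have lim: "(\<lambda>n. Fn n u) \<longlonglongrightarrow> F u" for u
    proof -
      let ?\<psi> = "levy_khintchine_exponent a \<sigma> \<pi>"
      define G where "G n v = of_nat (Suc n) * (exp (?\<psi> v / of_nat (Suc n)) - 1)" for n v
      have G: "(\<lambda>n. G n v) \<longlonglongrightarrow> ?\<psi> v" for v unfolding G_def by (rule tendsto_power_exp)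
      define g where "g v x = iexp (v * x)" for v x
      have ci: "complex_integrable (P n) (g v)" for n v unfolding g_def by (rule P.integrable_iexp) auto
      have "Fn n u = 3 / 2 * G n u - G n (u + h) - G n (u - h) + G n (u + 2 * h) / 4 + G n (u - 2 * h) / 4" for n
      proof -
        have "Fn n u = of_nat (Suc n) * (3 / 2 * char (P n) u - char (P n) (u + h) - char (P n) (u - h)
           + char (P n) (u + 2 * h) / 4 + char (P n) (u - 2 * h) / 4)"
          unfolding Fn_def iexp_cos_weight char_def unfolding g_def[symmetric] using ci by (simp del: of_nat_Suc)
        moreover have "k * (3 / 2 * A - B - C + D / 4 + F / 4) =
            3 / 2 * (k * (A - 1)) - k * (B - 1) - k * (C - 1) + k * (D - 1) / 4 + k * (F - 1) / 4" for k A B C D F :: complex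
          by (simp add: field_simps)
        ultimately show ?thesis unfolding G_def char by (simp only:)
      qed
      moreover have "(\<lambda>n. 3 / 2 * G n u - G n (u + h) - G n (u - h) + G n (u + 2 * h) / 4 + G n (u - 2 * h) / 4)
        \<longlonglongrightarrow> 3 / 2 * ?\<psi> u - ?\<psi> (u + h) - ?\<psi> (u - h) + ?\<psi> (u + 2 * h) / 4 + ?\<psi> (u - 2 * h) / 4"
        by (intro tendsto_intros G) auto
      ultimately show ?thesis
        unfolding F_def levy_exponent_cos_weight[OF s l, where a=a and \<sigma>=\<sigma>, symmetric] by (simp only:)
    qed
    define c where "c = (LINT x|\<pi>. cos_weight h x)"
    define cn where "cn n = real (Suc n) * (LINT x|P n. cos_weight h x)" for n
    have Fc: "F 0 = of_real c" "Fn n 0 = of_real (cn n)" for n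
      by (auto simp: F_def Fn_def c_def cn_def)
    have cnc: "cn \<longlonglongrightarrow> c"
      using lim[of 0] unfolding Fc tendsto_of_real_iff .
    have c0: "0 \<le> c" unfolding c_def by (intro integral_nonneg_AE AE_I2 cos_weight_bounds)
    show ?thesis
    proof (cases "c = 0")
      case True
      then have "AE x in \<pi>. cos_weight h x = 0"
        using integral_nonneg_eq_0_iff_AE[OF wint] cos_weight_bounds(1)[of h] by (auto simp: c_def)
      then show ?thesis by eventually_elim simp
    next
      case False
      then have c: "0 < c" using c0 by simp
      \<comment> \<open>The masses are positive only from some index on; dropping the earlier terms
        makes every normalised measure a probability measure.\<close>
      obtain N where N: "\<And>n. N \<le> n \<Longrightarrow> 0 < cn n"
        using order_tendstoD(1)[OF cnc c] by (auto simp: eventually_sequentially)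
      define Q where "Q = density \<pi> (\<lambda>x. ennreal (cos_weight h x / c))"
      define Qn where "Qn n = density (P (n + N)) (\<lambda>x. ennreal (real (Suc (n + N)) * cos_weight h x / cn (n + N)))" for n
      have rd: "real_distribution (density R (\<lambda>x. ennreal (k * cos_weight h x / d)))"
        if R [measurable_cong]: "sets R = sets borel" "integrable R (cos_weight h)" and k: "0 \<le> k" "0 < d" "k * (LINT x|R. cos_weight h x) = d" for R k d
      proof -
        have spR: "space R = UNIV" using sets_eq_imp_space_eq[OF R(1)] by simp
        have "emeasure (density R (\<lambda>x. ennreal (k * cos_weight h x / d))) UNIV = (\<integral>\<^sup>+x. ennreal (k * cos_weight h x / d) \<partial>R)"
          by (subst emeasure_density) (auto simp: R(1))
        also have "\<dots> = ennreal (LINT x|R. k * cos_weight h x / d)"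
          using R(2) k cos_weight_bounds(1)[of h] by (intro nn_integral_eq_integral) auto
        also have "\<dots> = 1" using k by simp
        finally interpret prob_space "density R (\<lambda>x. ennreal (k * cos_weight h x / d))"
          by (intro prob_spaceI) (simp add: spR)
        show ?thesis by unfold_locales (simp add: R(1))
      qed
      have rdQ: "real_distribution Q"
        using rd[OF s wint, of 1 c] c by (simp add: Q_def c_def)
      have rdQn: "real_distribution (Qn n)" for n
        unfolding Qn_def using N[of "n + N"] by (intro rd wintP) (auto simp: cn_def)
      have charQ: "char Q u = F u / of_real c" for u
      proof -
        have "char Q u = (CLINT x|\<pi>. (cos_weight h x / c) *\<^sub>R iexp (u * x))"
          unfolding char_def Q_def using c cos_weight_bounds(1)[of h] by (subst integral_density) auto
        also have "\<dots> = (CLINT x|\<pi>. iexp (u * x) * of_real (cos_weight h x) / of_real c)"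
          by (intro Bochner_Integration.integral_cong) (auto simp: scaleR_conv_of_real)
        finally show ?thesis by (simp add: F_def)
      qed
      have charQn: "char (Qn n) u = Fn (n + N) u / of_real (cn (n + N))" for n u
      proof -
        have "char (Qn n) u = (CLINT x|P (n + N). (real (Suc (n + N)) * cos_weight h x / cn (n + N)) *\<^sub>R iexp (u * x))"
          unfolding char_def Qn_def using N[of "n + N"] cos_weight_bounds(1)[of h] by (subst integral_density) auto
        also have "\<dots> = (CLINT x|P (n + N). of_nat (Suc (n + N)) / of_real (cn (n + N)) * (iexp (u * x) * of_real (cos_weight h x)))"
          by (intro Bochner_Integration.integral_cong) (auto simp: scaleR_conv_of_real)
        finally show ?thesis by (simp add: Fn_def)
      qed
      have weak: "weak_conv_m Qn Q"
      proof (rule levy_continuity[OF rdQn rdQ])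
        fix u
        have "(\<lambda>n. Fn (n + N) u / of_real (cn (n + N))) \<longlonglongrightarrow> F u / of_real c"
          using c by (intro tendsto_intros LIMSEQ_ignore_initial_segment lim cnc) auto
        then show "(\<lambda>n. char (Qn n) u) \<longlonglongrightarrow> char Q u" by (simp add: charQ charQn)
      qed
      interpret Q: real_distribution Q by (rule rdQ)
      \<comment> \<open>The weight is at most 4, so the mass left of \<open>x\<close> is controlled
        by the hypothesis \<open>left\<close>. Taking \<open>e = - x / 2\<close> passes from the
        closed half-line at \<open>x\<close> to an open one.\<close>
      have cdfn: "(\<lambda>n. cdf (Qn n) x) \<longlonglongrightarrow> 0" if x: "x < 0" for x
      proof (rule tendsto_sandwich[of "\<lambda>_. 0"])
        define e where "e = - x / 2"
        have e: "0 < e" "{..x} \<subseteq> {..<-e}" using x by (auto simp: e_def)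
        show "\<forall>\<^sub>F n in sequentially. cdf (Qn n) x \<le> 4 * (real (Suc (n + N)) * measure (P (n + N)) {..<-e}) / cn (n + N)"
        proof (intro always_eventually allI)
          fix n
          have cn: "0 < cn (n + N)" by (rule N) simp
          interpret Qn: real_distribution "Qn n" by (rule rdQn)
          have "ennreal (cdf (Qn n) x) = emeasure (Qn n) {..x}"
            by (simp add: cdf_def Qn.emeasure_eq_measure)
          also have "\<dots> = (\<integral>\<^sup>+y. ennreal (real (Suc (n + N)) * cos_weight h y / cn (n + N)) * indicator {..x} y \<partial>P (n + N))"
            unfolding Qn_def by (subst emeasure_density) auto
          also have "\<dots> \<le> (\<integral>\<^sup>+y. ennreal (real (Suc (n + N)) * 4 / cn (n + N)) * indicator {..<-e} y \<partial>P (n + N))"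
            using e(2) cos_weight_bounds(2)[of h] cn
            by (intro nn_integral_mono) (auto simp: indicator_def simp del: of_nat_Suc intro!: ennreal_leI divide_right_mono mult_left_mono)
          also have "\<dots> = ennreal (4 * (real (Suc (n + N)) * measure (P (n + N)) {..<-e}) / cn (n + N))"
            using cn by (subst nn_integral_cmult_indicator) (auto simp: P.emeasure_eq_measure ennreal_mult'[symmetric] mult_ac)
          finally show "cdf (Qn n) x \<le> 4 * (real (Suc (n + N)) * measure (P (n + N)) {..<-e}) / cn (n + N)"
            using cn by (subst (asm) ennreal_le_iff) auto
        qed
        have "(\<lambda>n. 4 * (real (Suc (n + N)) * measure (P (n + N)) {..<-e}) / cn (n + N)) \<longlonglongrightarrow> 4 * 0 / c"
          using c e(1) by (intro tendsto_intros LIMSEQ_ignore_initial_segment[OF left] LIMSEQ_ignore_initial_segment[OF cnc]) auto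
        then show "(\<lambda>n. 4 * (real (Suc (n + N)) * measure (P (n + N)) {..<-e}) / cn (n + N)) \<longlonglongrightarrow> 0" by simp
        show "\<forall>\<^sub>F n in sequentially. 0 \<le> cdf (Qn n) x" by (simp add: cdf_def)
      qed simp
      \<comment> \<open>Weak convergence speaks only about continuity points of the limit. Atoms are
        countable, so a suitable point exists between \<open>x\<close> and 0, and monotonicity does
        the rest.\<close>
      have cdf0: "cdf Q x = 0" if x: "x < 0" for x
      proof -
        have "uncountable {x<..<0}" using x by (simp add: uncountable_open_interval)
        then have "\<not> {x<..<0} \<subseteq> {y. measure Q {y} > 0}"
          using countable_subset[OF _ Q.countable_atoms] by blast
        then obtain y where y0: "y \<in> {x<..<0}" "\<not> 0 < measure Q {y}" by blast
        then have y: "x < y" "y < 0" "measure Q {y} = 0"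
          using measure_nonneg[of Q "{y}"] by (simp_all add: not_less)
        then have "(\<lambda>n. cdf (Qn n) y) \<longlonglongrightarrow> cdf Q y"
          using weak Q.isCont_cdf by (auto simp: weak_conv_m_def weak_conv_def)
        then have "cdf Q y = 0" using cdfn[OF y(2)] by (rule LIMSEQ_unique)
        then show ?thesis using Q.cdf_nondecreasing[of x y] Q.cdf_nonneg[of x] y by simp
      qed
      have "AE x in Q. \<not> x < 0"
      proof -
        have "{..<0::real} = (\<Union>n. {..- inverse (real (Suc n))})"
        proof (intro equalityI subsetI)
          fix x :: real assume "x \<in> {..<0}"
          then obtain n where "inverse (real (Suc n)) < - x" using reals_Archimedean[of "- x"] by auto
          then show "x \<in> (\<Union>n. {..- inverse (real (Suc n))})" by (auto intro!: exI[of _ n])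
        next
          fix x :: real assume "x \<in> (\<Union>n. {..- inverse (real (Suc n))})"
          then show "x \<in> {..<0}" by (auto simp del: of_nat_Suc) (meson inverse_positive_iff_positive le_less_trans neg_less_0_iff_less of_nat_0_less_iff zero_less_Suc)
        qed
        moreover have "{..- inverse (real (Suc n))} \<in> null_sets Q" for n
          using cdf0[of "- inverse (real (Suc n))"] by (auto simp: cdf_def null_sets_def Q.emeasure_eq_measure)
        ultimately have "{..<0} \<in> null_sets Q" by (auto intro: null_sets_UN)
        then have "AE x in Q. x \<notin> {..<0}" by (rule AE_not_in)
        then show ?thesis by eventually_elim simp
      qed
      then have "AE x in \<pi>. 0 < ennreal (cos_weight h x / c) \<longrightarrow> \<not> x < 0"
        unfolding Q_def by (subst (asm) AE_density) auto
      then show ?thesis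
      proof eventually_elim
        case (elim x)
        show ?case
        proof
          assume "x < 0"
          then have "cos_weight h x / c \<le> 0" using elim by (simp add: not_less)
          then have "cos_weight h x \<le> 0" using c by (simp add: divide_le_0_iff)
          then show "cos_weight h x = 0" using cos_weight_bounds(1)[of h x] by simp
        qed
      qed
    qed
  qed
  \<comment> \<open>A single weight vanishes also at nonzero multiples of the period. Taking
    \<open>h = 1 / (n + 1)\<close> for all \<open>n\<close> removes this: for \<open>n > - x\<close>
    the argument of the cosine lies strictly between 0 and 1 in absolute value.\<close>
  have "AE x in \<pi>. \<forall>n. x < 0 \<longrightarrow> cos_weight (inverse (real (Suc n))) x = 0"
    unfolding AE_all_countable[where P="\<lambda>n x. x < 0 \<longrightarrow> cos_weight (inverse (real (Suc n))) x = 0"]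
    using AEh by blast
  then have "AE x in \<pi>. \<not> x < 0"
  proof eventually_elim
    case (elim x)
    show ?case
    proof
      assume x: "x < 0"
      obtain n where n: "- x < real n" using reals_Archimedean2 by blast
      define z where "z = inverse (real (Suc n)) * (- x)"
      have "0 < z" unfolding z_def using x by (intro mult_pos_pos) auto
      moreover have "z < 1" using n by (simp add: z_def field_simps)
      ultimately have "cos z < cos 0" using pi_gt3 by (intro cos_monotone_0_pi) auto
      moreover have "cos z = cos (inverse (real (Suc n)) * x)" by (simp add: z_def del: of_nat_Suc)
      ultimately show False using elim x by (auto simp: cos_weight_def)
    qed
  qed
  then show ?thesis
    by (subst (asm) AE_iff_null) (auto simp: sp s null_sets_def lessThan_def)
qed

text \<open>The second moment is finite, by Fatou's lemma applied to \<open>(2 - 2 * cos (u * x)) / u\<^sup>2\<close> as \<open>u \<longlonglongrightarrow> 0\<close>.\<close>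
lemma integrable_abs_infinitely_divisible:
  assumes s [measurable_cong]: "sets \<pi> = sets borel" and l: "(\<integral>\<^sup>+x. ennreal (min 1 (x\<^sup>2)) \<partial>\<pi>) < \<infinity>"
    and neg: "emeasure \<pi> {..<0} = 0" and big: "integrable \<pi> (\<lambda>y. indicator {1<..} y * y\<^sup>2)"
    and P: "real_distribution P" and char: "\<And>u. char P u = exp (levy_khintchine_exponent a \<sigma> \<pi> u)"
  shows "integrable P (\<lambda>x. \<bar>x\<bar>)"
proof -
  interpret P: real_distribution P by (rule P)
  have pos: "AE x in \<pi>. 0 \<le> x"
  proof -
    have "AE x in \<pi>. x \<notin> {..<0}" using neg by (intro AE_not_in) (auto simp: null_sets_def s)
    then show ?thesis by eventually_elim auto
  qed
  have sq: "integrable \<pi> (\<lambda>x. x\<^sup>2)"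
  proof (rule Bochner_Integration.integrable_bound)
    show "integrable \<pi> (\<lambda>x. min 1 (x\<^sup>2) + indicator {1<..} x * x\<^sup>2)"
      by (intro Bochner_Integration.integrable_add integrable_min_square[OF s l] big)
    show "AE x in \<pi>. norm (x\<^sup>2) \<le> norm (min 1 (x\<^sup>2) + indicator {1<..} x * x\<^sup>2)"
      using pos
    proof eventually_elim
      case (elim x)
      show ?case
      proof (cases "x \<le> 1")
        case True
        then have "x\<^sup>2 \<le> 1" using elim by (simp add: power_le_one)
        then show ?thesis by simp
      next
        case False
        then show ?thesis by simp
      qed
    qed
  qed measurable
  define S where "S = (LINT x|\<pi>. x\<^sup>2)"
  have S0: "0 \<le> S" unfolding S_def by (intro integral_nonneg_AE AE_I2) simp
  define E where "E u x = iexp (u * x) - 1 - \<i> * of_real (u * x * indicator {-1..1} x)" for u x :: real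
  have iE: "complex_integrable \<pi> (E u)" for u unfolding E_def[abs_def] by (rule integrable_levy_integrand[OF s l])
  define A where "A u = Re (levy_khintchine_exponent a \<sigma> \<pi> u)" for u
  define B where "B u = Im (levy_khintchine_exponent a \<sigma> \<pi> u)" for u
  have A: "- A u \<le> (\<sigma>\<^sup>2 / 2 + S / 2) * u\<^sup>2" "A u \<le> 0" for u
  proof -
    have Au: "A u = - (\<sigma>\<^sup>2 * u\<^sup>2 / 2) + (LINT x|\<pi>. Re (E u x))"
      unfolding A_def levy_khintchine_exponent_def E_def[symmetric] by (simp add: iE power2_eq_square)
    have Re: "Re (E u x) = cos (u * x) - 1" for x by (simp add: E_def Re_exp)
    have "(LINT x|\<pi>. - Re (E u x)) \<le> (LINT x|\<pi>. u\<^sup>2 / 2 * x\<^sup>2)"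
    proof (intro integral_mono)
      show "- Re (E u x) \<le> u\<^sup>2 / 2 * x\<^sup>2" for x
        using one_minus_cos_le[of "u * x"] by (simp add: Re power_mult_distrib)
    qed (use iE sq in auto)
    then show "- A u \<le> (\<sigma>\<^sup>2 / 2 + S / 2) * u\<^sup>2"
      unfolding Au using iE by (simp add: S_def algebra_simps)
    have "integrable \<pi> (\<lambda>x. Re (E u x))" using iE by simp
    then have "(LINT x|\<pi>. Re (E u x)) \<le> (LINT x|\<pi>. 0)"
      by (rule integral_mono) (auto simp: Re)
    then have "(LINT x|\<pi>. Re (E u x)) \<le> 0" by simp
    then moreover have "0 \<le> \<sigma>\<^sup>2 * u\<^sup>2" by simp
    ultimately show "A u \<le> 0" unfolding Au by linarith
  qed
  have B: "\<bar>B u\<bar> \<le> (\<bar>a\<bar> + S) * \<bar>u\<bar>" if u: "\<bar>u\<bar> \<le> 1" for u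
  proof -
    have Bu: "B u = a * u + (LINT x|\<pi>. Im (E u x))"
      unfolding B_def levy_khintchine_exponent_def E_def[symmetric] by (simp add: iE power2_eq_square)
    have Im: "Im (E u x) = sin (u * x) - u * x * indicator {-1..1} x" for x by (simp add: E_def Im_exp)
    have "\<bar>LINT x|\<pi>. Im (E u x)\<bar> \<le> (LINT x|\<pi>. \<bar>Im (E u x)\<bar>)" by (rule integral_abs_bound)
    also have "\<dots> \<le> (LINT x|\<pi>. \<bar>u\<bar> * x\<^sup>2)"
    proof (intro integral_mono)
      fix x
      show "\<bar>Im (E u x)\<bar> \<le> \<bar>u\<bar> * x\<^sup>2"
      proof (cases "x \<in> {-1..1}")
        case True
        have "\<bar>sin (u * x) - u * x\<bar> \<le> (u * x)\<^sup>2 / 2" by (rule abs_sin_minus_le)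
        also have "\<dots> \<le> (u * x)\<^sup>2" by simp
        also have "\<dots> = \<bar>u\<bar> * \<bar>u\<bar> * x\<^sup>2" by (simp add: power_mult_distrib power2_eq_square)
        also have "\<dots> \<le> \<bar>u\<bar> * 1 * x\<^sup>2" using u by (intro mult_right_mono mult_left_mono) auto
        finally show ?thesis using True by (simp add: Im)
      next
        case False
        then have "1 \<le> \<bar>x\<bar>" by auto
        then have "1 * \<bar>x\<bar> \<le> \<bar>x\<bar> * \<bar>x\<bar>" by (intro mult_right_mono) auto
        have "\<bar>sin (u * x)\<bar> \<le> \<bar>u * x\<bar>" by (rule abs_sin_x_le_abs_x)
        also have "\<dots> = \<bar>u\<bar> * \<bar>x\<bar>" by (rule abs_mult)
        also have "\<dots> \<le> \<bar>u\<bar> * x\<^sup>2"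
          using \<open>1 * \<bar>x\<bar> \<le> \<bar>x\<bar> * \<bar>x\<bar>\<close> by (intro mult_left_mono) (auto simp: power2_eq_square)
        finally show ?thesis using False by (simp add: Im)
      qed
    qed (use iE sq in auto)
    finally have "\<bar>LINT x|\<pi>. Im (E u x)\<bar> \<le> \<bar>u\<bar> * S" by (simp add: S_def)
    then show ?thesis
      unfolding Bu by (intro order_trans[OF abs_triangle_ineq]) (simp add: abs_mult algebra_simps)
  qed
  \<comment> \<open>\<open>A\<close> and \<open>B\<close> are the real and imaginary parts of the
    exponent. Doubling the deficit \<open>1 - exp (A u)\<close> gives
    \<open>\<sigma>\<^sup>2 + S\<close>, and the phase adds the square of the bound on
    \<open>B\<close>.\<close>
  define K where "K = \<sigma>\<^sup>2 + S + (\<bar>a\<bar> + S)\<^sup>2"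
  have Re_bound: "2 - 2 * Re (char P u) \<le> K * u\<^sup>2" if u: "\<bar>u\<bar> \<le> 1" for u
  proof -
    have "Re (char P u) = exp (A u) * cos (B u)" by (simp add: char Re_exp A_def B_def)
    moreover have "1 - exp (A u) \<le> - A u" using exp_ge_add_one_self[of "A u"] by linarith
    moreover have "exp (A u) * (1 - cos (B u)) \<le> 1 * ((B u)\<^sup>2 / 2)"
      using A(2)[of u] one_minus_cos_le[of "B u"] by (intro mult_mono) auto
    moreover have "(B u)\<^sup>2 \<le> ((\<bar>a\<bar> + S) * \<bar>u\<bar>)\<^sup>2"
      using B[OF u] S0 by (subst power2_abs[symmetric]) (intro power_mono; simp)
    moreover have "((\<bar>a\<bar> + S) * \<bar>u\<bar>)\<^sup>2 = (\<bar>a\<bar> + S)\<^sup>2 * u\<^sup>2" by (simp add: power_mult_distrib)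
    moreover have "exp (A u) * (1 - cos (B u)) = exp (A u) - exp (A u) * cos (B u)"
      by (simp add: right_diff_distrib)
    moreover have "K * u\<^sup>2 = 2 * ((\<sigma>\<^sup>2 / 2 + S / 2) * u\<^sup>2) + (\<bar>a\<bar> + S)\<^sup>2 * u\<^sup>2"
      by (simp add: K_def algebra_simps)
    ultimately show ?thesis using A(1)[of u] by linarith
  qed
  have cosP: "(LINT x|P. 2 - 2 * cos (u * x)) = 2 - 2 * Re (char P u)" for u
  proof -
    have ci: "complex_integrable P (\<lambda>x. iexp (u * x))" by (rule P.integrable_iexp) auto
    have "Re (char P u) = (LINT x|P. Re (iexp (u * x)))" unfolding char_def using ci by simp
    also have "\<dots> = (LINT x|P. cos (u * x))" by (simp add: Re_exp)
    finally have "Re (char P u) = (LINT x|P. cos (u * x))" .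
    moreover have "integrable P (\<lambda>x. cos (u * x))"
      by (rule P.integrable_const_bound[of _ 1]) auto
    ultimately show ?thesis by (simp add: P.prob_space[unfolded P.space_eq_univ])
  qed
  define u where "u n = inverse (real (Suc n))" for n
  have u: "0 < u n" "\<bar>u n\<bar> \<le> 1" for n by (auto simp: u_def field_simps)
  have u0: "u \<longlonglongrightarrow> 0" unfolding u_def by (rule LIMSEQ_inverse_real_of_nat)
  have "(\<integral>\<^sup>+x. ennreal (x\<^sup>2) \<partial>P) = (\<integral>\<^sup>+x. liminf (\<lambda>n. ennreal ((2 - 2 * cos (u n * x)) / (u n)\<^sup>2)) \<partial>P)"
  proof (intro nn_integral_cong)
    fix x :: real
    have "(\<lambda>n. (2 - 2 * cos (u n * x)) / (u n)\<^sup>2) \<longlonglongrightarrow> x\<^sup>2"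
    proof (cases "x = 0")
      case False
      have half: "((\<lambda>h::real. sin h / h) \<longlongrightarrow> 1) (at 0)"
        using DERIV_sin[of 0] by (simp add: DERIV_def)
      have fl: "filterlim (\<lambda>n. u n * x / 2) (at 0) sequentially"
        unfolding filterlim_at
      proof
        have "(\<lambda>n. u n * (x / 2)) \<longlonglongrightarrow> 0 * (x / 2)" by (intro tendsto_mult_right u0)
        then show "(\<lambda>n. u n * x / 2) \<longlonglongrightarrow> 0" by simp
        have "u n \<noteq> 0" for n using u(1)[of n] by simp
        then show "\<forall>\<^sub>F n in sequentially. u n * x / 2 \<in> UNIV \<and> u n * x / 2 \<noteq> 0" using False by simp
      qed
      have "(\<lambda>n. (sin (u n * x / 2) / (u n * x / 2))\<^sup>2 * x\<^sup>2) \<longlonglongrightarrow> 1\<^sup>2 * x\<^sup>2"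
        by (intro tendsto_mult_right tendsto_power filterlim_compose[OF half fl])
      moreover have "(sin (u n * x / 2) / (u n * x / 2))\<^sup>2 * x\<^sup>2 = (2 - 2 * cos (u n * x)) / (u n)\<^sup>2" for n
      proof -
        have "cos (u n * x) = 1 - 2 * (sin (u n * x / 2))\<^sup>2"
          using cos_double_sin[of "u n * x / 2"] by simp
        then show ?thesis using u(1)[of n] False by (simp add: power_divide power_mult_distrib field_simps)
      qed
      ultimately show ?thesis by simp
    qed simp
    then have "(\<lambda>n. ennreal ((2 - 2 * cos (u n * x)) / (u n)\<^sup>2)) \<longlonglongrightarrow> ennreal (x\<^sup>2)"
      by (intro tendsto_ennrealI)
    then show "ennreal (x\<^sup>2) = liminf (\<lambda>n. ennreal ((2 - 2 * cos (u n * x)) / (u n)\<^sup>2))"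
      by (intro lim_imp_Liminf[symmetric]) auto
  qed
  also have "\<dots> \<le> liminf (\<lambda>n. \<integral>\<^sup>+x. ennreal ((2 - 2 * cos (u n * x)) / (u n)\<^sup>2) \<partial>P)"
    by (intro nn_integral_liminf) measurable
  also have "\<dots> \<le> liminf (\<lambda>n. ennreal K)"
  proof (intro Liminf_mono always_eventually allI)
    fix n
    have "integrable P (\<lambda>x. cos (u n * x))"
      by (rule P.integrable_const_bound[of _ 1]) auto
    then have "(\<integral>\<^sup>+x. ennreal ((2 - 2 * cos (u n * x)) / (u n)\<^sup>2) \<partial>P) = ennreal (LINT x|P. (2 - 2 * cos (u n * x)) / (u n)\<^sup>2)"
      by (intro nn_integral_eq_integral) auto
    also have "\<dots> \<le> ennreal K"
      using Re_bound[OF u(2), of n] u(1)[of n] cosP[of "u n"] by (intro ennreal_leI) (simp add: field_simps)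
    finally show "(\<integral>\<^sup>+x. ennreal ((2 - 2 * cos (u n * x)) / (u n)\<^sup>2) \<partial>P) \<le> ennreal K" .
  qed
  also have "\<dots> < \<infinity>" by (simp add: Liminf_const)
  finally have i2: "integrable P (\<lambda>x. x\<^sup>2)" by (intro integrableI_bounded) auto
  show ?thesis
  proof (rule Bochner_Integration.integrable_bound)
    show "integrable P (\<lambda>x. 1 + x\<^sup>2)" using i2 by simp
    show "AE x in P. norm \<bar>x\<bar> \<le> norm (1 + x\<^sup>2)"
    proof (intro AE_I2)
      fix x :: real
      have "0 \<le> (\<bar>x\<bar> - 1 / 2)\<^sup>2" by simp
      then show "norm \<bar>x\<bar> \<le> norm (1 + x\<^sup>2)" by (simp add: power2_eq_square algebra_simps)
    qed
  qed measurable
qed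

subsection \<open>The Fourier equation\<close>

context levy_process
begin

text \<open>Convergence of the integral does not depend on where it starts. Hence all
  \<open>remaining s\<close> are positive on one and the same event, and on its complement all of
  them have the value 0.\<close>

lemma remaining_pos_iff:
  assumes s: "0 \<le> s" and \<omega>: "\<omega> \<in> space M"
  shows "0 < remaining s \<omega> \<longleftrightarrow> set_integrable lborel {0..} (\<lambda>t. exp (- Y t \<omega>))"
proof
  note c = cadlag_paths[OF \<omega>]
  show "0 < remaining s \<omega>" if "set_integrable lborel {0..} (\<lambda>t. exp (- Y t \<omega>))"
    unfolding remaining_def by (rule path_functional_shift_pos[OF c that s])
  assume pos: "0 < remaining s \<omega>"
  have "set_integrable lborel {0..} (\<lambda>t. exp (- path_shift s (\<lambda>t. Y t \<omega>) t))"
  proof (rule ccontr)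
    assume "\<not> ?thesis"
    then have "path_functional (path_shift s (\<lambda>t. Y t \<omega>)) = 0"
      by (rule path_functional_not_integrable[OF cadlag_shift[OF c s]])
    then show False using pos by (simp add: remaining_def)
  qed
  then show "set_integrable lborel {0..} (\<lambda>t. exp (- Y t \<omega>))"
    by (simp only: set_integrable_shift_iff[OF c s])
qed

lemma remaining_pos_cong: "0 \<le> s \<Longrightarrow> \<omega> \<in> space M \<Longrightarrow> 0 < remaining s \<omega> \<longleftrightarrow> 0 < remaining 0 \<omega>"
  by (simp add: remaining_pos_iff)

lemma ln_remaining_diff:
  assumes t: "0 \<le> t" and \<omega>: "\<omega> \<in> space M" and pos: "0 < remaining 0 \<omega>"
  shows "set_integrable lborel {0..t} (\<lambda>s. inverse (remaining s \<omega>))"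
    and "(LBINT s:{0..t}. inverse (remaining s \<omega>)) = ln (remaining 0 \<omega>) - ln (remaining t \<omega>) + (Y t \<omega> - Y 0 \<omega>)"
proof -
  have i: "set_integrable lborel {0..} (\<lambda>t. exp (- Y t \<omega>))"
    using pos remaining_pos_iff[OF _ \<omega>, of 0] by simp
  note c = cadlag_paths[OF \<omega>]
  have eq: "(\<lambda>s. inverse (remaining s \<omega>)) = inverse_functional (\<lambda>t. Y t \<omega>)"
    unfolding inverse_functional_def[OF c i, abs_def] remaining_def by (rule refl)
  show "set_integrable lborel {0..t} (\<lambda>s. inverse (remaining s \<omega>))"
    unfolding eq by (rule set_integrable_inverse_functional[OF c i t])
  have "0 < remaining t \<omega>" using remaining_pos_cong[OF t \<omega>] pos by simp
  then have "ln (tail_functional (\<lambda>t. Y t \<omega>) t) = ln (remaining t \<omega>) - Y t \<omega>"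
    by (simp add: tail_functional_def remaining_def[symmetric] ln_mult)
  then show "(LBINT s:{0..t}. inverse (remaining s \<omega>)) = ln (remaining 0 \<omega>) - ln (remaining t \<omega>) + (Y t \<omega> - Y 0 \<omega>)"
    using ln_tail_functional_eq[OF c i t] unfolding eq by (simp add: remaining_def)
qed

lemma integral_remaining:
  fixes g :: "real \<Rightarrow> 'b::{banach, second_countable_topology}"
  assumes s: "0 < s" and g: "g \<in> borel_measurable borel"
  shows "(LINT \<omega>|M. g (remaining s \<omega>)) = (LINT \<omega>|M. g (remaining 0 \<omega>))"
  using integral_distr[of "remaining s" M borel g] integral_distr[of "remaining 0" M borel g] g s distr_remaining[OF s]
  by (simp add: random_variable_remaining)

lemma nn_integral_remaining:
  assumes s: "0 < s" and g: "g \<in> borel_measurable borel"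
  shows "(\<integral>\<^sup>+\<omega>. g (remaining s \<omega>) \<partial>M) = (\<integral>\<^sup>+\<omega>. g (remaining 0 \<omega>) \<partial>M)"
  using nn_integral_distr[of "remaining s" M borel g] nn_integral_distr[of "remaining 0" M borel g] g s distr_remaining[OF s]
  by (simp add: random_variable_remaining)

lemma pair_sigma_finite_lborel: "pair_sigma_finite lborel M"
  by (intro pair_sigma_finite.intro sigma_finite_lborel) unfold_locales

lemma nn_integral_inverse_remaining:
  assumes T: "0 \<le> T"
  shows "(\<integral>\<^sup>+\<omega>. (\<integral>\<^sup>+s. indicator {0..T} s * ennreal (inverse (remaining (max 0 s) \<omega>)) \<partial>lborel) \<partial>M) =
    ennreal T * (\<integral>\<^sup>+\<omega>. ennreal (inverse (remaining 0 \<omega>)) \<partial>M)"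
proof -
  note [measurable] = borel_measurable_remaining_pair
  have "(\<integral>\<^sup>+\<omega>. (\<integral>\<^sup>+s. indicator {0..T} s * ennreal (inverse (remaining (max 0 s) \<omega>)) \<partial>lborel) \<partial>M) =
    (\<integral>\<^sup>+s. (\<integral>\<^sup>+\<omega>. indicator {0..T} s * ennreal (inverse (remaining (max 0 s) \<omega>)) \<partial>M) \<partial>lborel)"
  proof (rule pair_sigma_finite.Fubini'[OF pair_sigma_finite_lborel])
    have "(\<lambda>x. indicator {0..T} (fst x) * ennreal (inverse ((\<lambda>x. remaining (max 0 (fst x)) (snd x)) x))) \<in> borel_measurable (lborel \<Otimes>\<^sub>M M)"
      by measurable
    then show "(\<lambda>(s, \<omega>). indicator {0..T} s * ennreal (inverse (remaining (max 0 s) \<omega>))) \<in> borel_measurable (lborel \<Otimes>\<^sub>M M)"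
      by (simp add: case_prod_beta')
  qed
  also have "\<dots> = (\<integral>\<^sup>+s. indicator {0..T} s * (\<integral>\<^sup>+\<omega>. ennreal (inverse (remaining 0 \<omega>)) \<partial>M) \<partial>lborel)"
  proof (rule nn_integral_cong_AE)
    \<comment> \<open>Equality in law with \<open>remaining 0\<close> was stated for positive times;
      the single time 0 is Lebesgue-null.\<close>
    have "AE s in lborel. s \<noteq> (0::real)" by (rule AE_lborel_singleton)
    then show "AE s in lborel. (\<integral>\<^sup>+\<omega>. indicator {0..T} s * ennreal (inverse (remaining (max 0 s) \<omega>)) \<partial>M) =
      indicator {0..T} s * (\<integral>\<^sup>+\<omega>. ennreal (inverse (remaining 0 \<omega>)) \<partial>M)"
    proof eventually_elim
      case (elim s)
      show ?case
      proof (cases "s \<in> {0..T}")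
        case True
        then have "0 < s" using elim by simp
        then show ?thesis using True nn_integral_remaining[of s "\<lambda>x. ennreal (inverse x)"] by simp
      qed simp
    qed
  qed
  also have "\<dots> = ennreal T * (\<integral>\<^sup>+\<omega>. ennreal (inverse (remaining 0 \<omega>)) \<partial>M)"
    using T by (subst nn_integral_multc) auto
  finally show ?thesis .
qed

text \<open>The clamped logarithms of two functionals with the same law have equal means, so only the increment of \<open>Y\<close> is left.\<close>
lemma integrable_inverse_remaining:
  assumes Y1: "integrable M (Y 1)"
  shows "integrable M (\<lambda>\<omega>. inverse (remaining 0 \<omega>))"
proof -
  define cl where "cl n x = (if 0 < x then max (- real n) (min (real n) (ln x)) else 0)" for n x
  define U where "U \<omega> = Y 1 \<omega> - Y 0 \<omega>" for \<omega>
  \<comment> \<open>Fatou's lemma needs nonnegative functions, hence the absolute value of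
    \<open>U\<close>. Clamping is monotone and does not enlarge differences, and
    \<open>ln (remaining 1)\<close> exceeds \<open>ln (remaining 0)\<close> by at most
    \<open>U\<close>, so \<open>D n\<close> is nonnegative for every \<open>n\<close>.\<close>
  define D where "D n \<omega> = (if 0 < remaining 0 \<omega> then cl n (remaining 0 \<omega>) - cl n (remaining 1 \<omega>) + \<bar>U \<omega>\<bar> else 0)" for n \<omega>
  have rv [measurable]: "random_variable borel (remaining 0)" "random_variable borel (remaining 1)" by auto
  have "integrable M (Y 0)"
    by (subst integrable_cong_AE[where g="\<lambda>_. 0"]) (use random_variable[of 0] start in auto)
  then have iU: "integrable M (\<lambda>\<omega>. \<bar>U \<omega>\<bar>)" unfolding U_def using Y1 by auto
  then have [measurable]: "(\<lambda>\<omega>. \<bar>U \<omega>\<bar>) \<in> borel_measurable M" by auto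
  have clm [measurable]: "cl n \<in> borel_measurable borel" for n unfolding cl_def[abs_def] by measurable
  have clb: "\<bar>cl n x\<bar> \<le> real n" for n x by (auto simp: cl_def)
  have icl: "integrable M (\<lambda>\<omega>. cl n (remaining s \<omega>))" if "0 \<le> s" for n s
  proof -
    note [measurable] = random_variable_remaining[OF that]
    show ?thesis using clb by (intro integrable_const_bound[of _ "real n"]) auto
  qed
  have Deq: "D n \<omega> = cl n (remaining 0 \<omega>) - cl n (remaining 1 \<omega>) + (if 0 < remaining 0 \<omega> then \<bar>U \<omega>\<bar> else 0)" if "\<omega> \<in> space M" for n \<omega>
    using remaining_pos_cong[of 1 \<omega>] that by (auto simp: D_def cl_def)
  have iV: "integrable M (\<lambda>\<omega>. if 0 < remaining 0 \<omega> then \<bar>U \<omega>\<bar> else 0)"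
    by (rule Bochner_Integration.integrable_bound[OF iU]) auto
  have iD: "integrable M (D n)" for n
    by (subst Bochner_Integration.integrable_cong[OF refl Deq])
      (auto intro!: Bochner_Integration.integrable_add Bochner_Integration.integrable_diff icl iV)
  have "(LINT \<omega>|M. D n \<omega>) = (LINT \<omega>|M. (if 0 < remaining 0 \<omega> then \<bar>U \<omega>\<bar> else 0))" for n
  proof -
    have "(LINT \<omega>|M. D n \<omega>) = (LINT \<omega>|M. cl n (remaining 0 \<omega>) - cl n (remaining 1 \<omega>) + (if 0 < remaining 0 \<omega> then \<bar>U \<omega>\<bar> else 0))"
      by (intro Bochner_Integration.integral_cong Deq) auto
    also have "\<dots> = (LINT \<omega>|M. cl n (remaining 0 \<omega>)) - (LINT \<omega>|M. cl n (remaining 1 \<omega>)) + (LINT \<omega>|M. (if 0 < remaining 0 \<omega> then \<bar>U \<omega>\<bar> else 0))"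
      using icl[of 0 n] icl[of 1 n] iV by simp
    finally show ?thesis using integral_remaining[of 1 "cl n"] by simp
  qed
  note ED = this
  have low: "ln (remaining 1 \<omega>) - ln (remaining 0 \<omega>) \<le> U \<omega>"
    and lim: "ennreal (LBINT s:{0..1}. inverse (remaining s \<omega>)) \<le> liminf (\<lambda>n. ennreal (D n \<omega>))"
    if \<omega>: "\<omega> \<in> space M" and pos: "0 < remaining 0 \<omega>" for \<omega>
  proof -
    have "0 \<le> (LBINT s:{0..1}. inverse (remaining s \<omega>))"
      unfolding set_lebesgue_integral_def using remaining_nonneg[OF _ \<omega>]
      by (intro integral_nonneg_AE AE_I2) (auto simp: indicator_def)
    then show le: "ln (remaining 1 \<omega>) - ln (remaining 0 \<omega>) \<le> U \<omega>"
      using ln_remaining_diff(2)[OF _ \<omega> pos, of 1] by (simp add: U_def)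
    have pos1: "0 < remaining 1 \<omega>" using remaining_pos_cong[of 1 \<omega>] \<omega> pos by simp
    obtain N where N: "\<bar>ln (remaining 0 \<omega>)\<bar> + \<bar>ln (remaining 1 \<omega>)\<bar> < real N" using reals_Archimedean2 by blast
    have "D n \<omega> = ln (remaining 0 \<omega>) - ln (remaining 1 \<omega>) + \<bar>U \<omega>\<bar>" if "N \<le> n" for n
    proof -
      have "real N \<le> real n" using that by simp
      then show ?thesis using N pos pos1 by (auto simp: D_def cl_def min_def max_def)
    qed
    then have "\<forall>\<^sub>F n in sequentially. ennreal (D n \<omega>) = ennreal (ln (remaining 0 \<omega>) - ln (remaining 1 \<omega>) + \<bar>U \<omega>\<bar>)"
      unfolding eventually_sequentially by metis
    then have "(\<lambda>n. ennreal (D n \<omega>)) \<longlonglongrightarrow> ennreal (ln (remaining 0 \<omega>) - ln (remaining 1 \<omega>) + \<bar>U \<omega>\<bar>)"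
      by (rule tendsto_eventually)
    then have "liminf (\<lambda>n. ennreal (D n \<omega>)) = ennreal (ln (remaining 0 \<omega>) - ln (remaining 1 \<omega>) + \<bar>U \<omega>\<bar>)"
      by (intro lim_imp_Liminf) auto
    moreover have "(LBINT s:{0..1}. inverse (remaining s \<omega>)) \<le> ln (remaining 0 \<omega>) - ln (remaining 1 \<omega>) + \<bar>U \<omega>\<bar>"
      using ln_remaining_diff(2)[OF _ \<omega> pos, of 1] by (simp add: U_def)
    ultimately show "ennreal (LBINT s:{0..1}. inverse (remaining s \<omega>)) \<le> liminf (\<lambda>n. ennreal (D n \<omega>))"
      by (simp add: ennreal_leI)
  qed
  have D0: "0 \<le> D n \<omega>" if "\<omega> \<in> space M" for n \<omega>
    using low[OF that] remaining_pos_cong[of 1 \<omega>] that by (auto simp: D_def cl_def min_def max_def)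
  have "(\<integral>\<^sup>+\<omega>. ennreal (inverse (remaining 0 \<omega>)) \<partial>M) =
    (\<integral>\<^sup>+\<omega>. (\<integral>\<^sup>+s. indicator {0..1} s * ennreal (inverse (remaining (max 0 s) \<omega>)) \<partial>lborel) \<partial>M)"
    by (subst nn_integral_inverse_remaining) auto
  also have "\<dots> \<le> (\<integral>\<^sup>+\<omega>. liminf (\<lambda>n. ennreal (D n \<omega>)) \<partial>M)"
  proof (intro nn_integral_mono)
    fix \<omega> assume \<omega>: "\<omega> \<in> space M"
    show "(\<integral>\<^sup>+s. indicator {0..1} s * ennreal (inverse (remaining (max 0 s) \<omega>)) \<partial>lborel) \<le> liminf (\<lambda>n. ennreal (D n \<omega>))"
    proof (cases "0 < remaining 0 \<omega>")
      case True
      have "(\<integral>\<^sup>+s. indicator {0..1} s * ennreal (inverse (remaining (max 0 s) \<omega>)) \<partial>lborel) =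
        (\<integral>\<^sup>+s. ennreal (indicator {0..1} s *\<^sub>R inverse (remaining s \<omega>)) \<partial>lborel)"
        by (intro nn_integral_cong) (auto simp: indicator_def)
      also have "\<dots> = ennreal (LBINT s:{0..1}. inverse (remaining s \<omega>))"
        unfolding set_lebesgue_integral_def using ln_remaining_diff(1)[OF _ \<omega> True, of 1] remaining_nonneg[OF _ \<omega>]
        by (intro nn_integral_eq_integral) (auto simp: set_integrable_def indicator_def)
      finally show ?thesis using lim[OF \<omega> True] by simp
    next
      case False
      have "remaining (max 0 s) \<omega> = 0" for s
        using False remaining_pos_cong[of "max 0 s" \<omega>] remaining_nonneg[of "max 0 s" \<omega>] \<omega> by simp
      then show ?thesis by simp
    qed
  qed
  also have "\<dots> \<le> liminf (\<lambda>n. \<integral>\<^sup>+\<omega>. ennreal (D n \<omega>) \<partial>M)"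
    using iD by (intro nn_integral_liminf) auto
  also have "(\<lambda>n. \<integral>\<^sup>+\<omega>. ennreal (D n \<omega>) \<partial>M) = (\<lambda>n. ennreal (LINT \<omega>|M. (if 0 < remaining 0 \<omega> then \<bar>U \<omega>\<bar> else 0)))"
    using nn_integral_eq_integral[OF iD] D0 ED by simp
  also have "liminf \<dots> < \<infinity>" by (simp add: Liminf_const)
  finally have "(\<integral>\<^sup>+\<omega>. ennreal (inverse (remaining 0 \<omega>)) \<partial>M) < \<infinity>" .
  then show ?thesis
    using remaining_nonneg[of 0] by (intro integrableI_nonneg) auto
qed

end

section \<open>Negative increments at small times and the support of the Levy measure\<close>

context spectrally_positive_levy_process
begin

text \<open>Cut \<open>{0..1}\<close> into \<open>n + 1\<close> equal pieces. On a path without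
  negative jumps eventually no increment falls below \<open>- e\<close>, so the probability
  \<open>1 - (1 - p n) ^ (n + 1)\<close> that some increment does tends to 0. Taking logarithms,
  \<open>(n + 1) * p n\<close> is at most \<open>- ln (1 - prob (A n))\<close>.\<close>

lemma small_time_negative_increments:
  assumes e: "0 < e"
  shows "(\<lambda>n. real (Suc n) * measure (distr M borel (Y (inverse (real (Suc n))))) {..<-e}) \<longlonglongrightarrow> 0"
proof -
  define p where "p n = measure (distr M borel (Y (inverse (real (Suc n))))) {..<-e}" for n
  define A where "A n = {\<omega> \<in> space M. \<exists>i<Suc n. increment n 0 i \<omega> < - e}" for n
  have rv [measurable]: "random_variable borel (increment n 0 i)" for n i by (rule random_variable_increment) simp
  have A [measurable]: "A n \<in> events" for n unfolding A_def by measurable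
  have "(\<lambda>n. LINT \<omega>|M. indicator (A n) \<omega>) \<longlonglongrightarrow> (LINT \<omega>|M. (0::real))"
  proof (rule integral_dominated_convergence[where w="\<lambda>_. 1"])
    show "AE \<omega> in M. (\<lambda>n. indicator (A n) \<omega>) \<longlonglongrightarrow> (0::real)"
      using no_negative_jumps AE_space
    proof eventually_elim
      case (elim \<omega>)
      obtain d where d: "0 < d" "\<And>s t. 0 \<le> s \<Longrightarrow> s \<le> t \<Longrightarrow> t \<le> 1 \<Longrightarrow> t - s < d \<Longrightarrow> - e < Y t \<omega> - Y s \<omega>"
        by (rule cadlag_increments_ge[OF cadlag_paths[OF elim(2)] _ e, of 1]) (use elim(1) in blast)+
      obtain N where N: "inverse (real (Suc N)) < d" using reals_Archimedean[OF d(1)] by blast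
      have "indicator (A n) \<omega> = (0::real)" if n: "N \<le> n" for n
      proof -
        have "- e < increment n 0 i \<omega>" if i: "i < Suc n" for i
          unfolding increment_def
        proof (rule d(2))
          show "0 + real (Suc i) / real (Suc n) \<le> 1" using i by simp
          have "0 + real (Suc i) / real (Suc n) - (0 + real i / real (Suc n)) = inverse (real (Suc n))"
            by (simp add: diff_divide_distrib[symmetric] inverse_eq_divide)
          also have "\<dots> \<le> inverse (real (Suc N))" using n by (intro le_imp_inverse_le) auto
          finally show "0 + real (Suc i) / real (Suc n) - (0 + real i / real (Suc n)) < d" using N by linarith
        qed (auto intro: divide_right_mono)
        then show ?thesis by (force simp: A_def indicator_def)
      qed
      then show ?case by (intro tendsto_eventually) (auto simp: eventually_sequentially)
    qed
  qed (auto simp: indicator_def)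
  then have q: "(\<lambda>n. prob (A n)) \<longlonglongrightarrow> 0" by simp
  have p: "prob (increment n 0 i -` {-e..} \<inter> space M) = 1 - p n" for n i
  proof -
    have "prob (increment n 0 i -` {-e..} \<inter> space M) = measure (distr M borel (increment n 0 i)) {-e..}"
      by (simp add: measure_distr)
    also have "\<dots> = measure (distr M borel (Y (inverse (real (Suc n))))) (UNIV - {..<-e})"
      by (subst distr_increment) (auto intro!: arg_cong2[where f=measure])
    also have "\<dots> = 1 - p n"
      using prob_space.prob_compl[OF prob_space_distr[OF random_variable[of "inverse (real (Suc n))"]], of "{..<-e}"]
      by (simp add: p_def)
    finally show ?thesis .
  qed
  have pow: "(1 - p n) ^ Suc n = 1 - prob (A n)" for n
  proof -
    have "prob (\<Inter>i\<in>{..<Suc n}. increment n 0 i -` {-e..} \<inter> space M) = (\<Prod>i\<in>{..<Suc n}. prob (increment n 0 i -` {-e..} \<inter> space M))"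
      by (intro indep_varsD_finite[OF indep_vars_increment]) auto
    then have "prob (\<Inter>i\<in>{..<Suc n}. increment n 0 i -` {-e..} \<inter> space M) = (1 - p n) ^ Suc n"
      by (simp only: p prod_constant card_lessThan)
    also have "(\<Inter>i\<in>{..<Suc n}. increment n 0 i -` {-e..} \<inter> space M) = space M - A n"
      by (auto simp: A_def not_less)
    finally show ?thesis by (simp add: prob_compl[OF A])
  qed
  have p0: "0 \<le> p n" "p n \<le> 1" for n
    using prob_space.prob_le_1[OF prob_space_distr[OF random_variable[of "inverse (real (Suc n))"]]] by (auto simp: p_def)
  show ?thesis
    unfolding p_def[symmetric]
  proof (rule tendsto_sandwich[of "\<lambda>_. 0"])
    show "\<forall>\<^sub>F n in sequentially. 0 \<le> real (Suc n) * p n" using p0 by simp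
    have "\<forall>\<^sub>F n in sequentially. prob (A n) < 1" using order_tendstoD(2)[OF q] by simp
    then show "\<forall>\<^sub>F n in sequentially. real (Suc n) * p n \<le> - ln (1 - prob (A n))"
    proof eventually_elim
      case (elim n)
      have "p n \<noteq> 1" using pow[of n] elim by auto
      then have "0 < 1 - p n" using p0[of n] by simp
      then have "ln (1 - p n) \<le> - p n" using ln_le_minus_one[of "1 - p n"] by simp
      then have "real (Suc n) * ln (1 - p n) \<le> real (Suc n) * (- p n)" by (intro mult_left_mono) auto
      moreover have "real (Suc n) * ln (1 - p n) = ln (1 - prob (A n))"
        unfolding pow[symmetric] by (rule ln_realpow[symmetric])
      ultimately show ?case by simp
    qed
    have "(\<lambda>n. - ln (1 - prob (A n))) \<longlonglongrightarrow> - ln (1 - 0)" by (intro tendsto_intros q) simp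
    then show "(\<lambda>n. - ln (1 - prob (A n))) \<longlonglongrightarrow> 0" by simp
  qed simp
qed

lemma levy_measure_nonpos_null:
  assumes "has_levy_measure M Y \<pi>" shows "emeasure \<pi> {..0} = 0"
proof -
  from assms obtain a \<sigma> where s: "sets \<pi> = sets borel" and z: "emeasure \<pi> {0} = 0"
    and l: "(\<integral>\<^sup>+x. ennreal (min 1 (x\<^sup>2)) \<partial>\<pi>) < \<infinity>"
    and char: "\<And>t u. 0 \<le> t \<Longrightarrow> char (distr M borel (Y t)) u = exp (of_real t * levy_khintchine_exponent a \<sigma> \<pi> u)"
    unfolding has_levy_measure_def by blast
  have "emeasure \<pi> {..<0} = 0"
  proof (rule levy_measure_negative_null[OF s l])
    show "real_distribution (distr M borel (Y (inverse (real (Suc n)))))" for n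
      by (intro real_distribution_distr random_variable) simp
    show "char (distr M borel (Y (inverse (real (Suc n))))) u = exp (levy_khintchine_exponent a \<sigma> \<pi> u / of_nat (Suc n))" for n u
      by (subst char) (auto simp: divide_inverse mult.commute)
    show "0 < e \<Longrightarrow> (\<lambda>n. real (Suc n) * measure (distr M borel (Y (inverse (real (Suc n))))) {..<-e}) \<longlonglongrightarrow> 0" for e
      by (rule small_time_negative_increments)
  qed
  moreover have "{..0} = {..<0} \<union> {0::real}" by auto
  ultimately show ?thesis using z
    by (metis null_sets.Un null_setsI null_setsD1 s sets_lborel lessThan_borel borel_singleton sets.empty_sets emeasure_Un_null_set sets_borel_eq_count_space)
qed

end

section \<open>Taking expectations along the path\<close>

lemma integral_exp_of_real_mult:
  fixes k :: complex
  assumes t: "0 \<le> t"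
  shows "k * (CLBINT s:{0..t}. exp (of_real s * k)) = exp (of_real t * k) - 1"
proof -
  have "(CLBINT s. indicator {0..t} s *\<^sub>R (k * exp (of_real s * k))) = exp (of_real t * k) - exp (of_real 0 * k)"
  proof (rule integral_FTC_atLeastAtMost[OF t])
    show "((\<lambda>s. exp (of_real s * k)) has_vector_derivative k * exp (of_real s * k)) (at s within {0..t})" for s
      by (auto intro!: derivative_eq_intros has_vector_derivative_real_field simp: scaleR_conv_of_real)
    show "continuous_on {0..t} (\<lambda>s. k * exp (of_real s * k))" by (intro continuous_intros)
  qed
  then show ?thesis
    unfolding set_lebesgue_integral_def mult_scaleR_right[symmetric]
    by (simp add: mult_scaleR_right[symmetric] del: mult_scaleR_right)
qed

lemma exp_neq_one_small:
  fixes z :: complex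
  assumes "cmod z < 1" "z \<noteq> 0" shows "exp z \<noteq> 1"
proof
  assume "exp z = 1"
  then obtain n :: int where n: "Re z = 0" "Im z = of_int (2 * n) * pi" by (auto simp: exp_eq_1)
  have "\<bar>Im z\<bar> < 1" using abs_Im_le_cmod[of z] assms(1) by linarith
  have "n = 0"
  proof (rule ccontr)
    assume "n \<noteq> 0"
    then have "1 \<le> \<bar>real_of_int (2 * n)\<bar>" by linarith
    then have "1 * pi \<le> \<bar>real_of_int (2 * n)\<bar> * pi" by (intro mult_right_mono) auto
    moreover have "\<bar>Im z\<bar> = \<bar>real_of_int (2 * n)\<bar> * pi" by (simp add: n(2) abs_mult)
    ultimately show False using \<open>\<bar>Im z\<bar> < 1\<close> pi_gt3 by linarith
  qed
  then show False using n assms(2) by (simp add: complex_eq_iff)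
qed

context levy_process
begin

lemma char_Y:
  assumes "0 \<le> s" shows "(CLINT \<omega>|M. iexp (u * Y s \<omega>)) = char (distr M borel (Y s)) u"
  unfolding char_def using random_variable[OF assms] by (subst integral_distr) auto

lemma integral_iexp_remaining:
  fixes k :: "real \<Rightarrow> complex"
  assumes s: "0 < s" and k: "k \<in> borel_measurable borel" and i: "complex_integrable M (\<lambda>\<omega>. k (remaining 0 \<omega>))"
  shows "(CLINT \<omega>|M. iexp (u * Y s \<omega>) * k (remaining s \<omega>)) =
    char (distr M borel (Y s)) u * (CLINT \<omega>|M. k (remaining 0 \<omega>))"
proof -
  note [measurable] = k random_variable[of 0, OF order.refl] random_variable[OF less_imp_le[OF s]]
    random_variable_remaining[OF less_imp_le[OF s]] random_variable_remaining[of 0, OF order.refl]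
  have ik: "complex_integrable M (\<lambda>\<omega>. k (remaining s \<omega>))"
  proof -
    have "complex_integrable (distr M borel (remaining s)) k"
      unfolding distr_remaining[OF s] using i by (subst integrable_distr_eq) auto
    then show ?thesis by (subst (asm) integrable_distr_eq) auto
  qed
  have ie: "complex_integrable M (\<lambda>\<omega>. iexp (u * (Y s \<omega> - Y 0 \<omega>)))"
    by (intro integrable_const_bound[of _ 1]) auto
  have AE0: "AE \<omega> in M. Y 0 \<omega> = 0" by (rule start)
  have "indep_var borel ((\<lambda>x. iexp (u * x)) \<circ> (\<lambda>\<omega>. Y s \<omega> - Y 0 \<omega>)) borel (k \<circ> remaining s)"
    by (rule indep_var_compose[OF indep_var_remaining[OF s]]) (use k in auto)
  then have ind: "indep_var borel (\<lambda>\<omega>. iexp (u * (Y s \<omega> - Y 0 \<omega>))) borel (\<lambda>\<omega>. k (remaining s \<omega>))"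
    by (simp only: comp_def)
  have "(CLINT \<omega>|M. iexp (u * Y s \<omega>) * k (remaining s \<omega>)) = (CLINT \<omega>|M. iexp (u * (Y s \<omega> - Y 0 \<omega>)) * k (remaining s \<omega>))"
    using AE0 by (intro integral_cong_AE) auto
  also have "\<dots> = (CLINT \<omega>|M. iexp (u * (Y s \<omega> - Y 0 \<omega>))) * (CLINT \<omega>|M. k (remaining s \<omega>))"
    by (rule indep_var_lebesgue_integral[OF ind ie ik])
  also have "(CLINT \<omega>|M. iexp (u * (Y s \<omega> - Y 0 \<omega>))) = (CLINT \<omega>|M. iexp (u * Y s \<omega>))"
    using AE0 by (intro integral_cong_AE) auto
  also have "\<dots> = char (distr M borel (Y s)) u" using s by (intro char_Y) simp
  also have "(CLINT \<omega>|M. k (remaining s \<omega>)) = (CLINT \<omega>|M. k (remaining 0 \<omega>))"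
    by (rule integral_remaining[OF s k])
  finally show ?thesis .
qed

text \<open>Expectations of the pathwise identity factor by independence and stationarity, giving
  \<open>G * (1 - exp (t * \<kappa>)) = \<i> * u * H\<close> times the integral of
  \<open>exp (s * \<kappa>)\<close> over \<open>{0..t}\<close>. Multiplied by \<kappa>, that
  integral is \<open>exp (t * \<kappa>) - 1\<close>, so one time with
  \<open>exp (t * \<kappa>) \<noteq> 1\<close> suffices. Finiteness of the mean of
  \<open>1 / I\<close> justifies Fubini.\<close>

lemma remaining_fourier_equation:
  assumes char: "\<And>t. 0 \<le> t \<Longrightarrow> char (distr M borel (Y t)) (- u) = exp (of_real t * \<kappa>)"
    and inv: "integrable M (\<lambda>\<omega>. inverse (remaining 0 \<omega>))"
  defines "g \<equiv> \<lambda>x. if 0 < x then iexp (u * ln x) else 0"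
  shows "\<i> * of_real u * (CLINT \<omega>|M. g (remaining 0 \<omega>) * of_real (inverse (remaining 0 \<omega>))) =
    - \<kappa> * (CLINT \<omega>|M. g (remaining 0 \<omega>))"
proof -
  define h where "h x = g x * complex_of_real (inverse x)" for x
  have g [measurable]: "g \<in> borel_measurable borel" unfolding g_def by measurable
  have h [measurable]: "h \<in> borel_measurable borel" unfolding h_def[abs_def] by measurable
  have g1: "cmod (g x) \<le> 1" for x by (simp add: g_def)
  have h1: "cmod (h x) \<le> inverse x" if "0 \<le> x" for x using that by (simp add: h_def g_def norm_mult norm_inverse)
  note R0 [measurable] = random_variable_remaining[of 0, OF order.refl]
  have ig: "complex_integrable M (\<lambda>\<omega>. g (remaining 0 \<omega>))"
    using g1 by (intro integrable_const_bound[of _ 1]) auto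
  have ih: "complex_integrable M (\<lambda>\<omega>. h (remaining 0 \<omega>))"
    by (rule Bochner_Integration.integrable_bound[OF inv]) (auto intro!: order_trans[OF h1] AE_I2 simp: remaining_nonneg)
  define G where "G = (CLINT \<omega>|M. g (remaining 0 \<omega>))"
  define H where "H = (CLINT \<omega>|M. h (remaining 0 \<omega>))"
  define q where "q s \<omega> = iexp (- u * Y (max 0 s) \<omega>) * h (remaining (max 0 s) \<omega>)" for s \<omega>
  have eq: "G * (1 - exp (of_real t * \<kappa>)) = \<i> * of_real u * (H * (CLBINT s:{0..t}. exp (of_real s * \<kappa>)))"
    if t: "0 < t" for t
  proof -
    note Rt [measurable] = random_variable_remaining[OF less_imp_le[OF t]]
    note Yt [measurable] = random_variable[OF less_imp_le[OF t]] random_variable[of 0, OF order.refl]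
    note [measurable] = borel_measurable_remaining_pair borel_measurable_Y_pair
    have path: "g (remaining 0 \<omega>) * iexp (- u * Y 0 \<omega>) - iexp (- u * Y t \<omega>) * g (remaining t \<omega>) =
        \<i> * of_real u * (CLBINT s:{0..t}. q s \<omega>)" if \<omega>: "\<omega> \<in> space M" for \<omega>
    proof (cases "0 < remaining 0 \<omega>")
      case True
      have i: "set_integrable lborel {0..} (\<lambda>t. exp (- Y t \<omega>))"
        using True remaining_pos_iff[OF _ \<omega>, of 0] by simp
      note c = cadlag_paths[OF \<omega>]
      have tail: "iexp_ln_tail (\<lambda>t. Y t \<omega>) u s = iexp (- u * Y s \<omega>) * g (remaining s \<omega>)" if s: "0 \<le> s" for s
      proof -
        have "0 < remaining s \<omega>" using remaining_pos_cong[OF s \<omega>] True by simp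
        then show ?thesis
          unfolding iexp_ln_tail_def[OF c i] tail_functional_def remaining_def[symmetric]
          by (simp add: ln_mult g_def exp_add[symmetric] algebra_simps)
      qed
      have "(CLBINT s:{0..t}. q s \<omega>) =
        (CLBINT s:{0..t}. iexp_ln_tail (\<lambda>t. Y t \<omega>) u s * of_real (inverse_functional (\<lambda>t. Y t \<omega>) s))"
        by (intro set_lebesgue_integral_cong)
          (auto simp: q_def tail h_def inverse_functional_def[OF c i] remaining_def[symmetric] mult_ac)
      then show ?thesis
        using iexp_ln_tail_eq[OF c i, of t u] t by (simp add: tail mult.commute)
    next
      case False
      have "remaining r \<omega> = 0" if "0 \<le> r" for r
        using False remaining_pos_cong[OF that \<omega>] remaining_nonneg[OF that \<omega>] by simp
      then have "remaining 0 \<omega> = 0" "remaining t \<omega> = 0" "\<And>s. q s \<omega> = 0" using t by (auto simp: q_def h_def g_def)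
      then show ?thesis by (simp add: g_def set_lebesgue_integral_def)
    qed
    have Et: "(CLINT \<omega>|M. iexp (- u * Y t \<omega>) * g (remaining t \<omega>)) = exp (of_real t * \<kappa>) * G"
      unfolding G_def by (subst integral_iexp_remaining[OF t g ig]) (use t char in simp)
    have E0: "(CLINT \<omega>|M. g (remaining 0 \<omega>) * iexp (- u * Y 0 \<omega>)) = G"
      unfolding G_def using start by (intro integral_cong_AE) auto
    have "(CLINT \<omega>|M. g (remaining 0 \<omega>) * iexp (- u * Y 0 \<omega>) - iexp (- u * Y t \<omega>) * g (remaining t \<omega>)) = G - exp (of_real t * \<kappa>) * G"
      unfolding Et[symmetric] unfolding E0[symmetric]
      using g1 by (intro Bochner_Integration.integral_diff integrable_const_bound[of _ 1]) (auto simp: norm_mult)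
    moreover have "(CLINT \<omega>|M. g (remaining 0 \<omega>) * iexp (- u * Y 0 \<omega>) - iexp (- u * Y t \<omega>) * g (remaining t \<omega>)) =
        \<i> * of_real u * (CLINT \<omega>|M. (CLBINT s:{0..t}. q s \<omega>))"
      by (subst Bochner_Integration.integral_cong[OF refl path]) auto
    moreover have "(CLINT \<omega>|M. (CLBINT s:{0..t}. q s \<omega>)) = H * (CLBINT s:{0..t}. exp (of_real s * \<kappa>))"
    proof -
      define Q where "Q s \<omega> = indicator {0..t} s *\<^sub>R q s \<omega>" for s \<omega>
      have Q: "case_prod Q \<in> borel_measurable (lborel \<Otimes>\<^sub>M M)"
      proof -
        have "(\<lambda>x. indicator {0..t} (fst x) *\<^sub>R (iexp (- u * (\<lambda>x. Y (max 0 (fst x)) (snd x)) x) * h ((\<lambda>x. remaining (max 0 (fst x)) (snd x)) x)))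
          \<in> borel_measurable (lborel \<Otimes>\<^sub>M M)" by measurable
        then show ?thesis by (simp add: case_prod_beta' Q_def q_def)
      qed
      have iQ: "integrable (lborel \<Otimes>\<^sub>M M) (case_prod Q)"
      proof (rule integrableI_bounded[OF Q])
        have "(\<integral>\<^sup>+x. ennreal (norm (case_prod Q x)) \<partial>(lborel \<Otimes>\<^sub>M M)) = (\<integral>\<^sup>+\<omega>. (\<integral>\<^sup>+s. ennreal (norm (Q s \<omega>)) \<partial>lborel) \<partial>M)"
          using pair_sigma_finite.nn_integral_snd[OF pair_sigma_finite_lborel, of "\<lambda>x. ennreal (norm (case_prod Q x))"] Q by simp
        also have "\<dots> \<le> (\<integral>\<^sup>+\<omega>. (\<integral>\<^sup>+s. indicator {0..t} s * ennreal (inverse (remaining (max 0 s) \<omega>)) \<partial>lborel) \<partial>M)"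
        proof (intro nn_integral_mono)
          fix \<omega> s assume "\<omega> \<in> space M"
          then have "cmod (h (remaining (max 0 s) \<omega>)) \<le> inverse (remaining (max 0 s) \<omega>)"
            by (intro h1 remaining_nonneg) auto
          then show "ennreal (norm (Q s \<omega>)) \<le> indicator {0..t} s * ennreal (inverse (remaining (max 0 s) \<omega>))"
            by (auto simp: Q_def q_def norm_mult indicator_def intro!: ennreal_leI)
        qed
        also have "\<dots> = ennreal t * (\<integral>\<^sup>+\<omega>. ennreal (inverse (remaining 0 \<omega>)) \<partial>M)"
          using t by (intro nn_integral_inverse_remaining) simp
        also have "(\<integral>\<^sup>+\<omega>. ennreal (inverse (remaining 0 \<omega>)) \<partial>M) = ennreal (LINT \<omega>|M. inverse (remaining 0 \<omega>))"
          using inv remaining_nonneg[of 0] by (intro nn_integral_eq_integral) auto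
        also have "ennreal t * \<dots> < \<infinity>" by (simp add: ennreal_mult_less_top)
        finally show "(\<integral>\<^sup>+x. ennreal (norm (case_prod Q x)) \<partial>(lborel \<Otimes>\<^sub>M M)) < \<infinity>" .
      qed
      have "(CLINT \<omega>|M. (CLBINT s:{0..t}. q s \<omega>)) = (CLINT \<omega>|M. (CLBINT s. Q s \<omega>))"
        by (simp add: Q_def set_lebesgue_integral_def)
      also have "\<dots> = (CLBINT s. (CLINT \<omega>|M. Q s \<omega>))"
        by (rule pair_sigma_finite.Fubini_integral[OF pair_sigma_finite_lborel iQ])
      also have "\<dots> = (CLBINT s. H * (indicator {0..t} s *\<^sub>R exp (of_real s * \<kappa>)))"
      proof (rule integral_cong_AE)
        have "AE s in lborel. s \<noteq> (0::real)" by (rule AE_lborel_singleton)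
        then show "AE s in lborel. (CLINT \<omega>|M. Q s \<omega>) = H * (indicator {0..t} s *\<^sub>R exp (of_real s * \<kappa>))"
        proof eventually_elim
          case (elim s)
          show ?case
          proof (cases "s \<in> {0..t}")
            case True
            then have s: "0 < s" "max 0 s = s" using elim by auto
            have "(CLINT \<omega>|M. Q s \<omega>) = (CLINT \<omega>|M. iexp (- u * Y s \<omega>) * h (remaining s \<omega>))"
              using True by (simp add: Q_def q_def s(2))
            also have "\<dots> = exp (of_real s * \<kappa>) * H"
              unfolding H_def by (subst integral_iexp_remaining[OF s(1) h ih]) (use s char in simp)
            finally show ?thesis using True by simp
          qed (simp add: Q_def)
        qed
        show "(\<lambda>s. CLINT \<omega>|M. Q s \<omega>) \<in> borel_measurable lborel"
          using Q by (intro borel_measurable_lebesgue_integral) simp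
      qed simp
      also have "\<dots> = H * (CLBINT s:{0..t}. exp (of_real s * \<kappa>))"
        unfolding set_lebesgue_integral_def by (rule integral_mult_right_zero)
      finally show ?thesis .
    qed
    ultimately show ?thesis by (simp add: right_diff_distrib mult.commute)
  qed
  show ?thesis
    unfolding h_def[symmetric] H_def[symmetric] G_def[symmetric]
  proof (cases "\<kappa> = 0")
    case True
    have "(CLBINT s:{0..1::real}. (1::complex)) = 1" by (simp add: set_lebesgue_integral_def)
    then show "\<i> * of_real u * H = - \<kappa> * G" using eq[of 1] True by simp
  next
    case False
    obtain t where t: "0 < t" "exp (of_real t * \<kappa>) \<noteq> 1"
    proof -
      \<comment> \<open>Small enough that \<open>t * \<kappa>\<close> has modulus below 1, hence is
        not a nonzero multiple of the period of the exponential.\<close>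
      define t where "t = inverse (1 + cmod \<kappa>)"
      have t0: "0 < t" by (simp add: t_def add_pos_nonneg)
      have "cmod (of_real t * \<kappa>) = t * cmod \<kappa>" using t0 by (simp add: norm_mult)
      also have "\<dots> < 1" by (simp add: t_def field_simps add_pos_nonneg)
      finally have "cmod (of_real t * \<kappa>) < 1" .
      moreover have "of_real t * \<kappa> \<noteq> 0" using False t0 by simp
      ultimately have "exp (of_real t * \<kappa>) \<noteq> 1" by (intro exp_neq_one_small)
      then show ?thesis using that t0 by blast
    qed
    have "\<kappa> * G * (1 - exp (of_real t * \<kappa>)) = \<i> * of_real u * H * (\<kappa> * (CLBINT s:{0..t}. exp (of_real s * \<kappa>)))"
      using eq[OF t(1)] by (simp add: mult_ac)
    also have "\<dots> = - (\<i> * of_real u * H) * (1 - exp (of_real t * \<kappa>))"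
      using t by (subst integral_exp_of_real_mult) (auto simp: algebra_simps)
    finally have "\<kappa> * G * (1 - exp (of_real t * \<kappa>)) = - (\<i> * of_real u * H) * (1 - exp (of_real t * \<kappa>))" .
    moreover have "1 - exp (of_real t * \<kappa>) \<noteq> 0" using t(2) by simp
    ultimately have "\<kappa> * G = - (\<i> * of_real u * H)" by (rule mult_right_cancel[THEN iffD1, rotated])
    then show "\<i> * of_real u * H = - \<kappa> * G" by simp
  qed
qed

end

subsection \<open>The density near zero\<close>

lemma nn_integral_exp_substitution:
  fixes f :: "real \<Rightarrow> ennreal"
  assumes f [measurable]: "f \<in> borel_measurable borel"
  shows "(\<integral>\<^sup>+z. f (exp z) * ennreal (exp z) \<partial>lborel) = (\<integral>\<^sup>+t. f t * indicator {0<..} t \<partial>lborel)"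
proof -
  define I where "I n = {- real (Suc n)..real (Suc n)}" for n
  define J where "J n = {exp (- real (Suc n))..exp (real (Suc n))}" for n
  have eq: "(\<integral>\<^sup>+t. f t * indicator (J n) t \<partial>lborel) = (\<integral>\<^sup>+z. f (exp z) * ennreal (exp z) * indicator (I n) z \<partial>lborel)" for n
    unfolding I_def J_def
    by (rule nn_integral_substitution_aux) (auto intro!: derivative_eq_intros continuous_intros)
  have "incseq I" by (auto simp: I_def incseq_def)
  moreover have "incseq J" by (auto simp: J_def incseq_def intro: order_trans)
  moreover have "(\<Union>n. I n) = UNIV"
  proof (intro equalityI subsetI UNIV_I)
    fix z :: real
    obtain n where "\<bar>z\<bar> < real n" using reals_Archimedean2 by blast
    then show "z \<in> (\<Union>n. I n)" by (auto simp: I_def intro!: exI[of _ n])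
  qed
  moreover have "(\<Union>n. J n) = {0<..}"
  proof (intro equalityI subsetI)
    fix t :: real assume t: "t \<in> {0<..}"
    obtain n where "\<bar>ln t\<bar> < real n" using reals_Archimedean2 by blast
    then have "- real (Suc n) \<le> ln t" "ln t \<le> real (Suc n)" by auto
    then have "exp (- real (Suc n)) \<le> t" "t \<le> exp (real (Suc n))"
      using t exp_ln[of t] by (metis exp_le_cancel_iff greaterThan_iff)+
    then show "t \<in> (\<Union>n. J n)" by (auto simp: J_def simp del: of_nat_Suc)
  qed (auto simp: J_def intro: less_le_trans[OF exp_gt_zero])
  moreover have lim: "(\<lambda>n. \<integral>\<^sup>+x. g x * indicator (K n) x \<partial>lborel) \<longlonglongrightarrow> (\<integral>\<^sup>+x. g x * indicator (\<Union>n. K n) x \<partial>lborel)"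
    if g: "g \<in> borel_measurable borel" and K: "incseq K" "\<And>n. K n \<in> sets borel" for g :: "real \<Rightarrow> ennreal" and K
  proof (rule nn_integral_LIMSEQ)
    show "incseq (\<lambda>n x. g x * indicator (K n) x)"
      using K(1) by (auto simp: incseq_def le_fun_def indicator_def)
    show "(\<lambda>n. g x * indicator (K n) x) \<longlonglongrightarrow> g x * indicator (\<Union>n. K n) x" for x
    proof (cases "x \<in> (\<Union>n. K n)")
      case True
      then obtain N where "x \<in> K N" by blast
      then have "x \<in> K n" if "N \<le> n" for n using K(1) that by (auto simp: incseq_def)
      then have "\<forall>\<^sub>F n in sequentially. g x * indicator (K n) x = g x"
        unfolding eventually_sequentially by (intro exI[of _ N]) simp
      then show ?thesis using True by (simp add: tendsto_eventually)
    qed auto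
    show "(\<lambda>x. g x * indicator (K n) x) \<in> borel_measurable lborel" for n
      using g K(2) by measurable
  qed
  ultimately have "(\<lambda>n. \<integral>\<^sup>+z. f (exp z) * ennreal (exp z) * indicator (I n) z \<partial>lborel) \<longlonglongrightarrow> (\<integral>\<^sup>+z. f (exp z) * ennreal (exp z) * indicator UNIV z \<partial>lborel)"
    and "(\<lambda>n. \<integral>\<^sup>+t. f t * indicator (J n) t \<partial>lborel) \<longlonglongrightarrow> (\<integral>\<^sup>+t. f t * indicator {0<..} t \<partial>lborel)"
    using lim[of "\<lambda>z. f (exp z) * ennreal (exp z)" I] lim[of f J] by (auto simp: I_def J_def)
  then show ?thesis unfolding eq by (auto dest: LIMSEQ_unique)
qed

text \<open>Test the inequality on the subset of \<open>S\<close> where \<open>f\<close> exceeds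
  \<open>g\<close>; the finite integral of \<open>g\<close> can be cancelled there, and the excess
  integrates to 0.\<close>

lemma AE_le_of_nn_integral_le:
  assumes [measurable]: "f \<in> borel_measurable M" "g \<in> borel_measurable M" "S \<in> sets M"
    and le: "\<And>B. B \<in> sets M \<Longrightarrow> B \<subseteq> S \<Longrightarrow> (\<integral>\<^sup>+x. f x * indicator B x \<partial>M) \<le> (\<integral>\<^sup>+x. g x * indicator B x \<partial>M)"
    and fin: "(\<integral>\<^sup>+x. g x * indicator S x \<partial>M) < \<infinity>"
  shows "AE x in M. x \<in> S \<longrightarrow> f x \<le> (g x :: ennreal)"
proof -
  define B where "B = {x \<in> space M. x \<in> S \<and> g x < f x}"
  have B [measurable]: "B \<in> sets M" unfolding B_def by measurable
  have BS: "B \<subseteq> S" by (auto simp: B_def)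
  define d where "d x = (f x - g x) * indicator B x" for x
  have d [measurable]: "d \<in> borel_measurable M" unfolding d_def[abs_def] by measurable
  have gfin: "(\<integral>\<^sup>+x. g x * indicator B x \<partial>M) < \<infinity>"
    by (rule le_less_trans[OF nn_integral_mono fin]) (use BS in \<open>auto simp: indicator_def\<close>)
  have "(\<integral>\<^sup>+x. g x * indicator B x \<partial>M) + (\<integral>\<^sup>+x. d x \<partial>M) = (\<integral>\<^sup>+x. g x * indicator B x + d x \<partial>M)"
    by (rule nn_integral_add[symmetric]) measurable
  also have "\<dots> = (\<integral>\<^sup>+x. f x * indicator B x \<partial>M)"
    by (intro nn_integral_cong) (auto simp: d_def B_def indicator_def add_diff_inverse_ennreal less_imp_le)
  also have "\<dots> \<le> (\<integral>\<^sup>+x. g x * indicator B x \<partial>M) + 0" using le[OF B BS] by simp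
  finally have "(\<integral>\<^sup>+x. d x \<partial>M) = 0"
    using gfin by (subst (asm) ennreal_add_left_cancel_le) auto
  then have "AE x in M. d x = 0" by (simp add: nn_integral_0_iff_AE)
  then show ?thesis using AE_space
    by eventually_elim (auto simp: d_def B_def indicator_def not_less[symmetric] diff_eq_0_iff_ennreal)
qed

context prob_space
begin

text \<open>The event \<open>I = 0\<close> is removed before the logarithm is taken, since
  \<open>ln 0\<close> would be a spurious value. The total mass may therefore fall short of
  1.\<close>

definition ln_law :: "('a \<Rightarrow> real) \<Rightarrow> real measure" where
  "ln_law I = distr (density M (\<lambda>\<omega>. ennreal (indicator {0<..} (I \<omega>)))) borel (\<lambda>\<omega>. ln (I \<omega>))"

context
  fixes I :: "'a \<Rightarrow> real"
  assumes I [measurable]: "random_variable borel I"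
begin

lemma sets_ln_law: "sets (ln_law I) = sets borel"
  by (simp add: ln_law_def)

lemma emeasure_ln_law:
  assumes [measurable]: "A \<in> sets borel"
  shows "emeasure (ln_law I) A = emeasure M {\<omega> \<in> space M. 0 < I \<omega> \<and> ln (I \<omega>) \<in> A}"
proof -
  have "emeasure (ln_law I) A = (\<integral>\<^sup>+\<omega>. ennreal (indicator {0<..} (I \<omega>)) * indicator ((\<lambda>\<omega>. ln (I \<omega>)) -` A \<inter> space M) \<omega> \<partial>M)"
    unfolding ln_law_def by (subst emeasure_distr) (auto simp: emeasure_density)
  also have "\<dots> = (\<integral>\<^sup>+\<omega>. indicator {\<omega> \<in> space M. 0 < I \<omega> \<and> ln (I \<omega>) \<in> A} \<omega> \<partial>M)"
    by (intro nn_integral_cong) (auto simp: indicator_def)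
  finally show ?thesis by simp
qed

lemma emeasure_ln_law_le: "emeasure (ln_law I) A \<le> 1"
proof -
  have "emeasure (ln_law I) A \<le> emeasure (ln_law I) UNIV"
    by (rule emeasure_mono) (auto simp: sets_ln_law)
  also have "\<dots> \<le> 1" by (subst emeasure_ln_law) (auto simp: emeasure_le_1)
  finally show ?thesis .
qed

lemma integral_ln_law:
  fixes g :: "real \<Rightarrow> 'b::{banach, second_countable_topology}"
  assumes [measurable]: "g \<in> borel_measurable borel"
  shows "(LINT z|ln_law I. g z) = (LINT \<omega>|M. indicator {0<..} (I \<omega>) *\<^sub>R g (ln (I \<omega>)))"
    and integrable_ln_law_iff: "integrable (ln_law I) g \<longleftrightarrow> integrable M (\<lambda>\<omega>. indicator {0<..} (I \<omega>) *\<^sub>R g (ln (I \<omega>)))"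
proof -
  have 1: "(\<lambda>\<omega>. ln (I \<omega>)) \<in> measurable (density M (\<lambda>\<omega>. ennreal (indicator {0<..} (I \<omega>)))) borel" by simp
  have 2: "(\<lambda>\<omega>. indicat_real {0<..} (I \<omega>)) \<in> borel_measurable M" "(\<lambda>\<omega>. g (ln (I \<omega>))) \<in> borel_measurable M"
    by measurable
  show "(LINT z|ln_law I. g z) = (LINT \<omega>|M. indicator {0<..} (I \<omega>) *\<^sub>R g (ln (I \<omega>)))"
    unfolding ln_law_def integral_distr[OF 1 assms] by (rule integral_density[OF 2(2,1)]) simp
  show "integrable (ln_law I) g \<longleftrightarrow> integrable M (\<lambda>\<omega>. indicator {0<..} (I \<omega>) *\<^sub>R g (ln (I \<omega>)))"
    unfolding ln_law_def integrable_distr_eq[OF 1 assms] by (rule integrable_density[OF 2(2,1)]) simp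
qed

end

end

context spectrally_positive_levy_process
begin

text \<open>The order matters: the exponential tail gives the big jumps a second moment, this gives
  \<open>Y 1\<close> a finite mean, hence \<open>1 / I\<close> has a finite mean, and only then is
  the Fourier equation available.\<close>

lemma ln_exp_functional_law:
  assumes lm: "has_levy_measure M Y \<pi>" and \<alpha>: "0 < \<alpha>"
    and tail: "\<And>y. ((\<lambda>x. levy_tail \<pi> (x + y) / levy_tail \<pi> x) \<longlongrightarrow> exp (- \<alpha> * y)) at_top"
  obtains a \<sigma> where "tail_log_functional_law (ln_law (exp_functional Y)) \<pi> a \<sigma> \<alpha>"
proof -
  from lm obtain a \<sigma> where s: "sets \<pi> = sets borel"
    and l: "(\<integral>\<^sup>+x. ennreal (min 1 (x\<^sup>2)) \<partial>\<pi>) < \<infinity>"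
    and char: "\<And>t u. 0 \<le> t \<Longrightarrow> char (distr M borel (Y t)) u = exp (of_real t * levy_khintchine_exponent a \<sigma> \<pi> u)"
    unfolding has_levy_measure_def by blast
  interpret E: exponential_tail \<pi> \<alpha>
    by unfold_locales (use s l \<alpha> tail in auto)
  have null: "emeasure \<pi> {..0} = 0" by (rule levy_measure_nonpos_null[OF lm])
  moreover have "emeasure \<pi> {..<0} \<le> emeasure \<pi> {..0}" by (intro emeasure_mono) (auto simp: s)
  ultimately have "emeasure \<pi> {..<0} = 0" by simp
  moreover have "integrable \<pi> (\<lambda>y. indicator {1<..} y * y\<^sup>2)"
    by (rule E.integrable_power_tail)
  ultimately have "integrable (distr M borel (Y 1)) (\<lambda>x. \<bar>x\<bar>)"
    using random_variable[of 1] char[of 1]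
    by (intro integrable_abs_infinitely_divisible[OF s l]) (auto intro: real_distribution_distr)
  then have "integrable M (\<lambda>\<omega>. \<bar>Y 1 \<omega>\<bar>)" using random_variable[of 1] by (subst (asm) integrable_distr_eq) auto
  then have "integrable M (Y 1)" using random_variable[of 1] by (subst (asm) integrable_abs_iff) auto
  note inv = integrable_inverse_remaining[OF this]
  let ?I = "exp_functional Y"
  note I [measurable] = random_variable_exp_functional
  note R [measurable] = random_variable_remaining[of 0, OF order.refl]
  have R0: "AE \<omega> in M. 0 \<le> remaining 0 \<omega>" by (intro AE_I2 remaining_nonneg) simp
  have "tail_log_functional_law (ln_law ?I) \<pi> a \<sigma> \<alpha>"
  proof (intro tail_log_functional_law.intro log_functional_law.intro)
    show "exponential_tail \<pi> \<alpha>" by (rule E.exponential_tail_axioms)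
    show "sets (ln_law ?I) = sets borel" by (rule sets_ln_law[OF I])
    show "finite_measure (ln_law ?I)"
      using emeasure_ln_law_le[OF I, of "space (ln_law ?I)"] by (intro finite_measureI) (auto simp: top_unique)
    show "measure (ln_law ?I) UNIV \<le> 1"
      using emeasure_ln_law_le[OF I, of UNIV] by (auto simp: measure_def intro: enn2real_leI)
    show "integrable (ln_law ?I) (\<lambda>z. exp (- z))"
    proof (subst integrable_ln_law_iff[OF I])
      show "integrable M (\<lambda>\<omega>. indicator {0<..} (?I \<omega>) *\<^sub>R exp (- ln (?I \<omega>)))"
      proof (subst integrable_cong_AE[where g="\<lambda>\<omega>. inverse (remaining 0 \<omega>)"])
        show "AE \<omega> in M. indicator {0<..} (?I \<omega>) *\<^sub>R exp (- ln (?I \<omega>)) = inverse (remaining 0 \<omega>)"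
          using remaining_0_eq R0 by eventually_elim (auto simp: exp_minus indicator_def)
      qed (use inv in measurable)
    qed measurable
    show "integrable \<pi> (\<lambda>y. indicator {1<..} y * y)"
      using E.integrable_power_tail[of 1] by simp
    fix u
    have m1: "(\<lambda>z. iexp (u * z) * complex_of_real (exp (- z))) \<in> borel_measurable borel"
      and m2: "(\<lambda>z. iexp (u * z)) \<in> borel_measurable borel" by measurable
    let ?g = "\<lambda>x. if 0 < x then iexp (u * ln x) else 0"
    have "(CLINT z|ln_law ?I. iexp (u * z) * of_real (exp (- z))) =
        (CLINT \<omega>|M. ?g (remaining 0 \<omega>) * of_real (inverse (remaining 0 \<omega>)))"
      unfolding integral_ln_law[OF I m1]
    proof (rule integral_cong_AE)
      show "AE \<omega> in M. indicator {0<..} (?I \<omega>) *\<^sub>R (iexp (u * ln (?I \<omega>)) * complex_of_real (exp (- ln (?I \<omega>)))) =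
         ?g (remaining 0 \<omega>) * of_real (inverse (remaining 0 \<omega>))"
        using remaining_0_eq R0 by eventually_elim (auto simp: exp_minus indicator_def)
    qed measurable
    moreover have "(CLINT z|ln_law ?I. iexp (u * z)) = (CLINT \<omega>|M. ?g (remaining 0 \<omega>))"
      unfolding integral_ln_law[OF I m2]
    proof (rule integral_cong_AE)
      show "AE \<omega> in M. indicator {0<..} (?I \<omega>) *\<^sub>R iexp (u * ln (?I \<omega>)) = ?g (remaining 0 \<omega>)"
        using remaining_0_eq by eventually_elim (auto simp: indicator_def)
    qed measurable
    ultimately show "\<i> * of_real u * (CLINT z|ln_law ?I. iexp (u * z) * of_real (exp (- z))) =
        - levy_khintchine_exponent a \<sigma> \<pi> (- u) * (CLINT z|ln_law ?I. iexp (u * z))"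
      using remaining_fourier_equation[where u=u and \<kappa>="levy_khintchine_exponent a \<sigma> \<pi> (- u)", OF char inv] by simp
  qed (use s l null in auto)
  then show ?thesis by (rule that)
qed

end

text \<open>\<open>law_asymp\<close> compares measures. Tested on all Borel subsets of a right
  neighbourhood of 0 and carried over by \<open>exp\<close>, it yields almost-everywhere bounds for
  whichever version of the density is given, and these are just what the filter
  \<open>ess_at_right 0\<close> sees.\<close>

theorem proposition1p17:
  fixes M :: "'a measure" and Y :: "real \<Rightarrow> 'a \<Rightarrow> real"
    and \<pi> :: "real measure" and \<alpha> :: real
  assumes "spectrally_positive_levy_process M Y"
    and "drifts_to_infinity M Y"
    and "has_levy_measure M Y \<pi>"
    and "emeasure \<pi> {0<..} \<noteq> 0"
    and "\<alpha> > 0"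
    and "\<forall>y. ((\<lambda>x. levy_tail \<pi> (x + y) / levy_tail \<pi> x) \<longlongrightarrow> exp (- \<alpha> * y)) at_top"
  shows "integrable M (\<lambda>\<omega>. exp_functional Y \<omega> powr (- \<alpha>)) \<and>
    (\<forall>m :: real \<Rightarrow> real. distributed M lborel (exp_functional Y) (\<lambda>x. ennreal (m x)) \<longrightarrow>
       ((\<lambda>x. m x / ((\<integral>\<omega>. exp_functional Y \<omega> powr (- \<alpha>) \<partial>M) * levy_tail \<pi> (ln (1 / x))))
         \<longlongrightarrow> 1) (ess_at_right 0))"
proof -
  interpret spectrally_positive_levy_process M Y by fact
  let ?I = "exp_functional Y" and ?L = "levy_tail \<pi>"
  note I [measurable] = random_variable_exp_functional
  obtain a \<sigma> where law: "tail_log_functional_law (ln_law ?I) \<pi> a \<sigma> \<alpha>"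
    by (rule ln_exp_functional_law[OF assms(3,5)]) (use assms(6) in auto)
  interpret T: tail_log_functional_law "ln_law ?I" \<pi> a \<sigma> \<alpha> by (rule law)
  have I0: "0 \<le> ?I \<omega>" if "\<omega> \<in> space M" for \<omega>
    unfolding exp_functional_eq by (rule path_functional_nonneg[OF cadlag_paths[OF that]])
  \<comment> \<open>At the value 0 both sides vanish, because \<open>0 powr x = 0\<close> and the
    indicator excludes it.\<close>
  have powr: "?I \<omega> powr (- \<alpha>) = indicator {0<..} (?I \<omega>) *\<^sub>R exp (- \<alpha> * ln (?I \<omega>))" if "\<omega> \<in> space M" for \<omega>
    using I0[OF that] by (auto simp: powr_def indicator_def)
  have "integrable (ln_law ?I) (\<lambda>z. exp (- \<alpha> * z))"
    using assms(5) by (intro T.integrable_exp_minus_mu) auto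
  then have int: "integrable M (\<lambda>\<omega>. ?I \<omega> powr (- \<alpha>))"
    by (subst Bochner_Integration.integrable_cong[OF refl powr]) (auto simp: integrable_ln_law_iff[OF I])
  define c where "c = (LINT \<omega>|M. ?I \<omega> powr (- \<alpha>))"
  have c: "T.neg_moment = c"
    unfolding T.neg_moment_def c_def
    by (subst integral_ln_law[OF I]) (auto intro!: Bochner_Integration.integral_cong simp: powr)
  have "((\<lambda>x. m x / (c * ?L (ln (1 / x)))) \<longlongrightarrow> 1) (ess_at_right 0)"
    if m: "distributed M lborel ?I (\<lambda>x. ennreal (m x))" for m
  proof -
    have mm: "(\<lambda>x. ennreal (m x)) \<in> borel_measurable lborel"
      by (rule distributed_borel_measurable[OF m])
    have emeasure_I: "emeasure M {\<omega> \<in> space M. ?I \<omega> \<in> A} = (\<integral>\<^sup>+x. ennreal (m x) * indicator A x \<partial>lborel)"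
      if "A \<in> sets borel" for A
    proof -
      have "?I -` A \<inter> space M = {\<omega> \<in> space M. ?I \<omega> \<in> A}" by auto
      then show ?thesis using distributed_emeasure[OF m, of A] that by simp
    qed
    \<comment> \<open>A law with a density does not charge the point 0. This makes the moment
      strictly positive, so that dividing by it is meaningful.\<close>
    have pos: "AE \<omega> in M. 0 < ?I \<omega>"
    proof -
      have "emeasure M {\<omega> \<in> space M. ?I \<omega> \<in> {0}} = (\<integral>\<^sup>+(x::real). 0 \<partial>lborel)"
        unfolding emeasure_I[OF borel_singleton[OF sets.empty_sets]]
        using AE_lborel_singleton[of "0::real"] by (intro nn_integral_cong_AE) auto
      then have "AE \<omega> in M. ?I \<omega> \<noteq> 0" by (subst AE_iff_measurable[OF _ refl]) auto
      then show ?thesis using AE_space by eventually_elim (use I0 in \<open>auto simp: less_le\<close>)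
    qed
    have "0 < c"
    proof (rule ccontr)
      assume "\<not> 0 < c"
      moreover have "0 \<le> c" unfolding c_def by (intro integral_nonneg_AE AE_I2) simp
      ultimately have "c = 0" by simp
      then have "AE \<omega> in M. ?I \<omega> powr (- \<alpha>) = 0"
        using integral_nonneg_eq_0_iff_AE[OF int] by (simp add: c_def)
      then have "AE \<omega> in M. False" using pos by eventually_elim auto
      then show False by simp
    qed
    show ?thesis
    proof (rule tendstoI)
      fix \<epsilon> :: real assume "0 < \<epsilon>"
      \<comment> \<open>At most half of \<open>c\<close>, so that the lower constant
        \<open>c - e\<close> stays positive, and at most half of \<open>c * \<epsilon>\<close>, so
        that the final estimate is strict.\<close>
      define e where "e = c * min (\<epsilon> / 2) (1 / 2)"
      have e: "0 < e" "e < c" "e < c * \<epsilon>" using \<open>0 < c\<close> \<open>0 < \<epsilon>\<close> by (auto simp: e_def min_def)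
      obtain X where X: "X \<le> - 1"
        and up: "\<And>A. A \<in> sets borel \<Longrightarrow> A \<subseteq> {..<X} \<Longrightarrow> emeasure (ln_law ?I) A \<le> emeasure (T.tail_measure (c + e) X) A"
        and lo: "\<And>A. A \<in> sets borel \<Longrightarrow> A \<subseteq> {..<X} \<Longrightarrow> emeasure (T.tail_measure (c - e) X) A \<le> emeasure (ln_law ?I) A"
        using T.law_asymp[OF e(1)] unfolding c by blast
      define w where "w z = indicator {..<X} z * ?L (- z)" for z
      have w [measurable]: "w \<in> borel_measurable borel"
        unfolding w_def by (rule T.borel_measurable_L_uminus[OF X])
      let ?S = "{0<..<exp X}"
      have lnS: "ln t < X" if "t \<in> ?S" for t using that ln_less_cancel_iff[of t "exp X"] by simp
      define k where "k b t = ennreal (b * w (ln t))" for b t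
      have k [measurable]: "k b \<in> borel_measurable borel" for b unfolding k_def[abs_def] by measurable
      \<comment> \<open>The substitution \<open>t = exp z\<close> absorbs the factor
        \<open>exp z\<close> in the density of \<open>tail_measure\<close>, leaving
        \<open>b * L (- ln t)\<close>.\<close>
      have tm: "emeasure (T.tail_measure b X) (exp -` B) = (\<integral>\<^sup>+t. k b t * indicator B t \<partial>lborel)"
        and mu: "emeasure (ln_law ?I) (exp -` B) = (\<integral>\<^sup>+t. ennreal (m t) * indicator B t \<partial>lborel)"
        and BX: "exp -` B \<in> sets borel" "exp -` B \<subseteq> {..<X}"
        if B [measurable]: "B \<in> sets borel" and BS: "B \<subseteq> ?S" for B b
      proof -
        show b: "exp -` B \<in> sets borel" using measurable_sets[of exp borel borel B] B by simp
        show "exp -` B \<subseteq> {..<X}" using BS by auto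
        have "emeasure (T.tail_measure b X) (exp -` B) = (\<integral>\<^sup>+z. indicator (exp -` B) z * ennreal (b * (exp z * w z)) \<partial>lborel)"
          unfolding w_def by (rule T.emeasure_tail_measure[OF X b])
        also have "\<dots> = (\<integral>\<^sup>+z. (k b (exp z) * indicator B (exp z)) * ennreal (exp z) \<partial>lborel)"
        proof (intro nn_integral_cong)
          fix z
          have "ennreal (b * (exp z * w z)) = k b (exp z) * ennreal (exp z)"
            unfolding k_def by (subst ennreal_mult''[symmetric]) (simp_all add: mult_ac)
          then show "indicator (exp -` B) z * ennreal (b * (exp z * w z)) = k b (exp z) * indicator B (exp z) * ennreal (exp z)"
            by (simp add: indicator_def)
        qed
        also have "\<dots> = (\<integral>\<^sup>+t. k b t * indicator B t * indicator {0<..} t \<partial>lborel)"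
          by (rule nn_integral_exp_substitution) measurable
        also have "\<dots> = (\<integral>\<^sup>+t. k b t * indicator B t \<partial>lborel)"
          using BS by (intro nn_integral_cong) (auto simp: indicator_def)
        finally show "emeasure (T.tail_measure b X) (exp -` B) = (\<integral>\<^sup>+t. k b t * indicator B t \<partial>lborel)" .
        have "{\<omega> \<in> space M. 0 < ?I \<omega> \<and> ln (?I \<omega>) \<in> exp -` B} = {\<omega> \<in> space M. ?I \<omega> \<in> B}"
          using BS by auto
        then show "emeasure (ln_law ?I) (exp -` B) = (\<integral>\<^sup>+t. ennreal (m t) * indicator B t \<partial>lborel)"
          unfolding emeasure_ln_law[OF I b] emeasure_I[OF B, symmetric] by simp
      qed
      have S: "?S \<in> sets borel" by simp
      have "AE t in lborel. t \<in> ?S \<longrightarrow> ennreal (m t) \<le> k (c + e) t"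
      proof (rule AE_le_of_nn_integral_le)
        show "(\<integral>\<^sup>+t. ennreal (m t) * indicator B t \<partial>lborel) \<le> (\<integral>\<^sup>+t. k (c + e) t * indicator B t \<partial>lborel)"
          if "B \<in> sets lborel" "B \<subseteq> ?S" for B
          using up[OF BX] that by (simp add: tm mu)
        show "(\<integral>\<^sup>+t. k (c + e) t * indicator ?S t \<partial>lborel) < \<infinity>"
          using T.finite_tail_measure[OF X, of "c + e" "exp -` ?S"] by (simp add: tm[OF S] less_top)
      qed (use mm k in simp_all)
      moreover have "AE t in lborel. t \<in> ?S \<longrightarrow> k (c - e) t \<le> ennreal (m t)"
      proof (rule AE_le_of_nn_integral_le)
        show "(\<integral>\<^sup>+t. k (c - e) t * indicator B t \<partial>lborel) \<le> (\<integral>\<^sup>+t. ennreal (m t) * indicator B t \<partial>lborel)"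
          if "B \<in> sets lborel" "B \<subseteq> ?S" for B
          using lo[OF BX] that by (simp add: tm mu)
        show "(\<integral>\<^sup>+t. ennreal (m t) * indicator ?S t \<partial>lborel) < \<infinity>"
          using emeasure_I[OF S] by (metis emeasure_eq_measure ennreal_less_top infinity_ennreal_def)
      qed (use mm k in simp_all)
      ultimately have "AE t in lborel. t \<in> ?S \<longrightarrow> dist (m t / (c * ?L (ln (1 / t)))) 1 < \<epsilon>"
      proof eventually_elim
        case (elim t)
        show ?case
        proof
          assume t: "t \<in> ?S"
          have "ln (1 / t) = - ln t" using t by (simp add: ln_div)
          then have w: "w (ln t) = ?L (ln (1 / t))" using lnS[OF t] by (simp add: w_def)
          have L: "0 < ?L (ln (1 / t))" using lnS[OF t] X \<open>ln (1 / t) = - ln t\<close> by (intro T.tail_pos) simp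
          have "ennreal (m t) \<le> ennreal ((c + e) * ?L (ln (1 / t)))" "ennreal ((c - e) * ?L (ln (1 / t))) \<le> ennreal (m t)"
            using elim t by (simp_all add: k_def w)
          \<comment> \<open>\<open>ennreal\<close> truncates at 0, so a negative \<open>m t\<close>
            could hide behind the inequalities; strict positivity of the lower bound rules this
            out.\<close>
          moreover have "0 < (c - e) * ?L (ln (1 / t))" "0 \<le> (c + e) * ?L (ln (1 / t))" using L e by auto
          ultimately have b: "m t \<le> (c + e) * ?L (ln (1 / t))" "(c - e) * ?L (ln (1 / t)) \<le> m t"
            by (auto simp: ennreal_le_iff ennreal_le_iff2)
          have "m t / (c * ?L (ln (1 / t))) - 1 = (m t - c * ?L (ln (1 / t))) / (c * ?L (ln (1 / t)))"
            using L \<open>0 < c\<close> by (simp add: diff_divide_distrib)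
          moreover have "\<bar>m t - c * ?L (ln (1 / t))\<bar> < \<epsilon> * (c * ?L (ln (1 / t)))"
          proof -
            have "\<bar>m t - c * ?L (ln (1 / t))\<bar> \<le> e * ?L (ln (1 / t))" using b by (auto simp: algebra_simps abs_le_iff)
            also have "\<dots> < c * \<epsilon> * ?L (ln (1 / t))" using e(3) L by (rule mult_strict_right_mono)
            finally show ?thesis by (simp add: mult_ac)
          qed
          ultimately show "dist (m t / (c * ?L (ln (1 / t)))) 1 < \<epsilon>"
            using L \<open>0 < c\<close> by (simp add: dist_real_def abs_mult pos_divide_less_eq)
        qed
      qed
      moreover have "\<forall>\<^sub>F t in at_right 0. t \<in> ?S"
        unfolding eventually_at_right_field by (intro exI[of _ "exp X"]) auto
      ultimately show "\<forall>\<^sub>F t in ess_at_right 0. dist (m t / (c * ?L (ln (1 / t)))) 1 < \<epsilon>"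
        unfolding ess_at_right_def eventually_inf by blast
    qed
  qed
  then show ?thesis using int unfolding c_def by blast
qed

end
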